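(* Let $n\ge3$, let $\Omega\subset\mathbb{R}^n$ be a bounded $C^{1,1}$-domain, and let $q\in L^\infty(\Omega)$ be a complex-valued potential, extended by zero outside $\Omega$, such that $0$ is not a Dirichlet eigenvalue of $-\Delta+q$ in $\Omega$. Let $0<\delta<1$. Then there exist $R>0$ and a constant $\tilde c(\delta,R)$ such that for all $\zeta\in\mathbb{C}^n$ with $\zeta\cdot\zeta=0$ and $|\zeta|>R$ the exponentially growing solution $\psi(\cdot,\zeta)$ exists and is unique, and $$|\mathbf{t}(\xi,\zeta)-\hat q(\xi)|\le\frac{\tilde c(\delta,R)}{|\zeta|}\,\|q\|_\delta^2\qquad\text{for all }\xi\in\mathbb{R}^n .$$
   Context: For $\zeta,\xi\in\mathbb{C}^n$, $\zeta\cdot\xi=\sum_j\zeta_j\xi_j$ (bilinear, no conjugation). $\langle x\rangle=(1+|x|^2)^{1/2}$, $\|f\|_\delta=\|\langle x\rangle^\delta f\|_{L^2(\mathbb{R}^n)}$ and $L^2_\delta(\mathbb{R}^n)=\{f:\|f\|_\delta<\infty\}$. For $\zeta\in\mathbb{C}^n\setminus\{0\}$ with $\zeta\cdot\zeta=0$: $g_\zeta(x)=\frac{1}{(2\pi)^n}\int_{\mathbb{R}^n}\frac{e^{ix\cdot\xi}}{|\xi|^2+2\zeta\cdot\xi}\,d\xi$ (as a tempered distribution) and $G_\zeta(x)=e^{ix\cdot\zeta}g_\zeta(x)$, a fundamental solution of $-\Delta$. The exponentially growing solution $\psi(\cdot,\zeta)$ is the solution of $\psi(x,\zeta)=e^{ix\cdot\zeta}-\int_{\mathbb{R}^n}G_\zeta(x-y)q(y)\psi(y,\zeta)\,dy$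 with $e^{-ix\cdot\zeta}\psi(x,\zeta)-1\in L^2_{\delta-1}(\mathbb{R}^n)$. Scattering transform: $\mathbf{t}(\xi,\zeta)=\int_{\mathbb{R}^n}e^{-ix\cdot(\zeta+\xi)}q(x)\psi(x,\zeta)\,dx$. Fourier transform: $\hat q(\xi)=\int_{\mathbb{R}^n}e^{-ix\cdot\xi}q(x)\,dx$. *)

theory Defs
  imports "HOL-Analysis.Analysis"
begin

text \<open>
  \<open>\<real>\<^sup>n\<close> is \<open>real ^ 'n\<close> and \<open>\<complex>\<^sup>n\<close> is \<open>complex ^ 'n\<close>. Elements of Lebesgue and Sobolev spaces are
  represented by Lebesgue measurable functions; equality of such functions means equality almost
  everywhere.
\<close>

section \<open>Smooth functions, test functions, Schwartz functions\<close>

definition partial :: "'n \<Rightarrow> (real ^ 'n \<Rightarrow> complex) \<Rightarrow> real ^ 'n \<Rightarrow> complex"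
  where "partial i f x = frechet_derivative f (at x) (axis i 1)"

primrec partials :: "'n list \<Rightarrow> (real ^ 'n \<Rightarrow> complex) \<Rightarrow> real ^ 'n \<Rightarrow> complex"
  where
    "partials [] f = f"
  | "partials (i # is) f = partial i (partials is f)"

text \<open>\<open>C\<^sup>\<infinity>\<close>: every iterated partial derivative is (totally) differentiable everywhere.\<close>

definition smooth :: "(real ^ 'n \<Rightarrow> complex) \<Rightarrow> bool"
  where "smooth f \<longleftrightarrow> (\<forall>is x. partials is f differentiable (at x))"

definition test_function :: "(real ^ 'n) set \<Rightarrow> (real ^ 'n \<Rightarrow> complex) \<Rightarrow> bool"
  where "test_function \<Omega> f \<longleftrightarrow>
    smooth f \<and> compact (closure {x. f x \<noteq> 0}) \<and> closure {x. f x \<noteq> 0} \<subseteq> \<Omega>"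

definition japanese :: "real ^ 'n \<Rightarrow> real"
  where "japanese x = sqrt (1 + (norm x)\<^sup>2)"

definition schwartz :: "(real ^ 'n \<Rightarrow> complex) \<Rightarrow> bool"
  where "schwartz f \<longleftrightarrow>
    smooth f \<and> (\<forall>is N. \<exists>C. \<forall>x. japanese x ^ N * cmod (partials is f x) \<le> C)"

section \<open>Domains with \<open>C\<^sup>1\<^sup>,\<^sup>1\<close> boundary\<close>

definition C11_function :: "(real ^ 'n \<Rightarrow> real) \<Rightarrow> bool"
  where "C11_function h \<longleftrightarrow>
    (\<exists>D L. (\<forall>x. (h has_derivative (\<lambda>v. D x \<bullet> v)) (at x)) \<and> L-lipschitz_on UNIV D)"

text \<open>
  Near each boundary point, \<open>\<Omega>\<close> is the part above the graph of a \<open>C\<^sup>1\<^sup>,\<^sup>1\<close> function over the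
  hyperplane orthogonal to a unit vector \<open>e\<close>. In place of \<open>\<real>\<^sup>n\<^sup>-\<^sup>1\<close>, the graph function is defined on
  \<open>\<real>\<^sup>n\<close> but only ever evaluated on that hyperplane.
\<close>

definition C11_domain :: "(real ^ 'n) set \<Rightarrow> bool"
  where "C11_domain \<Omega> \<longleftrightarrow>
    open \<Omega> \<and> connected \<Omega> \<and> \<Omega> \<noteq> {} \<and>
    (\<forall>p \<in> frontier \<Omega>. \<exists>r>0. \<exists>e h. norm e = 1 \<and> C11_function h \<and>
       \<Omega> \<inter> ball p r = {x \<in> ball p r. x \<bullet> e > h (x - (x \<bullet> e) *\<^sub>R e)})"

section \<open>Dirichlet eigenvalues\<close>

definition L2_on :: "(real ^ 'n) set \<Rightarrow> (real ^ 'n \<Rightarrow> complex) \<Rightarrow> bool"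
  where "L2_on \<Omega> u \<longleftrightarrow>
    set_borel_measurable lebesgue \<Omega> u \<and> set_integrable lebesgue \<Omega> (\<lambda>x. (cmod (u x))\<^sup>2)"

text \<open>\<open>u \<in> H\<^sup>1(\<Omega>)\<close> with weak gradient \<open>v\<close>.\<close>

definition H1_on :: "(real ^ 'n) set \<Rightarrow> (real ^ 'n \<Rightarrow> complex) \<Rightarrow> ('n \<Rightarrow> real ^ 'n \<Rightarrow> complex) \<Rightarrow> bool"
  where "H1_on \<Omega> u v \<longleftrightarrow>
    L2_on \<Omega> u \<and> (\<forall>i. L2_on \<Omega> (v i)) \<and>
    (\<forall>\<phi> i. test_function \<Omega> \<phi> \<longrightarrow>
       (LINT x:\<Omega>|lebesgue. u x * partial i \<phi> x) = - (LINT x:\<Omega>|lebesgue. v i x * \<phi> x))"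

text \<open>\<open>u \<in> H\<^sup>1\<^sub>0(\<Omega>)\<close>, the closure of the test functions in \<open>H\<^sup>1(\<Omega>)\<close>, with weak gradient \<open>v\<close>.\<close>

definition H10_on :: "(real ^ 'n) set \<Rightarrow> (real ^ 'n \<Rightarrow> complex) \<Rightarrow> ('n \<Rightarrow> real ^ 'n \<Rightarrow> complex) \<Rightarrow> bool"
  where "H10_on \<Omega> u v \<longleftrightarrow>
    H1_on \<Omega> u v \<and>
    (\<exists>\<phi> :: nat \<Rightarrow> real ^ 'n \<Rightarrow> complex. (\<forall>k. test_function \<Omega> (\<phi> k)) \<and>
       (\<lambda>k. (LINT x:\<Omega>|lebesgue. (cmod (\<phi> k x - u x))\<^sup>2) +
            (\<Sum>i\<in>UNIV. LINT x:\<Omega>|lebesgue. (cmod (partial i (\<phi> k) x - v i x))\<^sup>2))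
         \<longlonglongrightarrow> 0)"

text \<open>
  \<open>\<mu>\<close> is a Dirichlet eigenvalue of \<open>-\<Delta> + q\<close> in \<open>\<Omega>\<close>: some nonzero \<open>u \<in> H\<^sup>1\<^sub>0(\<Omega>)\<close> satisfies
  \<open>(-\<Delta> + q) u = \<mu> u\<close> in the sense of distributions on \<open>\<Omega>\<close>.
\<close>

definition dirichlet_eigenvalue ::
    "(real ^ 'n) set \<Rightarrow> (real ^ 'n \<Rightarrow> complex) \<Rightarrow> complex \<Rightarrow> bool"
  where "dirichlet_eigenvalue \<Omega> q \<mu> \<longleftrightarrow>
    (\<exists>u v. H10_on \<Omega> u v \<and> \<not> (AE x in lebesgue. x \<in> \<Omega> \<longrightarrow> u x = 0) \<and>
       (\<forall>\<phi>. test_function \<Omega> \<phi> \<longrightarrow>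
          (LINT x:\<Omega>|lebesgue. (\<Sum>i\<in>UNIV. v i x * partial i \<phi> x) + q x * u x * \<phi> x) =
          \<mu> * (LINT x:\<Omega>|lebesgue. u x * \<phi> x)))"

section \<open>Potentials, weighted spaces, Fourier transform\<close>

text \<open>\<open>q \<in> L\<^sup>\<infinity>(\<Omega>)\<close>, extended by zero.\<close>

definition Linf_ext :: "(real ^ 'n) set \<Rightarrow> (real ^ 'n \<Rightarrow> complex) \<Rightarrow> bool"
  where "Linf_ext \<Omega> q \<longleftrightarrow>
    q \<in> borel_measurable lebesgue \<and> (\<exists>M. AE x in lebesgue. cmod (q x) \<le> M) \<and>
    (\<forall>x. x \<notin> \<Omega> \<longrightarrow> q x = 0)"

definition weighted_L2 :: "real \<Rightarrow> (real ^ 'n \<Rightarrow> complex) \<Rightarrow> bool"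
  where "weighted_L2 \<delta> f \<longleftrightarrow>
    f \<in> borel_measurable lebesgue \<and>
    integrable lebesgue (\<lambda>x. (japanese x powr \<delta> * cmod (f x))\<^sup>2)"

definition weighted_norm :: "real \<Rightarrow> (real ^ 'n \<Rightarrow> complex) \<Rightarrow> real"
  where "weighted_norm \<delta> f = sqrt (LINT x|lebesgue. (japanese x powr \<delta> * cmod (f x))\<^sup>2)"

definition cvec :: "real ^ 'n \<Rightarrow> complex ^ 'n"
  where "cvec x = (\<chi> i. complex_of_real (x $ i))"

definition cdot :: "complex ^ 'n \<Rightarrow> complex ^ 'n \<Rightarrow> complex"
  where "cdot \<zeta> \<xi> = (\<Sum>j\<in>UNIV. \<zeta> $ j * \<xi> $ j)"

definition fourier :: "(real ^ 'n \<Rightarrow> complex) \<Rightarrow> real ^ 'n \<Rightarrow> complex"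
  where "fourier f \<xi> = (LINT x|lebesgue. exp (- \<i> * cdot (cvec x) (cvec \<xi>)) * f x)"

section \<open>The Faddeev Green function\<close>

text \<open>
  The tempered distribution \<open>g\<^sub>\<zeta>\<close>, i.e. the inverse Fourier transform of
  \<open>1 / (|\<xi>|\<^sup>2 + 2 \<zeta> \<cdot> \<xi>)\<close>: it pairs with a Schwartz function by transferring the factor
  \<open>e\<^sup>i\<^sup>x\<^sup>\<xi>\<close> onto that function.
\<close>

definition faddeev_distribution :: "complex ^ 'n \<Rightarrow> (real ^ 'n \<Rightarrow> complex) \<Rightarrow> complex"
  where "faddeev_distribution \<zeta> \<phi> =
    1 / (2 * pi) ^ CARD('n) *
    (LINT \<xi>|lebesgue. (LINT x|lebesgue. exp (\<i> * cdot (cvec x) (cvec \<xi>)) * \<phi> x) /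
       (of_real ((norm \<xi>)\<^sup>2) + 2 * cdot \<zeta> (cvec \<xi>)))"

definition represents_distribution ::
    "(real ^ 'n \<Rightarrow> complex) \<Rightarrow> ((real ^ 'n \<Rightarrow> complex) \<Rightarrow> complex) \<Rightarrow> bool"
  where "represents_distribution g T \<longleftrightarrow>
    g \<in> borel_measurable lebesgue \<and>
    (\<forall>\<phi>. schwartz \<phi> \<longrightarrow>
       integrable lebesgue (\<lambda>x. g x * \<phi> x) \<and> (LINT x|lebesgue. g x * \<phi> x) = T \<phi>)"

text \<open>
  For \<open>\<zeta> \<noteq> 0\<close> with \<open>\<zeta> \<cdot> \<zeta> = 0\<close> the distribution is given by a locally integrable function, which
  is determined up to a null set; the integrals below do not depend on the choice.
\<close>

definition faddeev_g :: "complex ^ 'n \<Rightarrow> real ^ 'n \<Rightarrow> complex"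
  where "faddeev_g \<zeta> = (SOME g. represents_distribution g (faddeev_distribution \<zeta>))"

definition faddeev_G :: "complex ^ 'n \<Rightarrow> real ^ 'n \<Rightarrow> complex"
  where "faddeev_G \<zeta> x = exp (\<i> * cdot (cvec x) \<zeta>) * faddeev_g \<zeta> x"

section \<open>Exponentially growing solutions and the scattering transform\<close>

definition exp_growing_solution ::
    "(real ^ 'n \<Rightarrow> complex) \<Rightarrow> real \<Rightarrow> complex ^ 'n \<Rightarrow> (real ^ 'n \<Rightarrow> complex) \<Rightarrow> bool"
  where "exp_growing_solution q \<delta> \<zeta> \<psi> \<longleftrightarrow>
    \<psi> \<in> borel_measurable lebesgue \<and>
    (AE x in lebesgue.
       integrable lebesgue (\<lambda>y. faddeev_G \<zeta> (x - y) * q y * \<psi> y) \<and>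
       \<psi> x = exp (\<i> * cdot (cvec x) \<zeta>)
              - (LINT y|lebesgue. faddeev_G \<zeta> (x - y) * q y * \<psi> y)) \<and>
    weighted_L2 (\<delta> - 1) (\<lambda>x. exp (- \<i> * cdot (cvec x) \<zeta>) * \<psi> x - 1)"

definition scattering_transform ::
    "(real ^ 'n \<Rightarrow> complex) \<Rightarrow> (real ^ 'n \<Rightarrow> complex) \<Rightarrow> real ^ 'n \<Rightarrow> complex ^ 'n \<Rightarrow> complex"
  where "scattering_transform q \<psi> \<xi> \<zeta> =
    (LINT x|lebesgue. exp (- \<i> * cdot (cvec x) (\<zeta> + cvec \<xi>)) * q x * \<psi> x)"

end

theory Submission
  imports Defs "HOL-Probability.Probability" "HOL-Real_Asymp.Real_Asymp"
begin

text \<open>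
  Write \<open>\<zeta> = a + i s e\<close> with \<open>a\<close> real, \<open>e\<close> a real unit vector and \<open>s > 0\<close>. The condition
  \<open>\<zeta> \<cdot> \<zeta> = 0\<close> says that \<open>|a| = s\<close> and \<open>a \<bullet> e = 0\<close>, so \<open>|\<zeta>|\<^sup>2 = 2 s\<^sup>2\<close>. The shift \<open>\<xi> = \<eta> - a\<close>
  turns the symbol \<open>|\<xi>|\<^sup>2 + 2 \<zeta> \<cdot> \<xi>\<close> into \<open>|\<eta>|\<^sup>2 - s\<^sup>2 + 2 i s (\<eta> \<bullet> e)\<close>, and with
  \<open>\<eta> = w + \<tau> e\<close>, \<open>w \<bullet> e = 0\<close>, this is
  \<open>(\<tau> + i s)\<^sup>2 + |w|\<^sup>2 = (|w| - s + i \<tau>) (|w| + s - i \<tau>)\<close>. By partial fractions, its reciprocal is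
  the Fourier transform in \<open>\<tau>\<close> of an explicit combination \<open>K(t, |w|)\<close> of exponentials
  (\<open>faddeev_kernel\<close>), and \<open>|K(t, r)| \<le> (4/s) exp (- |t| |r - s| / 2)\<close>. Hence
  \<open>g\<^sub>\<zeta>(x) = exp (- i a \<bullet> x) h(x)\<close>, where \<open>h\<close> (\<open>faddeev_h\<close>) is the inverse Fourier transform of
  \<open>K(x \<bullet> e, |w|)\<close> in the variables \<open>w\<close> of the hyperplane orthogonal to \<open>e\<close>
  (\<open>faddeev_h_distribution\<close>, \<open>faddeev_g_AE\<close>).

  All estimates come from this slicing. Between two slices at distance \<open>t\<close>, convolution with \<open>h\<close> is
  a Fourier multiplier with symbol \<open>K(t, |w|)\<close>, which is bounded by \<open>4/s\<close> uniformly in \<open>t\<close>.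
  Integrating over the slices that meet a ball of radius \<open>L\<close> shows that convolution with \<open>g\<^sub>\<zeta>\<close> is
  bounded on \<open>L\<^sup>2\<close> of that ball with norm at most \<open>8 L / s\<close>, which is of order \<open>1 / |\<zeta>|\<close>. Moreover
  \<open>exp (- y) \<le> y powr (- \<delta>)\<close> makes the squared norms on far slices decay like \<open>|t| powr (- \<delta>)\<close>, and
  together with the weight \<open>|t| powr (2 \<delta> - 2)\<close> this is integrable because \<open>\<delta> < 1\<close>; so the
  convolution lies in \<open>L\<^sup>2\<^sub>\<delta>\<^sub>-\<^sub>1\<close> (\<open>faddeev_convolution_bounds\<close>).

  For \<open>w = exp (- i x \<cdot> \<zeta>) \<psi> - 1\<close> the integral equation reads \<open>w = - g\<^sub>\<zeta> * (q (1 + w))\<close>. If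
  \<open>|q| \<le> M\<close> and \<open>q\<close> vanishes outside the ball of radius \<open>L\<close>, then \<open>w \<mapsto> g\<^sub>\<zeta> * (q w)\<close> has norm at
  most \<open>1/2\<close> on \<open>L\<^sup>2\<close> of the ball once \<open>|\<zeta>| \<ge> 32 L M\<close>. The Neumann series yields a solution, the
  contraction yields uniqueness, and the \<open>L\<^sup>2\<close> norm of \<open>w\<close> on the ball is at most \<open>(16 L / s)\<close> times
  that of \<open>q\<close> (\<open>neumann_series_solution\<close>, \<open>neumann_series_unique\<close>). The
  scattering transform minus the Fourier transform of \<open>q\<close> is the integral of
  \<open>exp (- i x \<bullet> \<xi>) q w\<close>, for which the Cauchy--Schwarz inequality gives the bound
  \<open>32 L / |\<zeta>|\<close> times the square of the \<open>L\<^sup>2\<close> norm of \<open>q\<close>, and that norm is at most the weighted norm.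
  The radius \<open>R\<close> is chosen after \<open>\<Omega>\<close> and \<open>q\<close>, so it may depend on \<open>L\<close> and \<open>M\<close>, and a constant that
  is a function of \<open>R\<close> can absorb them: \<open>R = 32 L (M + 1)\<close> and \<open>c(\<delta>, R) = R\<close> suffice.

  Finally, \<open>g\<^sub>\<zeta>\<close> is an arbitrarily chosen function representing a distribution. It agrees with
  the explicit one almost everywhere, because an integrable function that is orthogonal to all
  Gaussians vanishes almost everywhere (\<open>represents_distribution_unique\<close>).
\<close>

section \<open>Lebesgue measure on a hyperplane\<close>

lemma nn_integral_lborel_translate:
  fixes f :: "'a::euclidean_space \<Rightarrow> ennreal"
  assumes [measurable]: "f \<in> borel_measurable borel"
  shows "(\<integral>\<^sup>+x. f (x + c) \<partial>lborel) = (\<integral>\<^sup>+x. f x \<partial>lborel)"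
proof -
  have "(\<integral>\<^sup>+x. f x \<partial>lborel) = (\<integral>\<^sup>+x. f x \<partial>distr lborel borel ((+) c))"
    by (simp add: lborel_distr_plus)
  also have "\<dots> = (\<integral>\<^sup>+x. f (x + c) \<partial>lborel)"
    by (subst nn_integral_distr) (simp_all add: add.commute)
  finally show ?thesis by simp
qed

lemma integral_lborel_translate:
  fixes f :: "'a::euclidean_space \<Rightarrow> 'b::{banach, second_countable_topology}"
  assumes [measurable]: "f \<in> borel_measurable borel"
  shows "(\<integral>x. f (x + c) \<partial>lborel) = (\<integral>x. f x \<partial>lborel)"
proof -
  have "(\<integral>x. f x \<partial>lborel) = (\<integral>x. f x \<partial>distr lborel borel ((+) c))"
    by (simp add: lborel_distr_plus)
  also have "\<dots> = (\<integral>x. f (x + c) \<partial>lborel)"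
    by (subst integral_distr) (simp_all add: add.commute)
  finally show ?thesis by simp
qed

lemma integrable_lborel_translate:
  fixes f :: "'a::euclidean_space \<Rightarrow> 'b::{banach, second_countable_topology}"
  assumes "integrable lborel f"
  shows "integrable lborel (\<lambda>x. f (x + c))"
proof -
  have "integrable (distr lborel borel ((+) c)) f"
    using assms by (simp add: lborel_distr_plus)
  then have "integrable lborel (\<lambda>x. f (c + x))"
    by (subst (asm) integrable_distr_eq) (use assms in auto)
  then show ?thesis by (simp add: add.commute)
qed

lemma nn_integral_lborel_dilate:
  fixes f :: "'a::euclidean_space \<Rightarrow> ennreal"
  assumes [measurable]: "f \<in> borel_measurable borel" and "c > 0"
  shows "(\<integral>\<^sup>+x. f x \<partial>lborel) = ennreal (c ^ DIM('a)) * (\<integral>\<^sup>+x. f (c *\<^sub>R x) \<partial>lborel)"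
  using \<open>c > 0\<close>
  by (subst lborel_affine[of c 0])
     (simp_all add: nn_integral_density nn_integral_distr nn_integral_cmult)

definition slab :: "'a::euclidean_space \<Rightarrow> 'a set"
  where "slab e = {x. 0 \<le> x \<bullet> e \<and> x \<bullet> e \<le> 1}"

text \<open>
  The orthogonal projection of Lebesgue measure on a slab of width 1 is \<open>(n - 1)\<close>-dimensional
  Lebesgue measure on the hyperplane orthogonal to the unit vector \<open>e\<close>. Defined in this way, it
  lives on the ambient space, and no coordinates on the hyperplane have to be chosen.
\<close>

definition hyperplane_measure :: "'a::euclidean_space \<Rightarrow> 'a measure"
  where "hyperplane_measure e =
    distr (density lborel (indicator (slab e))) borel (\<lambda>x. x - (x \<bullet> e) *\<^sub>R e)"

lemma slab_measurable [measurable]: "slab e \<in> sets borel"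
  unfolding slab_def by measurable

lemma sets_hyperplane [simp, measurable_cong]: "sets (hyperplane_measure e) = sets borel"
  and space_hyperplane [simp]: "space (hyperplane_measure e) = UNIV"
  by (simp_all add: hyperplane_measure_def)

lemma nn_integral_hyperplane:
  assumes [measurable]: "f \<in> borel_measurable borel"
  shows "(\<integral>\<^sup>+w. f w \<partial>hyperplane_measure e) =
    (\<integral>\<^sup>+x. indicator (slab e) x * f (x - (x \<bullet> e) *\<^sub>R e) \<partial>lborel)"
  unfolding hyperplane_measure_def
  by (subst nn_integral_distr) (auto simp: nn_integral_density)

lemma AE_hyperplane_orthogonal:
  assumes "norm e = 1"
  shows "AE w in hyperplane_measure e. w \<bullet> e = 0"
  unfolding hyperplane_measure_def using assms
  by (subst AE_distr_iff)
     (auto simp: inner_diff_left dot_square_norm intro!: always_eventually)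

text \<open>
  Fubini's theorem for the decomposition \<open>x = w + t e\<close>. Unfolding the hyperplane measure gives an
  integral over \<open>t\<close> and over \<open>x\<close> in the slab; two shifts of the integration variables turn the
  condition on \<open>x\<close> into \<open>t \<in> [x \<bullet> e - 1, x \<bullet> e]\<close>, an interval of length 1.
\<close>

lemma nn_integral_slices:
  fixes f :: "'a::euclidean_space \<Rightarrow> ennreal"
  assumes e: "norm e = 1" and [measurable]: "f \<in> borel_measurable borel"
  shows "(\<integral>\<^sup>+x. f x \<partial>lborel) =
    (\<integral>\<^sup>+t. (\<integral>\<^sup>+w. f (w + t *\<^sub>R e) \<partial>hyperplane_measure e) \<partial>lborel)"
proof -
  have ee: "e \<bullet> e = 1" using e by (simp add: dot_square_norm)
  have "(\<integral>\<^sup>+t. (\<integral>\<^sup>+w. f (w + t *\<^sub>R e) \<partial>hyperplane_measure e) \<partial>lborel)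
    = (\<integral>\<^sup>+t. (\<integral>\<^sup>+x. indicator (slab e) x * f (x - (x \<bullet> e) *\<^sub>R e + t *\<^sub>R e) \<partial>lborel) \<partial>lborel)"
    by (subst nn_integral_hyperplane) auto
  also have "\<dots> = (\<integral>\<^sup>+x. (\<integral>\<^sup>+t. indicator (slab e) x * f (x - (x \<bullet> e) *\<^sub>R e + t *\<^sub>R e) \<partial>lborel) \<partial>lborel)"
    by (rule lborel_pair.Fubini') simp
  also have "\<dots> = (\<integral>\<^sup>+x. (\<integral>\<^sup>+t. indicator (slab e) x * f (x + t *\<^sub>R e) \<partial>lborel) \<partial>lborel)"
  proof (rule nn_integral_cong)
    fix x :: 'a
    show "(\<integral>\<^sup>+t. indicator (slab e) x * f (x - (x \<bullet> e) *\<^sub>R e + t *\<^sub>R e) \<partial>lborel)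
      = (\<integral>\<^sup>+t. indicator (slab e) x * f (x + t *\<^sub>R e) \<partial>lborel)"
      by (subst nn_integral_real_affine[where c=1 and t="x \<bullet> e"]) (auto simp: algebra_simps)
  qed
  also have "\<dots> = (\<integral>\<^sup>+t. (\<integral>\<^sup>+x. indicator (slab e) x * f (x + t *\<^sub>R e) \<partial>lborel) \<partial>lborel)"
    by (rule lborel_pair.Fubini') simp
  also have "\<dots> = (\<integral>\<^sup>+t. (\<integral>\<^sup>+x. indicator {0..1} (x \<bullet> e - t) * f x \<partial>lborel) \<partial>lborel)"
  proof (rule nn_integral_cong)
    fix t :: real
    show "(\<integral>\<^sup>+x. indicator (slab e) x * f (x + t *\<^sub>R e) \<partial>lborel)
        = (\<integral>\<^sup>+x. indicator {0..1} (x \<bullet> e - t) * f x \<partial>lborel)"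
      by (subst nn_integral_lborel_translate[of "\<lambda>x. indicator {0..1} (x \<bullet> e - t) * f x" "t *\<^sub>R e", symmetric])
         (auto simp: inner_add_left ee slab_def indicator_def)
  qed
  also have "\<dots> = (\<integral>\<^sup>+x. (\<integral>\<^sup>+t. indicator {0..1} (x \<bullet> e - t) * f x \<partial>lborel) \<partial>lborel)"
    by (rule lborel_pair.Fubini') simp
  also have "\<dots> = (\<integral>\<^sup>+x. f x \<partial>lborel)"
  proof (rule nn_integral_cong)
    fix x :: 'a
    have "(\<integral>\<^sup>+t. indicator {0..1} (x \<bullet> e - t) * f x \<partial>lborel)
      = (\<integral>\<^sup>+t. f x * indicator {x \<bullet> e - 1..x \<bullet> e} t \<partial>lborel)"
      by (intro nn_integral_cong) (auto simp: indicator_def)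
    also have "\<dots> = f x" by (subst nn_integral_cmult_indicator) auto
    finally show "(\<integral>\<^sup>+t. indicator {0..1} (x \<bullet> e - t) * f x \<partial>lborel) = f x" .
  qed
  finally show ?thesis by simp
qed

lemma sigma_finite_hyperplane:
  fixes e :: "'a::euclidean_space"
  assumes "norm e = 1"
  shows "sigma_finite_measure (hyperplane_measure e)"
proof (rule sigma_finite_measure.intro, intro exI[of _ "range (\<lambda>n. cball 0 (real n))"] conjI ballI)
  fix A assume "A \<in> range (\<lambda>n. cball (0::'a) (real n))"
  then obtain n where A: "A = cball 0 (real n)" by auto
  have "emeasure (hyperplane_measure e) A = (\<integral>\<^sup>+w. indicator A w \<partial>hyperplane_measure e)"
    using A by simp
  also have "\<dots> = (\<integral>\<^sup>+x. indicator (slab e) x * indicator A (x - (x \<bullet> e) *\<^sub>R e) \<partial>lborel)"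
    unfolding A by (subst nn_integral_hyperplane) (auto intro!: borel_measurable_indicator)
  also have "\<dots> \<le> (\<integral>\<^sup>+x. indicator (cball (0::'a) (real n + 1)) x \<partial>lborel)"
  proof (intro nn_integral_mono)
    fix x :: 'a
    have "norm x \<le> real n + 1" if "0 \<le> x \<bullet> e" "x \<bullet> e \<le> 1" "norm (x - (x \<bullet> e) *\<^sub>R e) \<le> real n"
      using that assms norm_triangle_ineq[of "x - (x \<bullet> e) *\<^sub>R e" "(x \<bullet> e) *\<^sub>R e"] by simp
    then show "indicator (slab e) x * indicator A (x - (x \<bullet> e) *\<^sub>R e)
        \<le> (indicator (cball 0 (real n + 1)) x :: ennreal)"
      by (auto simp: slab_def A indicator_def)
  qed
  also have "\<dots> < \<infinity>"
    using emeasure_lborel_cball_finite by (simp add: less_top)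
  finally show "emeasure (hyperplane_measure e) A \<noteq> \<infinity>" by simp
next
  show "\<Union> (range (\<lambda>n. cball (0::'a) (real n))) = space (hyperplane_measure e)"
    by (auto simp: real_arch_simple)
qed auto

lemma nn_integral_hyperplane_translate:
  fixes f :: "'a::euclidean_space \<Rightarrow> ennreal"
  assumes [measurable]: "f \<in> borel_measurable borel" and c: "c \<bullet> e = 0"
  shows "(\<integral>\<^sup>+w. f (w + c) \<partial>hyperplane_measure e) = (\<integral>\<^sup>+w. f w \<partial>hyperplane_measure e)"
proof -
  have "(\<integral>\<^sup>+w. f w \<partial>hyperplane_measure e) =
    (\<integral>\<^sup>+x. indicator (slab e) x * f (x - (x \<bullet> e) *\<^sub>R e) \<partial>lborel)"
    by (rule nn_integral_hyperplane) simp
  also have "\<dots> = (\<integral>\<^sup>+x. indicator (slab e) (x + c) * f ((x + c) - ((x + c) \<bullet> e) *\<^sub>R e) \<partial>lborel)"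
    by (subst nn_integral_lborel_translate[of "\<lambda>x. indicator (slab e) x * f (x - (x \<bullet> e) *\<^sub>R e)"]) auto
  also have "\<dots> = (\<integral>\<^sup>+x. indicator (slab e) x * f (x - (x \<bullet> e) *\<^sub>R e + c) \<partial>lborel)"
    using c by (intro nn_integral_cong) (simp add: slab_def inner_add_left algebra_simps indicator_def)
  also have "\<dots> = (\<integral>\<^sup>+w. f (w + c) \<partial>hyperplane_measure e)"
    by (subst nn_integral_hyperplane) auto
  finally show ?thesis by simp
qed

text \<open>
  The sharp factor would be \<open>c ^ (n - 1)\<close>. The power \<open>n\<close> comes directly from the dilation of the
  ambient space, since for \<open>c \<ge> 1\<close> division by \<open>c\<close> maps the slab into itself.
\<close>

lemma nn_integral_hyperplane_dilate_le:
  fixes f :: "'a::euclidean_space \<Rightarrow> ennreal"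
  assumes [measurable]: "f \<in> borel_measurable borel" and c: "c \<ge> 1"
  shows "(\<integral>\<^sup>+w. f w \<partial>hyperplane_measure e)
    \<le> ennreal (c ^ DIM('a)) * (\<integral>\<^sup>+w. f (c *\<^sub>R w) \<partial>hyperplane_measure e)"
proof -
  have "(\<integral>\<^sup>+w. f w \<partial>hyperplane_measure e) =
    ennreal (c ^ DIM('a)) * (\<integral>\<^sup>+x. indicator (slab e) (c *\<^sub>R x) * f (c *\<^sub>R x - ((c *\<^sub>R x) \<bullet> e) *\<^sub>R e) \<partial>lborel)"
    using c by (subst nn_integral_hyperplane, simp, subst nn_integral_lborel_dilate[of _ c]) simp_all
  also have "\<dots> \<le> ennreal (c ^ DIM('a)) *
      (\<integral>\<^sup>+x. indicator (slab e) x * f (c *\<^sub>R (x - (x \<bullet> e) *\<^sub>R e)) \<partial>lborel)"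
  proof (intro mult_left_mono nn_integral_mono)
    fix x :: 'a
    have "x \<in> slab e" if "c *\<^sub>R x \<in> slab e"
    proof -
      have "0 \<le> c * (x \<bullet> e)" "c * (x \<bullet> e) \<le> 1" using that by (auto simp: slab_def)
      moreover from this have "0 \<le> x \<bullet> e" using c by (simp add: zero_le_mult_iff)
      moreover from this have "x \<bullet> e \<le> c * (x \<bullet> e)" using c by (simp add: mult_le_cancel_right1)
      ultimately show ?thesis by (auto simp: slab_def)
    qed
    then show "indicator (slab e) (c *\<^sub>R x) * f (c *\<^sub>R x - ((c *\<^sub>R x) \<bullet> e) *\<^sub>R e)
      \<le> indicator (slab e) x * f (c *\<^sub>R (x - (x \<bullet> e) *\<^sub>R e))"
      by (auto simp: indicator_def algebra_simps)
  qed simp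
  also have "\<dots> = ennreal (c ^ DIM('a)) * (\<integral>\<^sup>+w. f (c *\<^sub>R w) \<partial>hyperplane_measure e)"
    by (subst nn_integral_hyperplane) auto
  finally show ?thesis .
qed

lemma lborel_eq_distr_slices:
  fixes e :: "'a::euclidean_space"
  assumes e: "norm e = 1"
  shows "lborel = distr (lborel \<Otimes>\<^sub>M hyperplane_measure e) borel (\<lambda>(t, w). w + t *\<^sub>R e)"
proof (rule measure_eqI)
  interpret H: sigma_finite_measure "hyperplane_measure e" by (rule sigma_finite_hyperplane[OF e])
  fix A :: "'a set" assume "A \<in> sets lborel"
  then have [measurable]: "A \<in> sets borel" by simp
  have "emeasure lborel A = (\<integral>\<^sup>+x. indicator A x \<partial>lborel)" by simp
  also have "\<dots> = (\<integral>\<^sup>+t. (\<integral>\<^sup>+w. indicator A (w + t *\<^sub>R e) \<partial>hyperplane_measure e) \<partial>lborel)"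
    by (rule nn_integral_slices[OF e]) simp
  also have "\<dots> = (\<integral>\<^sup>+p. indicator A (snd p + fst p *\<^sub>R e) \<partial>(lborel \<Otimes>\<^sub>M hyperplane_measure e))"
    by (subst H.nn_integral_fst[symmetric]) auto
  also have "\<dots> = (\<integral>\<^sup>+x. indicator A x \<partial>distr (lborel \<Otimes>\<^sub>M hyperplane_measure e) borel (\<lambda>(t, w). w + t *\<^sub>R e))"
    by (subst nn_integral_distr) (auto simp: case_prod_unfold)
  also have "\<dots> = emeasure (distr (lborel \<Otimes>\<^sub>M hyperplane_measure e) borel (\<lambda>(t, w). w + t *\<^sub>R e)) A"
    by simp
  finally show "emeasure lborel A = emeasure (distr (lborel \<Otimes>\<^sub>M hyperplane_measure e) borel (\<lambda>(t, w). w + t *\<^sub>R e)) A" .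
qed simp

lemma integrable_slices_iff:
  fixes f :: "'a::euclidean_space \<Rightarrow> 'b::{banach, second_countable_topology}"
  assumes e: "norm e = 1" and [measurable]: "f \<in> borel_measurable borel"
  shows "integrable lborel f \<longleftrightarrow>
    integrable (lborel \<Otimes>\<^sub>M hyperplane_measure e) (\<lambda>(t, w). f (w + t *\<^sub>R e))"
  by (subst lborel_eq_distr_slices[OF e], subst integrable_distr_eq) (auto simp: case_prod_unfold)

lemma integral_slices_pair:
  fixes f :: "'a::euclidean_space \<Rightarrow> 'b::{banach, second_countable_topology}"
  assumes e: "norm e = 1" and [measurable]: "f \<in> borel_measurable borel"
  shows "(\<integral>x. f x \<partial>lborel) = (\<integral>(t, w). f (w + t *\<^sub>R e) \<partial>(lborel \<Otimes>\<^sub>M hyperplane_measure e))"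
  by (subst lborel_eq_distr_slices[OF e], subst integral_distr) (auto simp: case_prod_unfold)

lemma pair_sigma_finite_hyperplane:
  assumes "sigma_finite_measure M" "norm e = 1"
  shows "pair_sigma_finite M (hyperplane_measure e)"
  using assms sigma_finite_hyperplane by (simp add: pair_sigma_finite_def)

lemma integral_slices:
  fixes f :: "'a::euclidean_space \<Rightarrow> 'b::{banach, second_countable_topology}"
  assumes e: "norm e = 1" and f: "integrable lborel f"
  shows "(\<integral>x. f x \<partial>lborel) = (\<integral>t. (\<integral>w. f (w + t *\<^sub>R e) \<partial>hyperplane_measure e) \<partial>lborel)"
    and "(\<integral>x. f x \<partial>lborel) = (\<integral>w. (\<integral>t. f (w + t *\<^sub>R e) \<partial>lborel) \<partial>hyperplane_measure e)"
    and "AE t in lborel. integrable (hyperplane_measure e) (\<lambda>w. f (w + t *\<^sub>R e))"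
    and "AE w in hyperplane_measure e. integrable lborel (\<lambda>t. f (w + t *\<^sub>R e))"
proof -
  interpret P: pair_sigma_finite lborel "hyperplane_measure e"
    by (intro pair_sigma_finite_hyperplane e sigma_finite_lborel)
  have [measurable]: "f \<in> borel_measurable borel" using f by auto
  have *: "integrable (lborel \<Otimes>\<^sub>M hyperplane_measure e) (\<lambda>(t, w). f (w + t *\<^sub>R e))"
    using integrable_slices_iff[OF e, of f] f by auto
  show "(\<integral>x. f x \<partial>lborel) = (\<integral>t. (\<integral>w. f (w + t *\<^sub>R e) \<partial>hyperplane_measure e) \<partial>lborel)"
    using P.integral_fst[OF *] integral_slices_pair[OF e, of f] by simp
  show "(\<integral>x. f x \<partial>lborel) = (\<integral>w. (\<integral>t. f (w + t *\<^sub>R e) \<partial>lborel) \<partial>hyperplane_measure e)"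
    using P.integral_snd[OF *] integral_slices_pair[OF e, of f] by simp
  show "AE t in lborel. integrable (hyperplane_measure e) (\<lambda>w. f (w + t *\<^sub>R e))"
    using P.AE_integrable_fst[OF *] .
  show "AE w in hyperplane_measure e. integrable lborel (\<lambda>t. f (w + t *\<^sub>R e))"
    using P.AE_integrable_snd[OF *] .
qed

section \<open>Gaussian integrals\<close>

lemma measurable_cis [measurable]: "cis \<in> borel_measurable borel"
  by (intro borel_measurable_continuous_onI continuous_intros)

lemma integrable_mult_bounded:
  fixes f g :: "'a \<Rightarrow> 'b::{banach, second_countable_topology, real_normed_algebra}"
  assumes f: "integrable M f" and [measurable]: "g \<in> borel_measurable M" and B: "\<And>x. norm (g x) \<le> B"
  shows "integrable M (\<lambda>x. g x * f x)"
proof (rule Bochner_Integration.integrable_bound)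
  show "integrable M (\<lambda>x. B * norm (f x))" using f by simp
  show "(\<lambda>x. g x * f x) \<in> borel_measurable M" using f by measurable
  show "AE x in M. norm (g x * f x) \<le> norm (B * norm (f x))"
  proof (rule AE_I2)
    fix x
    have "norm (g x * f x) \<le> norm (g x) * norm (f x)" by (rule norm_mult_ineq)
    also have "\<dots> \<le> B * norm (f x)" using B by (intro mult_right_mono) auto
    finally show "norm (g x * f x) \<le> norm (B * norm (f x))" by auto
  qed
qed

lemma integrable_mult_right_cancel:
  fixes c :: complex
  assumes "integrable M (\<lambda>x. c * f x)" "c \<noteq> 0"
  shows "integrable M f"
  using integrable_mult_right[of "inverse c" M "\<lambda>x. c * f x"] assms
  by (simp add: mult.assoc[symmetric])

lemma integrable_cis_mult [simp, intro]:
  fixes f :: "'a \<Rightarrow> complex"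
  assumes "integrable M f" "\<phi> \<in> borel_measurable M"
  shows "integrable M (\<lambda>x. cis (\<phi> x) * f x)"
  using assms by (intro integrable_mult_bounded[where B=1]) auto

lemma gaussian_1D:
  fixes b :: real
  assumes \<epsilon>: "\<epsilon> > 0"
  shows "integrable lborel (\<lambda>x. cis (x * b) * of_real (exp (- \<epsilon> * x\<^sup>2)))"
    and "(\<integral>x. cis (x * b) * of_real (exp (- \<epsilon> * x\<^sup>2)) \<partial>lborel) =
      of_real (sqrt (pi / \<epsilon>) * exp (- b\<^sup>2 / (4 * \<epsilon>)))"
proof -
  define c where "c = sqrt (2 * \<epsilon>)"
  have c: "c > 0" "c\<^sup>2 = 2 * \<epsilon>" using \<epsilon> by (auto simp: c_def)
  define f where "f = (\<lambda>x. cis (x * (b / c)) * complex_of_real (std_normal_density x))"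
  have int: "integrable lborel f"
    unfolding f_def by (intro integrable_cis_mult) (auto intro!: integrable_normal_density)
  have "(\<integral>x. f x \<partial>lborel) = char std_normal_distribution (b / c)"
    unfolding char_def f_def
    by (subst integral_density) (auto simp: normal_density_nonneg cis_conv_exp scaleR_conv_of_real mult_ac)
  also have "\<dots> = of_real (exp (- b\<^sup>2 / (4 * \<epsilon>)))"
    using c by (simp add: char_std_normal_distribution power_divide)
  finally have val: "(\<integral>x. f x \<partial>lborel) = of_real (exp (- b\<^sup>2 / (4 * \<epsilon>)))" .
  have eq: "f (0 + c * x) = (1 / sqrt (2 * pi)) * (cis (x * b) * of_real (exp (- \<epsilon> * x\<^sup>2)))" for x
    using c by (simp add: f_def std_normal_density_def power_mult_distrib mult_ac)
  have "integrable lborel (\<lambda>x. f (0 + c * x))"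
    using int c by (intro lborel_integrable_real_affine) auto
  then show "integrable lborel (\<lambda>x. cis (x * b) * of_real (exp (- \<epsilon> * x\<^sup>2)))"
    unfolding eq by (rule integrable_mult_right_cancel) simp
  have "(\<integral>x. f x \<partial>lborel) = c *\<^sub>R (\<integral>x. f (0 + c * x) \<partial>lborel)"
    using lborel_integral_real_affine[of c f 0] c by simp
  then have X: "complex_of_real (exp (- b\<^sup>2 / (4 * \<epsilon>))) =
     of_real (c / sqrt (2 * pi)) * (\<integral>x. cis (x * b) * of_real (exp (- \<epsilon> * x\<^sup>2)) \<partial>lborel)"
    unfolding val eq by (simp add: scaleR_conv_of_real)
  have k: "sqrt (pi / \<epsilon>) * (c / sqrt (2 * pi)) = 1"
    using \<epsilon> by (simp add: c_def real_sqrt_mult real_sqrt_divide)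
  have "complex_of_real (sqrt (pi / \<epsilon>) * exp (- b\<^sup>2 / (4 * \<epsilon>))) =
     of_real (sqrt (pi / \<epsilon>)) * complex_of_real (exp (- b\<^sup>2 / (4 * \<epsilon>)))" by simp
  also have "\<dots> = of_real (sqrt (pi / \<epsilon>) * (c / sqrt (2 * pi))) *
     (\<integral>x. cis (x * b) * of_real (exp (- \<epsilon> * x\<^sup>2)) \<partial>lborel)"
    unfolding X of_real_mult by (simp only: mult.assoc)
  finally show "(\<integral>x. cis (x * b) * of_real (exp (- \<epsilon> * x\<^sup>2)) \<partial>lborel) =
      of_real (sqrt (pi / \<epsilon>) * exp (- b\<^sup>2 / (4 * \<epsilon>)))"
    unfolding k by simp
qed

lemma
  fixes f :: "'a::euclidean_space \<Rightarrow> real \<Rightarrow> complex"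
  assumes f: "\<And>b. b \<in> Basis \<Longrightarrow> integrable lborel (f b)"
  shows integrable_lborel_prod: "integrable lborel (\<lambda>x. \<Prod>b\<in>Basis. f b (x \<bullet> b))"
    and integral_lborel_prod: "(\<integral>x. (\<Prod>b\<in>Basis. f b (x \<bullet> b)) \<partial>lborel) = (\<Prod>b\<in>Basis. \<integral>x. f b x \<partial>lborel)"
proof -
  interpret product_sigma_finite "\<lambda>_::'a. lborel :: real measure"
    by (simp add: product_sigma_finite_def sigma_finite_lborel)
  have [measurable]: "b \<in> Basis \<Longrightarrow> f b \<in> borel_measurable borel" for b using f by auto
  have *: "(\<Prod>b\<in>Basis. f b ((\<Sum>b\<in>Basis. y b *\<^sub>R b) \<bullet> b)) = (\<Prod>b\<in>Basis. f b (y b))" for y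
    by (intro prod.cong) auto
  show "integrable lborel (\<lambda>x. \<Prod>b\<in>Basis. f b (x \<bullet> b))"
    unfolding lborel_eq[where 'a='a] using product_integrable_prod[of Basis f] f
    by (subst integrable_distr_eq) (simp_all add: *)
  show "(\<integral>x. (\<Prod>b\<in>Basis. f b (x \<bullet> b)) \<partial>lborel) = (\<Prod>b\<in>Basis. \<integral>x. f b x \<partial>lborel)"
    unfolding lborel_eq[where 'a='a] using product_integral_prod[of Basis f] f
    by (subst integral_distr) (simp_all add: *)
qed

lemma gaussian_lborel:
  fixes \<xi> :: "'a::euclidean_space"
  assumes \<epsilon>: "\<epsilon> > 0"
  shows "integrable lborel (\<lambda>x. cis (x \<bullet> \<xi>) * of_real (exp (- \<epsilon> * (norm x)\<^sup>2)))"
    and "(\<integral>x. cis (x \<bullet> \<xi>) * of_real (exp (- \<epsilon> * (norm x)\<^sup>2)) \<partial>lborel) =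
      of_real (sqrt (pi / \<epsilon>) ^ DIM('a) * exp (- (norm \<xi>)\<^sup>2 / (4 * \<epsilon>)))"
proof -
  define f where "f = (\<lambda>b x. cis (x * (\<xi> \<bullet> b)) * complex_of_real (exp (- \<epsilon> * x\<^sup>2)))"
  have sq: "(norm y)\<^sup>2 = (\<Sum>b\<in>Basis. (y \<bullet> b)\<^sup>2)" for y :: 'a
    by (subst power2_norm_eq_inner, subst euclidean_inner) (simp add: power2_eq_square)
  have eq: "cis (x \<bullet> \<xi>) * of_real (exp (- \<epsilon> * (norm x)\<^sup>2)) = (\<Prod>b\<in>Basis. f b (x \<bullet> b))" for x :: 'a
    unfolding f_def prod.distrib sq
    by (simp add: cis_conv_exp euclidean_inner[of x \<xi>] sum_distrib_left exp_sum flip: sum_negf)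
  show "integrable lborel (\<lambda>x. cis (x \<bullet> \<xi>) * of_real (exp (- \<epsilon> * (norm x)\<^sup>2)))"
    unfolding eq using gaussian_1D(1)[OF \<epsilon>] by (intro integrable_lborel_prod) (simp add: f_def)
  have "(\<integral>x. cis (x \<bullet> \<xi>) * of_real (exp (- \<epsilon> * (norm x)\<^sup>2)) \<partial>lborel) =
      (\<Prod>b\<in>Basis. of_real (sqrt (pi / \<epsilon>) * exp (- (\<xi> \<bullet> b)\<^sup>2 / (4 * \<epsilon>))))"
    unfolding eq using gaussian_1D[OF \<epsilon>] by (subst integral_lborel_prod) (simp_all add: f_def)
  also have "\<dots> = of_real (sqrt (pi / \<epsilon>) ^ DIM('a) * exp (- (norm \<xi>)\<^sup>2 / (4 * \<epsilon>)))"
    unfolding of_real_mult prod.distrib sq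
    by (simp add: sum_divide_distrib exp_sum flip: sum_negf)
  finally show "(\<integral>x. cis (x \<bullet> \<xi>) * of_real (exp (- \<epsilon> * (norm x)\<^sup>2)) \<partial>lborel) =
      of_real (sqrt (pi / \<epsilon>) ^ DIM('a) * exp (- (norm \<xi>)\<^sup>2 / (4 * \<epsilon>)))" .
qed

lemma norm_add_scaleR_orthogonal:
  assumes "norm e = 1" "w \<bullet> e = 0"
  shows "(norm (w + t *\<^sub>R e))\<^sup>2 = (norm w)\<^sup>2 + t\<^sup>2"
  using norm_add_Pythagorean[of w "t *\<^sub>R e"] assms by (simp add: orthogonal_def)

text \<open>
  Dividing the Gaussian integral on the whole space by the one-dimensional integral over the normal
  direction leaves the integral over the hyperplane.
\<close>

lemma gaussian_hyperplane:
  fixes \<eta> e :: "'a::euclidean_space"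
  assumes \<epsilon>: "\<epsilon> > 0" and e: "norm e = 1" and \<eta>: "\<eta> \<bullet> e = 0"
  shows "integrable (hyperplane_measure e) (\<lambda>w. cis (w \<bullet> \<eta>) * of_real (exp (- \<epsilon> * (norm w)\<^sup>2)))"
    and "(\<integral>w. cis (w \<bullet> \<eta>) * of_real (exp (- \<epsilon> * (norm w)\<^sup>2)) \<partial>hyperplane_measure e) =
      of_real (sqrt (pi / \<epsilon>) ^ (DIM('a) - 1) * exp (- (norm \<eta>)\<^sup>2 / (4 * \<epsilon>)))"
proof -
  let ?f = "\<lambda>x. cis (x \<bullet> \<eta>) * complex_of_real (exp (- \<epsilon> * (norm x)\<^sup>2))"
  have AE: "AE w in hyperplane_measure e. ?f (w + t *\<^sub>R e) = of_real (exp (- \<epsilon> * t\<^sup>2)) * ?f w" for t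
    using AE_hyperplane_orthogonal[OF e]
  proof eventually_elim
    case (elim w)
    have "exp (- \<epsilon> * (norm (w + t *\<^sub>R e))\<^sup>2) = exp (- \<epsilon> * t\<^sup>2) * exp (- \<epsilon> * (norm w)\<^sup>2)"
      by (simp add: norm_add_scaleR_orthogonal[OF e elim] exp_add[symmetric] algebra_simps)
    moreover have "(w + t *\<^sub>R e) \<bullet> \<eta> = w \<bullet> \<eta>"
      using \<eta> by (simp add: inner_add_left inner_commute[of e \<eta>])
    ultimately show ?case by (simp only: of_real_mult) (simp only: mult_ac)
  qed
  have "AE t in lborel. integrable (hyperplane_measure e) (\<lambda>w. ?f (w + t *\<^sub>R e))"
    by (rule integral_slices(3)[OF e gaussian_lborel(1)[OF \<epsilon>]])
  then have "\<exists>t. integrable (hyperplane_measure e) (\<lambda>w. ?f (w + t *\<^sub>R e))"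
    by (rule eventually_happens'[rotated]) (simp add: ae_filter_eq_bot_iff)
  then obtain t where "integrable (hyperplane_measure e) (\<lambda>w. ?f (w + t *\<^sub>R e))" by blast
  then have "integrable (hyperplane_measure e) (\<lambda>w. of_real (exp (- \<epsilon> * t\<^sup>2)) * ?f w)"
  proof (rule integrable_cong_AE_imp)
    show "AE w in hyperplane_measure e. ?f (w + t *\<^sub>R e) = of_real (exp (- \<epsilon> * t\<^sup>2)) * ?f w"
      by (rule AE)
  qed simp
  then show "integrable (hyperplane_measure e) ?f"
    by (rule integrable_mult_right_cancel) simp
  have "of_real (sqrt (pi / \<epsilon>) ^ DIM('a) * exp (- (norm \<eta>)\<^sup>2 / (4 * \<epsilon>))) =
     (\<integral>t. (\<integral>w. ?f (w + t *\<^sub>R e) \<partial>hyperplane_measure e) \<partial>lborel)"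
    using integral_slices(1)[OF e gaussian_lborel(1)[OF \<epsilon>, of \<eta>]] gaussian_lborel(2)[OF \<epsilon>, of \<eta>] by simp
  also have "\<dots> = (\<integral>t. of_real (exp (- \<epsilon> * t\<^sup>2)) * (\<integral>w. ?f w \<partial>hyperplane_measure e) \<partial>lborel)"
  proof (rule Bochner_Integration.integral_cong[OF refl])
    fix t
    have "(\<integral>w. ?f (w + t *\<^sub>R e) \<partial>hyperplane_measure e) =
      (\<integral>w. of_real (exp (- \<epsilon> * t\<^sup>2)) * ?f w \<partial>hyperplane_measure e)"
      using AE[of t] by (intro integral_cong_AE) auto
    then show "(\<integral>w. ?f (w + t *\<^sub>R e) \<partial>hyperplane_measure e) =
      of_real (exp (- \<epsilon> * t\<^sup>2)) * (\<integral>w. ?f w \<partial>hyperplane_measure e)" by simp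
  qed
  also have "\<dots> = of_real (sqrt (pi / \<epsilon>)) * (\<integral>w. ?f w \<partial>hyperplane_measure e)"
    using gaussian_1D(2)[OF \<epsilon>, of 0] by simp
  finally have *: "of_real (sqrt (pi / \<epsilon>) ^ DIM('a) * exp (- (norm \<eta>)\<^sup>2 / (4 * \<epsilon>))) =
     of_real (sqrt (pi / \<epsilon>)) * (\<integral>w. ?f w \<partial>hyperplane_measure e)" .
  have "DIM('a) = Suc (DIM('a) - 1)" by simp
  then have "sqrt (pi / \<epsilon>) ^ DIM('a) = sqrt (pi / \<epsilon>) * sqrt (pi / \<epsilon>) ^ (DIM('a) - 1)"
    by (metis power_Suc)
  with * \<epsilon> show "(\<integral>w. ?f w \<partial>hyperplane_measure e) =
     of_real (sqrt (pi / \<epsilon>) ^ (DIM('a) - 1) * exp (- (norm \<eta>)\<^sup>2 / (4 * \<epsilon>)))"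
    by simp
qed

section \<open>Exponential integrals on half-lines\<close>

lemma exponential_half_line:
  fixes z :: complex
  assumes z: "Re z > 0"
  shows "integrable lborel (\<lambda>t. indicator {0..} t *\<^sub>R exp (- z * of_real t))"
    and "(\<integral>t. indicator {0..} t *\<^sub>R exp (- z * of_real t) \<partial>lborel) = 1 / z"
proof -
  let ?f = "\<lambda>t::real. indicator {0..} t *\<^sub>R exp (- z * of_real t)"
  have "(\<integral>\<^sup>+t. ennreal (exp (- (Re z) * t)) * indicator {0..} t \<partial>lborel) = ennreal (0 - (- 1 / Re z) * exp (- (Re z) * 0))"
    using z
    by (intro nn_integral_FTC_atLeast[where F="\<lambda>t. (- 1 / Re z) * exp (- (Re z) * t)"])
       ((auto intro!: derivative_eq_intros)[3], real_asymp)
  also have "(\<integral>\<^sup>+t. ennreal (exp (- (Re z) * t)) * indicator {0..} t \<partial>lborel) = (\<integral>\<^sup>+t. norm (?f t) \<partial>lborel)"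
    by (rule nn_integral_cong) (simp add: indicator_def)
  finally have fin: "(\<integral>\<^sup>+t. norm (?f t) \<partial>lborel) = ennreal (0 - (- 1 / Re z) * exp (- (Re z) * 0))" .
  show int: "integrable lborel ?f"
  proof (rule integrableI_bounded)
    show "?f \<in> borel_measurable lborel" by measurable
    show "(\<integral>\<^sup>+t. norm (?f t) \<partial>lborel) < \<infinity>" unfolding fin by simp
  qed
  have *: "(\<integral>t. indicator {..y} t *\<^sub>R ?f t \<partial>lborel) = 1 / z - exp (- z * of_real y) / z" if "y \<ge> 0" for y
  proof -
    have "(\<integral>t. indicator {..y} t *\<^sub>R ?f t \<partial>lborel) = (\<integral>t. indicator {0..y} t *\<^sub>R exp (- z * of_real t) \<partial>lborel)"
      by (intro Bochner_Integration.integral_cong) (auto simp: indicator_def)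
    also have "\<dots> = (- exp (- z * of_real y) / z) - (- exp (- z * of_real 0) / z)"
    proof (rule integral_FTC_Icc[OF that])
      fix x
      have "((\<lambda>t. - exp (- z * t) / z) has_field_derivative exp (- z * complex_of_real x)) (at (complex_of_real x))"
        using z by (auto intro!: derivative_eq_intros)
      then show "((\<lambda>t. - exp (- z * complex_of_real t) / z) has_vector_derivative exp (- z * complex_of_real x)) (at x within {0..y})"
        by (rule has_vector_derivative_real_field)
    qed (auto intro!: continuous_intros)
    finally show ?thesis by simp
  qed
  have "((\<lambda>y. exp (- z * complex_of_real y)) \<longlongrightarrow> 0) at_top"
    by (rule tendsto_norm_zero_cancel) (use z in \<open>simp, real_asymp\<close>)
  then have "((\<lambda>y. 1 / z - exp (- z * complex_of_real y) / z) \<longlongrightarrow> 1 / z - 0 / z) at_top"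
    by (intro tendsto_intros) (use z in auto)
  then have "((\<lambda>y. 1 / z - exp (- z * complex_of_real y) / z) \<longlongrightarrow> 1 / z) at_top" by simp
  moreover have "eventually (\<lambda>y. 1 / z - exp (- z * complex_of_real y) / z =
      (\<integral>t. indicator {..y} t *\<^sub>R ?f t \<partial>lborel)) at_top"
    using eventually_ge_at_top[of "0::real"] by eventually_elim (rule *[symmetric])
  ultimately have "((\<lambda>y. \<integral>t. indicator {..y} t *\<^sub>R ?f t \<partial>lborel) \<longlongrightarrow> 1 / z) at_top"
    by (rule Lim_transform_eventually)
  moreover have "((\<lambda>y. \<integral>t. indicator {..y} t *\<^sub>R ?f t \<partial>lborel) \<longlongrightarrow> (\<integral>t. ?f t \<partial>lborel)) at_top"
    by (rule tendsto_integral_at_top[OF _ int]) simp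
  ultimately have "1 / z = (\<integral>t. ?f t \<partial>lborel)"
    by (rule tendsto_unique[OF trivial_limit_at_top_linorder])
  then show "(\<integral>t. ?f t \<partial>lborel) = 1 / z" by (rule sym)
qed

lemma exponential_negative_half_line:
  fixes z :: complex
  assumes z: "Re z > 0"
  shows "integrable lborel (\<lambda>t. indicator {..0} t *\<^sub>R exp (z * of_real t))"
    and "(\<integral>t. indicator {..0} t *\<^sub>R exp (z * of_real t) \<partial>lborel) = 1 / z"
proof -
  let ?f = "\<lambda>t::real. indicator {0..} t *\<^sub>R exp (- z * of_real t)"
  have eq: "?f (0 + (-1) * t) = indicator {..0} t *\<^sub>R exp (z * of_real t)" for t
    by (auto simp: indicator_def)
  have "integrable lborel (\<lambda>t. ?f (0 + (-1) * t))"
    by (intro lborel_integrable_real_affine exponential_half_line z) simp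
  then show "integrable lborel (\<lambda>t. indicator {..0} t *\<^sub>R exp (z * of_real t))"
    unfolding eq .
  show "(\<integral>t. indicator {..0} t *\<^sub>R exp (z * of_real t) \<partial>lborel) = 1 / z"
    using lborel_integral_real_affine[of "-1" ?f 0] exponential_half_line(2)[OF z]
    unfolding eq by simp
qed

section \<open>Fourier inversion and the Plancherel inequality\<close>

lemma (in pair_sigma_finite) integrable_pair_product_bound:
  fixes f :: "'a \<times> 'b \<Rightarrow> 'c::{banach, second_countable_topology}"
    and a :: "'a \<Rightarrow> real" and b :: "'b \<Rightarrow> real"
  assumes [measurable]: "f \<in> borel_measurable (M1 \<Otimes>\<^sub>M M2)"
    and a: "integrable M1 a" and b: "integrable M2 b"
    and le: "\<And>x y. norm (f (x, y)) \<le> a x * b y"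
  shows "integrable (M1 \<Otimes>\<^sub>M M2) f"
proof (rule Fubini_integrable)
  have [measurable]: "a \<in> borel_measurable M1" "b \<in> borel_measurable M2" using a b by auto
  have y: "integrable M2 (\<lambda>y. f (x, y))" if "x \<in> space M1" for x
  proof (rule Bochner_Integration.integrable_bound)
    show "integrable M2 (\<lambda>y. a x * b y)" using b by simp
    show "AE y in M2. norm (f (x, y)) \<le> norm (a x * b y)"
      using le[of x] by (intro AE_I2) (auto intro: order_trans[OF _ abs_ge_self])
    show "(\<lambda>y. f (x, y)) \<in> borel_measurable M2" using that by measurable
  qed
  then show "AE x in M1. integrable M2 (\<lambda>y. f (x, y))" by (rule AE_I2)
  show "integrable M1 (\<lambda>x. \<integral>y. norm (f (x, y)) \<partial>M2)"
  proof (rule Bochner_Integration.integrable_bound)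
    show "integrable M1 (\<lambda>x. a x * (\<integral>y. b y \<partial>M2))" using a by simp
    show "AE x in M1. norm (\<integral>y. norm (f (x, y)) \<partial>M2) \<le> norm (a x * (\<integral>y. b y \<partial>M2))"
    proof (rule AE_I2)
      fix x assume x: "x \<in> space M1"
      have "(\<integral>y. norm (f (x, y)) \<partial>M2) \<le> (\<integral>y. a x * b y \<partial>M2)"
        using y[OF x] b le by (intro integral_mono) auto
      then show "norm (\<integral>y. norm (f (x, y)) \<partial>M2) \<le> norm (a x * (\<integral>y. b y \<partial>M2))"
        by simp
    qed
  qed simp
qed simp

lemma measurable_cnj [measurable]: "cnj \<in> borel_measurable borel"
  by (intro borel_measurable_continuous_onI continuous_intros)

text \<open>
  Inserting \<open>exp (- \<epsilon> \<tau>\<^sup>2)\<close> makes Fubini's theorem applicable and turns the left side into an average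
  of \<open>u\<close> near \<open>t\<close> with Gaussian weight, which tends to \<open>2 \<pi> u t\<close> as \<open>\<epsilon> \<rightarrow> 0\<close>.
\<close>

lemma fourier_inversion_1D:
  fixes u :: "real \<Rightarrow> complex"
  defines "U \<equiv> \<lambda>\<tau>. (\<integral>t. cis (\<tau> * t) * u t \<partial>lborel)"
  assumes cont: "continuous_on UNIV u" and bdd: "\<And>t. norm (u t) \<le> B"
    and u: "integrable lborel u" and U: "integrable lborel U"
  shows "(\<integral>\<tau>. cis (- (t * \<tau>)) * U \<tau> \<partial>lborel) = 2 * pi * u t"
proof -
  have [measurable]: "u \<in> borel_measurable borel" using u by auto
  have [measurable]: "U \<in> borel_measurable borel" using U by auto
  define \<epsilon> where "\<epsilon> = (\<lambda>k::nat. 1 / real (Suc k))"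
  have \<epsilon>: "\<epsilon> k > 0" for k by (simp add: \<epsilon>_def)
  have \<epsilon>0: "\<epsilon> \<longlonglongrightarrow> 0" unfolding \<epsilon>_def by (rule LIMSEQ_Suc[OF lim_1_over_n])
  let ?g = "\<lambda>k \<tau>. complex_of_real (exp (- \<epsilon> k * \<tau>\<^sup>2))"
  define L where "L = (\<lambda>k. \<integral>\<tau>. cis (- (t * \<tau>)) * ?g k \<tau> * U \<tau> \<partial>lborel)"
  have lim1: "L \<longlonglongrightarrow> (\<integral>\<tau>. cis (- (t * \<tau>)) * U \<tau> \<partial>lborel)"
    unfolding L_def
  proof (rule integral_dominated_convergence[where w="\<lambda>\<tau>. norm (U \<tau>)"])
    show "AE \<tau> in lborel. (\<lambda>k. cis (- (t * \<tau>)) * ?g k \<tau> * U \<tau>) \<longlonglongrightarrow> cis (- (t * \<tau>)) * U \<tau>"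
    proof (rule AE_I2)
      fix \<tau>
      have "(\<lambda>k. cis (- (t * \<tau>)) * ?g k \<tau> * U \<tau>) \<longlonglongrightarrow> cis (- (t * \<tau>)) * of_real (exp (- 0 * \<tau>\<^sup>2)) * U \<tau>"
        by (intro tendsto_intros \<epsilon>0)
      then show "(\<lambda>k. cis (- (t * \<tau>)) * ?g k \<tau> * U \<tau>) \<longlonglongrightarrow> cis (- (t * \<tau>)) * U \<tau>" by simp
    qed
    show "AE \<tau> in lborel. norm (cis (- (t * \<tau>)) * ?g k \<tau> * U \<tau>) \<le> norm (U \<tau>)" for k
      using \<epsilon>[of k] by (intro AE_I2) (auto simp: norm_mult intro!: mult_left_le_one_le)
  qed (use U in auto)
  have L: "L k = 2 * sqrt pi * (\<integral>z. u (t + 2 * sqrt (\<epsilon> k) * z) * of_real (exp (- z\<^sup>2)) \<partial>lborel)" for k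
  proof -
    let ?F = "\<lambda>\<tau> r. cis (- (t * \<tau>)) * ?g k \<tau> * (cis (\<tau> * r) * u r)"
    have int: "integrable (lborel \<Otimes>\<^sub>M lborel) (case_prod ?F)"
    proof (rule lborel_pair.integrable_pair_product_bound)
      show "integrable lborel (\<lambda>\<tau>. norm (?g k \<tau>))"
        using gaussian_1D(1)[OF \<epsilon>[of k], of 0] by (intro integrable_norm) simp
      show "integrable lborel (\<lambda>r. norm (u r))" using u by simp
    qed (auto simp: norm_mult)
    have "L k = (\<integral>\<tau>. (\<integral>r. ?F \<tau> r \<partial>lborel) \<partial>lborel)"
      unfolding L_def U_def by simp
    also have "\<dots> = (\<integral>r. (\<integral>\<tau>. ?F \<tau> r \<partial>lborel) \<partial>lborel)"
      by (rule lborel_pair.Fubini_integral[OF int, symmetric])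
    also have "\<dots> = (\<integral>r. u r * of_real (sqrt (pi / \<epsilon> k) * exp (- (r - t)\<^sup>2 / (4 * \<epsilon> k))) \<partial>lborel)"
    proof (rule Bochner_Integration.integral_cong[OF refl])
      fix r
      have "(\<integral>\<tau>. ?F \<tau> r \<partial>lborel) = (\<integral>\<tau>. u r * (cis (\<tau> * (r - t)) * ?g k \<tau>) \<partial>lborel)"
        by (intro Bochner_Integration.integral_cong refl) (simp add: cis_mult[symmetric] algebra_simps cis_divide[symmetric] cis_inverse[symmetric] field_simps)
      also have "\<dots> = u r * of_real (sqrt (pi / \<epsilon> k) * exp (- (r - t)\<^sup>2 / (4 * \<epsilon> k)))"
        using gaussian_1D(2)[OF \<epsilon>[of k], of "r - t"] by simp
      finally show "(\<integral>\<tau>. ?F \<tau> r \<partial>lborel) = u r * of_real (sqrt (pi / \<epsilon> k) * exp (- (r - t)\<^sup>2 / (4 * \<epsilon> k)))" .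
    qed
    also have "\<dots> = (2 * sqrt (\<epsilon> k)) *\<^sub>R (\<integral>z. u (t + 2 * sqrt (\<epsilon> k) * z) *
        of_real (sqrt (pi / \<epsilon> k) * exp (- ((t + 2 * sqrt (\<epsilon> k) * z) - t)\<^sup>2 / (4 * \<epsilon> k))) \<partial>lborel)"
      using \<epsilon>[of k] by (subst lborel_integral_real_affine[where c="2 * sqrt (\<epsilon> k)" and t=t]) auto
    also have "\<dots> = (2 * sqrt (\<epsilon> k)) *\<^sub>R (\<integral>z. of_real (sqrt (pi / \<epsilon> k)) * (u (t + 2 * sqrt (\<epsilon> k) * z) *
        of_real (exp (- z\<^sup>2))) \<partial>lborel)"
      using \<epsilon>[of k] by (simp add: power_mult_distrib mult_ac)
    also have "\<dots> = 2 * sqrt pi * (\<integral>z. u (t + 2 * sqrt (\<epsilon> k) * z) * of_real (exp (- z\<^sup>2)) \<partial>lborel)"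
      using \<epsilon>[of k] by (simp add: scaleR_conv_of_real real_sqrt_divide)
    finally show ?thesis .
  qed
  have lim2: "(\<lambda>k. \<integral>z. u (t + 2 * sqrt (\<epsilon> k) * z) * of_real (exp (- z\<^sup>2)) \<partial>lborel) \<longlonglongrightarrow>
     (\<integral>z. u t * of_real (exp (- z\<^sup>2)) \<partial>lborel)"
  proof (rule integral_dominated_convergence[where w="\<lambda>z. B * exp (- z\<^sup>2)"])
    have "integrable lborel (\<lambda>z. norm (complex_of_real (exp (- z\<^sup>2))))"
      using gaussian_1D(1)[of 1 0] by (intro integrable_norm) simp
    then show "integrable lborel (\<lambda>z. B * exp (- z\<^sup>2))" by simp
    show "AE z in lborel. (\<lambda>k. u (t + 2 * sqrt (\<epsilon> k) * z) * of_real (exp (- z\<^sup>2))) \<longlonglongrightarrow> u t * of_real (exp (- z\<^sup>2))"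
    proof (rule AE_I2)
      fix z
      have "(\<lambda>k. t + 2 * sqrt (\<epsilon> k) * z) \<longlonglongrightarrow> t + 2 * sqrt 0 * z"
        by (intro tendsto_intros \<epsilon>0)
      then have "(\<lambda>k. u (t + 2 * sqrt (\<epsilon> k) * z)) \<longlonglongrightarrow> u t"
        using cont by (intro isCont_tendsto_compose[of t u]) (auto simp: continuous_on_eq_continuous_at)
      then show "(\<lambda>k. u (t + 2 * sqrt (\<epsilon> k) * z) * of_real (exp (- z\<^sup>2))) \<longlonglongrightarrow> u t * of_real (exp (- z\<^sup>2))"
        by (intro tendsto_intros)
    qed
    show "AE z in lborel. norm (u (t + 2 * sqrt (\<epsilon> k) * z) * of_real (exp (- z\<^sup>2))) \<le> B * exp (- z\<^sup>2)" for k
      using bdd by (intro AE_I2) (auto simp: norm_mult)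
  qed auto
  have val: "(\<integral>z. u t * of_real (exp (- z\<^sup>2)) \<partial>lborel) = u t * sqrt pi"
    using gaussian_1D[of 1 0] by simp
  have "(\<lambda>k. 2 * sqrt pi * (\<integral>z. u (t + 2 * sqrt (\<epsilon> k) * z) * of_real (exp (- z\<^sup>2)) \<partial>lborel))
    \<longlonglongrightarrow> 2 * sqrt pi * (u t * sqrt pi)"
    by (intro tendsto_mult_left lim2[unfolded val])
  then have "L \<longlonglongrightarrow> 2 * sqrt pi * (u t * sqrt pi)"
    unfolding L[abs_def] .
  then have "(\<integral>\<tau>. cis (- (t * \<tau>)) * U \<tau> \<partial>lborel) = 2 * sqrt pi * (u t * sqrt pi)"
    by (rule LIMSEQ_unique[OF lim1])
  also have "\<dots> = 2 * pi * u t"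
    by (simp add: mult_ac flip: of_real_mult)
  finally show ?thesis .
qed

text \<open>
  With the factor \<open>exp (- \<epsilon> |\<eta>|\<^sup>2)\<close> inserted, the left side becomes the double integral of \<open>F v * cnj (F v')\<close> against a
  Gaussian in \<open>v - v'\<close> of total mass \<open>(2 \<pi>) ^ (n - 1)\<close>, and
  \<open>|F v| |F v'| \<le> |F v|\<^sup>2 / 2 + |F v'|\<^sup>2 / 2\<close> bounds that by the right side, uniformly in \<open>\<epsilon>\<close>. Fatou's
  lemma removes the factor.
\<close>

lemma plancherel_inequality_hyperplane:
  fixes e :: "'a::euclidean_space" and F :: "'a \<Rightarrow> complex"
  assumes e: "norm e = 1" and F: "integrable (hyperplane_measure e) F"
  shows "(\<integral>\<^sup>+\<eta>. ennreal ((norm (\<integral>w. cis (w \<bullet> \<eta>) * F w \<partial>hyperplane_measure e))\<^sup>2) \<partial>hyperplane_measure e)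
    \<le> ennreal ((2 * pi) ^ (DIM('a) - 1)) * (\<integral>\<^sup>+w. ennreal ((norm (F w))\<^sup>2) \<partial>hyperplane_measure e)"
proof -
  let ?H = "hyperplane_measure e"
  interpret H: sigma_finite_measure ?H by (rule sigma_finite_hyperplane[OF e])
  interpret HH: pair_sigma_finite ?H ?H ..
  interpret HHH: pair_sigma_finite ?H "?H \<Otimes>\<^sub>M ?H" ..
  have [measurable]: "F \<in> borel_measurable borel" using F by auto
  define Fh where "Fh = (\<lambda>\<eta>. \<integral>w. cis (w \<bullet> \<eta>) * F w \<partial>?H)"
  have [measurable]: "Fh \<in> borel_measurable borel"
    unfolding Fh_def by measurable
  define C where "C = ennreal ((2 * pi) ^ (DIM('a) - 1)) * (\<integral>\<^sup>+w. ennreal ((norm (F w))\<^sup>2) \<partial>?H)"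
  have gauss: "(\<integral>\<^sup>+\<eta>. ennreal ((norm (Fh \<eta>))\<^sup>2 * exp (- \<epsilon> * (norm \<eta>)\<^sup>2)) \<partial>?H) \<le> C" if \<epsilon>: "\<epsilon> > 0" for \<epsilon>
  proof -
    let ?g = "\<lambda>\<eta>. complex_of_real (exp (- \<epsilon> * (norm \<eta>)\<^sup>2))"
    define G where "G = (\<lambda>z::'a. sqrt (pi / \<epsilon>) ^ (DIM('a) - 1) * exp (- (norm z)\<^sup>2 / (4 * \<epsilon>)))"
    have G0: "G z \<ge> 0" for z using \<epsilon> by (simp add: G_def)
    have [measurable]: "G \<in> borel_measurable borel" unfolding G_def by measurable
    have ig: "integrable ?H ?g"
      using gaussian_hyperplane(1)[OF \<epsilon> e, of 0] by simp
    have iF2: "integrable (?H \<Otimes>\<^sub>M ?H) (\<lambda>(v, v'). F v * cnj (F v'))"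
      by (rule HH.integrable_pair_product_bound[where a="\<lambda>v. norm (F v)" and b="\<lambda>v. norm (F v)"])
         (use F in \<open>auto simp: norm_mult\<close>)
    let ?T = "\<lambda>\<eta> (v, v'). cis ((v - v') \<bullet> \<eta>) * ?g \<eta> * (F v * cnj (F v'))"
    have iT: "integrable (?H \<Otimes>\<^sub>M (?H \<Otimes>\<^sub>M ?H)) (case_prod ?T)"
      by (rule HHH.integrable_pair_product_bound[where a="\<lambda>\<eta>. norm (?g \<eta>)" and b="\<lambda>p. norm (case p of (v, v') \<Rightarrow> F v * cnj (F v'))"])
         (use integrable_norm[OF ig] integrable_norm[OF iF2] in \<open>auto simp: norm_mult case_prod_unfold\<close>)
    have sq: "of_real ((norm (Fh \<eta>))\<^sup>2 * exp (- \<epsilon> * (norm \<eta>)\<^sup>2)) = (\<integral>p. ?T \<eta> p \<partial>(?H \<Otimes>\<^sub>M ?H))" for \<eta>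
    proof -
      have i1: "integrable ?H (\<lambda>v. cis (v \<bullet> \<eta>) * F v)" by (intro integrable_cis_mult F) simp
      have i2: "integrable (?H \<Otimes>\<^sub>M ?H) (\<lambda>(v, v'). (cis (v \<bullet> \<eta>) * F v) * cnj (cis (v' \<bullet> \<eta>) * F v'))"
        by (rule HH.integrable_pair_product_bound[where a="\<lambda>v. norm (F v)" and b="\<lambda>v. norm (F v)"])
         (use F in \<open>auto simp: norm_mult\<close>)
      have "(\<integral>p. ?T \<eta> p \<partial>(?H \<Otimes>\<^sub>M ?H)) =
         (\<integral>p. ?g \<eta> * (case p of (v, v') \<Rightarrow> (cis (v \<bullet> \<eta>) * F v) * cnj (cis (v' \<bullet> \<eta>) * F v')) \<partial>(?H \<Otimes>\<^sub>M ?H))"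
        by (intro Bochner_Integration.integral_cong refl)
           (auto simp: inner_diff_left cis_divide[symmetric] cis_cnj divide_inverse cis_inverse)
      also have "\<dots> = ?g \<eta> * (\<integral>(v, v'). (cis (v \<bullet> \<eta>) * F v) * cnj (cis (v' \<bullet> \<eta>) * F v') \<partial>(?H \<Otimes>\<^sub>M ?H))"
        by simp
      also have "(\<integral>(v, v'). (cis (v \<bullet> \<eta>) * F v) * cnj (cis (v' \<bullet> \<eta>) * F v') \<partial>(?H \<Otimes>\<^sub>M ?H))
         = (\<integral>v. (\<integral>v'. (cis (v \<bullet> \<eta>) * F v) * cnj (cis (v' \<bullet> \<eta>) * F v') \<partial>?H) \<partial>?H)"
        by (rule HH.integral_fst[OF i2, symmetric])
      also have "\<dots> = Fh \<eta> * cnj (Fh \<eta>)"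
        unfolding Fh_def by (simp only: integral_mult_right_zero integral_mult_left_zero Bochner_Integration.integral_cnj)
      finally show ?thesis
        unfolding of_real_mult complex_norm_square by (simp only: mult.commute)
    qed
    have TG: "norm (\<integral>\<eta>. ?T \<eta> (v, v') \<partial>?H) = norm (F v) * norm (F v') * G (v - v')"
      if "v \<bullet> e = 0" "v' \<bullet> e = 0" for v v'
    proof -
      have "(\<integral>\<eta>. ?T \<eta> (v, v') \<partial>?H) = (\<integral>\<eta>. (F v * cnj (F v')) * (cis (\<eta> \<bullet> (v - v')) * ?g \<eta>) \<partial>?H)"
        by (intro Bochner_Integration.integral_cong refl) (simp add: inner_commute mult_ac)
      also have "\<dots> = (F v * cnj (F v')) * of_real (G (v - v'))"
        unfolding G_def using gaussian_hyperplane(2)[OF \<epsilon> e, of "v - v'"] that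
        by (simp add: inner_diff_left)
      finally have *: "(\<integral>\<eta>. ?T \<eta> (v, v') \<partial>?H) = (F v * cnj (F v')) * of_real (G (v - v'))" .
      show ?thesis unfolding * norm_mult using G0[of "v - v'"] by simp
    qed
    have intG: "(\<integral>\<^sup>+v. ennreal (G (v - c)) \<partial>?H) = ennreal ((2 * pi) ^ (DIM('a) - 1))" if "c \<bullet> e = 0" for c
    proof -
      have "(\<integral>\<^sup>+v. ennreal (G (v - c)) \<partial>?H) = (\<integral>\<^sup>+v. ennreal (G v) \<partial>?H)"
        using nn_integral_hyperplane_translate[of "\<lambda>v. ennreal (G v)" "- c" e] that by simp
      also have "\<dots> = ennreal (sqrt (pi / \<epsilon>) ^ (DIM('a) - 1) * (sqrt (pi * (4 * \<epsilon>)) ^ (DIM('a) - 1)))"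
      proof -
        have e4: "1 / (4 * \<epsilon>) > 0" using \<epsilon> by simp
        have i: "integrable ?H (\<lambda>v. complex_of_real (exp (- (1 / (4 * \<epsilon>)) * (norm v)\<^sup>2)))"
          and v: "(\<integral>v. complex_of_real (exp (- (1 / (4 * \<epsilon>)) * (norm v)\<^sup>2)) \<partial>?H) = of_real (sqrt (pi * (4 * \<epsilon>)) ^ (DIM('a) - 1))"
          using gaussian_hyperplane[OF e4 e, of 0] by simp_all
        have i': "integrable ?H (\<lambda>v. exp (- (1 / (4 * \<epsilon>)) * (norm v)\<^sup>2))"
          using integrable_Re[OF i] by simp
        have "(\<integral>v. exp (- (1 / (4 * \<epsilon>)) * (norm v)\<^sup>2) \<partial>?H) = sqrt (pi * (4 * \<epsilon>)) ^ (DIM('a) - 1)"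
          using v unfolding integral_complex_of_real of_real_eq_iff .
        moreover have "G = (\<lambda>v. sqrt (pi / \<epsilon>) ^ (DIM('a) - 1) * exp (- (1 / (4 * \<epsilon>)) * (norm v)\<^sup>2))"
          unfolding G_def by simp
        ultimately have "integrable ?H G"
          and "(\<integral>v. G v \<partial>?H) = sqrt (pi / \<epsilon>) ^ (DIM('a) - 1) * (sqrt (pi * (4 * \<epsilon>)) ^ (DIM('a) - 1))"
          using i' by (auto simp only: integral_mult_right_zero intro!: integrable_mult_right)
        then show ?thesis
          using G0 by (subst nn_integral_eq_integral) auto
      qed
      also have "sqrt (pi / \<epsilon>) ^ (DIM('a) - 1) * (sqrt (pi * (4 * \<epsilon>)) ^ (DIM('a) - 1)) = (2 * pi) ^ (DIM('a) - 1)"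
      proof -
        have "sqrt (pi / \<epsilon>) * sqrt (pi * (4 * \<epsilon>)) = sqrt ((2 * pi)\<^sup>2)"
          unfolding real_sqrt_mult[symmetric] using \<epsilon> by (simp add: power2_eq_square)
        then have "sqrt (pi / \<epsilon>) * sqrt (pi * (4 * \<epsilon>)) = 2 * pi"
          unfolding real_sqrt_abs by simp
        then show ?thesis unfolding power_mult_distrib[symmetric] by (rule arg_cong)
      qed
      finally show ?thesis .
    qed
    have "integrable ?H (\<lambda>\<eta>. \<integral>p. ?T \<eta> p \<partial>(?H \<Otimes>\<^sub>M ?H))"
      by (rule HHH.integrable_fst[OF iT])
    then have "integrable ?H (\<lambda>\<eta>. complex_of_real ((norm (Fh \<eta>))\<^sup>2 * exp (- \<epsilon> * (norm \<eta>)\<^sup>2)))"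
      unfolding sq .
    from integrable_Re[OF this] have i3: "integrable ?H (\<lambda>\<eta>. (norm (Fh \<eta>))\<^sup>2 * exp (- \<epsilon> * (norm \<eta>)\<^sup>2))"
      by simp
    have "complex_of_real (\<integral>\<eta>. (norm (Fh \<eta>))\<^sup>2 * exp (- \<epsilon> * (norm \<eta>)\<^sup>2) \<partial>?H) =
       (\<integral>\<eta>. (\<integral>p. ?T \<eta> p \<partial>(?H \<Otimes>\<^sub>M ?H)) \<partial>?H)"
      unfolding sq[symmetric] integral_complex_of_real ..
    also have "\<dots> = (\<integral>p. (\<integral>\<eta>. ?T \<eta> p \<partial>?H) \<partial>(?H \<Otimes>\<^sub>M ?H))"
      by (rule HHH.Fubini_integral[OF iT, symmetric])
    finally have eq: "complex_of_real (\<integral>\<eta>. (norm (Fh \<eta>))\<^sup>2 * exp (- \<epsilon> * (norm \<eta>)\<^sup>2) \<partial>?H) =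
       (\<integral>p. (\<integral>\<eta>. ?T \<eta> p \<partial>?H) \<partial>(?H \<Otimes>\<^sub>M ?H))" .
    have "(\<integral>\<^sup>+\<eta>. ennreal ((norm (Fh \<eta>))\<^sup>2 * exp (- \<epsilon> * (norm \<eta>)\<^sup>2)) \<partial>?H) =
       ennreal (\<integral>\<eta>. (norm (Fh \<eta>))\<^sup>2 * exp (- \<epsilon> * (norm \<eta>)\<^sup>2) \<partial>?H)"
      by (rule nn_integral_eq_integral[OF i3]) simp
    also have "\<dots> = ennreal (norm (complex_of_real (\<integral>\<eta>. (norm (Fh \<eta>))\<^sup>2 * exp (- \<epsilon> * (norm \<eta>)\<^sup>2) \<partial>?H)))"
      by simp
    also have "\<dots> \<le> (\<integral>\<^sup>+p. norm (\<integral>\<eta>. ?T \<eta> p \<partial>?H) \<partial>(?H \<Otimes>\<^sub>M ?H))"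
      unfolding eq by (rule integral_norm_bound_ennreal[OF HHH.integrable_snd[OF iT]])
    also have "\<dots> = (\<integral>\<^sup>+v. (\<integral>\<^sup>+v'. norm (\<integral>\<eta>. ?T \<eta> (v, v') \<partial>?H) \<partial>?H) \<partial>?H)"
      by (subst H.nn_integral_fst[symmetric]) simp_all
    also have "\<dots> \<le> (\<integral>\<^sup>+v. (\<integral>\<^sup>+v'. ennreal ((norm (F v))\<^sup>2 / 2) * G (v' - v) + ennreal ((norm (F v'))\<^sup>2 / 2) * G (v - v') \<partial>?H) \<partial>?H)"
    proof (rule nn_integral_mono_AE, use AE_hyperplane_orthogonal[OF e] in eventually_elim, rule nn_integral_mono_AE,
           use AE_hyperplane_orthogonal[OF e] in eventually_elim)
      fix v v' :: 'a assume v: "v \<bullet> e = 0" "v' \<bullet> e = 0"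
      have "norm (F v) * norm (F v') \<le> (norm (F v))\<^sup>2 / 2 + (norm (F v'))\<^sup>2 / 2"
        using zero_le_power2[of "norm (F v) - norm (F v')"] by (simp add: power2_diff)
      then have "norm (F v) * norm (F v') * G (v - v') \<le> ((norm (F v))\<^sup>2 / 2 + (norm (F v'))\<^sup>2 / 2) * G (v - v')"
        using G0 by (rule mult_right_mono)
      also have "\<dots> = (norm (F v))\<^sup>2 / 2 * G (v' - v) + (norm (F v'))\<^sup>2 / 2 * G (v - v')"
        by (simp add: G_def norm_minus_commute distrib_right)
      finally show "ennreal (norm (\<integral>\<eta>. ?T \<eta> (v, v') \<partial>?H)) \<le> ennreal ((norm (F v))\<^sup>2 / 2) * G (v' - v) + ennreal ((norm (F v'))\<^sup>2 / 2) * G (v - v')"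
        unfolding TG[OF v] using G0 by (simp flip: ennreal_mult ennreal_plus add: ennreal_leI)
    qed
    also have "\<dots> = (\<integral>\<^sup>+v. (\<integral>\<^sup>+v'. ennreal ((norm (F v))\<^sup>2 / 2) * G (v' - v) \<partial>?H) \<partial>?H)
        + (\<integral>\<^sup>+v. (\<integral>\<^sup>+v'. ennreal ((norm (F v'))\<^sup>2 / 2) * G (v - v') \<partial>?H) \<partial>?H)"
      by (subst nn_integral_add[symmetric]) (auto intro!: nn_integral_cong nn_integral_add)
    also have "(\<integral>\<^sup>+v. (\<integral>\<^sup>+v'. ennreal ((norm (F v'))\<^sup>2 / 2) * G (v - v') \<partial>?H) \<partial>?H)
        = (\<integral>\<^sup>+v. (\<integral>\<^sup>+v'. ennreal ((norm (F v))\<^sup>2 / 2) * G (v' - v) \<partial>?H) \<partial>?H)"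
      by (rule HH.Fubini') simp
    also have "(\<integral>\<^sup>+v. (\<integral>\<^sup>+v'. ennreal ((norm (F v))\<^sup>2 / 2) * G (v' - v) \<partial>?H) \<partial>?H)
        = (\<integral>\<^sup>+v. ennreal ((norm (F v))\<^sup>2 / 2) * ennreal ((2 * pi) ^ (DIM('a) - 1)) \<partial>?H)"
      by (rule nn_integral_cong_AE, use AE_hyperplane_orthogonal[OF e] in eventually_elim)
         (subst nn_integral_cmult, simp, simp add: intG)
    also have "(\<integral>\<^sup>+v. ennreal ((norm (F v))\<^sup>2 / 2) * ennreal ((2 * pi) ^ (DIM('a) - 1)) \<partial>?H)
      + (\<integral>\<^sup>+v. ennreal ((norm (F v))\<^sup>2 / 2) * ennreal ((2 * pi) ^ (DIM('a) - 1)) \<partial>?H) =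
      (\<integral>\<^sup>+v. ennreal ((norm (F v))\<^sup>2) * ennreal ((2 * pi) ^ (DIM('a) - 1)) \<partial>?H)"
      by (subst nn_integral_add[symmetric])
         (auto intro!: nn_integral_cong simp flip: distrib_right ennreal_plus)
    also have "\<dots> = C"
      unfolding C_def by (subst nn_integral_multc) (auto simp: mult.commute)
    finally show ?thesis .
  qed
  have "(\<integral>\<^sup>+\<eta>. ennreal ((norm (Fh \<eta>))\<^sup>2) \<partial>?H) =
     (\<integral>\<^sup>+\<eta>. liminf (\<lambda>k. ennreal ((norm (Fh \<eta>))\<^sup>2 * exp (- (1 / real (Suc k)) * (norm \<eta>)\<^sup>2))) \<partial>?H)"
  proof (rule nn_integral_cong)
    fix \<eta>
    have "(\<lambda>k. ennreal ((norm (Fh \<eta>))\<^sup>2 * exp (- (1 / real (Suc k)) * (norm \<eta>)\<^sup>2))) \<longlonglongrightarrow>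
       ennreal ((norm (Fh \<eta>))\<^sup>2 * exp (- 0 * (norm \<eta>)\<^sup>2))"
      by (intro tendsto_intros LIMSEQ_Suc[OF lim_1_over_n])
    then show "ennreal ((norm (Fh \<eta>))\<^sup>2) = liminf (\<lambda>k. ennreal ((norm (Fh \<eta>))\<^sup>2 * exp (- (1 / real (Suc k)) * (norm \<eta>)\<^sup>2)))"
      by (subst lim_imp_Liminf) auto
  qed
  also have "\<dots> \<le> liminf (\<lambda>k. \<integral>\<^sup>+\<eta>. ennreal ((norm (Fh \<eta>))\<^sup>2 * exp (- (1 / real (Suc k)) * (norm \<eta>)\<^sup>2)) \<partial>?H)"
    by (intro nn_integral_liminf) simp
  also have "\<dots> \<le> C"
    by (intro Liminf_le always_eventually allI gauss) simp_all
  finally show ?thesis unfolding Fh_def C_def .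
qed

section \<open>Integrability of weights and of singularities on spheres\<close>

lemma nn_integral_real_reflect:
  fixes f :: "real \<Rightarrow> ennreal"
  assumes [measurable]: "f \<in> borel_measurable borel"
  shows "(\<integral>\<^sup>+x. f (- x) \<partial>lborel) = (\<integral>\<^sup>+x. f x \<partial>lborel)"
  using nn_integral_real_affine[of f "-1" 0] by simp

lemma integrable_weight_powr:
  fixes p :: real
  assumes p: "p > 1"
  shows "integrable lborel (\<lambda>x::real. (1 + \<bar>x\<bar>) powr (- p))"
proof (rule integrableI_nonneg)
  let ?f = "\<lambda>x::real. ennreal (indicator {0..} x * (1 + \<bar>x\<bar>) powr (- p))"
  have f: "(\<integral>\<^sup>+x. ?f x \<partial>lborel) < \<infinity>"
  proof -
    have "((\<lambda>x. x powr (- p)) has_integral -(1 powr (- p + 1)) / (- p + 1)) {1..}"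
      using p by (intro has_integral_powr_to_inf) auto
    then have "(\<integral>\<^sup>+x. ennreal (indicator {1..} x * x powr (- p)) \<partial>lborel) = ennreal (-(1 powr (- p + 1)) / (- p + 1))"
      by (intro nn_integral_has_integral_lebesgue) auto
    moreover have "(\<integral>\<^sup>+x. ennreal (indicator {1..} (x + 1) * (x + 1) powr (- p)) \<partial>lborel) =
        (\<integral>\<^sup>+x. ennreal (indicator {1..} x * x powr (- p)) \<partial>lborel)"
      by (rule nn_integral_lborel_translate) simp
    moreover have "(\<integral>\<^sup>+x. ?f x \<partial>lborel) = (\<integral>\<^sup>+x. ennreal (indicator {1..} (x + 1) * (x + 1) powr (- p)) \<partial>lborel)"
      by (intro nn_integral_cong) (auto simp: indicator_def add.commute)
    ultimately show ?thesis by simp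
  qed
  have "(\<integral>\<^sup>+x. ennreal ((1 + \<bar>x\<bar>) powr (- p)) \<partial>lborel) \<le> (\<integral>\<^sup>+x. ?f x + ?f (- x) \<partial>lborel)"
    by (intro nn_integral_mono) (auto simp: indicator_def)
  also have "\<dots> = (\<integral>\<^sup>+x. ?f x \<partial>lborel) + (\<integral>\<^sup>+x. ?f (- x) \<partial>lborel)"
    by (rule nn_integral_add) simp_all
  also have "(\<integral>\<^sup>+x. ?f (- x) \<partial>lborel) = (\<integral>\<^sup>+x. ?f x \<partial>lborel)"
    by (rule nn_integral_real_reflect) simp
  finally show "(\<integral>\<^sup>+x. ennreal ((1 + \<bar>x\<bar>) powr (- p)) \<partial>lborel) < \<infinity>"
    using f by (auto simp: less_top intro: le_less_trans)
qed simp_all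

text \<open>
  The exponent \<open>2 n\<close> allows a comparison with the product of the one-dimensional weights
  \<open>(1 + |x \<bullet> b|) powr (- 2)\<close> over the basis.
\<close>

lemma integrable_lborel_weight:
  assumes N: "N \<ge> 2 * DIM('a::euclidean_space)"
  shows "integrable lborel (\<lambda>x::'a. 1 / (1 + norm x) ^ N)"
proof -
  have "integrable lborel (\<lambda>t::real. complex_of_real ((1 + \<bar>t\<bar>) powr (- 2)))"
    using integrable_weight_powr[of 2] by simp
  then have "integrable lborel (\<lambda>x::'a. \<Prod>b\<in>Basis. complex_of_real ((1 + \<bar>x \<bullet> b\<bar>) powr (- 2)))"
    by (intro integrable_lborel_prod) simp
  then show ?thesis
  proof (rule Bochner_Integration.integrable_bound)
    show "AE x::'a in lborel. norm (1 / (1 + norm x) ^ N) \<le> norm (\<Prod>b\<in>Basis. complex_of_real ((1 + \<bar>x \<bullet> b\<bar>) powr (- 2)))"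
    proof (rule AE_I2)
      fix x :: 'a
      have "1 / (1 + norm x) ^ N \<le> 1 / (1 + norm x) ^ (2 * DIM('a))"
        using N by (intro divide_left_mono power_increasing mult_pos_pos zero_less_power add_pos_nonneg) auto
      also have "\<dots> = (\<Prod>b\<in>(Basis::'a set). 1 / (1 + norm x)\<^sup>2)"
        by (simp add: power_mult power_one_over)
      also have "\<dots> \<le> (\<Prod>b\<in>Basis. (1 + \<bar>x \<bullet> b\<bar>) powr (- 2))"
      proof (rule prod_mono)
        fix b :: 'a assume "b \<in> Basis"
        then have "(1 + \<bar>x \<bullet> b\<bar>)\<^sup>2 \<le> (1 + norm x)\<^sup>2"
          by (intro power_mono) (auto simp: Basis_le_norm)
        then have "1 / (1 + norm x)\<^sup>2 \<le> 1 / (1 + \<bar>x \<bullet> b\<bar>)\<^sup>2"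
          by (intro divide_left_mono) (auto simp: add_pos_nonneg)
        moreover have "(1 + \<bar>x \<bullet> b\<bar>) powr (- 2) = 1 / (1 + \<bar>x \<bullet> b\<bar>)\<^sup>2"
          by (subst powr_minus_divide) (simp add: powr_numeral)
        ultimately show "0 \<le> 1 / (1 + norm x)\<^sup>2 \<and> 1 / (1 + norm x)\<^sup>2 \<le> (1 + \<bar>x \<bullet> b\<bar>) powr (- 2)"
          by simp
      qed
      finally show "norm (1 / (1 + norm x) ^ N) \<le> norm (\<Prod>b\<in>Basis. complex_of_real ((1 + \<bar>x \<bullet> b\<bar>) powr (- 2)))"
        by (simp add: prod_norm[symmetric])
    qed
  qed simp
qed

lemma integrable_hyperplane_weight:
  fixes e :: "'a::euclidean_space"
  assumes e: "norm e = 1" and N: "N \<ge> 2 * DIM('a)"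
  shows "integrable (hyperplane_measure e) (\<lambda>w. 1 / (1 + norm w) ^ N)"
proof (rule integrableI_nonneg)
  have aux: "\<And>a b :: real. a \<le> b + 1 \<Longrightarrow> 0 \<le> b \<Longrightarrow> 1 + a \<le> 2 * (1 + b)" by simp
  have "(\<integral>\<^sup>+w. ennreal (1 / (1 + norm w) ^ N) \<partial>hyperplane_measure e) =
    (\<integral>\<^sup>+x. indicator (slab e) x * ennreal (1 / (1 + norm (x - (x \<bullet> e) *\<^sub>R e)) ^ N) \<partial>lborel)"
    by (rule nn_integral_hyperplane) simp
  also have "\<dots> \<le> (\<integral>\<^sup>+x. ennreal (2 ^ N * (1 / (1 + norm (x::'a)) ^ N)) \<partial>lborel)"
  proof (rule nn_integral_mono)
    fix x :: 'a
    show "indicator (slab e) x * ennreal (1 / (1 + norm (x - (x \<bullet> e) *\<^sub>R e)) ^ N)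
      \<le> ennreal (2 ^ N * (1 / (1 + norm x) ^ N))"
    proof (cases "x \<in> slab e")
      case True
      then have "norm x \<le> norm (x - (x \<bullet> e) *\<^sub>R e) + 1"
        using e norm_triangle_ineq[of "x - (x \<bullet> e) *\<^sub>R e" "(x \<bullet> e) *\<^sub>R e"] by (simp add: slab_def)
      then have "1 + norm x \<le> 2 * (1 + norm (x - (x \<bullet> e) *\<^sub>R e))"
        using aux norm_ge_zero by blast
      then have "(1 + norm x) ^ N \<le> (2 * (1 + norm (x - (x \<bullet> e) *\<^sub>R e))) ^ N"
        by (intro power_mono) auto
      then have "1 / (1 + norm (x - (x \<bullet> e) *\<^sub>R e)) ^ N \<le> 2 ^ N * (1 / (1 + norm x) ^ N)"
        unfolding power_mult_distrib by (simp add: divide_simps add_pos_nonneg mult.commute)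
      then show ?thesis using True by (simp add: ennreal_leI)
    qed simp
  qed
  also have "\<dots> < \<infinity>"
    by (subst nn_integral_eq_integral[OF integrable_mult_right[OF integrable_lborel_weight[OF N]]]) auto
  finally show "(\<integral>\<^sup>+w. ennreal (1 / (1 + norm w) ^ N) \<partial>hyperplane_measure e) < \<infinity>" .
qed simp_all

lemma nn_integral_singular_interval:
  fixes a c \<alpha> :: real
  assumes a: "0 < a" "a < 1"
  shows "(\<integral>\<^sup>+x. indicator {\<alpha>..\<alpha> + 1} x * ennreal (\<bar>x - c\<bar> powr (- a)) \<partial>lborel) \<le> ennreal (1 + 2 / (1 - a))"
proof -
  let ?g = "\<lambda>x. ennreal (indicator {0..1} x * x powr (- a))"
  have "((\<lambda>x. x powr (- a)) has_integral (1 powr (- a + 1) / (- a + 1))) {0..1}"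
    using a by (intro has_integral_powr_from_0) auto
  then have g: "(\<integral>\<^sup>+x. ?g x \<partial>lborel) = ennreal (1 powr (- a + 1) / (- a + 1))"
    by (intro nn_integral_has_integral_lebesgue) auto
  let ?h = "\<lambda>x. ?g x + ?g (- x)"
  have h: "(\<integral>\<^sup>+x. ?h x \<partial>lborel) = ennreal (2 / (1 - a))"
  proof -
    have "(\<integral>\<^sup>+x. ?h x \<partial>lborel) = (\<integral>\<^sup>+x. ?g x \<partial>lborel) + (\<integral>\<^sup>+x. ?g (- x) \<partial>lborel)"
      by (rule nn_integral_add) simp_all
    also have "(\<integral>\<^sup>+x. ?g (- x) \<partial>lborel) = (\<integral>\<^sup>+x. ?g x \<partial>lborel)"
      by (rule nn_integral_real_reflect) simp
    finally show ?thesis unfolding g using a by (simp flip: ennreal_plus)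
  qed
  have "(\<integral>\<^sup>+x. indicator {\<alpha>..\<alpha> + 1} x * ennreal (\<bar>x - c\<bar> powr (- a)) \<partial>lborel)
    \<le> (\<integral>\<^sup>+x. indicator {\<alpha>..\<alpha> + 1} x + ?h (x + (- c)) \<partial>lborel)"
  proof (rule nn_integral_mono)
    fix x :: real
    have "\<bar>x - c\<bar> powr (- a) \<le> 1" if "\<bar>x - c\<bar> > 1"
      using that a powr_mono[of "-a" 0 "\<bar>x - c\<bar>"] by (auto split: if_splits)
    moreover have "ennreal (\<bar>x - c\<bar> powr (- a)) \<le> ?h (x + (- c))" if "\<bar>x - c\<bar> \<le> 1"
      using that by (cases "x \<ge> c") (auto simp: indicator_def)
    ultimately show "indicator {\<alpha>..\<alpha> + 1} x * ennreal (\<bar>x - c\<bar> powr (- a)) \<le> indicator {\<alpha>..\<alpha> + 1} x + ?h (x + (- c))"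
      by (cases "\<bar>x - c\<bar> \<le> 1"; cases "x \<in> {\<alpha>..\<alpha> + 1}")
         (auto simp: indicator_def[of "{\<alpha>..\<alpha>+1}"] intro: add_increasing add_increasing2 simp del: atLeastAtMost_iff)
  qed
  also have "\<dots> = (\<integral>\<^sup>+x. indicator {\<alpha>..\<alpha> + 1} x \<partial>lborel) + (\<integral>\<^sup>+x. ?h (x + (- c)) \<partial>lborel)"
    by (rule nn_integral_add) simp_all
  also have "(\<integral>\<^sup>+x. ?h (x + (- c)) \<partial>lborel) = (\<integral>\<^sup>+x. ?h x \<partial>lborel)"
    by (rule nn_integral_lborel_translate) simp
  also have "(\<integral>\<^sup>+x. indicator {\<alpha>..\<alpha> + 1} x \<partial>lborel) + (\<integral>\<^sup>+x. ?h x \<partial>lborel) = ennreal (1 + 2 / (1 - a))"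
    unfolding h using a by (simp flip: ennreal_plus ennreal_1)
  finally show ?thesis .
qed

text \<open>
  A substitute for polar coordinates: averaging over dilations by \<open>l \<in> [1, 2]\<close> turns a singularity
  on a sphere into a one-dimensional singularity in \<open>l\<close>.
\<close>

lemma nn_integral_hyperplane_average_dilations:
  fixes e :: "'a::euclidean_space" and f :: "'a \<Rightarrow> ennreal"
  assumes e: "norm e = 1" and [measurable]: "f \<in> borel_measurable borel"
  shows "(\<integral>\<^sup>+w. f w \<partial>hyperplane_measure e) \<le>
    ennreal (2 ^ DIM('a)) * (\<integral>\<^sup>+w. (\<integral>\<^sup>+l. indicator {1..2} l * f (l *\<^sub>R w) \<partial>lborel) \<partial>hyperplane_measure e)"
proof -
  interpret P: pair_sigma_finite "hyperplane_measure e" "lborel :: real measure"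
    by (simp add: pair_sigma_finite_def sigma_finite_hyperplane[OF e] sigma_finite_lborel)
  have "(\<integral>\<^sup>+w. f w \<partial>hyperplane_measure e) = (\<integral>\<^sup>+l. indicator {1..2::real} l * (\<integral>\<^sup>+w. f w \<partial>hyperplane_measure e) \<partial>lborel)"
    by (subst nn_integral_multc) auto
  also have "\<dots> \<le> (\<integral>\<^sup>+l. ennreal (2 ^ DIM('a)) * (\<integral>\<^sup>+w. indicator {1..2} l * f (l *\<^sub>R w) \<partial>hyperplane_measure e) \<partial>lborel)"
  proof (rule nn_integral_mono)
    fix l :: real
    show "indicator {1..2} l * (\<integral>\<^sup>+w. f w \<partial>hyperplane_measure e) \<le>
      ennreal (2 ^ DIM('a)) * (\<integral>\<^sup>+w. indicator {1..2} l * f (l *\<^sub>R w) \<partial>hyperplane_measure e)"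
    proof (cases "l \<in> {1..2}")
      case True
      have "(\<integral>\<^sup>+w. f w \<partial>hyperplane_measure e) \<le> ennreal (l ^ DIM('a)) * (\<integral>\<^sup>+w. f (l *\<^sub>R w) \<partial>hyperplane_measure e)"
        using True by (intro nn_integral_hyperplane_dilate_le) auto
      also have "\<dots> \<le> ennreal (2 ^ DIM('a)) * (\<integral>\<^sup>+w. f (l *\<^sub>R w) \<partial>hyperplane_measure e)"
        using True by (intro mult_right_mono ennreal_leI power_mono) auto
      finally show ?thesis using True by simp
    qed simp
  qed
  also have "\<dots> = ennreal (2 ^ DIM('a)) * (\<integral>\<^sup>+l. (\<integral>\<^sup>+w. indicator {1..2} l * f (l *\<^sub>R w) \<partial>hyperplane_measure e) \<partial>lborel)"
    by (rule nn_integral_cmult) simp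
  also have "(\<integral>\<^sup>+l. (\<integral>\<^sup>+w. indicator {1..2} l * f (l *\<^sub>R w) \<partial>hyperplane_measure e) \<partial>lborel) =
      (\<integral>\<^sup>+w. (\<integral>\<^sup>+l. indicator {1..2} l * f (l *\<^sub>R w) \<partial>lborel) \<partial>hyperplane_measure e)"
    by (rule P.Fubini') simp
  finally show ?thesis .
qed

text \<open>
  The bound is uniform in \<open>r\<close>: for \<open>r < s / 4\<close> the point \<open>l r\<close> stays away from \<open>s\<close>, and for
  \<open>r \<ge> s / 4\<close> the factor \<open>r powr (- a)\<close> that results from scaling is bounded.
\<close>

lemma nn_integral_dilated_singularity:
  fixes a s r :: real
  assumes a: "0 < a" "a < 1" and s: "s > 0" and r: "r \<ge> 0"
  shows "(\<integral>\<^sup>+l. indicator {1..2} l * ennreal (\<bar>l * r - s\<bar> powr (- a)) \<partial>lborel)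
    \<le> ennreal ((s / 4) powr (- a) * (1 + 2 / (1 - a)))"
proof (cases "r \<ge> s / 4")
  case True
  then have r0: "r > 0" using s by linarith
  have "(\<integral>\<^sup>+l. indicator {1..2} l * ennreal (\<bar>l * r - s\<bar> powr (- a)) \<partial>lborel)
     = (\<integral>\<^sup>+l. ennreal (r powr (- a)) * (indicator {1..1+1} l * ennreal (\<bar>l - s / r\<bar> powr (- a))) \<partial>lborel)"
  proof (rule nn_integral_cong)
    fix l :: real
    have "\<bar>l * r - s\<bar> = r * \<bar>l - s / r\<bar>" using r0 by (simp add: abs_mult[symmetric] field_simps flip: abs_of_pos)
    then have "\<bar>l * r - s\<bar> powr (- a) = r powr (- a) * \<bar>l - s / r\<bar> powr (- a)"
      using r0 by (simp add: powr_mult)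
    then show "indicator {1..2} l * ennreal (\<bar>l * r - s\<bar> powr (- a)) =
       ennreal (r powr (- a)) * (indicator {1..1+1} l * ennreal (\<bar>l - s / r\<bar> powr (- a)))"
      by (simp add: ennreal_mult indicator_def)
  qed
  also have "\<dots> = ennreal (r powr (- a)) * (\<integral>\<^sup>+l. indicator {1..1+1} l * ennreal (\<bar>l - s / r\<bar> powr (- a)) \<partial>lborel)"
    by (rule nn_integral_cmult) simp
  also have "\<dots> \<le> ennreal ((s / 4) powr (- a)) * ennreal (1 + 2 / (1 - a))"
    using a s True r0
    by (intro mult_mono nn_integral_singular_interval ennreal_leI powr_mono2') auto
  finally show ?thesis using a by (simp add: ennreal_mult)
next
  case False
  have "(\<integral>\<^sup>+l. indicator {1..2} l * ennreal (\<bar>l * r - s\<bar> powr (- a)) \<partial>lborel)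
     \<le> (\<integral>\<^sup>+l. ennreal ((s / 4) powr (- a)) * indicator {1..2::real} l \<partial>lborel)"
  proof (rule nn_integral_mono)
    fix l :: real
    have "\<bar>l * r - s\<bar> powr (- a) \<le> (s / 4) powr (- a)" if "l \<in> {1..2}"
    proof (rule powr_mono2')
      have "l * r \<le> 2 * (s / 4)" using that False r by (intro mult_mono) auto
      then show "s / 4 \<le> \<bar>l * r - s\<bar>" using s by linarith
    qed (use a s in auto)
    then show "indicator {1..2} l * ennreal (\<bar>l * r - s\<bar> powr (- a)) \<le> ennreal ((s / 4) powr (- a)) * indicator {1..2::real} l"
      by (auto simp: indicator_def intro: ennreal_leI)
  qed
  also have "\<dots> = ennreal ((s / 4) powr (- a))"
    by (subst nn_integral_cmult_indicator) auto
  also have "\<dots> \<le> ennreal ((s / 4) powr (- a) * (1 + 2 / (1 - a)))"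
    using a by (intro ennreal_leI) (simp add: mult_le_cancel_left1)
  finally show ?thesis .
qed

lemma integrable_hyperplane_singular_sphere:
  fixes e :: "'a::euclidean_space"
  assumes e: "norm e = 1" and a: "0 < a" "a < 1" and s: "s > 0" and N: "N \<ge> 2 * DIM('a)"
  shows "integrable (hyperplane_measure e) (\<lambda>w. \<bar>norm w - s\<bar> powr (- a) / (1 + norm w) ^ N)"
proof (rule integrableI_nonneg)
  let ?f = "\<lambda>w. ennreal (\<bar>norm w - s\<bar> powr (- a) / (1 + norm w) ^ N)"
  define C where "C = (s / 4) powr (- a) * (1 + 2 / (1 - a))"
  have "(\<integral>\<^sup>+w. ?f w \<partial>hyperplane_measure e) \<le>
    ennreal (2 ^ DIM('a)) * (\<integral>\<^sup>+w. (\<integral>\<^sup>+l. indicator {1..2} l * ?f (l *\<^sub>R w) \<partial>lborel) \<partial>hyperplane_measure e)"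
    by (rule nn_integral_hyperplane_average_dilations[OF e]) simp
  also have "\<dots> \<le> ennreal (2 ^ DIM('a)) * (\<integral>\<^sup>+w. ennreal C * ennreal (1 / (1 + norm w) ^ N) \<partial>hyperplane_measure e)"
  proof (intro mult_left_mono nn_integral_mono)
    fix w :: 'a
    have "(\<integral>\<^sup>+l. indicator {1..2} l * ?f (l *\<^sub>R w) \<partial>lborel) \<le>
      (\<integral>\<^sup>+l. (indicator {1..2} l * ennreal (\<bar>l * norm w - s\<bar> powr (- a))) * ennreal (1 / (1 + norm w) ^ N) \<partial>lborel)"
    proof (rule nn_integral_mono)
      fix l :: real
      have "\<bar>l * norm w - s\<bar> powr (- a) / (1 + norm (l *\<^sub>R w)) ^ N \<le> \<bar>l * norm w - s\<bar> powr (- a) * (1 / (1 + norm w) ^ N)"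
        if "l \<in> {1..2}"
      proof -
        have "norm w \<le> norm (l *\<^sub>R w)" using that by (simp add: mult_le_cancel_right1)
        then have "(1 + norm w) ^ N \<le> (1 + norm (l *\<^sub>R w)) ^ N" by (intro power_mono) auto
        then have "\<bar>l * norm w - s\<bar> powr (- a) / (1 + norm (l *\<^sub>R w)) ^ N \<le> \<bar>l * norm w - s\<bar> powr (- a) / (1 + norm w) ^ N"
          by (intro divide_left_mono) (auto simp: add_pos_nonneg)
        then show ?thesis by simp
      qed
      then show "indicator {1..2} l * ?f (l *\<^sub>R w) \<le>
        (indicator {1..2} l * ennreal (\<bar>l * norm w - s\<bar> powr (- a))) * ennreal (1 / (1 + norm w) ^ N)"
        by (auto simp: indicator_def ennreal_mult[symmetric] intro!: ennreal_leI)
    qed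
    also have "\<dots> = (\<integral>\<^sup>+l. (indicator {1..2} l * ennreal (\<bar>l * norm w - s\<bar> powr (- a))) \<partial>lborel) * ennreal (1 / (1 + norm w) ^ N)"
      by (rule nn_integral_multc) simp
    also have "\<dots> \<le> ennreal C * ennreal (1 / (1 + norm w) ^ N)"
      unfolding C_def by (intro mult_right_mono nn_integral_dilated_singularity a s) auto
    finally show "(\<integral>\<^sup>+l. indicator {1..2} l * ?f (l *\<^sub>R w) \<partial>lborel) \<le> ennreal C * ennreal (1 / (1 + norm w) ^ N)" .
  qed simp
  also have "\<dots> < \<infinity>"
    using integrable_hyperplane_weight[OF e N]
    by (subst nn_integral_cmult, simp, subst nn_integral_eq_integral) (auto simp: ennreal_mult_less_top)
  finally show "(\<integral>\<^sup>+w. ?f w \<partial>hyperplane_measure e) < \<infinity>" .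
qed simp_all

lemma nn_integral_hyperplane_gaussian:
  fixes e :: "'a::euclidean_space"
  assumes \<epsilon>: "\<epsilon> > 0" and e: "norm e = 1"
  shows "(\<integral>\<^sup>+w. ennreal (exp (- \<epsilon> * (norm w)\<^sup>2)) \<partial>hyperplane_measure e) = ennreal (sqrt (pi / \<epsilon>) ^ (DIM('a) - 1))"
proof -
  have i: "integrable (hyperplane_measure e) (\<lambda>v. complex_of_real (exp (- \<epsilon> * (norm v)\<^sup>2)))"
    and v: "(\<integral>v. complex_of_real (exp (- \<epsilon> * (norm v)\<^sup>2)) \<partial>hyperplane_measure e) = of_real (sqrt (pi / \<epsilon>) ^ (DIM('a) - 1))"
    using gaussian_hyperplane[OF \<epsilon> e, of 0] by simp_all
  have "integrable (hyperplane_measure e) (\<lambda>v. exp (- \<epsilon> * (norm v)\<^sup>2))"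
    using integrable_Re[OF i] by simp
  moreover have "(\<integral>v. exp (- \<epsilon> * (norm v)\<^sup>2) \<partial>hyperplane_measure e) = sqrt (pi / \<epsilon>) ^ (DIM('a) - 1)"
    using v unfolding integral_complex_of_real of_real_eq_iff .
  ultimately show ?thesis by (subst nn_integral_eq_integral) auto
qed

text \<open>
  The hyperplane has dimension at least 2, so \<open>1 / |w|\<close> is locally integrable. To prove this without
  polar coordinates, \<open>1 / |w|\<close> is written as the length of the interval \<open>[0, 1 / |w|]\<close>, and the part
  \<open>r \<ge> 1\<close> of the interval is dominated by a Gaussian \<open>exp (1 - r\<^sup>2 |w|\<^sup>2)\<close>, whose integral over \<open>w\<close> is
  at most a multiple of \<open>1 / r\<^sup>2\<close>.
\<close>

lemma integrable_hyperplane_inverse_norm: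
  fixes e :: "'a::euclidean_space"
  assumes e: "norm e = 1" and n: "DIM('a) \<ge> 3" and N: "N \<ge> 2 * DIM('a)"
  shows "integrable (hyperplane_measure e) (\<lambda>w. 1 / (norm w * (1 + norm w) ^ N))"
proof (rule integrableI_nonneg)
  let ?H = "hyperplane_measure e"
  interpret P: pair_sigma_finite ?H "lborel :: real measure"
    by (simp add: pair_sigma_finite_def sigma_finite_hyperplane[OF e] sigma_finite_lborel)
  let ?g = "\<lambda>w r. indicator {1..} r * ennreal (exp 1 * exp (- (r\<^sup>2) * (norm w)\<^sup>2))"
  have pow: "sqrt (pi / r\<^sup>2) ^ (DIM('a) - 1) \<le> (pi ^ (DIM('a) - 1)) * (1 / r\<^sup>2)" if "r \<ge> 1" for r :: real
  proof -
    have "sqrt (pi / r\<^sup>2) = sqrt pi / r" using that by (simp add: real_sqrt_divide)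
    moreover have "(sqrt pi / r) ^ (DIM('a) - 1) = sqrt pi ^ (DIM('a) - 1) * (1 / r) ^ (DIM('a) - 1)"
      by (simp add: power_divide)
    moreover have "sqrt pi ^ (DIM('a) - 1) \<le> pi ^ (DIM('a) - 1)"
      using pi_ge_two by (intro power_mono real_le_lsqrt) (auto simp: power2_eq_square)
    moreover have "(1 / r) ^ (DIM('a) - 1) \<le> (1 / r) ^ 2"
      using that n by (intro power_decreasing) auto
    moreover from calculation(3,4) have "sqrt pi ^ (DIM('a) - 1) * (1 / r) ^ (DIM('a) - 1) \<le> pi ^ (DIM('a) - 1) * (1 / r) ^ 2"
      using that by (intro mult_mono) auto
    ultimately show ?thesis by (simp only: power_one_over)
  qed
  have fin: "(\<integral>\<^sup>+w. (\<integral>\<^sup>+r. ?g w r \<partial>lborel) \<partial>?H) < \<infinity>"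
  proof -
    have "(\<integral>\<^sup>+w. (\<integral>\<^sup>+r. ?g w r \<partial>lborel) \<partial>?H) = (\<integral>\<^sup>+r. (\<integral>\<^sup>+w. ?g w r \<partial>?H) \<partial>lborel)"
      by (rule P.Fubini'[symmetric]) simp
    also have "\<dots> \<le> (\<integral>\<^sup>+r. ennreal (exp 1 * pi ^ (DIM('a) - 1)) * (ennreal (1 / r\<^sup>2) * indicator {1..} r) \<partial>lborel)"
    proof (rule nn_integral_mono)
      fix r :: real
      show "(\<integral>\<^sup>+w. ?g w r \<partial>?H) \<le> ennreal (exp 1 * pi ^ (DIM('a) - 1)) * (ennreal (1 / r\<^sup>2) * indicator {1..} r)"
      proof (cases "r \<ge> 1")
        case True
        have "(\<integral>\<^sup>+w. ?g w r \<partial>?H) = (\<integral>\<^sup>+w. ennreal (exp 1) * ennreal (exp (- (r\<^sup>2) * (norm w)\<^sup>2)) \<partial>?H)"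
          using True by (intro nn_integral_cong) (simp add: ennreal_mult)
        also have "\<dots> = ennreal (exp 1) * ennreal (sqrt (pi / r\<^sup>2) ^ (DIM('a) - 1))"
          using True nn_integral_hyperplane_gaussian[OF _ e, of "r\<^sup>2"] by (subst nn_integral_cmult) auto
        also have "\<dots> \<le> ennreal (exp 1) * ennreal (pi ^ (DIM('a) - 1) * (1 / r\<^sup>2))"
          using pow[OF True] by (intro mult_left_mono ennreal_leI) auto
        also have "\<dots> = ennreal (exp 1 * pi ^ (DIM('a) - 1)) * ennreal (1 / r\<^sup>2)"
          by (simp flip: ennreal_mult)
        finally show ?thesis using True by simp
      qed simp
    qed
    also have "\<dots> = ennreal (exp 1 * pi ^ (DIM('a) - 1)) * (\<integral>\<^sup>+r. ennreal (1 / r\<^sup>2) * indicator {1..} r \<partial>lborel)"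
      by (rule nn_integral_cmult) simp
    also have "(\<integral>\<^sup>+r. ennreal (1 / r\<^sup>2) * indicator {1..} r \<partial>lborel) = ennreal (0 - (- 1 / 1))"
    proof (rule nn_integral_FTC_atLeast[where F="\<lambda>r. - 1 / r"])
      show "((\<lambda>r::real. - 1 / r) has_real_derivative 1 / x\<^sup>2) (at x)" if "1 \<le> x" for x
        using that by (auto intro!: derivative_eq_intros simp: power2_eq_square)
      show "((\<lambda>r::real. - 1 / r) \<longlongrightarrow> 0) at_top" by real_asymp
    qed auto
    finally show ?thesis by (simp add: ennreal_mult_less_top le_less_trans)
  qed
  have "(\<integral>\<^sup>+w. ennreal (1 / (norm w * (1 + norm w) ^ N)) \<partial>?H) \<le>
    (\<integral>\<^sup>+w. ennreal (1 / (1 + norm w) ^ N) + (\<integral>\<^sup>+r. ?g w r \<partial>lborel) \<partial>?H)"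
  proof (rule nn_integral_mono)
    fix w :: 'a
    define \<rho> where "\<rho> = norm w"
    have \<rho>: "\<rho> \<ge> 0" by (simp add: \<rho>_def)
    have p1: "(1 + \<rho>) ^ N \<ge> 1" using \<rho> by (intro one_le_power) auto
    consider "\<rho> = 0" | "\<rho> \<ge> 1" | "0 < \<rho>" "\<rho> < 1" using \<rho> by linarith
    then show "ennreal (1 / (norm w * (1 + norm w) ^ N)) \<le> ennreal (1 / (1 + norm w) ^ N) + (\<integral>\<^sup>+r. ?g w r \<partial>lborel)"
    proof cases
      case 2
      then have "1 / (\<rho> * (1 + \<rho>) ^ N) \<le> 1 / (1 + \<rho>) ^ N"
        using p1 by (intro divide_left_mono) (auto simp: mult_le_cancel_right1)
      then show ?thesis unfolding \<rho>_def[symmetric] by (intro add_increasing2) (auto intro: ennreal_leI)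
    next
      case 3
      \<comment> \<open>\<open>1 / \<rho> = 1 + \<bar>[1, 1/\<rho>]\<bar>\<close>, and the Gaussian factor is at least 1 on that interval.\<close>
      have "ennreal (1 / \<rho> - 1) = (\<integral>\<^sup>+r. indicator {1..1/\<rho>} r \<partial>lborel)"
        using 3 by simp
      also have "\<dots> \<le> (\<integral>\<^sup>+r. ?g w r \<partial>lborel)"
      proof (rule nn_integral_mono)
        fix r :: real
        have "1 \<le> exp 1 * exp (- (r\<^sup>2) * \<rho>\<^sup>2)" if "1 \<le> r" "r \<le> 1 / \<rho>"
        proof -
          have "r * \<rho> \<le> 1" using that 3 by (simp add: field_simps)
          then have "(r * \<rho>)\<^sup>2 \<le> 1" using that 3 by (intro power_le_one) auto
          then show ?thesis by (simp add: exp_add[symmetric] power_mult_distrib)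
        qed
        then show "indicator {1..1/\<rho>} r \<le> ?g w r"
          unfolding \<rho>_def[symmetric] using ennreal_leI[of 1 "exp 1 * exp (- (r\<^sup>2) * \<rho>\<^sup>2)"]
          by (auto simp: indicator_def)
      qed
      finally have *: "ennreal (1 / \<rho> - 1) \<le> (\<integral>\<^sup>+r. ?g w r \<partial>lborel)" .
      have "1 / (\<rho> * (1 + \<rho>) ^ N) = 1 / (1 + \<rho>) ^ N + (1 / \<rho> - 1) * (1 / (1 + \<rho>) ^ N)"
        using 3 p1 by (simp add: field_simps)
      also have "\<dots> \<le> 1 / (1 + \<rho>) ^ N + (1 / \<rho> - 1) * 1"
        using 3 p1 by (intro add_left_mono mult_left_mono) auto
      finally have "ennreal (1 / (\<rho> * (1 + \<rho>) ^ N)) \<le> ennreal (1 / (1 + \<rho>) ^ N + (1 / \<rho> - 1))"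
        by (intro ennreal_leI) simp
      also have "\<dots> = ennreal (1 / (1 + \<rho>) ^ N) + ennreal (1 / \<rho> - 1)"
        using 3 by (intro ennreal_plus) auto
      also have "\<dots> \<le> ennreal (1 / (1 + \<rho>) ^ N) + (\<integral>\<^sup>+r. ?g w r \<partial>lborel)"
        using * by (intro add_left_mono)
      finally show ?thesis unfolding \<rho>_def .
    qed (simp add: \<rho>_def)
  qed
  also have "\<dots> = (\<integral>\<^sup>+w. ennreal (1 / (1 + norm w) ^ N) \<partial>?H) + (\<integral>\<^sup>+w. (\<integral>\<^sup>+r. ?g w r \<partial>lborel) \<partial>?H)"
    by (rule nn_integral_add) simp_all
  also have "\<dots> < \<infinity>"
    using fin integrable_hyperplane_weight[OF e N] by (subst nn_integral_eq_integral) auto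
  finally show "(\<integral>\<^sup>+w. ennreal (1 / (norm w * (1 + norm w) ^ N)) \<partial>?H) < \<infinity>" .
qed simp_all

section \<open>The Green function as a partial Fourier transform\<close>

lemma exp_Complex_mult: "exp (Complex a b * of_real t) = of_real (exp (a * t)) * cis (b * t)"
  by (simp add: exp_eq_polar)

lemma fourier_exp_abs:
  fixes r \<tau> :: real
  assumes r: "r > 0"
  shows "integrable lborel (\<lambda>t. cis (\<tau> * t) * of_real (exp (- (r * \<bar>t\<bar>))))"
    and "(\<integral>t. cis (\<tau> * t) * of_real (exp (- (r * \<bar>t\<bar>))) \<partial>lborel) = of_real (2 * r / (r\<^sup>2 + \<tau>\<^sup>2))"
proof -
  let ?A = "\<lambda>t::real. indicator {0..} t *\<^sub>R exp (- Complex r (- \<tau>) * of_real t)"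
  let ?B = "\<lambda>t::real. indicator {..0} t *\<^sub>R exp (Complex r \<tau> * of_real t)"
  let ?u = "\<lambda>t. cis (\<tau> * t) * complex_of_real (exp (- (r * \<bar>t\<bar>)))"
  have re: "Re (Complex r (- \<tau>)) > 0" "Re (Complex r \<tau>) > 0" using r by auto
  note AB = exponential_half_line[OF re(1)] exponential_negative_half_line[OF re(2)]
  have m: "- Complex r (- \<tau>) = Complex (- r) \<tau>" by (simp add: complex_eq_iff)
  have ae: "AE t in lborel. ?A t + ?B t = ?u t"
    using AE_lborel_singleton[of "0::real"]
  proof eventually_elim
    case (elim t)
    then show ?case unfolding m exp_Complex_mult
      by (cases "t > 0") (auto simp: indicator_def)
  qed
  show "integrable lborel ?u"
    by (rule integrable_cong_AE_imp[OF Bochner_Integration.integrable_add[OF AB(1) AB(3)] _ ae]) simp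
  have "(\<integral>t. ?u t \<partial>lborel) = (\<integral>t. ?A t + ?B t \<partial>lborel)"
    using ae AB by (intro integral_cong_AE) (auto elim!: eventually_mono)
  also have "\<dots> = 1 / Complex r (- \<tau>) + 1 / Complex r \<tau>"
    using Bochner_Integration.integral_add[OF AB(1) AB(3)] AB by simp
  also have "\<dots> = of_real (2 * r / (r\<^sup>2 + \<tau>\<^sup>2))"
  proof -
    have "1 / Complex r b = Complex (r / (r\<^sup>2 + b\<^sup>2)) (- b / (r\<^sup>2 + b\<^sup>2))" for b
      by (simp add: complex_eq_iff Re_divide Im_divide)
    then show ?thesis by (simp add: complex_eq_iff)
  qed
  finally show "(\<integral>t. ?u t \<partial>lborel) = of_real (2 * r / (r\<^sup>2 + \<tau>\<^sup>2))" .
qed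

text \<open>
  Fourier inversion of \<open>fourier_exp_abs\<close> represents the right side as an integral of
  \<open>cis (- (t * \<tau>)) / (r\<^sup>2 + \<tau>\<^sup>2)\<close>. Writing \<open>1 / (r\<^sup>2 + \<tau>\<^sup>2)\<close> as the integral of
  \<open>exp (- y (r\<^sup>2 + \<tau>\<^sup>2))\<close> over \<open>y > 0\<close> and integrating over \<open>\<tau>\<close> first leaves a Gaussian.
\<close>

lemma subordination:
  fixes r t :: real
  assumes r: "r > 0"
  defines "S \<equiv> \<lambda>y. indicator {0<..} y * (exp (- t\<^sup>2 / (4 * y) - y * r\<^sup>2) / sqrt (4 * pi * y))"
  shows "integrable lborel S" and "(\<integral>y. S y \<partial>lborel) = exp (- \<bar>t\<bar> * r) / (2 * r)"
proof -
  define u where "u = (\<lambda>t::real. complex_of_real (exp (- (r * \<bar>t\<bar>))))"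
  let ?U = "\<lambda>\<tau>. \<integral>t. cis (\<tau> * t) * u t \<partial>lborel"
  have U: "?U \<tau> = of_real (2 * r / (r\<^sup>2 + \<tau>\<^sup>2))" for \<tau>
    unfolding u_def by (rule fourier_exp_abs(2)[OF r])
  have pos: "r\<^sup>2 + \<tau>\<^sup>2 > 0" for \<tau> using r by (simp add: add_pos_nonneg)
  define m where "m = min 1 (r\<^sup>2)"
  have m: "m > 0" "m \<le> 1" "m \<le> r\<^sup>2" using r by (auto simp: m_def)
  have dec: "1 / (r\<^sup>2 + \<tau>\<^sup>2) \<le> 2 / m * (1 + \<bar>\<tau>\<bar>) powr (- 2)" for \<tau>
  proof -
    have "(1 + \<bar>\<tau>\<bar>)\<^sup>2 \<le> 2 * (1 + \<tau>\<^sup>2)"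
      using zero_le_power2[of "1 - \<bar>\<tau>\<bar>"] by (simp add: power2_eq_square algebra_simps)
    moreover have "m * (1 + \<tau>\<^sup>2) \<le> r\<^sup>2 + \<tau>\<^sup>2"
      using m mult_right_mono[of m 1 "\<tau>\<^sup>2"] by (simp add: algebra_simps)
    moreover from calculation(1) have "m * (1 + \<bar>\<tau>\<bar>)\<^sup>2 \<le> m * (2 * (1 + \<tau>\<^sup>2))"
      using m(1) by (intro mult_left_mono) auto
    ultimately have "m * (1 + \<bar>\<tau>\<bar>)\<^sup>2 \<le> 2 * (r\<^sup>2 + \<tau>\<^sup>2)" by (simp add: algebra_simps)
    then have "1 / (r\<^sup>2 + \<tau>\<^sup>2) \<le> 2 / (m * (1 + \<bar>\<tau>\<bar>)\<^sup>2)"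
      using m pos[of \<tau>] by (simp add: field_simps add_pos_nonneg)
    moreover have "(1 + \<bar>\<tau>\<bar>) powr (- 2) = 1 / (1 + \<bar>\<tau>\<bar>)\<^sup>2"
      by (subst powr_minus_divide) (simp add: powr_numeral)
    ultimately show ?thesis by simp
  qed
  have iR: "integrable lborel (\<lambda>\<tau>. 1 / (r\<^sup>2 + \<tau>\<^sup>2))"
  proof (rule Bochner_Integration.integrable_bound)
    show "integrable lborel (\<lambda>\<tau>::real. 2 / m * (1 + \<bar>\<tau>\<bar>) powr (- 2))"
      by (intro integrable_mult_right integrable_weight_powr) simp
    show "AE \<tau> in lborel. norm (1 / (r\<^sup>2 + \<tau>\<^sup>2)) \<le> norm (2 / m * (1 + \<bar>\<tau>\<bar>) powr (- 2))"
      using dec pos m by (intro AE_I2) (simp add: less_imp_le)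
  qed simp
  have inv: "(\<integral>\<tau>. cis (- (t * \<tau>)) * ?U \<tau> \<partial>lborel) = 2 * pi * u t"
  proof (rule fourier_inversion_1D[where B=1])
    show "continuous_on UNIV u" unfolding u_def by (intro continuous_intros)
    show "norm (u t) \<le> 1" for t using r by (simp add: u_def)
    show "integrable lborel u" using fourier_exp_abs(1)[OF r, of 0] by (simp add: u_def)
    have "integrable lborel (\<lambda>\<tau>. 2 * r * (1 / (r\<^sup>2 + \<tau>\<^sup>2)))"
      by (intro integrable_mult_right iR)
    then show "integrable lborel ?U"
      unfolding U by (intro integrable_of_real) simp
  qed
  let ?A = "\<lambda>\<tau> y::real. indicator {0..} y *\<^sub>R exp (- complex_of_real (r\<^sup>2 + \<tau>\<^sup>2) * of_real y)"
  have re: "Re (complex_of_real (r\<^sup>2 + \<tau>\<^sup>2)) > 0" for \<tau> using pos by simp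
  have An: "norm (?A \<tau> y) = Re (?A \<tau> y)" for \<tau> y
    by (simp add: exp_eq_polar)
  let ?F = "\<lambda>\<tau> y. cis (- (t * \<tau>)) * ?A \<tau> y"
  have int: "integrable (lborel \<Otimes>\<^sub>M lborel) (case_prod ?F)"
  proof (rule lborel_pair.Fubini_integrable)
    have "(\<integral>y. norm (?F \<tau> y) \<partial>lborel) = 1 / (r\<^sup>2 + \<tau>\<^sup>2)" for \<tau>
    proof -
      have "(\<integral>y. norm (?F \<tau> y) \<partial>lborel) = (\<integral>y. Re (?A \<tau> y) \<partial>lborel)"
        by (simp only: norm_mult norm_cis An mult_1)
      also have "\<dots> = Re (1 / complex_of_real (r\<^sup>2 + \<tau>\<^sup>2))"
        using integral_Re[OF exponential_half_line(1)[OF re]] exponential_half_line(2)[OF re] by simp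
      also have "\<dots> = Re (complex_of_real (1 / (r\<^sup>2 + \<tau>\<^sup>2)))" by (simp only: of_real_divide of_real_1)
      finally show ?thesis by (simp only: Re_complex_of_real)
    qed
    then show "integrable lborel (\<lambda>\<tau>. \<integral>y. norm (case (\<tau>, y) of (\<tau>, y) \<Rightarrow> ?F \<tau> y) \<partial>lborel)"
      using iR by simp
    show "AE \<tau> in lborel. integrable lborel (\<lambda>y. case (\<tau>, y) of (\<tau>, y) \<Rightarrow> ?F \<tau> y)"
      unfolding prod.case by (intro AE_I2 integrable_cis_mult exponential_half_line(1)[OF re]) simp
  qed (simp add: case_prod_unfold)
  have S: "AE y in lborel. (\<integral>\<tau>. ?F \<tau> y \<partial>lborel) = of_real (2 * pi * S y)"
    using AE_lborel_singleton[of "0::real"]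
  proof eventually_elim
    case (elim y)
    show ?case
    proof (cases "y > 0")
      case True
      have "(\<integral>\<tau>. ?F \<tau> y \<partial>lborel) = (\<integral>\<tau>. of_real (exp (- y * r\<^sup>2)) * (cis (\<tau> * (- t)) * of_real (exp (- y * \<tau>\<^sup>2))) \<partial>lborel)"
        using True by (intro Bochner_Integration.integral_cong refl)
          (simp add: exp_eq_polar algebra_simps exp_diff exp_minus field_simps)
      also have "\<dots> = of_real (exp (- y * r\<^sup>2)) * of_real (sqrt (pi / y) * exp (- t\<^sup>2 / (4 * y)))"
        using gaussian_1D(2)[OF True, of "- t"] by simp
      also have "\<dots> = of_real (2 * pi * S y)"
      proof -
        have "sqrt (pi / y) * sqrt (4 * pi * y) = sqrt ((2 * pi)\<^sup>2)"
          unfolding real_sqrt_mult[symmetric] using True by (simp add: power2_eq_square)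
        then have "sqrt (pi / y) * sqrt (4 * pi * y) = 2 * pi" unfolding real_sqrt_abs by simp
        then have "sqrt (pi / y) = 2 * pi / sqrt (4 * pi * y)" using True by (simp add: field_simps)
        moreover have "exp (- t\<^sup>2 / (4 * y) - y * r\<^sup>2) = exp (- y * r\<^sup>2) * exp (- t\<^sup>2 / (4 * y))"
          unfolding exp_add[symmetric] by simp
        ultimately show ?thesis unfolding of_real_mult[symmetric] of_real_eq_iff S_def
          using True by simp
      qed
      finally show ?thesis .
    next
      case False
      then have "y < 0" using elim by simp
      then show ?thesis by (simp add: S_def)
    qed
  qed
  have [measurable]: "S \<in> borel_measurable lborel" unfolding S_def by measurable
  have "integrable lborel (\<lambda>y. complex_of_real (2 * pi * S y))"
    by (rule integrable_cong_AE_imp[OF lborel_pair.integrable_snd[OF int] _ S]) simp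
  from integrable_Re[OF this] show iS: "integrable lborel S" by simp
  have "complex_of_real (2 * pi * (\<integral>y. S y \<partial>lborel)) = (\<integral>y. complex_of_real (2 * pi * S y) \<partial>lborel)"
    by simp
  also have "\<dots> = (\<integral>y. (\<integral>\<tau>. ?F \<tau> y \<partial>lborel) \<partial>lborel)"
    using S lborel_pair.integrable_snd[OF int] by (intro integral_cong_AE) (auto elim!: eventually_mono)
  also have "\<dots> = (\<integral>\<tau>. (\<integral>y. ?F \<tau> y \<partial>lborel) \<partial>lborel)"
    by (rule lborel_pair.Fubini_integral[OF int])
  also have "\<dots> = (\<integral>\<tau>. of_real (1 / (2 * r)) * (cis (- (t * \<tau>)) * ?U \<tau>) \<partial>lborel)"
  proof (intro Bochner_Integration.integral_cong refl)
    fix \<tau>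
    have "(\<integral>y. ?F \<tau> y \<partial>lborel) = cis (- (t * \<tau>)) * (1 / complex_of_real (r\<^sup>2 + \<tau>\<^sup>2))"
      by (simp only: integral_mult_right_zero exponential_half_line(2)[OF re])
    then show "(\<integral>y. ?F \<tau> y \<partial>lborel) = of_real (1 / (2 * r)) * (cis (- (t * \<tau>)) * ?U \<tau>)"
      unfolding U using r by simp
  qed
  also have "\<dots> = of_real (1 / (2 * r)) * (2 * pi * u t)"
    by (simp only: integral_mult_right_zero inv)
  also have "\<dots> = complex_of_real (2 * pi * (exp (- \<bar>t\<bar> * r) / (2 * r)))"
    by (simp add: u_def mult.commute)
  finally have "2 * pi * (\<integral>y. S y \<partial>lborel) = 2 * pi * (exp (- \<bar>t\<bar> * r) / (2 * r))"
    unfolding of_real_eq_iff .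
  then show "(\<integral>y. S y \<partial>lborel) = exp (- \<bar>t\<bar> * r) / (2 * r)"
    by (subst (asm) mult_left_cancel) auto
qed

text \<open>
  As a function of \<open>t\<close>, the inverse Fourier transform of \<open>1 / ((\<tau> + i s)\<^sup>2 + r\<^sup>2)\<close>, found by partial
  fractions in \<open>1 / (r + s - i \<tau>)\<close> and \<open>1 / (r - s + i \<tau>)\<close>, each of which is the Fourier transform of an
  exponential on a half-line. The half-line for the second fraction depends on the sign of \<open>r - s\<close>.
\<close>

definition faddeev_kernel :: "real \<Rightarrow> real \<Rightarrow> real \<Rightarrow> real"
  where "faddeev_kernel s t r =
    (if t > 0 then (if r > s then exp (- t * (r - s)) else 0)
     else exp (t * (s + r)) - (if r < s then exp (t * (s - r)) else 0)) / (2 * r)"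

lemma measurable_faddeev_kernel [measurable]:
  assumes [measurable]: "f \<in> borel_measurable M" "g \<in> borel_measurable M"
  shows "(\<lambda>x. faddeev_kernel s (f x) (g x)) \<in> borel_measurable M"
  unfolding faddeev_kernel_def by measurable

text \<open>
  The denominator \<open>2 r\<close> is harmless for \<open>r \<ge> s / 2\<close>. For smaller \<open>r\<close> and \<open>t \<le> 0\<close> the two exponentials
  cancel to first order in \<open>r\<close>, at the cost of a factor \<open>|t|\<close>; half of the exponential decay absorbs
  that factor, which is why only \<open>|t| |r - s| / 2\<close> is left in the exponent.
\<close>

lemma faddeev_kernel_bound:
  assumes s: "s > 0" and r: "r \<ge> 0"
  shows "\<bar>faddeev_kernel s t r\<bar> \<le> 4 / s * exp (- \<bar>t\<bar> * \<bar>r - s\<bar> / 2)"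
proof -
  have half: "x / (2 * r) \<le> 4 / s * y" if "r \<ge> s / 2" "x \<le> y" "x \<ge> 0" for x y
  proof -
    have "x / (2 * r) \<le> x / s" using that s by (intro divide_left_mono) auto
    also have "\<dots> \<le> y / s" using that s by (intro divide_right_mono) auto
    also have "\<dots> \<le> 4 / s * y" using that s by (simp add: field_simps)
    finally show ?thesis .
  qed
  consider "t > 0" "r \<le> s" | "t > 0" "r > s" | "t \<le> 0" "r \<ge> s" | "t \<le> 0" "r < s" "r = 0" | "t \<le> 0" "r < s" "r > 0"
    using r by linarith
  then show ?thesis
  proof cases
    case 1
    then show ?thesis using s by (simp add: faddeev_kernel_def)
  next
    case 2
    have "exp (- t * (r - s)) \<le> exp (- \<bar>t\<bar> * \<bar>r - s\<bar> / 2)"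
      using 2 by simp
    then show ?thesis
      using half[of "exp (- t * (r - s))" "exp (- \<bar>t\<bar> * \<bar>r - s\<bar> / 2)"] 2 s
      by (simp add: faddeev_kernel_def)
  next
    case 3
    have "0 \<le> - t * (r - s)" "0 \<le> - t * s" using 3 s by (auto intro: mult_nonneg_nonneg simp: mult_nonpos_nonneg)
    then have "t * (s + r) \<le> - \<bar>t\<bar> * \<bar>r - s\<bar> / 2"
      using 3 by (simp add: algebra_simps)
    then have "exp (t * (s + r)) \<le> exp (- \<bar>t\<bar> * \<bar>r - s\<bar> / 2)" by simp
    then show ?thesis
      using half[of "exp (t * (s + r))" "exp (- \<bar>t\<bar> * \<bar>r - s\<bar> / 2)"] 3 s
      by (simp add: faddeev_kernel_def)
  next
    case 4
    then show ?thesis using s by (simp add: faddeev_kernel_def)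
  next
    case 5
    define \<tau> where "\<tau> = - t"
    have \<tau>: "\<tau> \<ge> 0" using 5 by (simp add: \<tau>_def)
    have eq: "exp (t * (s + r)) = exp (- \<tau> * (s - r)) * exp (- 2 * \<tau> * r)"
      by (simp add: exp_add[symmetric] \<tau>_def algebra_simps)
    have K: "\<bar>faddeev_kernel s t r\<bar> = exp (- \<tau> * (s - r)) * (1 - exp (- 2 * \<tau> * r)) / (2 * r)"
    proof -
      have "faddeev_kernel s t r = - (exp (- \<tau> * (s - r)) * (1 - exp (- 2 * \<tau> * r)) / (2 * r))"
        using 5 unfolding faddeev_kernel_def eq by (simp add: \<tau>_def algebra_simps diff_divide_distrib)
      moreover have "exp (- 2 * \<tau> * r) \<le> 1" using \<tau> 5 by simp
      ultimately show ?thesis using 5 by (simp add: abs_mult)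
    qed
    show ?thesis
    proof (cases "r \<ge> s / 2")
      case True
      have "exp (- \<tau> * (s - r)) * (1 - exp (- 2 * \<tau> * r)) \<le> exp (- \<tau> * (s - r)) * 1"
        by (intro mult_left_mono) auto
      also have "\<dots> \<le> exp (- \<bar>t\<bar> * \<bar>r - s\<bar> / 2)"
        using 5 \<tau> by (simp add: \<tau>_def mult_nonpos_nonneg)
      finally show ?thesis unfolding K
        using \<tau> 5 by (intro half True) (auto intro!: mult_nonneg_nonneg)
    next
      case False
      define d where "d = \<tau> * (s - r) / 2"
      have "1 - exp (- 2 * \<tau> * r) \<le> 2 * \<tau> * r"
        using exp_ge_add_one_self[of "- 2 * \<tau> * r"] by linarith
      then have "(1 - exp (- 2 * \<tau> * r)) / (2 * r) \<le> \<tau>" using 5 by (simp add: field_simps)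
      moreover have "\<tau> \<le> 4 / s * exp d"
      proof -
        have "\<tau> * (s / 4) \<le> d" using False \<tau> mult_left_mono[of "s / 4" "(s - r) / 2" \<tau>] by (simp add: d_def)
        also have "d \<le> exp d" using exp_ge_add_one_self[of d] by linarith
        finally show ?thesis using s by (simp add: field_simps)
      qed
      ultimately have "(1 - exp (- 2 * \<tau> * r)) / (2 * r) \<le> 4 / s * exp d" by linarith
      then have "exp (- \<tau> * (s - r)) * ((1 - exp (- 2 * \<tau> * r)) / (2 * r)) \<le> exp (- \<tau> * (s - r)) * (4 / s * exp d)"
        by (intro mult_left_mono) auto
      also have "\<dots> = 4 / s * (exp (- \<tau> * (s - r)) * exp d)" by simp
      also have "exp (- \<tau> * (s - r)) * exp d = exp (- \<bar>t\<bar> * \<bar>r - s\<bar> / 2)"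
        using 5 unfolding exp_add[symmetric] d_def \<tau>_def by (simp add: field_simps)
      finally show ?thesis unfolding K by simp
    qed
  qed
qed

lemma faddeev_kernel_fourier:
  fixes s r \<sigma> :: real
  assumes s: "s > 0" and r: "r > 0" "r \<noteq> s"
  shows "integrable lborel (\<lambda>t. faddeev_kernel s t r)"
    and "(\<integral>t. cis (- (t * \<sigma>)) * of_real (faddeev_kernel s t r) \<partial>lborel) = 1 / ((of_real \<sigma> + \<i> * of_real s)\<^sup>2 + of_real (r\<^sup>2))"
proof -
  let ?B = "\<lambda>\<sigma> t::real. indicator {..0} t *\<^sub>R exp (Complex (r + s) (- \<sigma>) * of_real t)"
  let ?A = "\<lambda>\<sigma> t::real. indicator {0..} t *\<^sub>R exp (- Complex (r - s) \<sigma> * of_real t)"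
  let ?A' = "\<lambda>\<sigma> t::real. indicator {..0} t *\<^sub>R exp (Complex (s - r) (- \<sigma>) * of_real t)"
  let ?k = "\<lambda>\<sigma> t. cis (- (t * \<sigma>)) * complex_of_real (faddeev_kernel s t r)"
  have reB: "Re (Complex (r + s) (- \<sigma>)) > 0" for \<sigma> using s r by simp
  note B = exponential_negative_half_line[OF reB]
  have fact: "1 / (2 * complex_of_real r) * (1 / Complex (r + s) (- \<sigma>) + 1 / Complex (r - s) \<sigma>) =
     1 / ((of_real \<sigma> + \<i> * of_real s)\<^sup>2 + of_real (r\<^sup>2))" for \<sigma>
  proof -
    have nz: "Complex (r + s) (- \<sigma>) \<noteq> 0" "Complex (r - s) \<sigma> \<noteq> 0" using s r by (auto simp: complex_eq_iff)
    have sum: "Complex (r + s) (- \<sigma>) + Complex (r - s) \<sigma> = 2 * of_real r" by (simp add: complex_eq_iff)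
    have prod: "Complex (r + s) (- \<sigma>) * Complex (r - s) \<sigma> = (of_real \<sigma> + \<i> * of_real s)\<^sup>2 + of_real (r\<^sup>2)"
      by (simp add: complex_eq_iff power2_eq_square algebra_simps)
    have "1 / Complex (r + s) (- \<sigma>) + 1 / Complex (r - s) \<sigma> = 2 * of_real r / (Complex (r + s) (- \<sigma>) * Complex (r - s) \<sigma>)"
      unfolding sum[symmetric] using nz by (simp add: field_simps)
    then show ?thesis unfolding prod using r by simp
  qed
  have main: "integrable lborel (?k \<sigma>) \<and> (\<integral>t. ?k \<sigma> t \<partial>lborel) = 1 / ((of_real \<sigma> + \<i> * of_real s)\<^sup>2 + of_real (r\<^sup>2))"
    if I: "integrable lborel g" "(\<integral>t. g t \<partial>lborel) = 1 / Complex (r - s) \<sigma>"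
      and ae: "AE t in lborel. of_real (1 / (2 * r)) * (?B \<sigma> t + g t) = ?k \<sigma> t" for g \<sigma>
  proof
    have i: "integrable lborel (\<lambda>t. of_real (1 / (2 * r)) * (?B \<sigma> t + g t))"
      by (intro integrable_mult_right Bochner_Integration.integrable_add B I)
    show "integrable lborel (?k \<sigma>)"
      by (rule integrable_cong_AE_imp[OF i _ ae]) simp
    have "(\<integral>t. ?k \<sigma> t \<partial>lborel) = (\<integral>t. of_real (1 / (2 * r)) * (?B \<sigma> t + g t) \<partial>lborel)"
      using ae i by (intro integral_cong_AE) (auto elim!: eventually_mono)
    also have "\<dots> = of_real (1 / (2 * r)) * ((\<integral>t. ?B \<sigma> t \<partial>lborel) + (\<integral>t. g t \<partial>lborel))"
      by (simp only: integral_mult_right_zero Bochner_Integration.integral_add[OF B(1) I(1)])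
    also have "\<dots> = 1 / ((of_real \<sigma> + \<i> * of_real s)\<^sup>2 + of_real (r\<^sup>2))"
      unfolding B(2) I(2) using fact by simp
    finally show "(\<integral>t. ?k \<sigma> t \<partial>lborel) = 1 / ((of_real \<sigma> + \<i> * of_real s)\<^sup>2 + of_real (r\<^sup>2))" .
  qed
  have k: "integrable lborel (?k \<sigma>) \<and> (\<integral>t. ?k \<sigma> t \<partial>lborel) = 1 / ((of_real \<sigma> + \<i> * of_real s)\<^sup>2 + of_real (r\<^sup>2))" for \<sigma>
  proof (cases "r > s")
    case True
    then have re: "Re (Complex (r - s) \<sigma>) > 0" by simp
    have m: "- Complex (r - s) \<sigma> = Complex (- (r - s)) (- \<sigma>)" by (simp add: complex_eq_iff)
    show ?thesis
    proof (rule main[OF exponential_half_line[OF re]])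
      show "AE t in lborel. of_real (1 / (2 * r)) * (?B \<sigma> t + ?A \<sigma> t) = ?k \<sigma> t"
        using AE_lborel_singleton[of "0::real"]
      proof eventually_elim
        case (elim t)
        then show ?case unfolding m exp_Complex_mult faddeev_kernel_def using True r
          by (cases "t > 0") (auto simp: indicator_def algebra_simps)
      qed
    qed
  next
    case False
    then have re: "Re (Complex (s - r) (- \<sigma>)) > 0" using r by simp
    note A' = exponential_negative_half_line[OF re]
    have m: "Complex (r - s) \<sigma> = - Complex (s - r) (- \<sigma>)" by (simp add: complex_eq_iff)
    show ?thesis
    proof (rule main)
      show "integrable lborel (\<lambda>t. - ?A' \<sigma> t)" using A'(1) by (rule Bochner_Integration.integrable_minus)
      show "(\<integral>t. - ?A' \<sigma> t \<partial>lborel) = 1 / Complex (r - s) \<sigma>"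
        unfolding m using A' by simp
      show "AE t in lborel. of_real (1 / (2 * r)) * (?B \<sigma> t + - ?A' \<sigma> t) = ?k \<sigma> t"
        using AE_lborel_singleton[of "0::real"]
      proof eventually_elim
        case (elim t)
        then show ?case unfolding exp_Complex_mult faddeev_kernel_def using False r
          by (cases "t > 0") (auto simp: indicator_def mult.commute add.commute algebra_simps diff_divide_distrib)
      qed
    qed
  qed
  from k[of \<sigma>] show "(\<integral>t. ?k \<sigma> t \<partial>lborel) = 1 / ((of_real \<sigma> + \<i> * of_real s)\<^sup>2 + of_real (r\<^sup>2))" by blast
  from k[of 0] have "integrable lborel (\<lambda>t. complex_of_real (faddeev_kernel s t r))" by simp
  from integrable_Re[OF this] show "integrable lborel (\<lambda>t. faddeev_kernel s t r)" by simp
qed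

lemma exp_decay_polynomial:
  fixes a s :: real
  assumes a: "a > 0" and s: "s \<ge> 0"
  shows "\<exists>C>0. \<forall>\<rho>\<ge>0. exp (- a * \<bar>\<rho> - s\<bar>) \<le> C / (1 + \<rho>) ^ N"
proof (cases "N = 0")
  case True
  then show ?thesis using a by (intro exI[of _ 1]) (auto simp: mult_nonneg_nonneg)
next
  case False
  define c where "c = (1 + N / a) * (1 + s)"
  have c: "c > 0" using a s unfolding c_def by (intro mult_pos_pos add_pos_nonneg) auto
  show ?thesis
  proof (intro exI[of _ "c ^ N"] conjI allI impI)
    show "c ^ N > 0" using c by simp
    fix \<rho> :: real assume \<rho>: "\<rho> \<ge> 0"
    define y where "y = \<bar>\<rho> - s\<bar>"
    have y: "y \<ge> 0" "\<rho> \<le> y + s" by (auto simp: y_def)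
    have "(1 + s) * (1 + y) = 1 + s + y + s * y" by (simp add: algebra_simps)
    then have "1 + \<rho> \<le> (1 + s) * (1 + y)" using y mult_nonneg_nonneg[OF s y(1)] by linarith
    also have "1 + y \<le> (1 + N / a) * (1 + a * y / N)"
      using a False y by (simp add: field_simps add_nonneg_nonneg mult_nonneg_nonneg)
    then have "(1 + s) * (1 + y) \<le> (1 + s) * ((1 + N / a) * (1 + a * y / N))"
      using s by (intro mult_left_mono) auto
    also have "\<dots> \<le> (1 + s) * ((1 + N / a) * exp (a * y / N))"
      using s a by (intro mult_left_mono exp_ge_add_one_self) auto
    finally have "1 + \<rho> \<le> c * exp (a * y / N)" by (simp add: c_def mult_ac)
    then have "(1 + \<rho>) ^ N \<le> (c * exp (a * y / N)) ^ N" using \<rho> by (intro power_mono) auto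
    also have "\<dots> = c ^ N * exp (a * y)"
      using False by (simp add: power_mult_distrib exp_of_nat_mult[symmetric])
    finally have "(1 + \<rho>) ^ N \<le> c ^ N * exp (a * y)" .
    then have "exp (- a * y) * (1 + \<rho>) ^ N \<le> c ^ N"
      by (simp add: exp_minus field_simps)
    then show "exp (- a * \<bar>\<rho> - s\<bar>) \<le> c ^ N / (1 + \<rho>) ^ N"
      using \<rho> by (simp add: y_def[symmetric] field_simps)
  qed
qed

text \<open>
  Spheres in the hyperplane are null sets. A sphere of positive radius is met by every ray in at most
  one point, so averaging over dilations applies. The origin is dominated by arbitrarily narrow
  Gaussians.
\<close>

lemma AE_hyperplane_norm_neq:
  fixes e :: "'a::euclidean_space"
  assumes e: "norm e = 1" and n: "DIM('a) \<ge> 2" and r: "r \<ge> 0"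
  shows "AE w in hyperplane_measure e. norm w \<noteq> r"
proof -
  let ?H = "hyperplane_measure e"
  have "(\<integral>\<^sup>+w. indicator {w. norm w = r} w \<partial>?H) = 0"
  proof (cases "r = 0")
    case True
    have le: "(\<integral>\<^sup>+w. indicator {w. norm w = r} w \<partial>?H) \<le> ennreal (sqrt (pi / real (Suc k)) ^ (DIM('a) - 1))" for k
    proof -
      have "(\<integral>\<^sup>+w. indicator {w. norm w = r} w \<partial>?H) \<le> (\<integral>\<^sup>+w. ennreal (exp (- real (Suc k) * (norm w)\<^sup>2)) \<partial>?H)"
        using True by (intro nn_integral_mono) (auto simp: indicator_def)
      also have "\<dots> = ennreal (sqrt (pi / real (Suc k)) ^ (DIM('a) - 1))"
        by (rule nn_integral_hyperplane_gaussian[OF _ e]) simp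
      finally show ?thesis .
    qed
    have lim: "(\<lambda>k. ennreal (sqrt (pi / real (Suc k)) ^ (DIM('a) - 1))) \<longlonglongrightarrow> ennreal (sqrt (pi * 0) ^ (DIM('a) - 1))"
      using tendsto_mult_left[OF LIMSEQ_Suc[OF lim_1_over_n], of pi]
      by (intro tendsto_intros) simp
    have "(\<integral>\<^sup>+w. indicator {w. norm w = r} w \<partial>?H) \<le> ennreal (sqrt (pi * 0) ^ (DIM('a) - 1))"
      by (rule LIMSEQ_le_const[OF lim]) (intro exI allI impI le)
    then show ?thesis using n by (simp add: power_0_left)
  next
    case False
    have "(\<integral>\<^sup>+w. indicator {w. norm w = r} w \<partial>?H) \<le> ennreal (2 ^ DIM('a)) *
      (\<integral>\<^sup>+w. (\<integral>\<^sup>+l. indicator {1..2} l * indicator {w. norm w = r} (l *\<^sub>R w) \<partial>lborel) \<partial>?H)"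
      by (rule nn_integral_hyperplane_average_dilations[OF e]) measurable
    also have "(\<integral>\<^sup>+w. (\<integral>\<^sup>+l. indicator {1..2} l * indicator {w. norm w = r} (l *\<^sub>R w) \<partial>lborel) \<partial>?H) = (\<integral>\<^sup>+w. 0 \<partial>?H)"
    proof (rule nn_integral_cong)
      fix w :: 'a
      have "(\<integral>\<^sup>+l. indicator {1..2} l * indicator {w. norm w = r} (l *\<^sub>R w) \<partial>lborel) \<le> (\<integral>\<^sup>+l. indicator {r / norm w} l \<partial>lborel)"
        using False by (intro nn_integral_mono) (auto simp: indicator_def field_simps)
      also have "\<dots> = 0" by simp
      finally show "(\<integral>\<^sup>+l. indicator {1..2} l * indicator {w. norm w = r} (l *\<^sub>R w) \<partial>lborel) = 0" by simp
    qed
    finally show ?thesis by simp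
  qed
  then show ?thesis
    by (subst (asm) nn_integral_0_iff_AE) (auto simp: indicator_def elim!: eventually_mono)
qed

text \<open>
  The function \<open>exp (i a \<bullet> x) g\<^sub>\<zeta>(x)\<close> for \<open>\<zeta> = a + i s e\<close>: the inverse Fourier transform of
  \<open>faddeev_kernel\<close> in the variables orthogonal to \<open>e\<close>.
\<close>

definition faddeev_h :: "real \<Rightarrow> 'a::euclidean_space \<Rightarrow> 'a \<Rightarrow> complex"
  where "faddeev_h s e x = of_real (1 / (2 * pi) ^ (DIM('a) - 1)) *
    (\<integral>\<eta>. cis (x \<bullet> \<eta>) * of_real (faddeev_kernel s (x \<bullet> e) (norm \<eta>)) \<partial>hyperplane_measure e)"

text \<open>
  The time integral of the heat kernel, that is, the Newtonian potential of a point mass, which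
  majorizes the singularity of \<open>faddeev_h\<close> at the origin.
\<close>

definition heat_potential :: "'a::euclidean_space \<Rightarrow> ennreal"
  where "heat_potential x =
    (\<integral>\<^sup>+y. indicator {0<..} y * ennreal (exp (- (norm x)\<^sup>2 / (4 * y)) / sqrt (4 * pi * y) ^ DIM('a)) \<partial>lborel)"

lemma measurable_heat_potential [measurable]: "heat_potential \<in> borel_measurable borel"
  unfolding heat_potential_def by measurable

lemma measurable_faddeev_h [measurable]:
  assumes e: "norm e = 1"
  shows "faddeev_h s e \<in> borel_measurable borel"
proof -
  interpret H: sigma_finite_measure "hyperplane_measure e" by (rule sigma_finite_hyperplane[OF e])
  show ?thesis unfolding faddeev_h_def by measurable
qed

text \<open>
  The heat kernel has mass 1, which handles the times \<open>y \<le> 1\<close> with the bound for \<open>\<Phi>\<close>. For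
  \<open>y \<ge> 1\<close> it is at most \<open>y powr (- 3 / 2)\<close>, by \<open>n \<ge> 3\<close>, which is integrable in \<open>y\<close>.
\<close>

lemma nn_integral_heat_potential_finite:
  fixes \<Phi> :: "'a::euclidean_space \<Rightarrow> real"
  assumes n: "DIM('a) \<ge> 3" and i: "integrable lborel \<Phi>" and B: "\<And>x. \<bar>\<Phi> x\<bar> \<le> B"
  shows "(\<integral>\<^sup>+x. heat_potential x * ennreal \<bar>\<Phi> x\<bar> \<partial>lborel) < \<infinity>"
proof -
  have [measurable]: "\<Phi> \<in> borel_measurable borel" using i by auto
  have B0: "B \<ge> 0" using B[of 0] by linarith
  let ?p = "\<lambda>y (x::'a). indicator {0<..} y * ennreal (exp (- (norm x)\<^sup>2 / (4 * y)) / sqrt (4 * pi * y) ^ DIM('a))"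
  let ?I = "(\<integral>x. \<bar>\<Phi> x\<bar> \<partial>lborel)"
  have gauss: "(\<integral>\<^sup>+x. ?p y x \<partial>lborel) \<le> 1" for y
  proof (cases "y > 0")
    case True
    have e4: "1 / (4 * y) > 0" using True by simp
    have i: "integrable lborel (\<lambda>v::'a. complex_of_real (exp (- (1 / (4 * y)) * (norm v)\<^sup>2)))"
      and v: "(\<integral>v. complex_of_real (exp (- (1 / (4 * y)) * (norm (v::'a))\<^sup>2)) \<partial>lborel) = of_real (sqrt (pi / (1 / (4 * y))) ^ DIM('a))"
      using gaussian_lborel[OF e4, of "0::'a"] by simp_all
    have i': "integrable lborel (\<lambda>v::'a. exp (- (1 / (4 * y)) * (norm v)\<^sup>2))"
      using integrable_Re[OF i] by simp
    have v': "(\<integral>v. exp (- (1 / (4 * y)) * (norm (v::'a))\<^sup>2) \<partial>lborel) = sqrt (pi / (1 / (4 * y))) ^ DIM('a)"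
      using v unfolding integral_complex_of_real of_real_eq_iff .
    have "(\<integral>\<^sup>+x. ?p y x \<partial>lborel) = (\<integral>\<^sup>+x. ennreal (1 / sqrt (4 * pi * y) ^ DIM('a) * exp (- (1 / (4 * y)) * (norm (x::'a))\<^sup>2)) \<partial>lborel)"
      using True by (intro nn_integral_cong) simp
    also have "\<dots> = ennreal (\<integral>x. 1 / sqrt (4 * pi * y) ^ DIM('a) * exp (- (1 / (4 * y)) * (norm (x::'a))\<^sup>2) \<partial>lborel)"
      using True by (intro nn_integral_eq_integral integrable_mult_right i' AE_I2 mult_nonneg_nonneg) auto
    also have "\<dots> = ennreal (1 / sqrt (4 * pi * y) ^ DIM('a) * sqrt (pi / (1 / (4 * y))) ^ DIM('a))"
      by (simp only: integral_mult_right_zero v')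
    also have "\<dots> = 1"
      using True by (simp add: mult_ac)
    finally show ?thesis by simp
  qed simp
  have "(\<integral>\<^sup>+x. heat_potential x * ennreal \<bar>\<Phi> x\<bar> \<partial>lborel) = (\<integral>\<^sup>+x. (\<integral>\<^sup>+y. ?p y x * ennreal \<bar>\<Phi> x\<bar> \<partial>lborel) \<partial>lborel)"
    unfolding heat_potential_def by (subst nn_integral_multc) simp_all
  also have "\<dots> = (\<integral>\<^sup>+y. (\<integral>\<^sup>+x. ?p y x * ennreal \<bar>\<Phi> x\<bar> \<partial>lborel) \<partial>lborel)"
    by (rule lborel_pair.Fubini') simp
  also have "\<dots> \<le> (\<integral>\<^sup>+y. ennreal B * indicator {0..1} y + ennreal ?I * (ennreal (y powr (- 3 / 2)) * indicator {1..} y) \<partial>lborel)"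
  proof (rule nn_integral_mono)
    fix y :: real
    consider "y \<le> 0" | "0 < y" "y < 1" | "1 \<le> y" by linarith
    then show "(\<integral>\<^sup>+x. ?p y x * ennreal \<bar>\<Phi> x\<bar> \<partial>lborel) \<le>
      ennreal B * indicator {0..1} y + ennreal ?I * (ennreal (y powr (- 3 / 2)) * indicator {1..} y)"
    proof cases
      case 2
      have "(\<integral>\<^sup>+x. ?p y x * ennreal \<bar>\<Phi> x\<bar> \<partial>lborel) \<le> (\<integral>\<^sup>+x. ?p y x * ennreal B \<partial>lborel)"
        using B by (intro nn_integral_mono mult_left_mono ennreal_leI) auto
      also have "\<dots> = (\<integral>\<^sup>+x. ?p y x \<partial>lborel) * ennreal B"
        by (rule nn_integral_multc) simp
      also have "\<dots> \<le> 1 * ennreal B" using gauss by (intro mult_right_mono) auto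
      finally show ?thesis using 2 by simp
    next
      case 3
      have "(\<integral>\<^sup>+x. ?p y x * ennreal \<bar>\<Phi> x\<bar> \<partial>lborel) \<le> (\<integral>\<^sup>+x. ennreal (y powr (- 3 / 2)) * ennreal \<bar>\<Phi> x\<bar> \<partial>lborel)"
      proof (intro nn_integral_mono mult_right_mono)
        fix x :: 'a
        have "sqrt y ^ 3 \<le> sqrt y ^ DIM('a)" using 3 n by (intro power_increasing) auto
        also have "\<dots> \<le> sqrt (4 * pi * y) ^ DIM('a)"
          using 3 pi_ge_two by (intro power_mono) (auto simp: mult_le_cancel_right1)
        finally have "1 / sqrt (4 * pi * y) ^ DIM('a) \<le> 1 / sqrt y ^ 3"
          using 3 by (intro divide_left_mono) auto
        moreover have "sqrt y ^ 3 = y powr (3 / 2)"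
          using 3 by (simp add: powr_half_sqrt[symmetric] powr_powr flip: powr_realpow)
        ultimately have "exp (- (norm x)\<^sup>2 / (4 * y)) / sqrt (4 * pi * y) ^ DIM('a) \<le> 1 * (1 / y powr (3 / 2))"
          using 3 mult_mono[of "exp (- (norm x)\<^sup>2 / (4 * y))" 1 "1 / sqrt (4 * pi * y) ^ DIM('a)" "1 / y powr (3/2)"] by simp
        then show "?p y x \<le> ennreal (y powr (- 3 / 2))"
          using 3 by (auto simp: powr_minus_divide intro!: ennreal_leI)
      qed simp
      also have "\<dots> = ennreal (y powr (- 3 / 2)) * (\<integral>\<^sup>+x. ennreal \<bar>\<Phi> x\<bar> \<partial>lborel)"
        by (rule nn_integral_cmult) simp
      also have "(\<integral>\<^sup>+x. ennreal \<bar>\<Phi> x\<bar> \<partial>lborel) = ennreal ?I"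
        using i by (intro nn_integral_eq_integral integrable_abs) auto
      finally show ?thesis using 3 by (intro add_increasing) (auto simp: mult.commute)
    qed simp
  qed
  also have "\<dots> = (\<integral>\<^sup>+y. ennreal B * indicator {0..1::real} y \<partial>lborel) + (\<integral>\<^sup>+y. ennreal ?I * (ennreal (y powr (- 3 / 2)) * indicator {1..} y) \<partial>lborel)"
    by (rule nn_integral_add) simp_all
  also have "(\<integral>\<^sup>+y. ennreal ?I * (ennreal (y powr (- 3 / 2)) * indicator {1..} y) \<partial>lborel) = ennreal ?I * (\<integral>\<^sup>+y. ennreal (y powr (- 3 / 2)) * indicator {1..} y \<partial>lborel)"
    by (rule nn_integral_cmult) simp
  also have "(\<integral>\<^sup>+y. ennreal (y powr (- 3 / 2)) * indicator {1..} y \<partial>lborel) = ennreal (-(1 powr (- 3 / 2 + 1)) / (- 3 / 2 + 1))"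
    by (rule nn_integral_has_integral_lebesgue', simp, rule has_integral_powr_to_inf) simp_all
  also have "(\<integral>\<^sup>+y. ennreal B * indicator {0..1::real} y \<partial>lborel) = ennreal B"
    by (subst nn_integral_cmult_indicator) auto
  also have "ennreal B + ennreal ?I * ennreal (-(1 powr (- 3 / 2 + 1)) / (- 3 / 2 + 1)) < \<infinity>"
    by (simp add: ennreal_mult_less_top)
  finally show ?thesis .
qed

text \<open>
  Subordination writes \<open>exp (- |t| r) / (2 r)\<close> as a superposition of Gaussians in \<open>r\<close>; their Fourier
  transforms over the hyperplane are, with the remaining factors, the heat kernels of the full space.
\<close>

lemma norm_fourier_le_heat_potential:
  fixes e x :: "'a::euclidean_space"
  assumes e: "norm e = 1" and n: "DIM('a) \<ge> 3" and t: "x \<bullet> e \<noteq> 0"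
  shows "integrable (hyperplane_measure e) (\<lambda>\<eta>. exp (- \<bar>x \<bullet> e\<bar> * norm \<eta>) / (2 * norm \<eta>))"
    and "ennreal (norm (\<integral>\<eta>. cis (x \<bullet> \<eta>) * of_real (exp (- \<bar>x \<bullet> e\<bar> * norm \<eta>) / (2 * norm \<eta>)) \<partial>hyperplane_measure e))
      \<le> ennreal ((2 * pi) ^ (DIM('a) - 1)) * heat_potential x"
proof -
  let ?H = "hyperplane_measure e"
  interpret P: pair_sigma_finite ?H "lborel :: real measure"
    by (simp add: pair_sigma_finite_def sigma_finite_hyperplane[OF e] sigma_finite_lborel)
  define \<tau> where "\<tau> = x \<bullet> e"
  define w where "w = x - \<tau> *\<^sub>R e"
  have ee: "e \<bullet> e = 1" using e by (simp add: dot_square_norm)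
  have we: "w \<bullet> e = 0" by (simp add: w_def \<tau>_def inner_diff_left ee)
  have nx: "(norm x)\<^sup>2 = (norm w)\<^sup>2 + \<tau>\<^sup>2"
    using norm_add_scaleR_orthogonal[OF e we, of \<tau>] by (simp add: w_def)
  let ?S = "\<lambda>\<rho> y. indicator {0<..} y * (exp (- \<tau>\<^sup>2 / (4 * y) - y * \<rho>\<^sup>2) / sqrt (4 * pi * y))"
  let ?g = "\<lambda>\<eta>. exp (- \<bar>\<tau>\<bar> * norm \<eta>) / (2 * norm \<eta>)"
  have ne0: "AE \<eta> in ?H. norm \<eta> \<noteq> 0" using n by (intro AE_hyperplane_norm_neq[OF e]) auto
  show ig: "integrable ?H (\<lambda>\<eta>. exp (- \<bar>x \<bullet> e\<bar> * norm \<eta>) / (2 * norm \<eta>))"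
  proof -
    obtain C where C: "C > 0" "\<And>\<rho>. \<rho> \<ge> 0 \<Longrightarrow> exp (- \<bar>\<tau>\<bar> * \<bar>\<rho> - 0\<bar>) \<le> C / (1 + \<rho>) ^ (2 * DIM('a))"
      using exp_decay_polynomial[of "\<bar>\<tau>\<bar>" 0 "2 * DIM('a)"] t by (auto simp: \<tau>_def)
    show ?thesis
    proof (rule Bochner_Integration.integrable_bound)
      show "integrable ?H (\<lambda>\<eta>. C * (1 / (norm \<eta> * (1 + norm \<eta>) ^ (2 * DIM('a)))))"
        by (intro integrable_mult_right integrable_hyperplane_inverse_norm e n) simp
      show "AE \<eta> in ?H. norm (exp (- \<bar>x \<bullet> e\<bar> * norm \<eta>) / (2 * norm \<eta>)) \<le> norm (C * (1 / (norm \<eta> * (1 + norm \<eta>) ^ (2 * DIM('a)))))"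
      proof (rule AE_I2)
        fix \<eta> :: 'a
        have "exp (- \<bar>x \<bullet> e\<bar> * norm \<eta>) / (2 * norm \<eta>) \<le> (C / (1 + norm \<eta>) ^ (2 * DIM('a))) / (2 * norm \<eta>)"
          using C(2)[of "norm \<eta>"] by (intro divide_right_mono) (auto simp: \<tau>_def)
        also have "\<dots> \<le> (C / (1 + norm \<eta>) ^ (2 * DIM('a))) / norm \<eta>"
          using C by (cases "\<eta> = 0") (auto intro!: divide_left_mono divide_nonneg_nonneg mult_pos_pos zero_less_power add_pos_nonneg)
        also have "\<dots> = C * (1 / (norm \<eta> * (1 + norm \<eta>) ^ (2 * DIM('a))))"
          by simp
        finally show "norm (exp (- \<bar>x \<bullet> e\<bar> * norm \<eta>) / (2 * norm \<eta>)) \<le> norm (C * (1 / (norm \<eta> * (1 + norm \<eta>) ^ (2 * DIM('a)))))"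
          using C(1) by simp
      qed
    qed simp
  qed
  let ?F = "\<lambda>\<eta> y. cis (x \<bullet> \<eta>) * complex_of_real (?S (norm \<eta>) y)"
  have S0: "?S \<rho> y \<ge> 0" for \<rho> y by (auto simp: indicator_def)
  have int: "integrable (?H \<Otimes>\<^sub>M lborel) (case_prod ?F)"
  proof (rule P.Fubini_integrable)
    have "AE \<eta> in ?H. (\<integral>y. norm (?F \<eta> y) \<partial>lborel) = ?g \<eta>"
      using ne0
    proof eventually_elim
      case (elim \<eta>)
      have "(\<integral>y. norm (?F \<eta> y) \<partial>lborel) = (\<integral>y. ?S (norm \<eta>) y \<partial>lborel)"
        by (simp only: norm_mult norm_cis mult_1 norm_of_real abs_of_nonneg[OF S0])
      then show ?case using subordination(2)[of "norm \<eta>" \<tau>] elim by simp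
    qed
    then show "integrable ?H (\<lambda>\<eta>. \<integral>y. norm (case (\<eta>, y) of (\<eta>, y) \<Rightarrow> ?F \<eta> y) \<partial>lborel)"
      using ig unfolding prod.case \<tau>_def[symmetric]
      by (rule_tac integrable_cong_AE_imp[where g="?g"]) (auto elim!: eventually_mono)
    show "AE \<eta> in ?H. integrable lborel (\<lambda>y. case (\<eta>, y) of (\<eta>, y) \<Rightarrow> ?F \<eta> y)"
      using ne0
    proof eventually_elim
      case (elim \<eta>)
      show ?case unfolding prod.case
        using subordination(1)[of "norm \<eta>" \<tau>] elim by (intro integrable_cis_mult integrable_of_real) auto
    qed
  qed (simp add: case_prod_unfold)
  have "(\<integral>\<eta>. cis (x \<bullet> \<eta>) * of_real (?g \<eta>) \<partial>?H) = (\<integral>\<eta>. (\<integral>y. ?F \<eta> y \<partial>lborel) \<partial>?H)"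
  proof (rule integral_cong_AE)
    show "AE \<eta> in ?H. cis (x \<bullet> \<eta>) * of_real (?g \<eta>) = (\<integral>y. ?F \<eta> y \<partial>lborel)"
      using ne0
    proof eventually_elim
      case (elim \<eta>)
      then have "norm \<eta> > 0" by simp
      note S = subordination(2)[OF this, of \<tau>]
      show ?case by (simp only: integral_mult_right_zero integral_complex_of_real S)
    qed
  qed simp_all
  also have "\<dots> = (\<integral>y. (\<integral>\<eta>. ?F \<eta> y \<partial>?H) \<partial>lborel)"
    by (rule P.Fubini_integral[OF int, symmetric])
  finally have eq: "(\<integral>\<eta>. cis (x \<bullet> \<eta>) * of_real (?g \<eta>) \<partial>?H) = (\<integral>y. (\<integral>\<eta>. ?F \<eta> y \<partial>?H) \<partial>lborel)" .
  have inner: "ennreal (norm (\<integral>\<eta>. ?F \<eta> y \<partial>?H)) = ennreal ((2 * pi) ^ (DIM('a) - 1)) *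
      (indicator {0<..} y * ennreal (exp (- (norm x)\<^sup>2 / (4 * y)) / sqrt (4 * pi * y) ^ DIM('a)))" for y
  proof (cases "y > 0")
    case True
    let ?c = "exp (- \<tau>\<^sup>2 / (4 * y)) / sqrt (4 * pi * y)"
    have "(\<integral>\<eta>. ?F \<eta> y \<partial>?H) = (\<integral>\<eta>. of_real ?c * (cis (\<eta> \<bullet> w) * of_real (exp (- y * (norm \<eta>)\<^sup>2))) \<partial>?H)"
    proof (rule integral_cong_AE)
      show "AE \<eta> in ?H. ?F \<eta> y = of_real ?c * (cis (\<eta> \<bullet> w) * of_real (exp (- y * (norm \<eta>)\<^sup>2)))"
        using AE_hyperplane_orthogonal[OF e]
      proof eventually_elim
        case (elim \<eta>)
        have "x \<bullet> \<eta> = \<eta> \<bullet> w" using elim by (simp add: w_def inner_diff_right inner_commute)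
        moreover have "exp (- \<tau>\<^sup>2 / (4 * y) - y * (norm \<eta>)\<^sup>2) = exp (- \<tau>\<^sup>2 / (4 * y)) * exp (- y * (norm \<eta>)\<^sup>2)"
          unfolding exp_add[symmetric] by simp
        ultimately show ?case using True by simp
      qed
    qed simp_all
    also have "\<dots> = of_real (?c * (sqrt (pi / y) ^ (DIM('a) - 1) * exp (- (norm w)\<^sup>2 / (4 * y))))"
      using gaussian_hyperplane(2)[OF True e we] by simp
    finally have "norm (\<integral>\<eta>. ?F \<eta> y \<partial>?H) = ?c * (sqrt (pi / y) ^ (DIM('a) - 1) * exp (- (norm w)\<^sup>2 / (4 * y)))"
      using True by (simp only: norm_of_real) simp
    also have "\<dots> = (2 * pi) ^ (DIM('a) - 1) * (exp (- (norm x)\<^sup>2 / (4 * y)) / sqrt (4 * pi * y) ^ DIM('a))"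
    proof -
      have "sqrt (pi / y) * sqrt (4 * pi * y) = sqrt ((2 * pi)\<^sup>2)"
        unfolding real_sqrt_mult[symmetric] using True by (simp add: power2_eq_square)
      then have "sqrt (pi / y) * sqrt (4 * pi * y) = 2 * pi" unfolding real_sqrt_abs by simp
      then have sq: "sqrt (pi / y) = 2 * pi / sqrt (4 * pi * y)" using True by (simp add: field_simps)
      have ex: "exp (- (norm x)\<^sup>2 / (4 * y)) = exp (- \<tau>\<^sup>2 / (4 * y)) * exp (- (norm w)\<^sup>2 / (4 * y))"
        unfolding nx exp_add[symmetric] by (simp add: add_divide_distrib diff_divide_distrib)
      have "sqrt (4 * pi * y) ^ DIM('a) = sqrt (4 * pi * y) * sqrt (4 * pi * y) ^ (DIM('a) - 1)"
        using n by (cases "DIM('a)") auto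
      then show ?thesis unfolding sq ex by (simp add: power_divide)
    qed
    finally have eq': "norm (\<integral>\<eta>. ?F \<eta> y \<partial>?H) =
      (2 * pi) ^ (DIM('a) - 1) * (exp (- (norm x)\<^sup>2 / (4 * y)) / sqrt (4 * pi * y) ^ DIM('a))" .
    have ind: "indicator {0<..} y = (1 :: ennreal)" using True by simp
    show ?thesis unfolding eq' ind mult_1 by (rule ennreal_mult) (use True in auto)
  qed simp
  have "ennreal (norm (\<integral>\<eta>. cis (x \<bullet> \<eta>) * of_real (?g \<eta>) \<partial>?H)) \<le> (\<integral>\<^sup>+y. ennreal (norm (\<integral>\<eta>. ?F \<eta> y \<partial>?H)) \<partial>lborel)"
    unfolding eq by (rule integral_norm_bound_ennreal[OF P.integrable_snd[OF int]])
  also have "\<dots> = ennreal ((2 * pi) ^ (DIM('a) - 1)) * heat_potential x"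
    unfolding inner heat_potential_def by (rule nn_integral_cmult) simp
  finally show "ennreal (norm (\<integral>\<eta>. cis (x \<bullet> \<eta>) * of_real (exp (- \<bar>x \<bullet> e\<bar> * norm \<eta>) / (2 * norm \<eta>)) \<partial>?H))
      \<le> ennreal ((2 * pi) ^ (DIM('a) - 1)) * heat_potential x"
    by (simp add: \<tau>_def)
qed

lemma integrable_faddeev_kernel:
  fixes e :: "'a::euclidean_space"
  assumes e: "norm e = 1" and s: "s > 0" and t: "t \<noteq> 0"
  shows "integrable (hyperplane_measure e) (\<lambda>\<eta>. faddeev_kernel s t (norm \<eta>))"
proof -
  obtain C where C: "C > 0" "\<And>\<rho>. \<rho> \<ge> 0 \<Longrightarrow> exp (- (\<bar>t\<bar> / 2) * \<bar>\<rho> - s\<bar>) \<le> C / (1 + \<rho>) ^ (2 * DIM('a))"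
    using exp_decay_polynomial[of "\<bar>t\<bar> / 2" s "2 * DIM('a)"] t s by (auto simp: mult.commute)
  show ?thesis
  proof (rule Bochner_Integration.integrable_bound)
    show "integrable (hyperplane_measure e) (\<lambda>\<eta>. 4 / s * (C * (1 / (1 + norm \<eta>) ^ (2 * DIM('a)))))"
      by (intro integrable_mult_right integrable_hyperplane_weight e) simp
    show "AE \<eta> in hyperplane_measure e. norm (faddeev_kernel s t (norm \<eta>)) \<le> norm (4 / s * (C * (1 / (1 + norm \<eta>) ^ (2 * DIM('a)))))"
    proof (rule AE_I2)
      fix \<eta> :: 'a
      have "\<bar>faddeev_kernel s t (norm \<eta>)\<bar> \<le> 4 / s * exp (- (\<bar>t\<bar> / 2) * \<bar>norm \<eta> - s\<bar>)"
        using faddeev_kernel_bound[OF s, of "norm \<eta>" t] by simp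
      also have "\<dots> \<le> 4 / s * (C * (1 / (1 + norm \<eta>) ^ (2 * DIM('a))))"
        using C(2)[of "norm \<eta>"] s by (intro mult_left_mono) auto
      finally show "norm (faddeev_kernel s t (norm \<eta>)) \<le> norm (4 / s * (C * (1 / (1 + norm \<eta>) ^ (2 * DIM('a)))))"
        by (simp only: real_norm_def)
    qed
  qed simp
qed

text \<open>
  For \<open>|x \<bullet> e| \<ge> 1\<close> the kernel decays rapidly in \<open>\<eta>\<close>, which bounds \<open>faddeev_h\<close>. For
  \<open>|x \<bullet> e| < 1\<close> the kernel differs from \<open>exp (s t) exp (- |t| |\<eta>|) / (2 |\<eta>|)\<close> only for \<open>|\<eta>| \<le> s\<close>, where
  the difference is at most a multiple of \<open>1 / |\<eta>|\<close>; the comparison kernel is controlled by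
  \<open>norm_fourier_le_heat_potential\<close>.
\<close>

lemma faddeev_h_bound:
  fixes e :: "'a::euclidean_space"
  assumes e: "norm e = 1" and n: "DIM('a) \<ge> 3" and s: "s > 0"
  shows "\<exists>C\<ge>0. \<forall>x. x \<bullet> e \<noteq> 0 \<longrightarrow> ennreal (norm (faddeev_h s e x)) \<le> ennreal C * (1 + heat_potential x)"
proof -
  let ?H = "hyperplane_measure e"
  define c where "c = 1 / (2 * pi) ^ (DIM('a) - 1)"
  have c0: "c > 0" by (simp add: c_def)
  have hn: "norm (faddeev_h s e x) = c * norm (\<integral>\<eta>. cis (x \<bullet> \<eta>) * of_real (faddeev_kernel s (x \<bullet> e) (norm \<eta>)) \<partial>?H)" for x
    unfolding faddeev_h_def norm_mult c_def[symmetric] using c0 by simp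
  obtain C where C: "C > 0" "\<And>\<rho>. \<rho> \<ge> 0 \<Longrightarrow> exp (- (1 / 2) * \<bar>\<rho> - s\<bar>) \<le> C / (1 + \<rho>) ^ (2 * DIM('a))"
    using exp_decay_polynomial[of "1 / 2" s "2 * DIM('a)"] s by (auto simp: mult.commute)
  define W where "W = (\<integral>\<eta>. 1 / (1 + norm (\<eta>::'a)) ^ (2 * DIM('a)) \<partial>?H)"
  have iW: "integrable ?H (\<lambda>\<eta>::'a. 1 / (1 + norm \<eta>) ^ (2 * DIM('a)))"
    by (intro integrable_hyperplane_weight e) simp
  define V where "V = (\<integral>\<eta>. 1 / (norm (\<eta>::'a) * (1 + norm \<eta>) ^ (2 * DIM('a))) \<partial>?H)"
  have iV: "integrable ?H (\<lambda>\<eta>::'a. 1 / (norm \<eta> * (1 + norm \<eta>) ^ (2 * DIM('a))))"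
    by (intro integrable_hyperplane_inverse_norm e n) simp
  have W0: "W \<ge> 0" unfolding W_def by (intro Bochner_Integration.integral_nonneg) auto
  have V0: "V \<ge> 0" unfolding V_def by (intro Bochner_Integration.integral_nonneg) auto
  have far: "norm (faddeev_h s e x) \<le> c * (4 / s * (C * W))" if x: "\<bar>x \<bullet> e\<bar> \<ge> 1" for x
  proof -
    have "norm (\<integral>\<eta>. cis (x \<bullet> \<eta>) * of_real (faddeev_kernel s (x \<bullet> e) (norm \<eta>)) \<partial>?H) \<le> (\<integral>\<eta>. 4 / s * (C * (1 / (1 + norm \<eta>) ^ (2 * DIM('a)))) \<partial>?H)"
    proof (rule order_trans[OF integral_norm_bound], rule integral_mono)
      show "integrable ?H (\<lambda>\<eta>. norm (cis (x \<bullet> \<eta>) * of_real (faddeev_kernel s (x \<bullet> e) (norm \<eta>))))"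
        using x by (intro integrable_norm integrable_cis_mult integrable_of_real integrable_faddeev_kernel e s) auto
      show "integrable ?H (\<lambda>\<eta>. 4 / s * (C * (1 / (1 + norm \<eta>) ^ (2 * DIM('a)))))"
        by (intro integrable_mult_right iW)
      fix \<eta> :: 'a
      have "\<bar>faddeev_kernel s (x \<bullet> e) (norm \<eta>)\<bar> \<le> 4 / s * exp (- \<bar>x \<bullet> e\<bar> * \<bar>norm \<eta> - s\<bar> / 2)"
        by (rule faddeev_kernel_bound[OF s]) simp
      also have "\<dots> \<le> 4 / s * exp (- (1 / 2) * \<bar>norm \<eta> - s\<bar>)"
        using x s mult_right_mono[of 1 "\<bar>x \<bullet> e\<bar>" "\<bar>norm \<eta> - s\<bar>"] by (intro mult_left_mono) auto
      also have "\<dots> \<le> 4 / s * (C * (1 / (1 + norm \<eta>) ^ (2 * DIM('a))))"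
        using C(2)[of "norm \<eta>"] s by (intro mult_left_mono) auto
      finally show "norm (cis (x \<bullet> \<eta>) * of_real (faddeev_kernel s (x \<bullet> e) (norm \<eta>))) \<le> 4 / s * (C * (1 / (1 + norm \<eta>) ^ (2 * DIM('a))))"
        by (simp only: norm_mult norm_cis norm_of_real mult_1)
    qed
    also have "\<dots> = 4 / s * (C * W)" by (simp only: integral_mult_right_zero W_def)
    finally show ?thesis unfolding hn using c0 by (intro mult_left_mono) auto
  qed
  define D where "D = exp (2 * s) * (1 + s) ^ (2 * DIM('a))"
  have D0: "D \<ge> 0" using s by (simp add: D_def)
  \<comment> \<open>the comparison kernel \<open>exp (s t) exp (- |t| r) / (2 r)\<close>; the factor \<open>exp (s t)\<close> is at most \<open>exp s\<close> here\<close>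
  have near: "norm (faddeev_h s e x) \<le> c * exp s * norm (\<integral>\<eta>. cis (x \<bullet> \<eta>) * of_real (exp (- \<bar>x \<bullet> e\<bar> * norm \<eta>) / (2 * norm \<eta>)) \<partial>?H) + c * (D * V)"
    if x: "\<bar>x \<bullet> e\<bar> < 1" "x \<bullet> e \<noteq> 0" for x
  proof -
    define t where "t = x \<bullet> e"
    let ?K = "\<lambda>\<eta>. cis (x \<bullet> \<eta>) * complex_of_real (faddeev_kernel s t (norm \<eta>))"
    let ?g = "\<lambda>\<eta>. exp (- \<bar>t\<bar> * norm \<eta>) / (2 * norm \<eta>)"
    let ?E = "\<lambda>\<eta>. complex_of_real (exp (s * t)) * (cis (x \<bullet> \<eta>) * complex_of_real (?g \<eta>))"
    have iK: "integrable ?H ?K"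
      using x by (intro integrable_cis_mult integrable_of_real integrable_faddeev_kernel e s) (auto simp: t_def)
    have iE: "integrable ?H ?E"
      using norm_fourier_le_heat_potential(1)[OF e n x(2)] by (intro integrable_mult_right integrable_cis_mult integrable_of_real) (auto simp: t_def)
    have est: "s * t \<le> s" using x s mult_left_mono[of t 1 s] by (simp add: t_def)
    have diff: "norm (?K \<eta> - ?E \<eta>) \<le> D * (1 / (norm \<eta> * (1 + norm \<eta>) ^ (2 * DIM('a))))" for \<eta>
    proof -
      define \<rho> where "\<rho> = norm \<eta>"
      have \<rho>: "\<rho> \<ge> 0" by (simp add: \<rho>_def)
      have "?K \<eta> - ?E \<eta> = cis (x \<bullet> \<eta>) * of_real (faddeev_kernel s t \<rho> - exp (s * t) * ?g \<eta>)"
        by (simp add: \<rho>_def algebra_simps)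
      then have "norm (?K \<eta> - ?E \<eta>) = \<bar>faddeev_kernel s t \<rho> - exp (s * t) * ?g \<eta>\<bar>"
        by (simp only: norm_mult norm_cis norm_of_real mult_1)
      also have "\<dots> \<le> (if \<rho> \<le> s then exp (2 * s) / (2 * \<rho>) else 0)"
      proof (cases "\<rho> \<le> s")
        case True
        have K: "faddeev_kernel s t \<rho> = exp (s * t) * ?g \<eta> - (if t > 0 \<or> \<rho> < s then exp (s * t) * exp (- t * \<rho>) / (2 * \<rho>) else 0)"
        proof (cases "t > 0")
          case t: True
          then show ?thesis using True by (simp add: faddeev_kernel_def \<rho>_def[symmetric])
        next
          case False
          then have "t < 0" using x by (simp add: t_def)
          then have ab: "\<bar>t\<bar> = - t" by simp
          have "exp (t * (s + \<rho>)) = exp (s * t) * exp (- \<bar>t\<bar> * \<rho>)" "exp (t * (s - \<rho>)) = exp (s * t) * exp (- t * \<rho>)"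
            unfolding exp_add[symmetric] ab by (simp_all add: algebra_simps)
          then show ?thesis using False by (simp add: faddeev_kernel_def \<rho>_def[symmetric] diff_divide_distrib)
        qed
        have "- t * \<rho> \<le> 1 * s" using x True \<rho> s mult_mono[of "-t" 1 \<rho> s] by (simp add: t_def)
        then have "exp (s * t) * exp (- t * \<rho>) \<le> exp (2 * s)"
          using est unfolding exp_add[symmetric] by simp
        then have "exp (s * t) * exp (- t * \<rho>) / (2 * \<rho>) \<le> exp (2 * s) / (2 * \<rho>)"
          using \<rho> by (intro divide_right_mono) auto
        then show ?thesis unfolding K using True \<rho> by simp
      next
        case False
        have "exp (s * t) * exp (- \<bar>t\<bar> * \<rho>) = (if t > 0 then exp (- t * (\<rho> - s)) else exp (t * (s + \<rho>)))"
          unfolding exp_add[symmetric] by (simp add: algebra_simps)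
        then show ?thesis using False by (auto simp: faddeev_kernel_def \<rho>_def[symmetric])
      qed
      also have "\<dots> \<le> D * (1 / (\<rho> * (1 + \<rho>) ^ (2 * DIM('a))))"
      proof (cases "\<rho> \<le> s \<and> \<rho> > 0")
        case True
        then have "(1 + \<rho>) ^ (2 * DIM('a)) \<le> (1 + s) ^ (2 * DIM('a))" by (intro power_mono) auto
        then have "1 \<le> (1 + s) ^ (2 * DIM('a)) / (1 + \<rho>) ^ (2 * DIM('a))" using \<rho> by simp
        then have "exp (2 * s) / (2 * \<rho>) * 1 \<le> exp (2 * s) / \<rho> * ((1 + s) ^ (2 * DIM('a)) / (1 + \<rho>) ^ (2 * DIM('a)))"
          using True by (intro mult_mono divide_left_mono) auto
        then show ?thesis using True by (simp add: D_def)
      next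
        case False
        then show ?thesis using \<rho> D0 by auto
      qed
      finally show ?thesis by (simp add: \<rho>_def)
    qed
    have "norm (\<integral>\<eta>. ?K \<eta> - ?E \<eta> \<partial>?H) \<le> (\<integral>\<eta>. D * (1 / (norm \<eta> * (1 + norm \<eta>) ^ (2 * DIM('a)))) \<partial>?H)"
      by (rule order_trans[OF integral_norm_bound integral_mono[OF
            integrable_norm[OF Bochner_Integration.integrable_diff[OF iK iE]] integrable_mult_right[OF iV] diff]])
    also have "\<dots> = D * V" by (simp only: integral_mult_right_zero V_def)
    finally have "norm (\<integral>\<eta>. ?K \<eta> \<partial>?H) \<le> norm (\<integral>\<eta>. ?E \<eta> \<partial>?H) + D * V"
      unfolding Bochner_Integration.integral_diff[OF iK iE]
      using norm_triangle_sub[of "\<integral>\<eta>. ?K \<eta> \<partial>?H" "\<integral>\<eta>. ?E \<eta> \<partial>?H"] by linarith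
    also have "norm (\<integral>\<eta>. ?E \<eta> \<partial>?H) = exp (s * t) * norm (\<integral>\<eta>. cis (x \<bullet> \<eta>) * complex_of_real (?g \<eta>) \<partial>?H)"
      by (simp only: integral_mult_right_zero norm_mult norm_of_real abs_exp_cancel)
    also have "\<dots> \<le> exp s * norm (\<integral>\<eta>. cis (x \<bullet> \<eta>) * complex_of_real (?g \<eta>) \<partial>?H)"
      using est by (intro mult_right_mono) auto
    finally have "norm (\<integral>\<eta>. ?K \<eta> \<partial>?H) \<le> exp s * norm (\<integral>\<eta>. cis (x \<bullet> \<eta>) * complex_of_real (?g \<eta>) \<partial>?H) + D * V" by simp
    from mult_left_mono[OF this, of c] show ?thesis
      unfolding hn t_def using c0 by (simp add: distrib_left mult.assoc)
  qed
  define M where "M = c * (4 / s * (C * W)) + c * (D * V) + exp s"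
  have nn: "0 \<le> c * (4 / s * (C * W))" "0 \<le> c * (D * V)" using c0 C W0 D0 V0 s by auto
  have M0: "M \<ge> 0" using nn unfolding M_def by simp
  show ?thesis
  proof (intro exI[of _ M] conjI allI impI M0)
    fix x :: 'a assume x: "x \<bullet> e \<noteq> 0"
    show "ennreal (norm (faddeev_h s e x)) \<le> ennreal M * (1 + heat_potential x)"
    proof (cases "\<bar>x \<bullet> e\<bar> \<ge> 1")
      case True
      have "ennreal (norm (faddeev_h s e x)) \<le> ennreal M"
        using far[OF True] nn exp_ge_zero[of s] unfolding M_def by (intro ennreal_leI) linarith
      also have "\<dots> \<le> ennreal M * (1 + heat_potential x)"
        by (simp add: distrib_left)
      finally show ?thesis .
    next
      case False
      let ?N = "norm (\<integral>\<eta>. cis (x \<bullet> \<eta>) * of_real (exp (- \<bar>x \<bullet> e\<bar> * norm \<eta>) / (2 * norm \<eta>)) \<partial>?H)"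
      have "ennreal (norm (faddeev_h s e x)) \<le> ennreal (c * exp s * ?N + c * (D * V))"
        using near[of x] False x by (intro ennreal_leI) auto
      also have "\<dots> = ennreal (c * exp s) * ennreal ?N + ennreal (c * (D * V))"
        using c0 nn by (simp add: ennreal_mult ennreal_plus)
      also have "\<dots> \<le> ennreal (c * exp s) * (ennreal ((2 * pi) ^ (DIM('a) - 1)) * heat_potential x) + ennreal (c * (D * V))"
        by (intro add_right_mono mult_left_mono norm_fourier_le_heat_potential(2) e n x) simp
      also have "ennreal (c * exp s) * (ennreal ((2 * pi) ^ (DIM('a) - 1)) * heat_potential x) = ennreal (exp s) * heat_potential x"
        unfolding mult.assoc[symmetric] by (subst ennreal_mult[symmetric]) (use c0 in \<open>auto simp: c_def\<close>)
      also have "ennreal (exp s) * heat_potential x + ennreal (c * (D * V)) \<le> ennreal M * heat_potential x + ennreal M * 1"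
        using nn unfolding mult_1_right by (intro add_mono mult_right_mono ennreal_leI) (auto simp: M_def)
      also have "\<dots> = ennreal M * (1 + heat_potential x)" by (simp add: distrib_left add.commute)
      finally show ?thesis .
    qed
  qed
qed

lemma AE_inner_neq_0:
  fixes e :: "'a::euclidean_space"
  assumes e: "norm e = 1"
  shows "AE x in lborel. (x - c) \<bullet> e \<noteq> 0"
proof -
  have "negligible {x. e \<bullet> x = e \<bullet> c}"
    using e by (intro negligible_hyperplane) auto
  then have "{x. e \<bullet> x = e \<bullet> c} \<in> null_sets lborel"
    by (subst (asm) negligible_iff_null_sets) (auto simp: null_sets_completion_iff)
  then show ?thesis
    by (rule AE_I') (auto simp: inner_diff_left inner_diff_right inner_commute)
qed

lemma integrable_faddeev_h_mult:
  fixes e :: "'a::euclidean_space"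
  assumes e: "norm e = 1" and n: "DIM('a) \<ge> 3" and s: "s > 0"
    and i: "integrable lborel \<Phi>" and B: "\<And>x. norm (\<Phi> x) \<le> B"
  shows "integrable lborel (\<lambda>x. faddeev_h s e x * \<Phi> x)"
proof (rule integrableI_bounded)
  have [measurable]: "\<Phi> \<in> borel_measurable borel" "faddeev_h s e \<in> borel_measurable borel"
    using i measurable_faddeev_h[OF e] by auto
  show "(\<lambda>x. faddeev_h s e x * \<Phi> x) \<in> borel_measurable lborel" by simp
  obtain C where C: "C \<ge> 0" "\<And>x. x \<bullet> e \<noteq> 0 \<Longrightarrow> ennreal (norm (faddeev_h s e x)) \<le> ennreal C * (1 + heat_potential x)"
    using faddeev_h_bound[OF e n s] by blast
  have i': "integrable lborel (\<lambda>x. norm (\<Phi> x))" using i by simp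
  have "(\<integral>\<^sup>+x. ennreal (norm (faddeev_h s e x * \<Phi> x)) \<partial>lborel) \<le>
    (\<integral>\<^sup>+x. ennreal C * (ennreal (norm (\<Phi> x)) + heat_potential x * ennreal \<bar>norm (\<Phi> x)\<bar>) \<partial>lborel)"
  proof (rule nn_integral_mono_AE)
    show "AE x in lborel. ennreal (norm (faddeev_h s e x * \<Phi> x)) \<le> ennreal C * (ennreal (norm (\<Phi> x)) + heat_potential x * ennreal \<bar>norm (\<Phi> x)\<bar>)"
      using AE_inner_neq_0[OF e, of 0]
    proof eventually_elim
      case (elim x)
      have "ennreal (norm (faddeev_h s e x * \<Phi> x)) = ennreal (norm (faddeev_h s e x)) * ennreal (norm (\<Phi> x))"
        by (simp add: norm_mult ennreal_mult)
      also have "\<dots> \<le> ennreal C * (1 + heat_potential x) * ennreal (norm (\<Phi> x))"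
        using C(2)[of x] elim by (intro mult_right_mono) auto
      finally show ?case by (simp add: distrib_left distrib_right mult.assoc)
    qed
  qed
  also have "\<dots> = ennreal C * ((\<integral>\<^sup>+x. ennreal (norm (\<Phi> x)) \<partial>lborel) + (\<integral>\<^sup>+x. heat_potential x * ennreal \<bar>norm (\<Phi> x)\<bar> \<partial>lborel))"
    by (subst nn_integral_cmult, simp, subst nn_integral_add) simp_all
  also have "\<dots> < \<infinity>"
    using nn_integral_heat_potential_finite[OF n i'] B i
    by (auto simp: ennreal_mult_less_top integrable_iff_bounded)
  finally show "(\<integral>\<^sup>+x. ennreal (norm (faddeev_h s e x * \<Phi> x)) \<partial>lborel) < \<infinity>" .
qed

section \<open>The Green function as the inverse Fourier transform of its symbol\<close>

lemma (in pair_sigma_finite) integrable_pair_product_bound_AE: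
  fixes f :: "'a \<times> 'b \<Rightarrow> 'c::{banach, second_countable_topology}"
    and a :: "'a \<Rightarrow> real" and b :: "'b \<Rightarrow> real"
  assumes [measurable]: "f \<in> borel_measurable (M1 \<Otimes>\<^sub>M M2)"
    and a: "integrable M1 a" and b: "integrable M2 b"
    and nn: "\<And>x. a x \<ge> 0" "\<And>y. b y \<ge> 0"
    and le: "AE x in M1. AE y in M2. norm (f (x, y)) \<le> a x * b y"
  shows "integrable (M1 \<Otimes>\<^sub>M M2) f"
proof (rule integrableI_bounded)
  have [measurable]: "a \<in> borel_measurable M1" "b \<in> borel_measurable M2" using a b by auto
  have "(\<integral>\<^sup>+p. ennreal (norm (f p)) \<partial>(M1 \<Otimes>\<^sub>M M2)) = (\<integral>\<^sup>+x. (\<integral>\<^sup>+y. ennreal (norm (f (x, y))) \<partial>M2) \<partial>M1)"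
    by (subst M2.nn_integral_fst[symmetric]) simp_all
  also have "\<dots> \<le> (\<integral>\<^sup>+x. (\<integral>\<^sup>+y. ennreal (a x) * ennreal (b y) \<partial>M2) \<partial>M1)"
  proof (rule nn_integral_mono_AE, use le in eventually_elim)
    fix x assume "AE y in M2. norm (f (x, y)) \<le> a x * b y"
    then show "(\<integral>\<^sup>+y. ennreal (norm (f (x, y))) \<partial>M2) \<le> (\<integral>\<^sup>+y. ennreal (a x) * ennreal (b y) \<partial>M2)"
      by (intro nn_integral_mono_AE) (auto elim!: eventually_mono simp: ennreal_mult[symmetric] nn intro!: ennreal_leI)
  qed
  also have "\<dots> = (\<integral>\<^sup>+x. ennreal (a x) * (\<integral>\<^sup>+y. ennreal (b y) \<partial>M2) \<partial>M1)"
    by (intro nn_integral_cong nn_integral_cmult) simp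
  also have "\<dots> = (\<integral>\<^sup>+x. ennreal (a x) \<partial>M1) * (\<integral>\<^sup>+y. ennreal (b y) \<partial>M2)"
    by (rule nn_integral_multc) simp
  also have "\<dots> < \<infinity>"
    using nn_integral_eq_integral[OF a] nn_integral_eq_integral[OF b] nn by (simp add: ennreal_mult_less_top)
  finally show "(\<integral>\<^sup>+p. ennreal (norm (f p)) \<partial>(M1 \<Otimes>\<^sub>M M2)) < \<infinity>" .
qed simp

lemma integrable_slices_product_bound:
  fixes f :: "'a::euclidean_space \<Rightarrow> complex" and a :: "real \<Rightarrow> real" and b :: "'a \<Rightarrow> real"
  assumes e: "norm e = 1" and [measurable]: "f \<in> borel_measurable borel"
    and a: "integrable lborel a" and b: "integrable (hyperplane_measure e) b"
    and nn: "\<And>x. a x \<ge> 0" "\<And>y. b y \<ge> 0"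
    and le: "AE t in lborel. AE w in hyperplane_measure e. norm (f (w + t *\<^sub>R e)) \<le> a t * b w"
  shows "integrable lborel f"
proof -
  interpret P: pair_sigma_finite lborel "hyperplane_measure e"
    by (intro pair_sigma_finite_hyperplane e sigma_finite_lborel)
  show ?thesis
    unfolding integrable_slices_iff[OF e assms(2)]
    by (rule P.integrable_pair_product_bound_AE[OF _ a b nn]) (use le in \<open>auto simp: case_prod_unfold\<close>)
qed

definition rapidly_decreasing :: "('a::real_normed_vector \<Rightarrow> complex) \<Rightarrow> bool"
  where "rapidly_decreasing \<Phi> \<longleftrightarrow> (\<forall>N. \<exists>C. \<forall>x. norm (\<Phi> x) \<le> C / (1 + norm x) ^ N)"

lemma rapidly_decreasingE:
  assumes "rapidly_decreasing \<Phi>"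
  obtains C where "C \<ge> 0" "\<And>x. norm (\<Phi> x) \<le> C / (1 + norm x) ^ N"
proof -
  obtain C where C: "\<And>x. norm (\<Phi> x) \<le> C / (1 + norm x) ^ N"
    using assms unfolding rapidly_decreasing_def by blast
  from C[of 0] have "C \<ge> 0" by (rule_tac order_trans[OF norm_ge_zero]) simp
  with C that show thesis by blast
qed

lemma rapidly_decreasing_integrable:
  fixes \<Phi> :: "'a::euclidean_space \<Rightarrow> complex"
  assumes r: "rapidly_decreasing \<Phi>" and [measurable]: "\<Phi> \<in> borel_measurable borel"
  shows "integrable lborel \<Phi>"
proof -
  obtain C where C: "C \<ge> 0" "\<And>x. norm (\<Phi> x) \<le> C / (1 + norm x) ^ (2 * DIM('a))"
    using rapidly_decreasingE[OF r] by blast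
  show ?thesis
  proof (rule Bochner_Integration.integrable_bound)
    show "integrable lborel (\<lambda>x::'a. C * (1 / (1 + norm x) ^ (2 * DIM('a))))"
      by (intro integrable_mult_right integrable_lborel_weight) simp
    show "AE x in lborel. norm (\<Phi> x) \<le> norm (C * (1 / (1 + norm (x::'a)) ^ (2 * DIM('a))))"
      using C by (intro AE_I2) simp
  qed simp
qed

lemma weight_slices_le:
  fixes e w :: "'a::euclidean_space"
  assumes e: "norm e = 1" and w: "w \<bullet> e = 0" and C: "C \<ge> 0"
  shows "C / (1 + norm (w + t *\<^sub>R e)) ^ (M + N) \<le> C * (1 / (1 + \<bar>t\<bar>) ^ M) * (1 / (1 + norm w) ^ N)"
proof -
  have sq: "(norm (w + t *\<^sub>R e))\<^sup>2 = (norm w)\<^sup>2 + t\<^sup>2" by (rule norm_add_scaleR_orthogonal[OF e w])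
  have "\<bar>t\<bar> \<le> norm (w + t *\<^sub>R e)" "norm w \<le> norm (w + t *\<^sub>R e)"
    by (rule power2_le_imp_le; simp add: sq)+
  then have "(1 + \<bar>t\<bar>) ^ M * (1 + norm w) ^ N \<le> (1 + norm (w + t *\<^sub>R e)) ^ M * (1 + norm (w + t *\<^sub>R e)) ^ N"
    by (intro mult_mono power_mono) auto
  then have "C / (1 + norm (w + t *\<^sub>R e)) ^ (M + N) \<le> C / ((1 + \<bar>t\<bar>) ^ M * (1 + norm w) ^ N)"
    unfolding power_add using C by (intro divide_left_mono mult_pos_pos zero_less_power add_pos_nonneg) auto
  then show ?thesis by simp
qed

lemma weight_real_2: "1 / (1 + \<bar>t\<bar>)\<^sup>2 = (1 + \<bar>t\<bar>) powr (- 2)" for t :: real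
  by (subst powr_minus_divide) (simp add: powr_numeral)

lemma integrable_weight_real: "integrable lborel (\<lambda>t::real. 1 / (1 + \<bar>t\<bar>)\<^sup>2)"
  unfolding weight_real_2 by (rule integrable_weight_powr) simp

lemma integrable_singular_weight_real: "integrable lborel (\<lambda>t::real. \<bar>t\<bar> powr (- 1 / 2) * (1 / (1 + \<bar>t\<bar>)\<^sup>2))"
proof (rule integrableI_nonneg)
  have "(\<integral>\<^sup>+t. ennreal (\<bar>t\<bar> powr (- 1 / 2) * (1 / (1 + \<bar>t\<bar>)\<^sup>2)) \<partial>lborel) \<le>
    (\<integral>\<^sup>+t. (indicator {-1..-1+1} t * ennreal (\<bar>t - 0\<bar> powr (- (1 / 2))) + indicator {0..0+1} t * ennreal (\<bar>t - 0\<bar> powr (- (1 / 2))))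
      + ennreal (1 / (1 + \<bar>t\<bar>)\<^sup>2) \<partial>lborel)"
  proof (rule nn_integral_mono)
    fix t :: real
    have "1 / (1 + \<bar>t\<bar>)\<^sup>2 \<le> 1" by simp
    then have le1: "\<bar>t\<bar> powr (- 1 / 2) * (1 / (1 + \<bar>t\<bar>)\<^sup>2) \<le> \<bar>t\<bar> powr (- (1 / 2)) * 1" by (intro mult_mono) auto
    have le2: "\<bar>t\<bar> powr (- 1 / 2) * (1 / (1 + \<bar>t\<bar>)\<^sup>2) \<le> 1 * (1 / (1 + \<bar>t\<bar>)\<^sup>2)" if "\<bar>t\<bar> \<ge> 1"
      using that powr_mono[of "- 1 / 2" 0 "\<bar>t\<bar>"] by (intro mult_right_mono) (auto split: if_splits)
    consider "\<bar>t\<bar> \<ge> 1" | "t \<in> {-1..0}" | "t \<in> {0..1}" by fastforce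
    then show "ennreal (\<bar>t\<bar> powr (- 1 / 2) * (1 / (1 + \<bar>t\<bar>)\<^sup>2)) \<le>
      (indicator {-1..-1+1} t * ennreal (\<bar>t - 0\<bar> powr (- (1 / 2))) + indicator {0..0+1} t * ennreal (\<bar>t - 0\<bar> powr (- (1 / 2))))
      + ennreal (1 / (1 + \<bar>t\<bar>)\<^sup>2)"
    proof cases
      case 1
      then show ?thesis using le2 by (intro add_increasing) (auto intro!: ennreal_leI)
    next
      case 2
      then have "ennreal (\<bar>t\<bar> powr (- 1 / 2) * (1 / (1 + \<bar>t\<bar>)\<^sup>2)) \<le> indicator {-1..-1+1} t * ennreal (\<bar>t - 0\<bar> powr (- (1 / 2)))"
        using le1 by (auto intro!: ennreal_leI)
      then show ?thesis by (rule add_increasing2[OF _ add_increasing2, rotated 2]) simp_all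
    next
      case 3
      then have "ennreal (\<bar>t\<bar> powr (- 1 / 2) * (1 / (1 + \<bar>t\<bar>)\<^sup>2)) \<le> indicator {0..0+1} t * ennreal (\<bar>t - 0\<bar> powr (- (1 / 2)))"
        using le1 by (auto intro!: ennreal_leI)
      then show ?thesis by (rule add_increasing2[OF _ add_increasing, rotated 2]) simp_all
    qed
  qed
  also have "\<dots> = ((\<integral>\<^sup>+t. indicator {-1..-1+1} t * ennreal (\<bar>t - 0\<bar> powr (- (1 / 2))) \<partial>lborel)
     + (\<integral>\<^sup>+t. indicator {0..0+1} t * ennreal (\<bar>t - 0\<bar> powr (- (1 / 2))) \<partial>lborel))
      + (\<integral>\<^sup>+t. ennreal (1 / (1 + \<bar>t\<bar>)\<^sup>2) \<partial>lborel)"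
    by (subst nn_integral_add, simp, simp, subst nn_integral_add) simp_all
  also have "\<dots> \<le> (ennreal (1 + 2 / (1 - 1 / 2)) + ennreal (1 + 2 / (1 - 1 / 2))) + ennreal (\<integral>t. 1 / (1 + \<bar>t\<bar>)\<^sup>2 \<partial>lborel)"
    by (intro add_mono nn_integral_singular_interval eq_refl[OF nn_integral_eq_integral] integrable_weight_real) auto
  also have "\<dots> < \<infinity>" by simp
  finally show "(\<integral>\<^sup>+t. ennreal (\<bar>t\<bar> powr (- 1 / 2) * (1 / (1 + \<bar>t\<bar>)\<^sup>2)) \<partial>lborel) < \<infinity>" .
qed simp_all

lemma exp_le_powr:
  fixes a y :: real
  assumes "0 < a" "a < 1" "y > 0"
  shows "exp (- y) \<le> y powr (- a)"
proof -
  have "y powr a \<le> 1 + y"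
  proof (cases "y \<ge> 1")
    case True
    then show ?thesis using powr_mono[of a 1 y] assms by simp
  next
    case False
    then show ?thesis using powr_mono2[of a y 1] assms by simp
  qed
  also have "\<dots> \<le> exp y" by (rule exp_ge_add_one_self)
  finally have "y powr a \<le> exp y" .
  then show ?thesis using assms by (simp add: powr_minus exp_minus le_imp_inverse_le)
qed

text \<open>
  The symbol \<open>|\<xi>|\<^sup>2 + 2 \<zeta> \<cdot> \<xi>\<close> in the variable \<open>\<eta> = \<xi> + a\<close>.
\<close>

definition faddeev_symbol :: "real \<Rightarrow> 'a::euclidean_space \<Rightarrow> 'a \<Rightarrow> complex"
  where "faddeev_symbol s e \<eta> = of_real ((norm \<eta>)\<^sup>2 - s\<^sup>2) + 2 * \<i> * of_real (s * (\<eta> \<bullet> e))"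

lemma measurable_faddeev_symbol [measurable]: "faddeev_symbol s e \<in> borel_measurable borel"
  unfolding faddeev_symbol_def by measurable

lemma faddeev_symbol_slice:
  fixes e w :: "'a::euclidean_space"
  assumes e: "norm e = 1" and w: "w \<bullet> e = 0"
  shows "faddeev_symbol s e (w + \<tau> *\<^sub>R e) = (of_real \<tau> + \<i> * of_real s)\<^sup>2 + of_real ((norm w)\<^sup>2)"
proof -
  have "(w + \<tau> *\<^sub>R e) \<bullet> e = \<tau>" using e w by (simp add: inner_add_left dot_square_norm)
  then show ?thesis
    unfolding faddeev_symbol_def norm_add_scaleR_orthogonal[OF e w]
    by (simp add: complex_eq_iff power2_eq_square algebra_simps)
qed

text \<open>
  The symbol factors as \<open>(|w| - s + i \<tau>) (|w| + s - i \<tau>)\<close>. The second factor is at least \<open>s\<close>, and the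
  first is at least \<open>sqrt (|\<tau>| | |w| - s |)\<close>; both resulting singularities are integrable.
\<close>

lemma faddeev_symbol_lower_bound:
  fixes e w :: "'a::euclidean_space"
  assumes e: "norm e = 1" and w: "w \<bullet> e = 0" and s: "s > 0" and \<tau>: "\<tau> \<noteq> 0" and ws: "norm w \<noteq> s"
  shows "1 / norm (faddeev_symbol s e (w + \<tau> *\<^sub>R e)) \<le> 1 / s * (\<bar>\<tau>\<bar> powr (- 1 / 2) * \<bar>norm w - s\<bar> powr (- 1 / 2))"
proof -
  define \<rho> where "\<rho> = norm w"
  have \<rho>: "\<rho> \<ge> 0" "\<bar>\<rho> - s\<bar> > 0" using ws by (auto simp: \<rho>_def)
  have eq: "faddeev_symbol s e (w + \<tau> *\<^sub>R e) = Complex (\<rho> - s) \<tau> * Complex (\<rho> + s) (- \<tau>)"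
    unfolding faddeev_symbol_slice[OF e w] \<rho>_def by (simp add: complex_eq_iff power2_eq_square algebra_simps)
  have "\<bar>\<tau>\<bar> * \<bar>\<rho> - s\<bar> \<le> (norm (Complex (\<rho> - s) \<tau>))\<^sup>2"
    using abs_Re_le_cmod[of "Complex (\<rho> - s) \<tau>"] abs_Im_le_cmod[of "Complex (\<rho> - s) \<tau>"]
    unfolding power2_eq_square by (intro mult_mono) auto
  then have "sqrt (\<bar>\<tau>\<bar> * \<bar>\<rho> - s\<bar>) \<le> norm (Complex (\<rho> - s) \<tau>)"
    by (intro real_le_lsqrt) auto
  moreover have "s \<le> norm (Complex (\<rho> + s) (- \<tau>))"
    using abs_Re_le_cmod[of "Complex (\<rho> + s) (- \<tau>)"] \<rho> s by simp
  ultimately have le: "sqrt (\<bar>\<tau>\<bar> * \<bar>\<rho> - s\<bar>) * s \<le> norm (faddeev_symbol s e (w + \<tau> *\<^sub>R e))"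
    unfolding eq norm_mult using s by (intro mult_mono) auto
  have "0 < sqrt (\<bar>\<tau>\<bar> * \<bar>\<rho> - s\<bar>) * s" using s \<tau> \<rho> by simp
  then have "1 / norm (faddeev_symbol s e (w + \<tau> *\<^sub>R e)) \<le> 1 / (sqrt (\<bar>\<tau>\<bar> * \<bar>\<rho> - s\<bar>) * s)"
    by (rule frac_le[OF _ _ _ le, rotated 2]) simp_all
  also have "\<dots> = 1 / s * (\<bar>\<tau>\<bar> powr (- 1 / 2) * \<bar>\<rho> - s\<bar> powr (- 1 / 2))"
    using \<tau> \<rho> by (simp add: powr_minus_divide powr_half_sqrt real_sqrt_mult)
  finally show ?thesis by (simp add: \<rho>_def)
qed

lemma integrable_div_faddeev_symbol:
  fixes e :: "'a::euclidean_space"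
  assumes e: "norm e = 1" and n: "DIM('a) \<ge> 2" and s: "s > 0" and r: "rapidly_decreasing \<Psi>"
    and [measurable]: "\<Psi> \<in> borel_measurable borel"
  shows "integrable lborel (\<lambda>\<eta>. \<Psi> \<eta> / faddeev_symbol s e \<eta>)"
proof -
  obtain C where C: "C \<ge> 0" "\<And>x. norm (\<Psi> x) \<le> C / (1 + norm x) ^ (2 + 2 * DIM('a))"
    using rapidly_decreasingE[OF r] by blast
  let ?a = "\<lambda>t::real. C / s * (\<bar>t\<bar> powr (- 1 / 2) * (1 / (1 + \<bar>t\<bar>)\<^sup>2))"
  let ?b = "\<lambda>w::'a. \<bar>norm w - s\<bar> powr (- (1 / 2)) / (1 + norm w) ^ (2 * DIM('a))"
  show ?thesis
  proof (rule integrable_slices_product_bound[OF e, where a="?a" and b="?b"])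
    show "integrable lborel ?a" by (intro integrable_mult_right integrable_singular_weight_real)
    show "integrable (hyperplane_measure e) ?b"
      using s by (intro integrable_hyperplane_singular_sphere e) auto
    show "?a t \<ge> 0" for t using C s by simp
    show "?b w \<ge> 0" for w by simp
    show "AE t in lborel. AE w in hyperplane_measure e. norm (\<Psi> (w + t *\<^sub>R e) / faddeev_symbol s e (w + t *\<^sub>R e)) \<le> ?a t * ?b w"
      using AE_lborel_singleton[of "0::real"]
    proof eventually_elim
      case (elim t)
      have "AE w in hyperplane_measure e. norm w \<noteq> s"
        using s n by (intro AE_hyperplane_norm_neq[OF e]) auto
      then show ?case using AE_hyperplane_orthogonal[OF e]
      proof eventually_elim
        case w: (elim w)
        have "norm (\<Psi> (w + t *\<^sub>R e)) \<le> C * (1 / (1 + \<bar>t\<bar>)\<^sup>2) * (1 / (1 + norm w) ^ (2 * DIM('a)))"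
          using C(2)[of "w + t *\<^sub>R e"] weight_slices_le[OF e w(2) C(1), of t 2 "2 * DIM('a)"] by linarith
        then have "norm (\<Psi> (w + t *\<^sub>R e)) * (1 / norm (faddeev_symbol s e (w + t *\<^sub>R e))) \<le>
          (C * (1 / (1 + \<bar>t\<bar>)\<^sup>2) * (1 / (1 + norm w) ^ (2 * DIM('a)))) * (1 / s * (\<bar>t\<bar> powr (- 1 / 2) * \<bar>norm w - s\<bar> powr (- 1 / 2)))"
          using C by (intro mult_mono faddeev_symbol_lower_bound e w s elim) auto
        then show ?case by (simp add: norm_divide mult_ac)
      qed
    qed
  qed simp
qed

lemma norm_le_geometric_mean:
  fixes x a b :: real
  assumes "x \<ge> 0" "x \<le> a" "x \<le> b" "a \<ge> 0" "b \<ge> 0"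
  shows "x \<le> sqrt a * sqrt b"
proof -
  have "x * x \<le> a * b" using assms by (intro mult_mono) auto
  then show ?thesis using assms by (auto simp: real_sqrt_mult[symmetric] power2_eq_square intro!: real_le_rsqrt)
qed

text \<open>
  On the line \<open>w + \<tau> e\<close> the reciprocal of the symbol is the Fourier transform of
  \<open>faddeev_kernel s t (norm w)\<close> in \<open>t\<close>, and \<open>\<Psi>\<close> is the Fourier transform of \<open>u w t\<close>, the partial
  transform of \<open>\<Phi>\<close> along the slice at height \<open>t\<close>. One-dimensional Fourier inversion turns the integral
  over \<open>\<tau>\<close> into \<open>2 \<pi>\<close> times the integral of the kernel against \<open>u w t\<close>; integrating over \<open>w\<close> then
  replaces the partial transform of \<open>\<Phi>\<close> by that of the kernel, which is \<open>faddeev_h\<close>. Exchanging the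
  integrals over \<open>w\<close> and \<open>t\<close> requires joint decay of \<open>u w t\<close> in both variables.
\<close>

theorem faddeev_h_distribution:
  fixes e :: "'a::euclidean_space" and \<Phi> :: "'a \<Rightarrow> complex"
  defines "\<Psi> \<equiv> \<lambda>\<eta>. \<integral>x. cis (x \<bullet> \<eta>) * \<Phi> x \<partial>lborel"
  assumes e: "norm e = 1" and n: "DIM('a) \<ge> 3" and s: "s > 0"
    and cont: "continuous_on UNIV \<Phi>" and \<Phi>: "rapidly_decreasing \<Phi>" and \<Psi>: "rapidly_decreasing \<Psi>"
  shows "(\<integral>\<eta>. \<Psi> \<eta> / faddeev_symbol s e \<eta> \<partial>lborel) = (2 * pi) ^ DIM('a) * (\<integral>x. faddeev_h s e x * \<Phi> x \<partial>lborel)"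
proof -
  let ?H = "hyperplane_measure e"
  let ?W = "\<lambda>w::'a. 1 / (1 + norm w) ^ (2 * DIM('a))"
  interpret H: sigma_finite_measure ?H by (rule sigma_finite_hyperplane[OF e])
  interpret P: pair_sigma_finite ?H "lborel :: real measure"
    by (simp add: pair_sigma_finite_def sigma_finite_hyperplane[OF e] sigma_finite_lborel)
  interpret HH: pair_sigma_finite ?H ?H ..
  have [measurable]: "\<Phi> \<in> borel_measurable borel" using cont by (rule borel_measurable_continuous_onI)
  have [measurable]: "faddeev_h s e \<in> borel_measurable borel" by (rule measurable_faddeev_h[OF e])
  have [measurable]: "\<Psi> \<in> borel_measurable borel" unfolding \<Psi>_def by measurable
  have i\<Phi>: "integrable lborel \<Phi>" by (rule rapidly_decreasing_integrable[OF \<Phi>]) simp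
  have iW: "integrable ?H ?W" by (intro integrable_hyperplane_weight e) simp
  have ee: "e \<bullet> e = 1" using e by (simp add: dot_square_norm)
  note orth = AE_hyperplane_orthogonal[OF e]
  define u where "u = (\<lambda>w t. \<integral>v. cis (v \<bullet> w) * \<Phi> (v + t *\<^sub>R e) \<partial>?H)"
  have [measurable]: "(\<lambda>p. u (fst p) (snd p)) \<in> borel_measurable (borel \<Otimes>\<^sub>M borel)"
    unfolding u_def by measurable
  have [measurable]: "(\<lambda>p. u (snd p) (fst p)) \<in> borel_measurable (borel \<Otimes>\<^sub>M borel)"
    unfolding u_def by measurable
  have [measurable]: "(\<lambda>t. u w t) \<in> borel_measurable borel" for w
    unfolding u_def by measurable
  obtain C where C: "C \<ge> 0" "\<And>x. norm (\<Phi> x) \<le> C / (1 + norm x) ^ (4 + 2 * DIM('a))"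
    using rapidly_decreasingE[OF \<Phi>] by blast
  obtain D where D: "D \<ge> 0" "\<And>x. norm (\<Psi> x) \<le> D / (1 + norm x) ^ (2 + 4 * DIM('a))"
    using rapidly_decreasingE[OF \<Psi>] by blast
  have \<Phi>b: "norm (\<Phi> (v + t *\<^sub>R e)) \<le> C * (1 / (1 + \<bar>t\<bar>) ^ 4) * ?W v" if "v \<bullet> e = 0" for v t
    using C(2)[of "v + t *\<^sub>R e"] weight_slices_le[OF e that C(1), of t 4 "2 * DIM('a)"] by linarith
  have \<Psi>b: "norm (\<Psi> (w + \<tau> *\<^sub>R e)) \<le> D * (1 / (1 + \<bar>\<tau>\<bar>)\<^sup>2) * (1 / (1 + norm w) ^ (4 * DIM('a)))" if "w \<bullet> e = 0" for w \<tau>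
    using D(2)[of "w + \<tau> *\<^sub>R e"] weight_slices_le[OF e that D(1), of \<tau> 2 "4 * DIM('a)"] by linarith
  have i\<Phi>s: "integrable ?H (\<lambda>v. \<Phi> (v + t *\<^sub>R e))" for t
  proof (rule Bochner_Integration.integrable_bound)
    show "integrable ?H (\<lambda>v. C * (1 / (1 + \<bar>t\<bar>) ^ 4) * ?W v)" by (intro integrable_mult_right iW)
    show "AE v in ?H. norm (\<Phi> (v + t *\<^sub>R e)) \<le> norm (C * (1 / (1 + \<bar>t\<bar>) ^ 4) * ?W v)"
      using orth by eventually_elim (rule order_trans[OF \<Phi>b], assumption, simp only: real_norm_def abs_ge_self)
  qed simp
  define A where "A = (\<integral>v. ?W v \<partial>?H)"
  have A0: "A \<ge> 0" unfolding A_def by (intro Bochner_Integration.integral_nonneg) auto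
  \<comment> \<open>decay of the partial transform in \<open>t\<close>\<close>
  have ut: "norm (u w t) \<le> C * A * (1 / (1 + \<bar>t\<bar>) ^ 4)" for w t
  proof -
    have "norm (u w t) \<le> (\<integral>v. norm (cis (v \<bullet> w) * \<Phi> (v + t *\<^sub>R e)) \<partial>?H)"
      unfolding u_def by (rule integral_norm_bound)
    also have "\<dots> \<le> (\<integral>v. C * (1 / (1 + \<bar>t\<bar>) ^ 4) * ?W v \<partial>?H)"
    proof (rule integral_mono_AE)
      show "integrable ?H (\<lambda>v. norm (cis (v \<bullet> w) * \<Phi> (v + t *\<^sub>R e)))" by (intro integrable_norm integrable_cis_mult i\<Phi>s) simp
      show "integrable ?H (\<lambda>v. C * (1 / (1 + \<bar>t\<bar>) ^ 4) * ?W v)" by (intro integrable_mult_right iW)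
      show "AE v in ?H. norm (cis (v \<bullet> w) * \<Phi> (v + t *\<^sub>R e)) \<le> C * (1 / (1 + \<bar>t\<bar>) ^ 4) * ?W v"
        using orth by eventually_elim (simp only: norm_mult norm_cis mult_1 \<Phi>b)
    qed
    also have "\<dots> = C * (1 / (1 + \<bar>t\<bar>) ^ 4) * A"
      by (simp only: integral_mult_right_zero A_def)
    finally show ?thesis by (simp only: mult_ac)
  qed
  have ut2: "norm (u w t) \<le> C * A * (1 / (1 + \<bar>t\<bar>)\<^sup>2)" for w t
  proof -
    have "(1 + \<bar>t\<bar>)\<^sup>2 \<le> (1 + \<bar>t\<bar>) ^ 4" by (intro power_increasing) auto
    then have "1 / (1 + \<bar>t\<bar>) ^ 4 \<le> 1 / (1 + \<bar>t\<bar>)\<^sup>2" by (intro divide_left_mono mult_pos_pos zero_less_power) auto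
    then have "C * A * (1 / (1 + \<bar>t\<bar>) ^ 4) \<le> C * A * (1 / (1 + \<bar>t\<bar>)\<^sup>2)" using C A0 by (intro mult_left_mono) auto
    with ut[of w t] show ?thesis by linarith
  qed
  have iu: "integrable lborel (\<lambda>t. u w t)" for w
  proof (rule Bochner_Integration.integrable_bound)
    show "integrable lborel (\<lambda>t::real. C * A * (1 / (1 + \<bar>t\<bar>)\<^sup>2))"
      by (intro integrable_mult_right integrable_weight_real)
    show "AE t in lborel. norm (u w t) \<le> norm (C * A * (1 / (1 + \<bar>t\<bar>)\<^sup>2))"
      by (intro AE_I2 order_trans[OF ut2]) (simp only: real_norm_def abs_ge_self)
  qed simp
  have ucont: "continuous_on UNIV (\<lambda>t. u w t)" for w
    unfolding continuous_on_sequentially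
  proof (intro allI ballI impI, elim conjE)
    fix X :: "nat \<Rightarrow> real" and t assume X: "X \<longlonglongrightarrow> t"
    show "((\<lambda>t. u w t) \<circ> X) \<longlonglongrightarrow> u w t"
      unfolding u_def comp_def
    proof (rule integral_dominated_convergence)
      show "integrable ?H (\<lambda>v. C * ?W v)" by (intro integrable_mult_right iW)
      show "AE v in ?H. (\<lambda>i. cis (v \<bullet> w) * \<Phi> (v + X i *\<^sub>R e)) \<longlonglongrightarrow> cis (v \<bullet> w) * \<Phi> (v + t *\<^sub>R e)"
      proof (intro AE_I2 tendsto_mult_left)
        fix v
        have "(\<lambda>i. v + X i *\<^sub>R e) \<longlonglongrightarrow> v + t *\<^sub>R e" by (intro tendsto_intros X)
        then show "(\<lambda>i. \<Phi> (v + X i *\<^sub>R e)) \<longlonglongrightarrow> \<Phi> (v + t *\<^sub>R e)"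
          using cont by (intro isCont_tendsto_compose[of _ \<Phi>]) (auto simp: continuous_on_eq_continuous_at)
      qed
      show "AE v in ?H. norm (cis (v \<bullet> w) * \<Phi> (v + X i *\<^sub>R e)) \<le> C * ?W v" for i
        using orth
      proof eventually_elim
        case (elim v)
        have "C * (1 / (1 + \<bar>X i\<bar>) ^ 4) * ?W v \<le> C * 1 * ?W v"
          using C by (intro mult_right_mono mult_left_mono) auto
        then show ?case using \<Phi>b[OF elim, of "X i"] by (simp add: norm_mult)
      qed
    qed simp_all
  qed
  have U: "(\<integral>t. cis (\<tau> * t) * u w t \<partial>lborel) = \<Psi> (w + \<tau> *\<^sub>R e)" if w: "w \<bullet> e = 0" for w \<tau>
  proof -
    have "\<Psi> (w + \<tau> *\<^sub>R e) = (\<integral>t. (\<integral>v. cis ((v + t *\<^sub>R e) \<bullet> (w + \<tau> *\<^sub>R e)) * \<Phi> (v + t *\<^sub>R e) \<partial>?H) \<partial>lborel)"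
      unfolding \<Psi>_def by (rule integral_slices(1)[OF e]) (intro integrable_cis_mult i\<Phi>, simp)
    also have "\<dots> = (\<integral>t. cis (\<tau> * t) * u w t \<partial>lborel)"
    proof (rule Bochner_Integration.integral_cong[OF refl])
      fix t
      have "(\<integral>v. cis ((v + t *\<^sub>R e) \<bullet> (w + \<tau> *\<^sub>R e)) * \<Phi> (v + t *\<^sub>R e) \<partial>?H) =
        (\<integral>v. cis (\<tau> * t) * (cis (v \<bullet> w) * \<Phi> (v + t *\<^sub>R e)) \<partial>?H)"
      proof (rule integral_cong_AE)
        show "AE v in ?H. cis ((v + t *\<^sub>R e) \<bullet> (w + \<tau> *\<^sub>R e)) * \<Phi> (v + t *\<^sub>R e) = cis (\<tau> * t) * (cis (v \<bullet> w) * \<Phi> (v + t *\<^sub>R e))"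
          using orth
        proof eventually_elim
          case (elim v)
          have "(v + t *\<^sub>R e) \<bullet> (w + \<tau> *\<^sub>R e) = \<tau> * t + v \<bullet> w"
            using elim w ee by (simp add: inner_add_left inner_add_right inner_commute[of e w])
          then show ?case by (simp add: cis_mult[symmetric])
        qed
      qed simp_all
      then show "(\<integral>v. cis ((v + t *\<^sub>R e) \<bullet> (w + \<tau> *\<^sub>R e)) * \<Phi> (v + t *\<^sub>R e) \<partial>?H) = cis (\<tau> * t) * u w t"
        by (simp only: integral_mult_right_zero u_def)
    qed
    finally show ?thesis by simp
  qed
  have i\<Psi>s: "integrable lborel (\<lambda>\<tau>. \<Psi> (w + \<tau> *\<^sub>R e))" if w: "w \<bullet> e = 0" for w
  proof (rule Bochner_Integration.integrable_bound)
    show "integrable lborel (\<lambda>\<tau>::real. D * (1 / (1 + norm w) ^ (4 * DIM('a))) * (1 / (1 + \<bar>\<tau>\<bar>)\<^sup>2))"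
      by (intro integrable_mult_right integrable_weight_real)
    show "AE \<tau> in lborel. norm (\<Psi> (w + \<tau> *\<^sub>R e)) \<le> norm (D * (1 / (1 + norm w) ^ (4 * DIM('a))) * (1 / (1 + \<bar>\<tau>\<bar>)\<^sup>2))"
      by (intro AE_I2 order_trans[OF \<Psi>b[OF w]], unfold real_norm_def, rule order_trans[OF _ abs_ge_self]) (simp only: mult_ac order_refl)
  qed simp
  have inv: "(\<integral>\<tau>. cis (- (t * \<tau>)) * \<Psi> (w + \<tau> *\<^sub>R e) \<partial>lborel) = 2 * pi * u w t" if w: "w \<bullet> e = 0" for w t
  proof -
    have "norm (u w t) \<le> C * A" for t
    proof -
      have "C * A * (1 / (1 + \<bar>t\<bar>)\<^sup>2) \<le> C * A * 1" using C A0 by (intro mult_left_mono) auto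
      with ut2[of w t] show ?thesis by linarith
    qed
    from fourier_inversion_1D[OF ucont this iu, of t] show ?thesis
      unfolding U[OF w] using i\<Psi>s[OF w] by blast
  qed
  define T where "T = (\<integral>\<tau>. 1 / (1 + \<bar>\<tau>::real\<bar>)\<^sup>2 \<partial>lborel)"
  have T0: "T \<ge> 0" unfolding T_def by (intro Bochner_Integration.integral_nonneg) auto
  \<comment> \<open>decay of the partial transform in \<open>w\<close>, by inverting the remaining one-dimensional transform\<close>
  have uw: "norm (u w t) \<le> D * T * (1 / (1 + norm w) ^ (4 * DIM('a)))" if w: "w \<bullet> e = 0" for w t
  proof -
    have "2 * pi * norm (u w t) = norm (2 * pi * u w t)" by (simp add: norm_mult)
    also have "\<dots> \<le> (\<integral>\<tau>. norm (cis (- (t * \<tau>)) * \<Psi> (w + \<tau> *\<^sub>R e)) \<partial>lborel)"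
      unfolding inv[OF w, symmetric] by (rule integral_norm_bound)
    also have "\<dots> \<le> (\<integral>\<tau>. D * (1 / (1 + norm w) ^ (4 * DIM('a))) * (1 / (1 + \<bar>\<tau>\<bar>)\<^sup>2) \<partial>lborel)"
    proof (rule integral_mono)
      show "integrable lborel (\<lambda>\<tau>. norm (cis (- (t * \<tau>)) * \<Psi> (w + \<tau> *\<^sub>R e)))"
        by (intro integrable_norm integrable_cis_mult i\<Psi>s w) simp
      show "integrable lborel (\<lambda>\<tau>::real. D * (1 / (1 + norm w) ^ (4 * DIM('a))) * (1 / (1 + \<bar>\<tau>\<bar>)\<^sup>2))"
        by (intro integrable_mult_right integrable_weight_real)
      show "norm (cis (- (t * \<tau>)) * \<Psi> (w + \<tau> *\<^sub>R e)) \<le> D * (1 / (1 + norm w) ^ (4 * DIM('a))) * (1 / (1 + \<bar>\<tau>\<bar>)\<^sup>2)" for \<tau>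
        using \<Psi>b[OF w, of \<tau>] by (simp add: norm_mult mult_ac)
    qed
    also have "\<dots> = D * (1 / (1 + norm w) ^ (4 * DIM('a))) * T"
      by (simp only: integral_mult_right_zero T_def)
    finally have le: "2 * pi * norm (u w t) \<le> D * T * (1 / (1 + norm w) ^ (4 * DIM('a)))" by (simp only: mult_ac)
    have "1 * norm (u w t) \<le> 2 * pi * norm (u w t)" using pi_ge_two by (intro mult_right_mono) auto
    with le show ?thesis by linarith
  qed
  have nz: "AE w in ?H. norm w \<noteq> 0" and ns: "AE w in ?H. norm w \<noteq> s"
    by (rule AE_hyperplane_norm_neq[OF e]; use n s in simp)+
  define E where "E = 4 / s * sqrt 2 * (sqrt (C * A) * sqrt (D * T))"
  have E0: "E \<ge> 0" using s C D A0 T0 by (simp add: E_def)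
  \<comment> \<open>the geometric mean of the two decay estimates separates the variables, and
    \<open>exp_le_powr\<close> does the same for the kernel\<close>
  have iKu: "integrable (?H \<Otimes>\<^sub>M lborel) (\<lambda>(w, t). of_real (faddeev_kernel s t (norm w)) * u w t)"
  proof (rule P.integrable_pair_product_bound_AE)
    show "integrable ?H (\<lambda>w::'a. E * (\<bar>norm w - s\<bar> powr (- (1 / 2)) / (1 + norm w) ^ (2 * DIM('a))))"
      using s by (intro integrable_mult_right integrable_hyperplane_singular_sphere e) auto
    show "integrable lborel (\<lambda>t::real. \<bar>t\<bar> powr (- 1 / 2) * (1 / (1 + \<bar>t\<bar>)\<^sup>2))"
      by (rule integrable_singular_weight_real)
    show "AE w in ?H. AE t in lborel. norm (case (w, t) of (w, t) \<Rightarrow> of_real (faddeev_kernel s t (norm w)) * u w t)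
       \<le> E * (\<bar>norm w - s\<bar> powr (- (1 / 2)) / (1 + norm w) ^ (2 * DIM('a))) * (\<bar>t\<bar> powr (- 1 / 2) * (1 / (1 + \<bar>t\<bar>)\<^sup>2))"
      using orth ns
    proof eventually_elim
      case w: (elim w)
      show ?case using AE_lborel_singleton[of "0::real"]
      proof eventually_elim
        case t: (elim t)
        have "\<bar>faddeev_kernel s t (norm w)\<bar> \<le> 4 / s * exp (- (\<bar>t\<bar> * \<bar>norm w - s\<bar> / 2))"
          using faddeev_kernel_bound[OF s, of "norm w" t] by simp
        also have "exp (- (\<bar>t\<bar> * \<bar>norm w - s\<bar> / 2)) \<le> (\<bar>t\<bar> * \<bar>norm w - s\<bar> / 2) powr (- (1 / 2))"
          using w t by (intro exp_le_powr) auto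
        also have "(\<bar>t\<bar> * \<bar>norm w - s\<bar> / 2) powr (- (1 / 2)) = sqrt 2 * (\<bar>t\<bar> powr (- 1 / 2) * \<bar>norm w - s\<bar> powr (- (1 / 2)))"
          using w t by (simp add: powr_minus_divide powr_half_sqrt real_sqrt_mult real_sqrt_divide)
        finally have K: "\<bar>faddeev_kernel s t (norm w)\<bar> \<le> 4 / s * (sqrt 2 * (\<bar>t\<bar> powr (- 1 / 2) * \<bar>norm w - s\<bar> powr (- (1 / 2))))"
          using s by (simp add: mult_left_mono divide_right_mono)
        have "norm (u w t) \<le> sqrt (C * A * (1 / (1 + \<bar>t\<bar>) ^ 4)) * sqrt (D * T * (1 / (1 + norm w) ^ (4 * DIM('a))))"
          using C D A0 T0 by (intro norm_le_geometric_mean ut uw w) auto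
        also have "sqrt (C * A * (1 / (1 + \<bar>t\<bar>) ^ 4)) = sqrt (C * A) * (1 / (1 + \<bar>t\<bar>)\<^sup>2)"
        proof -
          have "sqrt ((1 + \<bar>t\<bar>) ^ 4) = (1 + \<bar>t\<bar>)\<^sup>2"
            using real_sqrt_abs[of "(1 + \<bar>t\<bar>)\<^sup>2"] by (simp add: power_mult[symmetric])
          then show ?thesis by (simp add: real_sqrt_mult real_sqrt_divide)
        qed
        also have "sqrt (D * T * (1 / (1 + norm w) ^ (4 * DIM('a)))) = sqrt (D * T) * (1 / (1 + norm w) ^ (2 * DIM('a)))"
        proof -
          have "sqrt ((1 + norm w) ^ (4 * DIM('a))) = (1 + norm w) ^ (2 * DIM('a))"
            using real_sqrt_abs[of "(1 + norm w) ^ (2 * DIM('a))"] by (simp add: power_mult[symmetric] mult.commute)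
          then show ?thesis by (simp add: real_sqrt_mult real_sqrt_divide)
        qed
        finally have u: "norm (u w t) \<le> sqrt (C * A) * (1 / (1 + \<bar>t\<bar>)\<^sup>2) * (sqrt (D * T) * (1 / (1 + norm w) ^ (2 * DIM('a))))" .
        have "\<bar>faddeev_kernel s t (norm w)\<bar> * norm (u w t) \<le>
          4 / s * (sqrt 2 * (\<bar>t\<bar> powr (- 1 / 2) * \<bar>norm w - s\<bar> powr (- (1 / 2)))) *
          (sqrt (C * A) * (1 / (1 + \<bar>t\<bar>)\<^sup>2) * (sqrt (D * T) * (1 / (1 + norm w) ^ (2 * DIM('a)))))"
          using s by (intro mult_mono K u) auto
        then show ?case by (simp add: norm_mult E_def mult_ac)
      qed
    qed
  qed (use E0 in simp_all)
  have slice: "(\<integral>\<tau>. \<Psi> (w + \<tau> *\<^sub>R e) / faddeev_symbol s e (w + \<tau> *\<^sub>R e) \<partial>lborel) =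
      2 * pi * (\<integral>t. of_real (faddeev_kernel s t (norm w)) * u w t \<partial>lborel)"
    if w: "w \<bullet> e = 0" and w0: "norm w \<noteq> 0" and ws: "norm w \<noteq> s" for w
  proof -
    have w1: "norm w > 0" using w0 by simp
    note K = faddeev_kernel_fourier[OF s w1 ws]
    have int: "integrable (lborel \<Otimes>\<^sub>M lborel) (\<lambda>(\<tau>, t). \<Psi> (w + \<tau> *\<^sub>R e) * (cis (- (t * \<tau>)) * of_real (faddeev_kernel s t (norm w))))"
      by (rule lborel_pair.integrable_pair_product_bound[where a="\<lambda>\<tau>. norm (\<Psi> (w + \<tau> *\<^sub>R e))" and b="\<lambda>t. \<bar>faddeev_kernel s t (norm w)\<bar>"])
         (use i\<Psi>s[OF w] K(1) in \<open>auto simp: norm_mult\<close>)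
    have "(\<integral>\<tau>. \<Psi> (w + \<tau> *\<^sub>R e) / faddeev_symbol s e (w + \<tau> *\<^sub>R e) \<partial>lborel) =
      (\<integral>\<tau>. (\<integral>t. \<Psi> (w + \<tau> *\<^sub>R e) * (cis (- (t * \<tau>)) * of_real (faddeev_kernel s t (norm w))) \<partial>lborel) \<partial>lborel)"
      unfolding faddeev_symbol_slice[OF e w] by (simp only: integral_mult_right_zero K(2)) simp
    also have "\<dots> = (\<integral>t. (\<integral>\<tau>. \<Psi> (w + \<tau> *\<^sub>R e) * (cis (- (t * \<tau>)) * of_real (faddeev_kernel s t (norm w))) \<partial>lborel) \<partial>lborel)"
      by (rule lborel_pair.Fubini_integral[OF int, symmetric])
    also have "\<dots> = (\<integral>t. of_real (faddeev_kernel s t (norm w)) * (\<integral>\<tau>. cis (- (t * \<tau>)) * \<Psi> (w + \<tau> *\<^sub>R e) \<partial>lborel) \<partial>lborel)"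
      unfolding integral_mult_right_zero[symmetric] by (simp only: mult_ac)
    also have "\<dots> = (\<integral>t. 2 * pi * (of_real (faddeev_kernel s t (norm w)) * u w t) \<partial>lborel)"
      unfolding inv[OF w] by (simp only: mult_ac)
    finally show ?thesis by (simp only: integral_mult_right_zero)
  qed
  have hslice: "(\<integral>w. of_real (faddeev_kernel s t (norm w)) * u w t \<partial>?H) =
      (2 * pi) ^ (DIM('a) - 1) * (\<integral>v. faddeev_h s e (v + t *\<^sub>R e) * \<Phi> (v + t *\<^sub>R e) \<partial>?H)"
    if t: "t \<noteq> 0" for t
  proof -
    note K = integrable_faddeev_kernel[OF e s t]
    let ?F = "\<lambda>w v. of_real (faddeev_kernel s t (norm w)) * (cis (v \<bullet> w) * \<Phi> (v + t *\<^sub>R e))"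
    have int: "integrable (?H \<Otimes>\<^sub>M ?H) (\<lambda>(w, v). ?F w v)"
      by (rule HH.integrable_pair_product_bound[where a="\<lambda>w. \<bar>faddeev_kernel s t (norm w)\<bar>" and b="\<lambda>v. norm (\<Phi> (v + t *\<^sub>R e))"])
         (use K i\<Phi>s in \<open>auto simp: norm_mult\<close>)
    have "(\<integral>w. of_real (faddeev_kernel s t (norm w)) * u w t \<partial>?H) = (\<integral>w. (\<integral>v. ?F w v \<partial>?H) \<partial>?H)"
      by (simp only: u_def integral_mult_right_zero)
    also have "\<dots> = (\<integral>v. (\<integral>w. ?F w v \<partial>?H) \<partial>?H)"
      by (rule HH.Fubini_integral[OF int, symmetric])
    also have "\<dots> = (\<integral>v. (2 * pi) ^ (DIM('a) - 1) * (faddeev_h s e (v + t *\<^sub>R e) * \<Phi> (v + t *\<^sub>R e)) \<partial>?H)"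
    proof (rule integral_cong_AE)
      show "AE v in ?H. (\<integral>w. ?F w v \<partial>?H) = (2 * pi) ^ (DIM('a) - 1) * (faddeev_h s e (v + t *\<^sub>R e) * \<Phi> (v + t *\<^sub>R e))"
        using orth
      proof eventually_elim
        case (elim v)
        have te: "(v + t *\<^sub>R e) \<bullet> e = t" using elim ee by (simp add: inner_add_left)
        have "(\<integral>w. cis ((v + t *\<^sub>R e) \<bullet> w) * of_real (faddeev_kernel s ((v + t *\<^sub>R e) \<bullet> e) (norm w)) \<partial>?H) =
           (\<integral>w. of_real (faddeev_kernel s t (norm w)) * cis (v \<bullet> w) \<partial>?H)"
          unfolding te
        proof (rule integral_cong_AE)
          show "AE w in ?H. cis ((v + t *\<^sub>R e) \<bullet> w) * of_real (faddeev_kernel s t (norm w)) = of_real (faddeev_kernel s t (norm w)) * cis (v \<bullet> w)"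
            using orth by eventually_elim (simp add: inner_add_left inner_commute[of e] mult.commute)
        qed simp_all
        then have h: "(2 * pi) ^ (DIM('a) - 1) * faddeev_h s e (v + t *\<^sub>R e) = (\<integral>w. of_real (faddeev_kernel s t (norm w)) * cis (v \<bullet> w) \<partial>?H)"
          unfolding faddeev_h_def by simp
        have "(\<integral>w. ?F w v \<partial>?H) = (\<integral>w. (of_real (faddeev_kernel s t (norm w)) * cis (v \<bullet> w)) * \<Phi> (v + t *\<^sub>R e) \<partial>?H)"
          by (simp only: mult.assoc)
        also have "\<dots> = (\<integral>w. of_real (faddeev_kernel s t (norm w)) * cis (v \<bullet> w) \<partial>?H) * \<Phi> (v + t *\<^sub>R e)"
          by (rule integral_mult_left_zero)
        finally show ?case unfolding h[symmetric] by (simp only: mult.assoc)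
      qed
    qed simp_all
    finally show ?thesis by (simp only: integral_mult_right_zero)
  qed
  have bdd: "norm (\<Phi> x) \<le> C" for x
  proof -
    have "C / (1 + norm x) ^ (4 + 2 * DIM('a)) \<le> C / 1"
      using C by (intro divide_left_mono one_le_power) (auto intro!: zero_less_power add_pos_nonneg)
    then show ?thesis using C(2)[of x] by simp
  qed
  have "(\<integral>\<eta>. \<Psi> \<eta> / faddeev_symbol s e \<eta> \<partial>lborel) =
    (\<integral>w. (\<integral>\<tau>. \<Psi> (w + \<tau> *\<^sub>R e) / faddeev_symbol s e (w + \<tau> *\<^sub>R e) \<partial>lborel) \<partial>?H)"
    using n by (intro integral_slices(2)[OF e] integrable_div_faddeev_symbol e s \<Psi>) auto
  also have "\<dots> = (\<integral>w. 2 * pi * (\<integral>t. of_real (faddeev_kernel s t (norm w)) * u w t \<partial>lborel) \<partial>?H)"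
  proof (rule integral_cong_AE)
    show "AE w in ?H. (\<integral>\<tau>. \<Psi> (w + \<tau> *\<^sub>R e) / faddeev_symbol s e (w + \<tau> *\<^sub>R e) \<partial>lborel) =
      2 * pi * (\<integral>t. of_real (faddeev_kernel s t (norm w)) * u w t \<partial>lborel)"
      using orth nz ns by eventually_elim (rule slice)
  qed simp_all
  also have "\<dots> = 2 * pi * (\<integral>w. (\<integral>t. of_real (faddeev_kernel s t (norm w)) * u w t \<partial>lborel) \<partial>?H)"
    by (simp only: integral_mult_right_zero)
  also have "(\<integral>w. (\<integral>t. of_real (faddeev_kernel s t (norm w)) * u w t \<partial>lborel) \<partial>?H) =
    (\<integral>t. (\<integral>w. of_real (faddeev_kernel s t (norm w)) * u w t \<partial>?H) \<partial>lborel)"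
    by (rule P.Fubini_integral[OF iKu, symmetric])
  also have "\<dots> = (\<integral>t. (2 * pi) ^ (DIM('a) - 1) * (\<integral>v. faddeev_h s e (v + t *\<^sub>R e) * \<Phi> (v + t *\<^sub>R e) \<partial>?H) \<partial>lborel)"
  proof (rule integral_cong_AE)
    show "AE t in lborel. (\<integral>w. of_real (faddeev_kernel s t (norm w)) * u w t \<partial>?H) =
      (2 * pi) ^ (DIM('a) - 1) * (\<integral>v. faddeev_h s e (v + t *\<^sub>R e) * \<Phi> (v + t *\<^sub>R e) \<partial>?H)"
      using AE_lborel_singleton[of "0::real"] by eventually_elim (rule hslice)
  qed simp_all
  also have "\<dots> = (2 * pi) ^ (DIM('a) - 1) * (\<integral>t. (\<integral>v. faddeev_h s e (v + t *\<^sub>R e) * \<Phi> (v + t *\<^sub>R e) \<partial>?H) \<partial>lborel)"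
    by (simp only: integral_mult_right_zero)
  also have "(\<integral>t. (\<integral>v. faddeev_h s e (v + t *\<^sub>R e) * \<Phi> (v + t *\<^sub>R e) \<partial>?H) \<partial>lborel) = (\<integral>x. faddeev_h s e x * \<Phi> x \<partial>lborel)"
    by (rule integral_slices(1)[OF e integrable_faddeev_h_mult[OF e n s i\<Phi> bdd], symmetric])
  finally have fin: "(\<integral>\<eta>. \<Psi> \<eta> / faddeev_symbol s e \<eta> \<partial>lborel) =
    complex_of_real (2 * pi) * (complex_of_real ((2 * pi) ^ (DIM('a) - 1)) * (\<integral>x. faddeev_h s e x * \<Phi> x \<partial>lborel))" by simp
  have "(2 * pi) ^ DIM('a) = 2 * pi * (2 * pi) ^ (DIM('a) - 1)" using n by (cases "DIM('a)") auto
  then show ?thesis unfolding fin by simp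
qed

section \<open>Convolution with the Green function\<close>

lemma measurable_cball [measurable]: "cball (a::'a::metric_space) r \<in> sets borel"
  by (intro borel_closed closed_cball)

lemma nn_integral_square_le:
  fixes g :: "'b \<Rightarrow> ennreal"
  assumes [measurable]: "g \<in> borel_measurable M" "B \<in> sets M" and g: "\<And>x. x \<in> space M \<Longrightarrow> x \<notin> B \<Longrightarrow> g x = 0"
  shows "(\<integral>\<^sup>+x. g x \<partial>M)\<^sup>2 \<le> emeasure M B * (\<integral>\<^sup>+x. (g x)\<^sup>2 \<partial>M)"
proof -
  have "(\<integral>\<^sup>+x. g x \<partial>M) = (\<integral>\<^sup>+x. indicator B x * g x \<partial>M)"
    using g by (intro nn_integral_cong) (auto simp: indicator_def)
  moreover have "(\<integral>\<^sup>+x. indicator B x * g x \<partial>M)\<^sup>2 \<le> (\<integral>\<^sup>+x. (indicator B x)\<^sup>2 \<partial>M) * (\<integral>\<^sup>+x. (g x)\<^sup>2 \<partial>M)"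
    by (rule Cauchy_Schwarz_nn_integral) simp_all
  moreover have "(\<integral>\<^sup>+x. (indicator B x)\<^sup>2 \<partial>M) = (\<integral>\<^sup>+x. indicator B x \<partial>M)"
    by (rule nn_integral_cong) (simp add: indicator_def)
  ultimately show ?thesis by simp
qed

lemma norm_integral_le_nn_integral:
  fixes f :: "'b \<Rightarrow> complex"
  shows "ennreal (norm (\<integral>x. f x \<partial>M)) \<le> (\<integral>\<^sup>+x. ennreal (norm (f x)) \<partial>M)"
proof (cases "integrable M f")
  case True
  then show ?thesis by (rule integral_norm_bound_ennreal)
next
  case False
  then show ?thesis by (simp add: not_integrable_integral_eq)
qed

lemma AE_integrable_convolution:
  fixes h f :: "'a::euclidean_space \<Rightarrow> complex"
  assumes h: "h \<in> borel_measurable borel" and loc: "\<And>M. integrable lborel (\<lambda>x. indicator (cball 0 M) x *\<^sub>R h x)"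
    and f: "integrable lborel f" and supp: "\<And>y. norm y > L \<Longrightarrow> f y = 0"
  shows "AE x in lborel. integrable lborel (\<lambda>y. h (x - y) * f y)"
proof -
  have [measurable]: "h \<in> borel_measurable borel" "f \<in> borel_measurable borel" using h f by auto
  have fin: "(\<integral>\<^sup>+x. indicator (cball 0 M) x * (\<integral>\<^sup>+y. ennreal (norm (h (x - y) * f y)) \<partial>lborel) \<partial>lborel) < \<infinity>" for M
  proof -
    define K where "K = (\<integral>\<^sup>+z. ennreal (norm (indicator (cball 0 (M + L)) z *\<^sub>R h z)) \<partial>lborel)"
    have K: "K < \<infinity>" using loc[of "M + L"] by (simp add: K_def integrable_iff_bounded)
    have "(\<integral>\<^sup>+x. indicator (cball 0 M) x * (\<integral>\<^sup>+y. ennreal (norm (h (x - y) * f y)) \<partial>lborel) \<partial>lborel) =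
      (\<integral>\<^sup>+x. (\<integral>\<^sup>+y. indicator (cball 0 M) x * ennreal (norm (h (x - y) * f y)) \<partial>lborel) \<partial>lborel)"
      by (intro nn_integral_cong nn_integral_cmult[symmetric]) simp
    also have "\<dots> = (\<integral>\<^sup>+y. (\<integral>\<^sup>+x. indicator (cball 0 M) x * ennreal (norm (h (x - y) * f y)) \<partial>lborel) \<partial>lborel)"
      by (rule lborel_pair.Fubini') simp
    also have "\<dots> \<le> (\<integral>\<^sup>+y. K * ennreal (norm (f y)) \<partial>lborel)"
    proof (rule nn_integral_mono)
      fix y :: 'a
      show "(\<integral>\<^sup>+x. indicator (cball 0 M) x * ennreal (norm (h (x - y) * f y)) \<partial>lborel) \<le> K * ennreal (norm (f y))"
      proof (cases "norm y \<le> L")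
        case True
        have "(\<integral>\<^sup>+x. indicator (cball 0 M) x * ennreal (norm (h (x - y) * f y)) \<partial>lborel) \<le>
          (\<integral>\<^sup>+x. ennreal (norm (indicator (cball 0 (M + L)) (x + (- y)) *\<^sub>R h (x + (- y)))) * ennreal (norm (f y)) \<partial>lborel)"
        proof (rule nn_integral_mono)
          fix x :: 'a
          show "indicator (cball 0 M) x * ennreal (norm (h (x - y) * f y)) \<le>
            ennreal (norm (indicator (cball 0 (M + L)) (x + (- y)) *\<^sub>R h (x + (- y)))) * ennreal (norm (f y))"
          proof (cases "norm x \<le> M")
            case x: True
            then have "norm (x - y) \<le> M + L" using True norm_triangle_ineq4[of x y] by linarith
            then show ?thesis using x by (simp add: norm_mult ennreal_mult)
          qed simp
        qed
        also have "\<dots> = (\<integral>\<^sup>+x. ennreal (norm (indicator (cball 0 (M + L)) (x + (- y)) *\<^sub>R h (x + (- y)))) \<partial>lborel) * ennreal (norm (f y))"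
          by (rule nn_integral_multc) simp
        also have "(\<integral>\<^sup>+x. ennreal (norm (indicator (cball 0 (M + L)) (x + (- y)) *\<^sub>R h (x + (- y)))) \<partial>lborel) = K"
          unfolding K_def by (rule nn_integral_lborel_translate) simp
        finally show ?thesis .
      next
        case False
        then show ?thesis using supp[of y] by simp
      qed
    qed
    also have "\<dots> = K * (\<integral>\<^sup>+y. ennreal (norm (f y)) \<partial>lborel)"
      by (rule nn_integral_cmult) simp
    also have "\<dots> < \<infinity>"
      using K f by (simp add: ennreal_mult_less_top integrable_iff_bounded)
    finally show ?thesis .
  qed
  have "AE x in lborel. \<forall>k::nat. indicator (cball 0 (real k)) x * (\<integral>\<^sup>+y. ennreal (norm (h (x - y) * f y)) \<partial>lborel) \<noteq> \<infinity>"
    unfolding AE_all_countable using fin by (intro allI nn_integral_PInf_AE) (auto simp: less_top[symmetric])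
  then show "AE x in lborel. integrable lborel (\<lambda>y. h (x - y) * f y)"
  proof eventually_elim
    case (elim x)
    obtain k :: nat where "norm x \<le> real k" using real_arch_simple by blast
    then show ?case using elim[rule_format, of k]
      by (intro integrableI_bounded) (auto simp: less_top)
  qed
qed

lemma AE_slices:
  fixes e :: "'a::euclidean_space"
  assumes e: "norm e = 1" and [measurable]: "Measurable.pred borel P" and P: "AE x in lborel. P x"
  shows "AE t in lborel. AE w in hyperplane_measure e. P (w + t *\<^sub>R e)"
proof -
  interpret H: sigma_finite_measure "hyperplane_measure e" by (rule sigma_finite_hyperplane[OF e])
  have "(\<integral>\<^sup>+x. indicator {x. \<not> P x} x \<partial>lborel) = (0::ennreal)"
    using P by (subst nn_integral_0_iff_AE) (auto elim!: eventually_mono)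
  then have "(\<integral>\<^sup>+t. (\<integral>\<^sup>+w. indicator {x. \<not> P x} (w + t *\<^sub>R e) \<partial>hyperplane_measure e) \<partial>lborel) = (0::ennreal)"
    by (subst nn_integral_slices[OF e, symmetric]) simp_all
  then have "AE t in lborel. (\<integral>\<^sup>+w. indicator {x. \<not> P x} (w + t *\<^sub>R e) \<partial>hyperplane_measure e) = (0::ennreal)"
    by (subst (asm) nn_integral_0_iff_AE) simp_all
  then show ?thesis
  proof eventually_elim
    case (elim t)
    then have "AE w in hyperplane_measure e. indicator {x. \<not> P x} (w + t *\<^sub>R e) = (0::ennreal)"
      by (subst (asm) nn_integral_0_iff_AE) simp_all
    then show ?case by (auto elim!: eventually_mono simp: indicator_def split: if_splits)
  qed
qed

text \<open>
  On the hyperplane, convolution with the slice of \<open>faddeev_h\<close> at height \<open>t\<close> multiplies the Fourier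
  transform by \<open>faddeev_kernel s t\<close>; the Plancherel inequality bounds the result.
\<close>

lemma faddeev_convolution_slice:
  fixes e :: "'a::euclidean_space" and \<phi> :: "'a \<Rightarrow> complex"
  assumes e: "norm e = 1" and s: "s > 0" and t: "t \<noteq> 0" and \<phi>: "integrable (hyperplane_measure e) \<phi>"
  shows "(\<integral>\<^sup>+w. ennreal ((norm (\<integral>v. faddeev_h s e (w - v + t *\<^sub>R e) * \<phi> v \<partial>hyperplane_measure e))\<^sup>2) \<partial>hyperplane_measure e)
    \<le> ennreal (1 / (2 * pi) ^ (DIM('a) - 1)) * (\<integral>\<^sup>+\<eta>. ennreal ((faddeev_kernel s t (norm \<eta>))\<^sup>2 *
      (norm (\<integral>v. cis (- (v \<bullet> \<eta>)) * \<phi> v \<partial>hyperplane_measure e))\<^sup>2) \<partial>hyperplane_measure e)"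
proof -
  let ?H = "hyperplane_measure e"
  interpret H: sigma_finite_measure ?H by (rule sigma_finite_hyperplane[OF e])
  interpret HH: pair_sigma_finite ?H ?H ..
  define c where "c = 1 / (2 * pi) ^ (DIM('a) - 1)"
  have c0: "c > 0" by (simp add: c_def)
  have ee: "e \<bullet> e = 1" using e by (simp add: dot_square_norm)
  note orth = AE_hyperplane_orthogonal[OF e]
  have [measurable]: "\<phi> \<in> borel_measurable borel" using \<phi> by auto
  have [measurable]: "faddeev_h s e \<in> borel_measurable borel" by (rule measurable_faddeev_h[OF e])
  let ?K = "\<lambda>\<eta>::'a. complex_of_real (faddeev_kernel s t (norm \<eta>))"
  have iK: "integrable ?H ?K" by (intro integrable_of_real integrable_faddeev_kernel e s t)
  define F where "F = (\<lambda>\<eta>. \<integral>v. cis (- (v \<bullet> \<eta>)) * \<phi> v \<partial>?H)"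
  have [measurable]: "F \<in> borel_measurable borel" unfolding F_def by measurable
  have Fb: "norm (F \<eta>) \<le> (\<integral>v. norm (\<phi> v) \<partial>?H)" for \<eta>
    unfolding F_def using integral_norm_bound[of ?H "\<lambda>v. cis (- (v \<bullet> \<eta>)) * \<phi> v"] by (simp add: norm_mult)
  have iKF: "integrable ?H (\<lambda>\<eta>. F \<eta> * ?K \<eta>)"
    by (rule integrable_mult_bounded[OF iK _ Fb]) simp
  have A: "AE w in ?H. (\<integral>v. faddeev_h s e (w - v + t *\<^sub>R e) * \<phi> v \<partial>?H) =
      of_real c * (\<integral>\<eta>. cis (\<eta> \<bullet> w) * (F \<eta> * ?K \<eta>) \<partial>?H)"
    using orth
  proof eventually_elim
    case w: (elim w)
    let ?G = "\<lambda>v \<eta>. (cis (w \<bullet> \<eta>) * cis (- (v \<bullet> \<eta>)) * ?K \<eta>) * \<phi> v"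
    have int: "integrable (?H \<Otimes>\<^sub>M ?H) (\<lambda>(v, \<eta>). ?G v \<eta>)"
      by (rule HH.integrable_pair_product_bound[where a="\<lambda>v. norm (\<phi> v)" and b="\<lambda>\<eta>. norm (?K \<eta>)"])
         (use integrable_norm[OF \<phi>] integrable_norm[OF iK] in \<open>auto simp: norm_mult\<close>)
    have "(\<integral>v. faddeev_h s e (w - v + t *\<^sub>R e) * \<phi> v \<partial>?H) = (\<integral>v. of_real c * (\<integral>\<eta>. ?G v \<eta> \<partial>?H) \<partial>?H)"
    proof (rule integral_cong_AE)
      show "AE v in ?H. faddeev_h s e (w - v + t *\<^sub>R e) * \<phi> v = of_real c * (\<integral>\<eta>. ?G v \<eta> \<partial>?H)"
        using orth
      proof eventually_elim
        case v: (elim v)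
        have te: "(w - v + t *\<^sub>R e) \<bullet> e = t" using v w ee by (simp add: inner_add_left inner_diff_left)
        have "(\<integral>\<eta>. cis ((w - v + t *\<^sub>R e) \<bullet> \<eta>) * ?K \<eta> \<partial>?H) = (\<integral>\<eta>. cis (w \<bullet> \<eta>) * cis (- (v \<bullet> \<eta>)) * ?K \<eta> \<partial>?H)"
        proof (rule integral_cong_AE)
          show "AE \<eta> in ?H. cis ((w - v + t *\<^sub>R e) \<bullet> \<eta>) * ?K \<eta> = cis (w \<bullet> \<eta>) * cis (- (v \<bullet> \<eta>)) * ?K \<eta>"
            using orth
          proof eventually_elim
            case (elim \<eta>)
            then have "(w - v + t *\<^sub>R e) \<bullet> \<eta> = w \<bullet> \<eta> + - (v \<bullet> \<eta>)"
              by (simp add: inner_add_left inner_diff_left inner_commute[of e])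
            then show ?case by (simp only: cis_mult)
          qed
        qed simp_all
        then have h: "faddeev_h s e (w - v + t *\<^sub>R e) = of_real c * (\<integral>\<eta>. cis (w \<bullet> \<eta>) * cis (- (v \<bullet> \<eta>)) * ?K \<eta> \<partial>?H)"
          unfolding faddeev_h_def te c_def by simp
        show ?case unfolding h integral_mult_left_zero by (rule mult.assoc)
      qed
    qed simp_all
    also have "\<dots> = of_real c * (\<integral>v. (\<integral>\<eta>. ?G v \<eta> \<partial>?H) \<partial>?H)" by (simp only: integral_mult_right_zero)
    also have "(\<integral>v. (\<integral>\<eta>. ?G v \<eta> \<partial>?H) \<partial>?H) = (\<integral>\<eta>. (\<integral>v. ?G v \<eta> \<partial>?H) \<partial>?H)"
      by (rule HH.Fubini_integral[OF int, symmetric])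
    also have "\<dots> = (\<integral>\<eta>. cis (\<eta> \<bullet> w) * (F \<eta> * ?K \<eta>) \<partial>?H)"
    proof (rule Bochner_Integration.integral_cong[OF refl])
      fix \<eta>
      have "(\<integral>v. ?G v \<eta> \<partial>?H) = (\<integral>v. (cis (w \<bullet> \<eta>) * ?K \<eta>) * (cis (- (v \<bullet> \<eta>)) * \<phi> v) \<partial>?H)"
        by (simp only: mult_ac)
      also have "\<dots> = (cis (w \<bullet> \<eta>) * ?K \<eta>) * F \<eta>" unfolding F_def by (rule integral_mult_right_zero)
      finally show "(\<integral>v. ?G v \<eta> \<partial>?H) = cis (\<eta> \<bullet> w) * (F \<eta> * ?K \<eta>)"
        by (simp only: mult_ac inner_commute)
    qed
    finally show ?case .
  qed
  have "(\<integral>\<^sup>+w. ennreal ((norm (\<integral>v. faddeev_h s e (w - v + t *\<^sub>R e) * \<phi> v \<partial>?H))\<^sup>2) \<partial>?H) =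
    (\<integral>\<^sup>+w. ennreal (c\<^sup>2) * ennreal ((norm (\<integral>\<eta>. cis (\<eta> \<bullet> w) * (F \<eta> * ?K \<eta>) \<partial>?H))\<^sup>2) \<partial>?H)"
  proof (rule nn_integral_cong_AE, use A in eventually_elim)
    case (elim w)
    show ?case unfolding elim norm_mult power_mult_distrib using c0 by (simp add: ennreal_mult)
  qed
  also have "\<dots> = ennreal (c\<^sup>2) * (\<integral>\<^sup>+w. ennreal ((norm (\<integral>\<eta>. cis (\<eta> \<bullet> w) * (F \<eta> * ?K \<eta>) \<partial>?H))\<^sup>2) \<partial>?H)"
    by (rule nn_integral_cmult) simp
  also have "\<dots> \<le> ennreal (c\<^sup>2) * (ennreal ((2 * pi) ^ (DIM('a) - 1)) * (\<integral>\<^sup>+\<eta>. ennreal ((norm (F \<eta> * ?K \<eta>))\<^sup>2) \<partial>?H))"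
    by (intro mult_left_mono plancherel_inequality_hyperplane e iKF) simp
  also have "\<dots> = ennreal (c\<^sup>2 * (2 * pi) ^ (DIM('a) - 1)) * (\<integral>\<^sup>+\<eta>. ennreal ((norm (F \<eta> * ?K \<eta>))\<^sup>2) \<partial>?H)"
    by (simp only: mult.assoc[symmetric]) (subst ennreal_mult, auto)
  also have "c\<^sup>2 * (2 * pi) ^ (DIM('a) - 1) = c"
    unfolding c_def by (simp add: power2_eq_square)
  also have "(\<lambda>\<eta>. ennreal ((norm (F \<eta> * ?K \<eta>))\<^sup>2)) = (\<lambda>\<eta>. ennreal ((faddeev_kernel s t (norm \<eta>))\<^sup>2 * (norm (F \<eta>))\<^sup>2))"
    by (simp add: norm_mult power_mult_distrib mult.commute)
  finally show ?thesis unfolding F_def c_def .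
qed

text \<open>
  The kernel is bounded by \<open>4 / s\<close>, and a second application of the Plancherel inequality returns from
  the Fourier transform of \<open>\<phi>\<close> to \<open>\<phi>\<close>.
\<close>

lemma faddeev_convolution_slice_uniform:
  fixes e :: "'a::euclidean_space" and \<phi> :: "'a \<Rightarrow> complex"
  assumes e: "norm e = 1" and s: "s > 0" and t: "t \<noteq> 0" and \<phi>: "integrable (hyperplane_measure e) \<phi>"
  shows "(\<integral>\<^sup>+w. ennreal ((norm (\<integral>v. faddeev_h s e (w - v + t *\<^sub>R e) * \<phi> v \<partial>hyperplane_measure e))\<^sup>2) \<partial>hyperplane_measure e)
    \<le> ennreal ((4 / s)\<^sup>2) * (\<integral>\<^sup>+v. ennreal ((norm (\<phi> v))\<^sup>2) \<partial>hyperplane_measure e)"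
proof -
  let ?H = "hyperplane_measure e"
  interpret H: sigma_finite_measure ?H by (rule sigma_finite_hyperplane[OF e])
  have [measurable]: "\<phi> \<in> borel_measurable borel" using \<phi> by auto
  define F where "F = (\<lambda>\<eta>. \<integral>v. cis (- (v \<bullet> \<eta>)) * \<phi> v \<partial>?H)"
  have [measurable]: "F \<in> borel_measurable borel" unfolding F_def by measurable
  have Fc: "norm (F \<eta>) = norm (\<integral>v. cis (v \<bullet> \<eta>) * cnj (\<phi> v) \<partial>?H)" for \<eta>
  proof -
    have "(\<integral>v. cis (v \<bullet> \<eta>) * cnj (\<phi> v) \<partial>?H) = (\<integral>v. cnj (cis (- (v \<bullet> \<eta>)) * \<phi> v) \<partial>?H)"
      by (simp add: cis_cnj)
    also have "\<dots> = cnj (F \<eta>)" unfolding F_def by (rule Bochner_Integration.integral_cnj)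
    finally show ?thesis by simp
  qed
  have "(\<integral>\<^sup>+\<eta>. ennreal ((norm (F \<eta>))\<^sup>2) \<partial>?H) \<le> ennreal ((2 * pi) ^ (DIM('a) - 1)) * (\<integral>\<^sup>+v. ennreal ((norm (cnj (\<phi> v)))\<^sup>2) \<partial>?H)"
    unfolding Fc using \<phi> by (intro plancherel_inequality_hyperplane e integrable_cnj)
  then have FP: "(\<integral>\<^sup>+\<eta>. ennreal ((norm (F \<eta>))\<^sup>2) \<partial>?H) \<le> ennreal ((2 * pi) ^ (DIM('a) - 1)) * (\<integral>\<^sup>+v. ennreal ((norm (\<phi> v))\<^sup>2) \<partial>?H)"
    by simp
  have K: "(faddeev_kernel s t (norm \<eta>))\<^sup>2 \<le> (4 / s)\<^sup>2" for \<eta> :: 'a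
  proof -
    have "\<bar>faddeev_kernel s t (norm \<eta>)\<bar> \<le> 4 / s * exp (- \<bar>t\<bar> * \<bar>norm \<eta> - s\<bar> / 2)"
      by (rule faddeev_kernel_bound[OF s]) simp
    also have "\<dots> \<le> 4 / s * 1" using s by (intro mult_left_mono) auto
    finally show ?thesis using s by (intro power2_le_iff_abs_le[THEN iffD2]) auto
  qed
  have "(\<integral>\<^sup>+w. ennreal ((norm (\<integral>v. faddeev_h s e (w - v + t *\<^sub>R e) * \<phi> v \<partial>?H))\<^sup>2) \<partial>?H) \<le>
    ennreal (1 / (2 * pi) ^ (DIM('a) - 1)) * (\<integral>\<^sup>+\<eta>. ennreal ((faddeev_kernel s t (norm \<eta>))\<^sup>2 * (norm (F \<eta>))\<^sup>2) \<partial>?H)"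
    unfolding F_def by (rule faddeev_convolution_slice[OF assms])
  also have "\<dots> \<le> ennreal (1 / (2 * pi) ^ (DIM('a) - 1)) * (\<integral>\<^sup>+\<eta>. ennreal ((4 / s)\<^sup>2) * ennreal ((norm (F \<eta>))\<^sup>2) \<partial>?H)"
  proof (intro mult_left_mono nn_integral_mono)
    fix \<eta> :: 'a
    show "ennreal ((faddeev_kernel s t (norm \<eta>))\<^sup>2 * (norm (F \<eta>))\<^sup>2) \<le> ennreal ((4 / s)\<^sup>2) * ennreal ((norm (F \<eta>))\<^sup>2)"
      by (subst ennreal_mult[OF zero_le_power2 zero_le_power2, symmetric])
         (rule ennreal_leI, rule mult_right_mono[OF K zero_le_power2])
  qed simp
  also have "\<dots> = ennreal (1 / (2 * pi) ^ (DIM('a) - 1)) * (ennreal ((4 / s)\<^sup>2) * (\<integral>\<^sup>+\<eta>. ennreal ((norm (F \<eta>))\<^sup>2) \<partial>?H))"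
    by (subst nn_integral_cmult) simp_all
  also have "\<dots> \<le> ennreal (1 / (2 * pi) ^ (DIM('a) - 1)) * (ennreal ((4 / s)\<^sup>2) * (ennreal ((2 * pi) ^ (DIM('a) - 1)) * (\<integral>\<^sup>+v. ennreal ((norm (\<phi> v))\<^sup>2) \<partial>?H)))"
    by (intro mult_left_mono FP) simp_all
  also have "\<dots> = ennreal (1 / (2 * pi) ^ (DIM('a) - 1)) * ennreal ((2 * pi) ^ (DIM('a) - 1)) * (ennreal ((4 / s)\<^sup>2) * (\<integral>\<^sup>+v. ennreal ((norm (\<phi> v))\<^sup>2) \<partial>?H))"
    by (simp only: mult_ac)
  also have "ennreal (1 / (2 * pi) ^ (DIM('a) - 1)) * ennreal ((2 * pi) ^ (DIM('a) - 1)) = 1"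
    by (subst ennreal_mult[symmetric]) auto
  finally show ?thesis by simp
qed

text \<open>
  The kernel does not decay uniformly as \<open>|t| \<rightarrow> \<infinity>\<close>, because of the sphere \<open>|\<eta>| = s\<close>. But \<open>\<phi>\<close> has
  bounded support, so its Fourier transform is bounded by a multiple of its \<open>L\<^sup>2\<close> norm, and the square
  of the kernel has an integral over \<open>\<eta>\<close> of order \<open>|t| powr (- \<delta>)\<close>, by
  \<open>exp (- y) \<le> y powr (- \<delta>)\<close>.
\<close>

lemma faddeev_convolution_slice_decay:
  fixes e :: "'a::euclidean_space"
  assumes e: "norm e = 1" and n: "DIM('a) \<ge> 2" and s: "s > 0" and \<delta>: "0 < \<delta>" "\<delta> < 1" and L: "L > 0"
  shows "\<exists>C\<ge>0. \<forall>t \<phi>. t \<noteq> 0 \<longrightarrow> integrable (hyperplane_measure e) \<phi> \<longrightarrow> (\<forall>v. norm v > L \<longrightarrow> \<phi> v = 0) \<longrightarrow>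
    (\<integral>\<^sup>+w. ennreal ((norm (\<integral>v. faddeev_h s e (w - v + t *\<^sub>R e) * (\<phi> v :: complex) \<partial>hyperplane_measure e))\<^sup>2) \<partial>hyperplane_measure e)
    \<le> ennreal (C * (1 + \<bar>t\<bar>) powr (- \<delta>)) * (\<integral>\<^sup>+v. ennreal ((norm (\<phi> v))\<^sup>2) \<partial>hyperplane_measure e)"
proof -
  let ?H = "hyperplane_measure e"
  interpret H: sigma_finite_measure ?H by (rule sigma_finite_hyperplane[OF e])
  define c where "c = 1 / (2 * pi) ^ (DIM('a) - 1)"
  have c0: "c > 0" by (simp add: c_def)
  obtain D where D: "D > 0" "\<And>\<rho>. \<rho> \<ge> 0 \<Longrightarrow> exp (- (1 / 2) * \<bar>\<rho> - s\<bar>) \<le> D / (1 + \<rho>) ^ (2 * DIM('a))"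
    using exp_decay_polynomial[of "1 / 2" s "2 * DIM('a)"] s by (auto simp: mult.commute)
  let ?S = "\<lambda>w::'a. \<bar>norm w - s\<bar> powr (- \<delta>) / (1 + norm w) ^ (2 * DIM('a))"
  define J where "J = (\<integral>w. ?S w \<partial>?H)"
  have iJ: "integrable ?H ?S" by (intro integrable_hyperplane_singular_sphere e \<delta> s) simp
  have J0: "J \<ge> 0" unfolding J_def by (intro Bochner_Integration.integral_nonneg) auto
  have HB: "emeasure ?H (cball 0 L) < \<infinity>"
  proof -
    have iW: "integrable ?H (\<lambda>w::'a. (1 + L) ^ (2 * DIM('a)) * (1 / (1 + norm w) ^ (2 * DIM('a))))"
      by (intro integrable_mult_right integrable_hyperplane_weight e) simp
    have "emeasure ?H (cball 0 L) = (\<integral>\<^sup>+w. indicator (cball 0 L) w \<partial>?H)" by simp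
    also have "\<dots> \<le> (\<integral>\<^sup>+w. ennreal (norm ((1 + L) ^ (2 * DIM('a)) * (1 / (1 + norm (w::'a)) ^ (2 * DIM('a))))) \<partial>?H)"
    proof (rule nn_integral_mono)
      fix w :: 'a
      have "1 \<le> (1 + L) ^ (2 * DIM('a)) * (1 / (1 + norm w) ^ (2 * DIM('a)))" if "norm w \<le> L"
      proof -
        have "(1 + norm w) ^ (2 * DIM('a)) \<le> (1 + L) ^ (2 * DIM('a))" using that by (intro power_mono) auto
        moreover have "(1 + norm w) ^ (2 * DIM('a)) > 0" by (intro zero_less_power add_pos_nonneg) auto
        ultimately show ?thesis by simp
      qed
      then show "indicator (cball 0 L) w \<le> ennreal (norm ((1 + L) ^ (2 * DIM('a)) * (1 / (1 + norm (w::'a)) ^ (2 * DIM('a)))))"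
        using ennreal_leI[of 1 "(1 + L) ^ (2 * DIM('a)) * (1 / (1 + norm w) ^ (2 * DIM('a)))"] L
        by (auto simp: indicator_def)
    qed
    also have "\<dots> < \<infinity>" using iW unfolding integrable_iff_bounded by simp
    finally show ?thesis .
  qed
  define B where "B = enn2real (emeasure ?H (cball 0 L))"
  have B: "emeasure ?H (cball 0 L) = ennreal B" "B \<ge> 0" using HB by (auto simp: B_def less_top)
  define E where "E = (4 / s)\<^sup>2 * 2 * D * J"
  have E0: "E \<ge> 0" using D J0 by (simp add: E_def)
  define C where "C = 2 * (4 / s)\<^sup>2 + 2 * (c * E * B)"
  have C0: "C \<ge> 0" using c0 E0 B by (simp add: C_def)
  show ?thesis
  proof (intro exI[of _ C] conjI C0 allI impI)
    fix t :: real and \<phi> :: "'a \<Rightarrow> complex"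
    assume t: "t \<noteq> 0" and \<phi>: "integrable ?H \<phi>" and supp: "\<forall>v. norm v > L \<longrightarrow> \<phi> v = 0"
    have [measurable]: "\<phi> \<in> borel_measurable borel" using \<phi> by auto
    let ?X = "(\<integral>\<^sup>+v. ennreal ((norm (\<phi> v))\<^sup>2) \<partial>?H)"
    let ?A = "\<integral>\<^sup>+w. ennreal ((norm (\<integral>v. faddeev_h s e (w - v + t *\<^sub>R e) * \<phi> v \<partial>?H))\<^sup>2) \<partial>?H"
    have two: "2 powr \<delta> \<le> 2" using powr_mono[of \<delta> 1 2] \<delta> by simp
    show "?A \<le> ennreal (C * (1 + \<bar>t\<bar>) powr (- \<delta>)) * ?X"
    proof (cases "\<bar>t\<bar> \<le> 1")
      case True
      have "2 powr (- \<delta>) \<le> (1 + \<bar>t\<bar>) powr (- \<delta>)" using True \<delta> by (intro powr_mono2') auto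
      moreover have "2 powr (- \<delta>) \<ge> 1 / 2" using two by (simp add: powr_minus_divide divide_simps)
      ultimately have "1 / 2 \<le> (1 + \<bar>t\<bar>) powr (- \<delta>)" by linarith
      then have "(2 * (4 / s)\<^sup>2) * (1 / 2) \<le> C * (1 + \<bar>t\<bar>) powr (- \<delta>)"
        using C0 c0 E0 B by (intro mult_mono) (auto simp: C_def)
      then have "(4 / s)\<^sup>2 \<le> C * (1 + \<bar>t\<bar>) powr (- \<delta>)" by simp
      then show ?thesis
        by (intro order_trans[OF faddeev_convolution_slice_uniform[OF e s t \<phi>]] mult_right_mono ennreal_leI) auto
    next
      case False
      define F where "F = (\<lambda>\<eta>. \<integral>v. cis (- (v \<bullet> \<eta>)) * \<phi> v \<partial>?H)"
      have [measurable]: "F \<in> borel_measurable borel" unfolding F_def by measurable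
      have Fb: "ennreal ((norm (F \<eta>))\<^sup>2) \<le> ennreal B * ?X" for \<eta>
      proof -
        have "ennreal (norm (F \<eta>)) \<le> (\<integral>\<^sup>+v. ennreal (norm (\<phi> v)) \<partial>?H)"
          unfolding F_def using norm_integral_le_nn_integral[where M="?H" and f="\<lambda>v. cis (- (v \<bullet> \<eta>)) * \<phi> v"]
          by (simp add: norm_mult)
        then have "(ennreal (norm (F \<eta>)))\<^sup>2 \<le> (\<integral>\<^sup>+v. ennreal (norm (\<phi> v)) \<partial>?H)\<^sup>2" by (intro power_mono) auto
        also have "\<dots> \<le> emeasure ?H (cball 0 L) * (\<integral>\<^sup>+v. (ennreal (norm (\<phi> v)))\<^sup>2 \<partial>?H)"
          using supp by (intro nn_integral_square_le) auto
        finally show ?thesis by (simp add: B(1) ennreal_power)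
      qed
      have K: "AE \<eta> in ?H. ennreal ((faddeev_kernel s t (norm \<eta>))\<^sup>2 * (norm (F \<eta>))\<^sup>2) \<le>
          ennreal ((4 / s)\<^sup>2 * 2 * D * \<bar>t\<bar> powr (- \<delta>) * ?S \<eta>) * (ennreal B * ?X)"
      proof (rule AE_mp[OF _ AE_I2])
        show "AE \<eta> in ?H. norm \<eta> \<noteq> s" using s by (intro AE_hyperplane_norm_neq[OF e n]) auto
      next
        fix \<eta> :: 'a
        show "norm \<eta> \<noteq> s \<longrightarrow> ennreal ((faddeev_kernel s t (norm \<eta>))\<^sup>2 * (norm (F \<eta>))\<^sup>2) \<le>
          ennreal ((4 / s)\<^sup>2 * 2 * D * \<bar>t\<bar> powr (- \<delta>) * ?S \<eta>) * (ennreal B * ?X)"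
        proof
          assume ns: "norm \<eta> \<noteq> s"
          define y where "y = \<bar>t\<bar> * \<bar>norm \<eta> - s\<bar> / 2"
          have y: "y > 0" using t ns by (simp add: y_def)
          have "\<bar>faddeev_kernel s t (norm \<eta>)\<bar> \<le> 4 / s * exp (- y)"
            using faddeev_kernel_bound[OF s, of "norm \<eta>" t] by (simp add: y_def)
          then have "(faddeev_kernel s t (norm \<eta>))\<^sup>2 \<le> (4 / s * exp (- y))\<^sup>2"
            using s by (intro power2_le_iff_abs_le[THEN iffD2]) auto
          also have "\<dots> = (4 / s)\<^sup>2 * (exp (- y) * exp (- y))"
            by (simp add: power_mult_distrib power2_eq_square)
          also have "\<dots> \<le> (4 / s)\<^sup>2 * ((2 * \<bar>t\<bar> powr (- \<delta>) * \<bar>norm \<eta> - s\<bar> powr (- \<delta>)) * (D / (1 + norm \<eta>) ^ (2 * DIM('a))))"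
          proof (intro mult_left_mono mult_mono)
            have "exp (- y) \<le> y powr (- \<delta>)" by (rule exp_le_powr[OF \<delta> y])
            also have "\<dots> = 2 powr \<delta> * (\<bar>t\<bar> powr (- \<delta>) * \<bar>norm \<eta> - s\<bar> powr (- \<delta>))"
              unfolding y_def using t ns by (simp add: powr_mult powr_divide powr_minus_divide)
            also have "\<dots> \<le> 2 * (\<bar>t\<bar> powr (- \<delta>) * \<bar>norm \<eta> - s\<bar> powr (- \<delta>))"
              using two by (intro mult_right_mono) auto
            finally show "exp (- y) \<le> 2 * \<bar>t\<bar> powr (- \<delta>) * \<bar>norm \<eta> - s\<bar> powr (- \<delta>)" by simp
            have "1 * \<bar>norm \<eta> - s\<bar> \<le> \<bar>t\<bar> * \<bar>norm \<eta> - s\<bar>" using False by (intro mult_right_mono) auto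
            then have "exp (- y) \<le> exp (- (1 / 2) * \<bar>norm \<eta> - s\<bar>)" by (simp add: y_def)
            also have "\<dots> \<le> D / (1 + norm \<eta>) ^ (2 * DIM('a))" by (rule D(2)) simp
            finally show "exp (- y) \<le> D / (1 + norm \<eta>) ^ (2 * DIM('a))" .
          qed auto
          also have "\<dots> = (4 / s)\<^sup>2 * 2 * D * \<bar>t\<bar> powr (- \<delta>) * ?S \<eta>" by (simp add: mult_ac)
          finally have k: "(faddeev_kernel s t (norm \<eta>))\<^sup>2 \<le> (4 / s)\<^sup>2 * 2 * D * \<bar>t\<bar> powr (- \<delta>) * ?S \<eta>" .
          have "ennreal ((faddeev_kernel s t (norm \<eta>))\<^sup>2 * (norm (F \<eta>))\<^sup>2) =
             ennreal ((faddeev_kernel s t (norm \<eta>))\<^sup>2) * ennreal ((norm (F \<eta>))\<^sup>2)"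
            by (rule ennreal_mult) auto
          also have "\<dots> \<le> ennreal ((4 / s)\<^sup>2 * 2 * D * \<bar>t\<bar> powr (- \<delta>) * ?S \<eta>) * (ennreal B * ?X)"
            by (intro mult_mono ennreal_leI k Fb) auto
          finally show "ennreal ((faddeev_kernel s t (norm \<eta>))\<^sup>2 * (norm (F \<eta>))\<^sup>2) \<le>
            ennreal ((4 / s)\<^sup>2 * 2 * D * \<bar>t\<bar> powr (- \<delta>) * ?S \<eta>) * (ennreal B * ?X)" .
        qed
      qed
      have "?A \<le> ennreal c * (\<integral>\<^sup>+\<eta>. ennreal ((faddeev_kernel s t (norm \<eta>))\<^sup>2 * (norm (F \<eta>))\<^sup>2) \<partial>?H)"
        unfolding F_def c_def by (rule faddeev_convolution_slice[OF e s t \<phi>])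
      also have "\<dots> \<le> ennreal c * (\<integral>\<^sup>+\<eta>. ennreal ((4 / s)\<^sup>2 * 2 * D * \<bar>t\<bar> powr (- \<delta>) * ?S \<eta>) * (ennreal B * ?X) \<partial>?H)"
        by (intro mult_left_mono nn_integral_mono_AE K) simp
      also have "\<dots> = ennreal c * ((\<integral>\<^sup>+\<eta>. ennreal ((4 / s)\<^sup>2 * 2 * D * \<bar>t\<bar> powr (- \<delta>) * ?S \<eta>) \<partial>?H) * (ennreal B * ?X))"
        by (subst nn_integral_multc) simp_all
      also have "(\<integral>\<^sup>+\<eta>. ennreal ((4 / s)\<^sup>2 * 2 * D * \<bar>t\<bar> powr (- \<delta>) * ?S \<eta>) \<partial>?H) =
          ennreal (\<integral>\<eta>. (4 / s)\<^sup>2 * 2 * D * \<bar>t\<bar> powr (- \<delta>) * ?S \<eta> \<partial>?H)"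
        using D by (intro nn_integral_eq_integral integrable_mult_right iJ AE_I2 mult_nonneg_nonneg) auto
      also have "(\<integral>\<eta>. (4 / s)\<^sup>2 * 2 * D * \<bar>t\<bar> powr (- \<delta>) * ?S \<eta> \<partial>?H) = E * \<bar>t\<bar> powr (- \<delta>)"
        unfolding integral_mult_right_zero J_def[symmetric] E_def by (simp only: mult_ac)
      also have "ennreal c * (ennreal (E * \<bar>t\<bar> powr (- \<delta>)) * (ennreal B * ?X)) = ennreal (c * E * B * \<bar>t\<bar> powr (- \<delta>)) * ?X"
        using c0 E0 B by (simp add: ennreal_mult mult_ac)
      also have "\<dots> \<le> ennreal (C * (1 + \<bar>t\<bar>) powr (- \<delta>)) * ?X"
      proof (intro mult_right_mono ennreal_leI)
        have "(2 * \<bar>t\<bar>) powr (- \<delta>) \<le> (1 + \<bar>t\<bar>) powr (- \<delta>)" using False \<delta> by (intro powr_mono2') auto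
        moreover have "(2 * \<bar>t\<bar>) powr (- \<delta>) = 2 powr (- \<delta>) * \<bar>t\<bar> powr (- \<delta>)" by (simp add: powr_mult)
        moreover have "1 / 2 * \<bar>t\<bar> powr (- \<delta>) \<le> 2 powr (- \<delta>) * \<bar>t\<bar> powr (- \<delta>)"
          using two by (intro mult_right_mono) (auto simp: powr_minus_divide divide_simps)
        ultimately have "\<bar>t\<bar> powr (- \<delta>) \<le> 2 * (1 + \<bar>t\<bar>) powr (- \<delta>)" by linarith
        then have "c * E * B * \<bar>t\<bar> powr (- \<delta>) \<le> c * E * B * (2 * (1 + \<bar>t\<bar>) powr (- \<delta>))"
          using c0 E0 B by (intro mult_left_mono) auto
        also have "\<dots> \<le> C * (1 + \<bar>t\<bar>) powr (- \<delta>)" by (simp add: C_def distrib_right)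
        finally show "c * E * B * \<bar>t\<bar> powr (- \<delta>) \<le> C * (1 + \<bar>t\<bar>) powr (- \<delta>)" .
      qed simp
      finally show ?thesis .
    qed
  qed
qed

text \<open>
  The convolution at height \<open>x1\<close> collects contributions from the slices of \<open>f\<close> at heights
  \<open>y \<in> [- L, L]\<close>. The Cauchy--Schwarz inequality in \<open>y\<close> costs the factor \<open>2 L\<close>.
\<close>

lemma convolution_slice_bound:
  fixes e :: "'a::euclidean_space" and h f :: "'a \<Rightarrow> complex" and x1 :: real
  assumes e: "norm e = 1" and [measurable]: "h \<in> borel_measurable borel"
    and f: "integrable lborel f" and supp: "\<And>y. norm y > L \<Longrightarrow> f y = 0" and L: "L > 0"
    and conv: "AE w in hyperplane_measure e. integrable lborel (\<lambda>y. h (w + x1 *\<^sub>R e - y) * f y)"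
    and k: "\<And>y. \<bar>y\<bar> \<le> L \<Longrightarrow> y \<noteq> x1 \<Longrightarrow> integrable (hyperplane_measure e) (\<lambda>v. f (v + y *\<^sub>R e)) \<Longrightarrow>
      (\<integral>\<^sup>+w. ennreal ((norm (\<integral>v. h (w - v + (x1 - y) *\<^sub>R e) * f (v + y *\<^sub>R e) \<partial>hyperplane_measure e))\<^sup>2) \<partial>hyperplane_measure e)
      \<le> ennreal k * (\<integral>\<^sup>+v. ennreal ((norm (f (v + y *\<^sub>R e)))\<^sup>2) \<partial>hyperplane_measure e)"
    and k0: "k \<ge> 0"
  shows "(\<integral>\<^sup>+w. ennreal ((norm (\<integral>y. h (w + x1 *\<^sub>R e - y) * f y \<partial>lborel))\<^sup>2) \<partial>hyperplane_measure e)
    \<le> ennreal (2 * L * k) * (\<integral>\<^sup>+y. ennreal ((norm (f y))\<^sup>2) \<partial>lborel)"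
proof -
  let ?H = "hyperplane_measure e"
  interpret H: sigma_finite_measure ?H by (rule sigma_finite_hyperplane[OF e])
  interpret P: pair_sigma_finite ?H "lborel :: real measure"
    by (simp add: pair_sigma_finite_def sigma_finite_hyperplane[OF e] sigma_finite_lborel)
  note orth = AE_hyperplane_orthogonal[OF e]
  have [measurable]: "f \<in> borel_measurable borel" using f by auto
  define A where "A = (\<lambda>y w. \<integral>v. h (w - v + (x1 - y) *\<^sub>R e) * f (v + y *\<^sub>R e) \<partial>?H)"
  have [measurable]: "(\<lambda>(w, y). A y w) \<in> borel_measurable (borel \<Otimes>\<^sub>M borel)"
    unfolding A_def by measurable
  have [measurable]: "(\<lambda>y. A y w) \<in> borel_measurable borel" "(\<lambda>w. A y w) \<in> borel_measurable borel" for w y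
    unfolding A_def by measurable
  have A0: "A y w = 0" if y: "\<bar>y\<bar> > L" for y w
    unfolding A_def
  proof (rule integral_eq_zero_AE)
    show "AE v in ?H. h (w - v + (x1 - y) *\<^sub>R e) * f (v + y *\<^sub>R e) = 0"
      using orth
    proof eventually_elim
      case (elim v)
      have "\<bar>y\<bar> \<le> norm (v + y *\<^sub>R e)"
        by (rule power2_le_imp_le) (simp_all add: norm_add_scaleR_orthogonal[OF e elim])
      then have "f (v + y *\<^sub>R e) = 0" using y by (intro supp) linarith
      then show ?case by simp
    qed
  qed
  have "(\<integral>\<^sup>+w. ennreal ((norm (\<integral>y. h (w + x1 *\<^sub>R e - y) * f y \<partial>lborel))\<^sup>2) \<partial>?H) \<le>
    (\<integral>\<^sup>+w. ennreal (2 * L) * (\<integral>\<^sup>+y. indicator {-L..L} y * ennreal ((norm (A y w))\<^sup>2) \<partial>lborel) \<partial>?H)"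
  proof (rule nn_integral_mono_AE, use conv in eventually_elim)
    case (elim w)
    have "(\<integral>y. h (w + x1 *\<^sub>R e - y) * f y \<partial>lborel) = (\<integral>y. A y w \<partial>lborel)"
      unfolding A_def by (subst integral_slices(1)[OF e elim]) (simp add: algebra_simps)
    then have "ennreal (norm (\<integral>y. h (w + x1 *\<^sub>R e - y) * f y \<partial>lborel)) \<le> (\<integral>\<^sup>+y. ennreal (norm (A y w)) \<partial>lborel)"
      by (simp add: norm_integral_le_nn_integral)
    then have "(ennreal (norm (\<integral>y. h (w + x1 *\<^sub>R e - y) * f y \<partial>lborel)))\<^sup>2 \<le> (\<integral>\<^sup>+y. ennreal (norm (A y w)) \<partial>lborel)\<^sup>2"
      by (intro power_mono) auto
    also have "\<dots> \<le> emeasure lborel {-L..L} * (\<integral>\<^sup>+y. (ennreal (norm (A y w)))\<^sup>2 \<partial>lborel)"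
      using A0 by (intro nn_integral_square_le) auto
    also have "(\<integral>\<^sup>+y. (ennreal (norm (A y w)))\<^sup>2 \<partial>lborel) = (\<integral>\<^sup>+y. indicator {-L..L} y * ennreal ((norm (A y w))\<^sup>2) \<partial>lborel)"
      using A0 by (intro nn_integral_cong) (auto simp: ennreal_power indicator_def abs_le_iff not_le)
    finally show ?case using L by (simp add: ennreal_power)
  qed
  also have "\<dots> = ennreal (2 * L) * (\<integral>\<^sup>+w. (\<integral>\<^sup>+y. indicator {-L..L} y * ennreal ((norm (A y w))\<^sup>2) \<partial>lborel) \<partial>?H)"
    by (rule nn_integral_cmult) simp
  also have "(\<integral>\<^sup>+w. (\<integral>\<^sup>+y. indicator {-L..L} y * ennreal ((norm (A y w))\<^sup>2) \<partial>lborel) \<partial>?H) =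
    (\<integral>\<^sup>+y. (\<integral>\<^sup>+w. indicator {-L..L} y * ennreal ((norm (A y w))\<^sup>2) \<partial>?H) \<partial>lborel)"
    by (rule P.Fubini'[symmetric]) simp
  also have "\<dots> \<le> (\<integral>\<^sup>+y. ennreal k * (\<integral>\<^sup>+v. ennreal ((norm (f (v + y *\<^sub>R e)))\<^sup>2) \<partial>?H) \<partial>lborel)"
  proof (rule nn_integral_mono_AE, use integral_slices(3)[OF e f] AE_lborel_singleton[of x1] in eventually_elim)
    case (elim y)
    show ?case
    proof (cases "y \<in> {-L..L}")
      case True
      have "(\<integral>\<^sup>+w. indicator {-L..L} y * ennreal ((norm (A y w))\<^sup>2) \<partial>?H) = (\<integral>\<^sup>+w. ennreal ((norm (A y w))\<^sup>2) \<partial>?H)"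
        using True by simp
      also have "\<dots> \<le> ennreal k * (\<integral>\<^sup>+v. ennreal ((norm (f (v + y *\<^sub>R e)))\<^sup>2) \<partial>?H)"
        unfolding A_def using True elim by (intro k) auto
      finally show ?thesis .
    qed simp
  qed
  also have "\<dots> = ennreal k * (\<integral>\<^sup>+y. (\<integral>\<^sup>+v. ennreal ((norm (f (v + y *\<^sub>R e)))\<^sup>2) \<partial>?H) \<partial>lborel)"
    by (rule nn_integral_cmult) simp
  also have "(\<integral>\<^sup>+y. (\<integral>\<^sup>+v. ennreal ((norm (f (v + y *\<^sub>R e)))\<^sup>2) \<partial>?H) \<partial>lborel) = (\<integral>\<^sup>+y. ennreal ((norm (f y))\<^sup>2) \<partial>lborel)"
    by (rule nn_integral_slices[OF e, symmetric]) simp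
  finally show ?thesis
    using L k0 by (simp add: ennreal_mult mult.assoc mult_left_mono)
qed

lemma locally_integrable_faddeev_h:
  fixes e :: "'a::euclidean_space"
  assumes e: "norm e = 1" and n: "DIM('a) \<ge> 3" and s: "s > 0"
  shows "integrable lborel (\<lambda>x. indicator (cball 0 M) x *\<^sub>R faddeev_h s e x)"
proof -
  have i: "integrable lborel (indicator (cball 0 M) :: 'a \<Rightarrow> real)"
    using emeasure_lborel_cball_finite[of "0::'a" M] by (intro integrable_real_indicator) (auto simp: less_top)
  have "integrable lborel (\<lambda>x. faddeev_h s e x * complex_of_real (indicator (cball 0 M) x))"
    by (rule integrable_faddeev_h_mult[OF e n s integrable_of_real[OF i], where B=1]) (simp add: indicator_def)
  then show ?thesis by (simp add: scaleR_conv_of_real mult.commute)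
qed

text \<open>
  The uniform bound on slices gives the second part: one factor \<open>2 L\<close> comes from
  \<open>convolution_slice_bound\<close>, another from integrating over the heights \<open>x \<bullet> e \<in> [- L, L]\<close> that meet
  the ball, and \<open>2 L * 2 L * (4 / s)\<^sup>2 = (8 L / s)\<^sup>2\<close>. The decay on slices gives the third part, because
  the exponents \<open>2 \<delta> - 2\<close> of the weight and \<open>- \<delta>\<close> of the decay add up to less than \<open>- 1\<close>.
\<close>

theorem faddeev_convolution_bounds:
  fixes e :: "'a::euclidean_space" and f :: "'a \<Rightarrow> complex"
  assumes e: "norm e = 1" and n: "DIM('a) \<ge> 3" and s: "s > 0"
    and f: "integrable lborel f" and f2: "(\<integral>\<^sup>+y. ennreal ((norm (f y))\<^sup>2) \<partial>lborel) < \<infinity>"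
    and supp: "\<And>y. norm y > L \<Longrightarrow> f y = 0" and L: "L > 0"
  shows "AE x in lborel. integrable lborel (\<lambda>y. faddeev_h s e (x - y) * f y)"
    and "(\<integral>\<^sup>+x. indicator (cball 0 L) x * ennreal ((norm (\<integral>y. faddeev_h s e (x - y) * f y \<partial>lborel))\<^sup>2) \<partial>lborel)
      \<le> ennreal ((8 * L / s)\<^sup>2) * (\<integral>\<^sup>+y. ennreal ((norm (f y))\<^sup>2) \<partial>lborel)"
    and "0 < \<delta> \<Longrightarrow> \<delta> < 1 \<Longrightarrow>
      (\<integral>\<^sup>+x. ennreal ((1 + norm x) powr (2 * \<delta> - 2)) * ennreal ((norm (\<integral>y. faddeev_h s e (x - y) * f y \<partial>lborel))\<^sup>2) \<partial>lborel) < \<infinity>"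
proof -
  let ?H = "hyperplane_measure e"
  interpret H: sigma_finite_measure ?H by (rule sigma_finite_hyperplane[OF e])
  note orth = AE_hyperplane_orthogonal[OF e]
  have [measurable]: "f \<in> borel_measurable borel" using f by auto
  have hm[measurable]: "faddeev_h s e \<in> borel_measurable borel" by (rule measurable_faddeev_h[OF e])
  show conv: "AE x in lborel. integrable lborel (\<lambda>y. faddeev_h s e (x - y) * f y)"
    by (rule AE_integrable_convolution[OF hm locally_integrable_faddeev_h[OF e n s] f supp])
  have convs: "AE t in lborel. AE w in ?H. integrable lborel (\<lambda>y. faddeev_h s e (w + t *\<^sub>R e - y) * f y)"
    by (rule AE_slices[OF e _ conv]) measurable
  define c where "c = (\<lambda>x. \<integral>y. faddeev_h s e (x - y) * f y \<partial>lborel)"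
  have [measurable]: "c \<in> borel_measurable borel" unfolding c_def by measurable
  define X where "X = (\<integral>\<^sup>+y. ennreal ((norm (f y))\<^sup>2) \<partial>lborel)"
  have tn: "\<bar>t\<bar> \<le> norm (w + t *\<^sub>R e)" if "w \<bullet> e = 0" for w t
    by (rule power2_le_imp_le) (simp_all add: norm_add_scaleR_orthogonal[OF e that])
  have unif: "AE t in lborel. (\<integral>\<^sup>+w. ennreal ((norm (c (w + t *\<^sub>R e)))\<^sup>2) \<partial>?H) \<le> ennreal (2 * L * (4 / s)\<^sup>2) * X"
    using convs
  proof eventually_elim
    case (elim t)
    show ?case unfolding c_def X_def
      by (rule convolution_slice_bound[OF e hm f supp L elim])
         (auto intro!: faddeev_convolution_slice_uniform e s)
  qed
  have "(\<integral>\<^sup>+x. indicator (cball 0 L) x * ennreal ((norm (c x))\<^sup>2) \<partial>lborel) =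
    (\<integral>\<^sup>+t. (\<integral>\<^sup>+w. indicator (cball 0 L) (w + t *\<^sub>R e) * ennreal ((norm (c (w + t *\<^sub>R e)))\<^sup>2) \<partial>?H) \<partial>lborel)"
    by (rule nn_integral_slices[OF e]) simp
  also have "\<dots> \<le> (\<integral>\<^sup>+t. (ennreal (2 * L * (4 / s)\<^sup>2) * X) * indicator {-L..L} t \<partial>lborel)"
  proof (rule nn_integral_mono_AE, use unif in eventually_elim)
    case (elim t)
    have "(\<integral>\<^sup>+w. indicator (cball 0 L) (w + t *\<^sub>R e) * ennreal ((norm (c (w + t *\<^sub>R e)))\<^sup>2) \<partial>?H) \<le>
      (\<integral>\<^sup>+w. indicator {-L..L} t * ennreal ((norm (c (w + t *\<^sub>R e)))\<^sup>2) \<partial>?H)"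
    proof (rule nn_integral_mono_AE, use orth in eventually_elim)
      case (elim w)
      then show ?case using tn[of w t] by (auto simp: indicator_def abs_le_iff)
    qed
    also have "\<dots> = indicator {-L..L} t * (\<integral>\<^sup>+w. ennreal ((norm (c (w + t *\<^sub>R e)))\<^sup>2) \<partial>?H)"
      by (rule nn_integral_cmult) simp
    also have "\<dots> \<le> indicator {-L..L} t * (ennreal (2 * L * (4 / s)\<^sup>2) * X)"
      by (intro mult_left_mono elim) simp
    finally show ?case by (simp only: mult.commute)
  qed
  also have "\<dots> = (ennreal (2 * L * (4 / s)\<^sup>2) * X) * ennreal (2 * L)"
    using L by (subst nn_integral_cmult_indicator) auto
  also have "\<dots> = (ennreal (2 * L * (4 / s)\<^sup>2) * ennreal (2 * L)) * X" by (simp only: mult_ac)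
  also have "ennreal (2 * L * (4 / s)\<^sup>2) * ennreal (2 * L) = ennreal (2 * L * (4 / s)\<^sup>2 * (2 * L))"
    using L by (intro ennreal_mult[symmetric]) auto
  also have "2 * L * (4 / s)\<^sup>2 * (2 * L) = (8 * L / s)\<^sup>2" by (simp add: power2_eq_square)
  finally show "(\<integral>\<^sup>+x. indicator (cball 0 L) x * ennreal ((norm (\<integral>y. faddeev_h s e (x - y) * f y \<partial>lborel))\<^sup>2) \<partial>lborel)
      \<le> ennreal ((8 * L / s)\<^sup>2) * (\<integral>\<^sup>+y. ennreal ((norm (f y))\<^sup>2) \<partial>lborel)"
    unfolding c_def X_def .
  show "(\<integral>\<^sup>+x. ennreal ((1 + norm x) powr (2 * \<delta> - 2)) * ennreal ((norm (\<integral>y. faddeev_h s e (x - y) * f y \<partial>lborel))\<^sup>2) \<partial>lborel) < \<infinity>"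
    if \<delta>: "0 < \<delta>" "\<delta> < 1"
  proof -
    obtain C where C: "C \<ge> 0" and slice: "\<And>t \<phi>. t \<noteq> 0 \<Longrightarrow> integrable ?H \<phi> \<Longrightarrow> (\<forall>v. norm v > L \<longrightarrow> \<phi> v = 0) \<Longrightarrow>
      (\<integral>\<^sup>+w. ennreal ((norm (\<integral>v. faddeev_h s e (w - v + t *\<^sub>R e) * (\<phi> v :: complex) \<partial>?H))\<^sup>2) \<partial>?H)
      \<le> ennreal (C * (1 + \<bar>t\<bar>) powr (- \<delta>)) * (\<integral>\<^sup>+v. ennreal ((norm (\<phi> v))\<^sup>2) \<partial>?H)"
      using faddeev_convolution_slice_decay[OF e _ s \<delta> L] n by auto
    define k where "k = (\<lambda>t. C * ((1 + L) powr \<delta> * (1 + \<bar>t\<bar>) powr (- \<delta>)))"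
    have k0: "k t \<ge> 0" for t using C by (simp add: k_def)
    have kb: "(\<integral>\<^sup>+w. ennreal ((norm (\<integral>v. faddeev_h s e (w - v + (t - y) *\<^sub>R e) * f (v + y *\<^sub>R e) \<partial>?H))\<^sup>2) \<partial>?H)
      \<le> ennreal (k t) * (\<integral>\<^sup>+v. ennreal ((norm (f (v + y *\<^sub>R e)))\<^sup>2) \<partial>?H)"
      if y: "\<bar>y\<bar> \<le> L" "y \<noteq> t" and i: "integrable ?H (\<lambda>v. f (v + y *\<^sub>R e))" for t y
    proof -
      define \<phi> where "\<phi> = (\<lambda>v. indicator {v. v \<bullet> e = 0} v *\<^sub>R f (v + y *\<^sub>R e))"
      have ae: "AE v in ?H. \<phi> v = f (v + y *\<^sub>R e)"
        using orth by eventually_elim (simp add: \<phi>_def)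
      have [measurable]: "\<phi> \<in> borel_measurable borel" unfolding \<phi>_def by measurable
      have i\<phi>: "integrable ?H \<phi>"
        by (rule integrable_cong_AE_imp[OF i]) (use ae in \<open>auto elim!: eventually_mono\<close>)
      have sup: "\<forall>v. norm v > L \<longrightarrow> \<phi> v = 0"
      proof (intro allI impI)
        fix v :: 'a assume v: "norm v > L"
        show "\<phi> v = 0"
        proof (cases "v \<bullet> e = 0")
          case True
          have "norm v \<le> norm (v + y *\<^sub>R e)"
            by (rule power2_le_imp_le) (simp_all add: norm_add_scaleR_orthogonal[OF e True])
          then have "f (v + y *\<^sub>R e) = 0" using v by (intro supp) linarith
          then show ?thesis by (simp add: \<phi>_def)
        qed (simp add: \<phi>_def)
      qed
      have eq1: "(\<integral>v. faddeev_h s e (w - v + (t - y) *\<^sub>R e) * f (v + y *\<^sub>R e) \<partial>?H) = (\<integral>v. faddeev_h s e (w - v + (t - y) *\<^sub>R e) * \<phi> v \<partial>?H)" for w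
        by (rule integral_cong_AE) (use ae in \<open>auto elim!: eventually_mono\<close>)
      have eq2: "(\<integral>\<^sup>+v. ennreal ((norm (f (v + y *\<^sub>R e)))\<^sup>2) \<partial>?H) = (\<integral>\<^sup>+v. ennreal ((norm (\<phi> v))\<^sup>2) \<partial>?H)"
        by (rule nn_integral_cong_AE) (use ae in \<open>auto elim!: eventually_mono\<close>)
      have "C * (1 + \<bar>t - y\<bar>) powr (- \<delta>) \<le> k t"
        unfolding k_def
      proof (intro mult_left_mono C)
        have "\<bar>t\<bar> \<le> \<bar>t - y\<bar> + L" using y by linarith
        moreover have "0 \<le> \<bar>t - y\<bar> * L" using L by simp
        moreover have "(1 + L) * (1 + \<bar>t - y\<bar>) = 1 + L + \<bar>t - y\<bar> + \<bar>t - y\<bar> * L" by (simp add: algebra_simps)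
        ultimately have "1 + \<bar>t\<bar> \<le> (1 + L) * (1 + \<bar>t - y\<bar>)" by linarith
        then have "((1 + L) * (1 + \<bar>t - y\<bar>)) powr (- \<delta>) \<le> (1 + \<bar>t\<bar>) powr (- \<delta>)"
          using \<delta> by (intro powr_mono2') auto
        then have "(1 + L) powr (- \<delta>) * (1 + \<bar>t - y\<bar>) powr (- \<delta>) \<le> (1 + \<bar>t\<bar>) powr (- \<delta>)"
          using L by (simp add: powr_mult)
        then have "(1 + L) powr \<delta> * ((1 + L) powr (- \<delta>) * (1 + \<bar>t - y\<bar>) powr (- \<delta>)) \<le> (1 + L) powr \<delta> * (1 + \<bar>t\<bar>) powr (- \<delta>)"
          by (intro mult_left_mono) auto
        moreover have "(1 + L) powr \<delta> * (1 + L) powr (- \<delta>) = 1" using L by (simp add: powr_add[symmetric])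
        ultimately show "(1 + \<bar>t - y\<bar>) powr (- \<delta>) \<le> (1 + L) powr \<delta> * (1 + \<bar>t\<bar>) powr (- \<delta>)"
          by (simp only: mult.assoc[symmetric] mult_1_left)
      qed
      then have "ennreal (C * (1 + \<bar>t - y\<bar>) powr (- \<delta>)) \<le> ennreal (k t)" by (rule ennreal_leI)
      then show ?thesis unfolding eq1 eq2
        using y by (intro order_trans[OF slice[OF _ i\<phi> sup]] mult_right_mono) auto
    qed
    have dec: "AE t in lborel. (\<integral>\<^sup>+w. ennreal ((norm (c (w + t *\<^sub>R e)))\<^sup>2) \<partial>?H) \<le> ennreal (2 * L * k t) * X"
      using convs
    proof eventually_elim
      case (elim t)
      show ?case unfolding c_def X_def
        by (rule convolution_slice_bound[OF e hm f supp L elim kb k0])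
    qed
    have "(\<integral>\<^sup>+x. ennreal ((1 + norm x) powr (2 * \<delta> - 2)) * ennreal ((norm (c x))\<^sup>2) \<partial>lborel) =
      (\<integral>\<^sup>+t. (\<integral>\<^sup>+w. ennreal ((1 + norm (w + t *\<^sub>R e)) powr (2 * \<delta> - 2)) * ennreal ((norm (c (w + t *\<^sub>R e)))\<^sup>2) \<partial>?H) \<partial>lborel)"
      by (rule nn_integral_slices[OF e]) simp
    also have "\<dots> \<le> (\<integral>\<^sup>+t. ennreal (2 * L * C * (1 + L) powr \<delta>) * X * ennreal ((1 + \<bar>t\<bar>) powr (- (2 - \<delta>))) \<partial>lborel)"
    proof (rule nn_integral_mono_AE, use dec in eventually_elim)
      case (elim t)
      have "(\<integral>\<^sup>+w. ennreal ((1 + norm (w + t *\<^sub>R e)) powr (2 * \<delta> - 2)) * ennreal ((norm (c (w + t *\<^sub>R e)))\<^sup>2) \<partial>?H) \<le>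
        (\<integral>\<^sup>+w. ennreal ((1 + \<bar>t\<bar>) powr (2 * \<delta> - 2)) * ennreal ((norm (c (w + t *\<^sub>R e)))\<^sup>2) \<partial>?H)"
      proof (rule nn_integral_mono_AE, use orth in eventually_elim)
        case (elim w)
        then show ?case using tn[of w t] \<delta>
          by (intro mult_right_mono ennreal_leI powr_mono2') auto
      qed
      also have "\<dots> = ennreal ((1 + \<bar>t\<bar>) powr (2 * \<delta> - 2)) * (\<integral>\<^sup>+w. ennreal ((norm (c (w + t *\<^sub>R e)))\<^sup>2) \<partial>?H)"
        by (rule nn_integral_cmult) simp
      also have "\<dots> \<le> ennreal ((1 + \<bar>t\<bar>) powr (2 * \<delta> - 2)) * (ennreal (2 * L * k t) * X)"
        by (intro mult_left_mono elim) simp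
      also have "\<dots> = ennreal ((1 + \<bar>t\<bar>) powr (2 * \<delta> - 2) * (2 * L * k t)) * X"
        using L k0[of t] by (subst ennreal_mult) (auto simp: mult.assoc)
      also have "(1 + \<bar>t\<bar>) powr (2 * \<delta> - 2) * (2 * L * k t) = 2 * L * C * (1 + L) powr \<delta> * ((1 + \<bar>t\<bar>) powr (2 * \<delta> - 2) * (1 + \<bar>t\<bar>) powr (- \<delta>))"
        by (simp add: k_def mult_ac)
      also have "(1 + \<bar>t\<bar>) powr (2 * \<delta> - 2) * (1 + \<bar>t\<bar>) powr (- \<delta>) = (1 + \<bar>t\<bar>) powr (- (2 - \<delta>))"
        by (simp add: powr_add[symmetric])
      also have "ennreal (2 * L * C * (1 + L) powr \<delta> * (1 + \<bar>t\<bar>) powr (- (2 - \<delta>))) * X =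
          ennreal (2 * L * C * (1 + L) powr \<delta>) * X * ennreal ((1 + \<bar>t\<bar>) powr (- (2 - \<delta>)))"
        using L C by (subst ennreal_mult) (auto simp: mult_ac)
      finally show ?case .
    qed
    also have "\<dots> = ennreal (2 * L * C * (1 + L) powr \<delta>) * X * (\<integral>\<^sup>+t. ennreal ((1 + \<bar>t\<bar>) powr (- (2 - \<delta>))) \<partial>lborel)"
      by (rule nn_integral_cmult) simp
    also have "(\<integral>\<^sup>+t. ennreal ((1 + \<bar>t\<bar>) powr (- (2 - \<delta>))) \<partial>lborel) = ennreal (\<integral>t. (1 + \<bar>t\<bar>) powr (- (2 - \<delta>)) \<partial>lborel)"
      using \<delta> by (intro nn_integral_eq_integral integrable_weight_powr) auto
    also have "ennreal (2 * L * C * (1 + L) powr \<delta>) * X * ennreal (\<integral>t. (1 + \<bar>t\<bar>) powr (- (2 - \<delta>)) \<partial>lborel) < \<infinity>"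
      using f2 unfolding X_def by (simp add: ennreal_mult_less_top)
    finally show ?thesis unfolding c_def .
  qed
qed

section \<open>Functions annihilated by all Gaussians\<close>

lemma integral_lborel_dilate:
  fixes f :: "'a::euclidean_space \<Rightarrow> real"
  assumes [measurable]: "f \<in> borel_measurable borel" and "c > 0"
  shows "(\<integral>x. f x \<partial>lborel) = c ^ DIM('a) * (\<integral>x. f (c *\<^sub>R x) \<partial>lborel)"
  using \<open>c > 0\<close>
  by (subst lborel_affine[of c 0])
     (simp_all add: integral_density integral_distr)

text \<open>
  Integrating the hypothesis over the centres \<open>y\<close> in a box shows that \<open>d\<close> is orthogonal to the
  mollified indicator of the box. The mollified indicators converge off the frontier of the box, so
  \<open>d\<close> has integral 0 over every box. The positive and the negative part of \<open>d\<close> therefore define the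
  same measure.
\<close>

lemma AE_eq_0_of_gaussians_real:
  fixes d :: "'a::euclidean_space \<Rightarrow> real"
  assumes d: "integrable lborel d"
    and gauss: "\<And>k y. k > 0 \<Longrightarrow> (\<integral>x. d x * exp (- k * (norm (x - y))\<^sup>2) \<partial>lborel) = 0"
  shows "AE x in lborel. d x = 0"
proof -
  have [measurable]: "d \<in> borel_measurable borel" using d by auto
  let ?\<gamma> = "\<lambda>z::'a. exp (- 1 * (norm z)\<^sup>2)"
  have i\<gamma>: "integrable lborel ?\<gamma>" and v\<gamma>: "(\<integral>z. ?\<gamma> z \<partial>lborel) = sqrt (pi / 1) ^ DIM('a)"
  proof -
    have i: "integrable lborel (\<lambda>v::'a. complex_of_real (?\<gamma> v))"
      and v: "(\<integral>v. complex_of_real (?\<gamma> v) \<partial>lborel) = of_real (sqrt (pi / 1) ^ DIM('a))"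
      using gaussian_lborel[of 1 "0::'a"] by simp_all
    show "integrable lborel ?\<gamma>" using integrable_Re[OF i] by simp
    show "(\<integral>z. ?\<gamma> z \<partial>lborel) = sqrt (pi / 1) ^ DIM('a)"
      using v unfolding integral_complex_of_real of_real_eq_iff .
  qed
  have box0: "(\<integral>x. d x * indicator (box a b) x \<partial>lborel) = 0" for a b :: 'a
  proof -
    let ?I = "\<lambda>y. indicator (box a b) y :: real"
    define m where "m = (\<lambda>(j::nat) x. \<integral>z. ?I (x + (1 / real (Suc j)) *\<^sub>R z) * ?\<gamma> z \<partial>lborel)"
    have zero: "(\<integral>x. d x * m j x \<partial>lborel) = 0" for j
    proof -
      define c where "c = real (Suc j)"
      have c: "c > 0" by (simp add: c_def)
      have m: "m j x = c ^ DIM('a) * (\<integral>y. ?I y * exp (- c\<^sup>2 * (norm (y - x))\<^sup>2) \<partial>lborel)" for x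
      proof -
        have "m j x = c ^ DIM('a) * (\<integral>z. ?I (x + (1 / c) *\<^sub>R (c *\<^sub>R z)) * ?\<gamma> (c *\<^sub>R z) \<partial>lborel)"
          unfolding m_def c_def[symmetric] by (rule integral_lborel_dilate[OF _ c]) measurable
        also have "(\<integral>z. ?I (x + (1 / c) *\<^sub>R (c *\<^sub>R z)) * ?\<gamma> (c *\<^sub>R z) \<partial>lborel) =
          (\<integral>z. ?I (z + x) * exp (- c\<^sup>2 * (norm ((z + x) - x))\<^sup>2) \<partial>lborel)"
          using c by (intro Bochner_Integration.integral_cong refl) (simp add: power_mult_distrib add.commute)
        also have "\<dots> = (\<integral>y. ?I y * exp (- c\<^sup>2 * (norm (y - x))\<^sup>2) \<partial>lborel)"
          by (rule integral_lborel_translate[of "\<lambda>y. ?I y * exp (- c\<^sup>2 * (norm (y - x))\<^sup>2)"]) measurable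
        finally show ?thesis .
      qed
      have bfin: "emeasure lborel (box a b) < \<infinity>"
        using emeasure_bounded_finite[OF bounded_box[of a b]] by (simp add: less_top)
      have int: "integrable (lborel \<Otimes>\<^sub>M lborel) (\<lambda>(x, y). d x * (?I y * exp (- c\<^sup>2 * (norm (y - x))\<^sup>2)))"
      proof (rule lborel_pair.integrable_pair_product_bound[where a="\<lambda>x. \<bar>d x\<bar>" and b="?I"])
        show "integrable lborel ?I" using bfin by (intro integrable_real_indicator) auto
        show "norm (case (x, y) of (x, y) \<Rightarrow> d x * (?I y * exp (- c\<^sup>2 * (norm (y - x))\<^sup>2))) \<le> \<bar>d x\<bar> * ?I y" for x y
        proof -
          have "exp (- c\<^sup>2 * (norm (y - x))\<^sup>2) \<le> 1" by simp
          then have "\<bar>d x\<bar> * (?I y * exp (- c\<^sup>2 * (norm (y - x))\<^sup>2)) \<le> \<bar>d x\<bar> * (?I y * 1)"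
            by (intro mult_left_mono) auto
          then show ?thesis by (simp add: abs_mult)
        qed
      qed (use d in auto)
      have "(\<integral>x. d x * m j x \<partial>lborel) = c ^ DIM('a) * (\<integral>x. (\<integral>y. d x * (?I y * exp (- c\<^sup>2 * (norm (y - x))\<^sup>2)) \<partial>lborel) \<partial>lborel)"
        unfolding m by (simp add: mult.left_commute[of "d _" "c ^ _"])
      also have "(\<integral>x. (\<integral>y. d x * (?I y * exp (- c\<^sup>2 * (norm (y - x))\<^sup>2)) \<partial>lborel) \<partial>lborel) =
        (\<integral>y. (\<integral>x. d x * (?I y * exp (- c\<^sup>2 * (norm (y - x))\<^sup>2)) \<partial>lborel) \<partial>lborel)"
        by (rule lborel_pair.Fubini_integral[OF int, symmetric])
      also have "\<dots> = (\<integral>y. ?I y * (\<integral>x. d x * exp (- c\<^sup>2 * (norm (x - y))\<^sup>2) \<partial>lborel) \<partial>lborel)"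
        unfolding integral_mult_right_zero[symmetric] by (simp only: mult_ac norm_minus_commute)
      also have "\<dots> = 0" using gauss[of "c\<^sup>2"] c by simp
      finally show ?thesis by simp
    qed
    have "(\<lambda>j. \<integral>x. d x * m j x \<partial>lborel) \<longlonglongrightarrow> (\<integral>x. d x * (?I x * sqrt (pi / 1) ^ DIM('a)) \<partial>lborel)"
    proof (rule integral_dominated_convergence[where w="\<lambda>x. \<bar>d x\<bar> * sqrt (pi / 1) ^ DIM('a)"])
      have mm[measurable]: "m j \<in> borel_measurable borel" for j unfolding m_def by measurable
      show "(\<lambda>x. d x * m j x) \<in> borel_measurable lborel" for j by simp
      show "AE x in lborel. norm (d x * m j x) \<le> \<bar>d x\<bar> * sqrt (pi / 1) ^ DIM('a)" for j
      proof (rule AE_I2)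
        fix x :: 'a
        have "norm (m j x) \<le> (\<integral>z. ?\<gamma> z \<partial>lborel)"
          unfolding m_def
        proof (rule order_trans[OF integral_norm_bound], rule integral_mono)
          show "integrable lborel (\<lambda>z. norm (?I (x + (1 / real (Suc j)) *\<^sub>R z) * ?\<gamma> z))"
            by (intro integrable_norm integrable_mult_bounded[OF i\<gamma>, where B=1]) (auto simp: indicator_def)
        qed (use i\<gamma> in \<open>auto simp: indicator_def\<close>)
        then show "norm (d x * m j x) \<le> \<bar>d x\<bar> * sqrt (pi / 1) ^ DIM('a)"
          unfolding v\<gamma> real_norm_def abs_mult by (rule mult_left_mono) simp
      qed
      have "AE x in lborel. x \<notin> frontier (box a b)"
      proof -
        have "frontier (box a b) \<in> null_sets lborel"
          using negligible_convex_frontier[OF convex_box(2)[of a b]]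
          by (subst (asm) negligible_iff_null_sets) (auto simp: null_sets_completion_iff)
        then show ?thesis by (rule AE_I') auto
      qed
      then show "AE x in lborel. (\<lambda>j. d x * m j x) \<longlonglongrightarrow> d x * (?I x * sqrt (pi / 1) ^ DIM('a))"
      proof eventually_elim
        case (elim x)
        have "(\<lambda>j. m j x) \<longlonglongrightarrow> (\<integral>z. ?I x * ?\<gamma> z \<partial>lborel)"
          unfolding m_def
        proof (rule integral_dominated_convergence[where w="?\<gamma>"])
          show "AE z in lborel. (\<lambda>j. ?I (x + (1 / real (Suc j)) *\<^sub>R z) * ?\<gamma> z) \<longlonglongrightarrow> ?I x * ?\<gamma> z"
          proof (rule AE_I2)
            fix z :: 'a
            have "(\<lambda>j. x + (1 / real (Suc j)) *\<^sub>R z) \<longlonglongrightarrow> x + 0 *\<^sub>R z"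
              by (intro tendsto_intros LIMSEQ_Suc[OF lim_1_over_n])
            then have lim: "(\<lambda>j. x + (1 / real (Suc j)) *\<^sub>R z) \<longlonglongrightarrow> x" by simp
            have "eventually (\<lambda>j. ?I (x + (1 / real (Suc j)) *\<^sub>R z) = ?I x) sequentially"
            proof (cases "x \<in> box a b")
              case True
              have "eventually (\<lambda>j. x + (1 / real (Suc j)) *\<^sub>R z \<in> box a b) sequentially"
                by (rule topological_tendstoD[OF lim open_box True])
              then show ?thesis by eventually_elim (use True in simp)
            next
              case False
              then have "x \<notin> closure (box a b)" using elim interior_subset[of "box a b"] by (auto simp: frontier_def)
              then have x: "x \<in> - closure (box a b)" by simp
              have "eventually (\<lambda>j. x + (1 / real (Suc j)) *\<^sub>R z \<in> - closure (box a b)) sequentially"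
                by (rule topological_tendstoD[OF lim _ x]) (simp add: open_Compl)
              then show ?thesis
              proof eventually_elim
                case (elim j)
                then have nb: "x + (1 / real (Suc j)) *\<^sub>R z \<notin> box a b" using closure_subset by blast
                show ?case unfolding indicator_simps(2)[OF nb] indicator_simps(2)[OF False] by (rule refl)
              qed
            qed
            then have "(\<lambda>j. ?I (x + (1 / real (Suc j)) *\<^sub>R z)) \<longlonglongrightarrow> ?I x" by (rule tendsto_eventually)
            then show "(\<lambda>j. ?I (x + (1 / real (Suc j)) *\<^sub>R z) * ?\<gamma> z) \<longlonglongrightarrow> ?I x * ?\<gamma> z" by (rule tendsto_mult_right)
          qed
        qed (use i\<gamma> in \<open>auto simp: indicator_def\<close>)
        then have "(\<lambda>j. m j x) \<longlonglongrightarrow> ?I x * sqrt (pi / 1) ^ DIM('a)"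
          by (simp only: integral_mult_right_zero v\<gamma>)
        then show ?case by (rule tendsto_mult_left)
      qed
      show "integrable lborel (\<lambda>x. \<bar>d x\<bar> * sqrt (pi / 1) ^ DIM('a))"
        by (intro integrable_mult_left integrable_abs d)
    qed simp
    then have "(\<integral>x. d x * (?I x * sqrt (pi / 1) ^ DIM('a)) \<partial>lborel) = 0"
      unfolding zero by (simp add: LIMSEQ_const_iff)
    then have "(\<integral>x. d x * ?I x \<partial>lborel) * sqrt (pi / 1) ^ DIM('a) = 0"
      by (simp only: integral_mult_left_zero[symmetric] mult.assoc)
    then show ?thesis by simp
  qed
  let ?p = "\<lambda>x. ennreal (d x)" and ?n = "\<lambda>x. ennreal (- d x)"
  have fin: "(\<integral>\<^sup>+x. ?p x \<partial>lborel) < \<infinity>" "(\<integral>\<^sup>+x. ?n x \<partial>lborel) < \<infinity>"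
    using d unfolding real_integrable_def by (auto simp: less_top)
  have eqb: "emeasure (density lborel ?p) (box a b) = emeasure (density lborel ?n) (box a b)" for a b :: 'a
  proof -
    let ?f = "\<lambda>x. d x * indicator (box a b) x"
    have i: "integrable lborel ?f" using d by (intro integrable_real_mult_indicator) auto
    have eq: "emeasure (density lborel ?p) (box a b) = (\<integral>\<^sup>+x. ennreal (?f x) \<partial>lborel)"
      "emeasure (density lborel ?n) (box a b) = (\<integral>\<^sup>+x. ennreal (- ?f x) \<partial>lborel)"
      by (auto simp: emeasure_density intro!: nn_integral_cong split: split_indicator)
    have fin: "(\<integral>\<^sup>+x. ennreal (?f x) \<partial>lborel) < \<top>" "(\<integral>\<^sup>+x. ennreal (- ?f x) \<partial>lborel) < \<top>"
      using i unfolding real_integrable_def by (auto simp: less_top)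
    have "enn2real (\<integral>\<^sup>+x. ennreal (?f x) \<partial>lborel) = enn2real (\<integral>\<^sup>+x. ennreal (- ?f x) \<partial>lborel)"
      using real_lebesgue_integral_def[OF i] box0[of a b] by simp
    then have "ennreal (enn2real (\<integral>\<^sup>+x. ennreal (?f x) \<partial>lborel)) = ennreal (enn2real (\<integral>\<^sup>+x. ennreal (- ?f x) \<partial>lborel))"
      by (rule arg_cong)
    then show ?thesis unfolding eq ennreal_enn2real[OF fin(1)] ennreal_enn2real[OF fin(2)] .
  qed
  have "density lborel ?p = density lborel ?n"
  proof (rule measure_eqI_generator_eq[where E="range (\<lambda>(a, b). box a b :: 'a set)" and \<Omega>=UNIV and
        A="\<lambda>k. box (- (real k *\<^sub>R One)) (real k *\<^sub>R One)"])
    show "Int_stable (range (\<lambda>(a, b). box a b :: 'a set))"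
      by (auto simp: Int_stable_def box_Int_box)
    show "emeasure (density lborel ?p) (box (- (real k *\<^sub>R One)) (real k *\<^sub>R One)) \<noteq> \<infinity>" for k
    proof -
      have "emeasure (density lborel ?p) (box (- (real k *\<^sub>R One)) (real k *\<^sub>R One)) \<le> (\<integral>\<^sup>+x. ?p x \<partial>lborel)"
        by (subst emeasure_density) (auto intro!: nn_integral_mono simp: indicator_def)
      then show ?thesis using fin(1) by (auto simp: less_top dest: le_less_trans)
    qed
    show "(\<Union>k. box (- (real k *\<^sub>R One)) (real k *\<^sub>R One)) = (UNIV :: 'a set)" by (rule UN_box_eq_UNIV)
    show "sets (density lborel ?p) = sigma_sets UNIV (range (\<lambda>(a, b). box a b))"
      by (simp add: borel_eq_box)
    show "sets (density lborel ?n) = sigma_sets UNIV (range (\<lambda>(a, b). box a b))"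
      by (simp add: borel_eq_box)
  qed (use eqb in auto)
  then have "AE x in lborel. ?p x = ?n x"
    by (subst (asm) sigma_finite_measure.density_unique_iff[OF sigma_finite_lborel]) simp_all
  then show ?thesis
  proof eventually_elim
    case (elim x)
    show ?case
    proof (rule ccontr)
      assume "d x \<noteq> 0"
      then consider "d x > 0" | "d x < 0" by linarith
      then show False using elim by cases (simp_all add: ennreal_neg ennreal_eq_0_iff)
    qed
  qed
qed

lemma AE_eq_0_of_gaussians:
  fixes d :: "'a::euclidean_space \<Rightarrow> complex"
  assumes d: "integrable lborel d"
    and gauss: "\<And>k y. k > 0 \<Longrightarrow> (\<integral>x. d x * of_real (exp (- k * (norm (x - y))\<^sup>2)) \<partial>lborel) = 0"
  shows "AE x in lborel. d x = 0"
proof -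
  have i: "integrable lborel (\<lambda>x. d x * of_real (exp (- k * (norm (x - y))\<^sup>2)))" if "k > 0" for k y
  proof (subst mult.commute, rule integrable_mult_bounded[OF d, where B=1])
    show "(\<lambda>x. complex_of_real (exp (- k * (norm (x - y))\<^sup>2))) \<in> borel_measurable lborel" by simp
    show "norm (complex_of_real (exp (- k * (norm (x - y))\<^sup>2))) \<le> 1" for x using that by simp
  qed
  have "AE x in lborel. Re (d x) = 0"
  proof (rule AE_eq_0_of_gaussians_real)
    show "integrable lborel (\<lambda>x. Re (d x))" using d by simp
    show "(\<integral>x. Re (d x) * exp (- k * (norm (x - y))\<^sup>2) \<partial>lborel) = 0" if "k > 0" for k y
      using integral_Re[OF i[OF that, of y]] gauss[OF that, of y] by simp
  qed
  moreover have "AE x in lborel. Im (d x) = 0"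
  proof (rule AE_eq_0_of_gaussians_real)
    show "integrable lborel (\<lambda>x. Im (d x))" using d by simp
    show "(\<integral>x. Im (d x) * exp (- k * (norm (x - y))\<^sup>2) \<partial>lborel) = 0" if "k > 0" for k y
      using integral_Im[OF i[OF that, of y]] gauss[OF that, of y] by simp
  qed
  ultimately show ?thesis by eventually_elim (simp add: complex_eq_iff)
qed

section \<open>Schwartz functions\<close>

lemma partials_append: "partials is (partials js f) = partials (is @ js) f"
  by (induction "is") auto

lemma schwartz_partial:
  assumes "schwartz f"
  shows "schwartz (partial i f)"
proof -
  have eq: "partials is (partial i f) = partials (is @ [i]) f" for "is"
    using partials_append[of "is" "[i]" f] by simp
  show ?thesis
    using assms unfolding schwartz_def smooth_def eq by blast
qed

lemma schwartz_differentiable: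
  assumes "schwartz f"
  shows "f differentiable (at x)"
  using assms unfolding schwartz_def smooth_def by (metis partials.simps(1))

lemma schwartz_continuous:
  assumes "schwartz f"
  shows "continuous_on UNIV f"
  using schwartz_differentiable[OF assms]
  by (intro continuous_at_imp_continuous_on ballI differentiable_imp_continuous_within)

lemma schwartz_measurable:
  assumes "schwartz f"
  shows "f \<in> borel_measurable borel"
  by (intro borel_measurable_continuous_onI schwartz_continuous assms)

lemma japanese_ge:
  "japanese x \<ge> 1" "1 + norm x \<le> 2 * japanese x"
proof -
  show 1: "japanese x \<ge> 1" by (simp add: japanese_def)
  have "norm x \<le> japanese x" unfolding japanese_def by (rule real_le_rsqrt) simp
  with 1 show "1 + norm x \<le> 2 * japanese x" by simp
qed

lemma japanese_le: "japanese x \<le> 1 + norm x"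
  unfolding japanese_def by (rule real_le_lsqrt) (auto simp: power2_eq_square algebra_simps)

lemma schwartz_rapidly_decreasing:
  fixes f :: "real ^ 'n \<Rightarrow> complex"
  assumes "schwartz f"
  shows "rapidly_decreasing f"
  unfolding rapidly_decreasing_def
proof (intro allI)
  fix N
  obtain C where C: "\<And>x. japanese x ^ N * cmod (f x) \<le> C"
    using assms unfolding schwartz_def by (metis partials.simps(1))
  show "\<exists>C. \<forall>x. norm (f x) \<le> C / (1 + norm x) ^ N"
  proof (intro exI allI)
    fix x :: "real ^ 'n"
    have le: "(1 + norm x) ^ N \<le> (2 * japanese x) ^ N" using japanese_ge by (intro power_mono) auto
    have "(1 + norm x) ^ N * norm (f x) \<le> 2 ^ N * (japanese x ^ N * norm (f x))"
      using mult_right_mono[OF le norm_ge_zero[of "f x"]] by (simp add: power_mult_distrib mult.assoc)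
    also have "\<dots> \<le> 2 ^ N * C" using C by (intro mult_left_mono) auto
    finally have "(1 + norm x) ^ N * norm (f x) \<le> 2 ^ N * C" .
    moreover have "(1 + norm x) ^ N > 0" by (intro zero_less_power add_pos_nonneg) auto
    ultimately show "norm (f x) \<le> (2 ^ N * C) / (1 + norm x) ^ N"
      by (simp add: pos_le_divide_eq mult.commute)
  qed
qed

lemma schwartz_integrable:
  assumes "schwartz f"
  shows "integrable lborel f"
  by (intro rapidly_decreasing_integrable schwartz_rapidly_decreasing schwartz_measurable assms)

text \<open>
  Integration by parts without boundary terms: the integral of \<open>F (x + v) - F x\<close> is 0 by translation
  invariance, and this difference is the integral of \<open>D\<close> over the segment from \<open>x\<close> to \<open>x + v\<close>.
\<close>

lemma integral_directional_derivative_eq_0: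
  fixes F D :: "'a::euclidean_space \<Rightarrow> complex" and v :: 'a
  assumes deriv: "\<And>x t. ((\<lambda>t. F (x + t *\<^sub>R v)) has_vector_derivative D (x + t *\<^sub>R v)) (at t)"
    and cont: "continuous_on UNIV D" and F: "integrable lborel F" and D: "integrable lborel D"
  shows "(\<integral>x. D x \<partial>lborel) = 0"
proof -
  have [measurable]: "F \<in> borel_measurable borel" "D \<in> borel_measurable borel" using F D by auto
  let ?G = "\<lambda>(t::real) x. indicator {0..1} t *\<^sub>R D (x + t *\<^sub>R v)"
  have int: "integrable (lborel \<Otimes>\<^sub>M lborel) (case_prod ?G)"
  proof (rule integrableI_bounded)
    have "(\<integral>\<^sup>+p. ennreal (norm (case_prod ?G p)) \<partial>(lborel \<Otimes>\<^sub>M lborel)) = (\<integral>\<^sup>+t. (\<integral>\<^sup>+x. ennreal (norm (?G t x)) \<partial>lborel) \<partial>lborel)"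
      by (subst lborel.nn_integral_fst[symmetric]) simp_all
    also have "\<dots> = (\<integral>\<^sup>+t. (\<integral>\<^sup>+x. ennreal (norm (D x)) \<partial>lborel) * indicator {0..1::real} t \<partial>lborel)"
    proof (rule nn_integral_cong)
      fix t :: real
      have "(\<integral>\<^sup>+x. ennreal (norm (D (x + t *\<^sub>R v))) \<partial>lborel) = (\<integral>\<^sup>+x. ennreal (norm (D x)) \<partial>lborel)"
        by (rule nn_integral_lborel_translate) simp
      then show "(\<integral>\<^sup>+x. ennreal (norm (?G t x)) \<partial>lborel) = (\<integral>\<^sup>+x. ennreal (norm (D x)) \<partial>lborel) * indicator {0..1::real} t"
        by (simp add: indicator_def)
    qed
    also have "\<dots> = (\<integral>\<^sup>+x. ennreal (norm (D x)) \<partial>lborel)"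
      by (subst nn_integral_cmult_indicator) auto
    also have "\<dots> < \<infinity>" using D by (simp add: integrable_iff_bounded)
    finally show "(\<integral>\<^sup>+p. ennreal (norm (case_prod ?G p)) \<partial>(lborel \<Otimes>\<^sub>M lborel)) < \<infinity>" .
  qed (simp add: case_prod_unfold)
  have "(\<integral>t. (\<integral>x. ?G t x \<partial>lborel) \<partial>lborel) = (\<integral>t. indicator {0..1::real} t *\<^sub>R (\<integral>x. D x \<partial>lborel) \<partial>lborel)"
    using integral_lborel_translate[of D] by (intro Bochner_Integration.integral_cong) simp_all
  also have "\<dots> = (\<integral>x. D x \<partial>lborel)"
    by (subst integral_scaleR_left) (auto intro!: integrable_real_indicator)
  finally have "(\<integral>x. D x \<partial>lborel) = (\<integral>t. (\<integral>x. ?G t x \<partial>lborel) \<partial>lborel)" by simp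
  also have "\<dots> = (\<integral>x. (\<integral>t. ?G t x \<partial>lborel) \<partial>lborel)"
    by (rule lborel_pair.Fubini_integral[OF int, symmetric])
  also have "\<dots> = (\<integral>x. F (x + v) - F x \<partial>lborel)"
  proof (intro Bochner_Integration.integral_cong refl)
    fix x
    have "(\<integral>t. ?G t x \<partial>lborel) = F (x + 1 *\<^sub>R v) - F (x + 0 *\<^sub>R v)"
    proof (rule integral_FTC_Icc)
      show "((\<lambda>t. F (x + t *\<^sub>R v)) has_vector_derivative D (x + t *\<^sub>R v)) (at t within {0..1})" for t
        by (rule has_vector_derivative_at_within[OF deriv])
      show "continuous_on {0..1} (\<lambda>t. D (x + t *\<^sub>R v))"
        by (rule continuous_on_compose2[OF cont]) (auto intro!: continuous_intros)
    qed simp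
    then show "(\<integral>t. ?G t x \<partial>lborel) = F (x + v) - F x" by simp
  qed
  also have "\<dots> = (\<integral>x. F (x + v) \<partial>lborel) - (\<integral>x. F x \<partial>lborel)"
    by (intro Bochner_Integration.integral_diff integrable_lborel_translate F)
  also have "\<dots> = 0" by (simp add: integral_lborel_translate)
  finally show ?thesis .
qed

lemma partial_has_vector_derivative:
  fixes f :: "real ^ 'n \<Rightarrow> complex"
  assumes "\<And>x. f differentiable (at x)"
  shows "((\<lambda>t. f (x + t *\<^sub>R axis i 1)) has_vector_derivative partial i f (x + t *\<^sub>R axis i 1)) (at t)"
proof -
  let ?y = "x + t *\<^sub>R axis i 1"
  have f: "(f has_derivative frechet_derivative f (at ?y)) (at ?y)"
    using assms by (simp add: frechet_derivative_works)
  have "((\<lambda>t. x + t *\<^sub>R axis i 1) has_derivative (\<lambda>h. h *\<^sub>R axis i 1)) (at t)"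
    by (auto intro!: derivative_eq_intros)
  from has_derivative_compose[OF this f]
  have "((\<lambda>t. f (x + t *\<^sub>R axis i 1)) has_derivative (\<lambda>h. frechet_derivative f (at ?y) (h *\<^sub>R axis i 1))) (at t)" .
  moreover have "(\<lambda>h. frechet_derivative f (at ?y) (h *\<^sub>R axis i 1)) = (\<lambda>h. h *\<^sub>R partial i f ?y)"
    using linear_frechet_derivative[OF assms] by (auto simp: partial_def linear_cmul)
  ultimately show ?thesis by (simp add: has_vector_derivative_def)
qed

lemma cis_has_vector_derivative:
  "((\<lambda>t. cis ((x + t *\<^sub>R v) \<bullet> \<xi>)) has_vector_derivative \<i> * of_real (v \<bullet> \<xi>) * cis ((x + t *\<^sub>R v) \<bullet> \<xi>)) (at t)"
proof -
  have "((\<lambda>z. exp (\<i> * (of_real (x \<bullet> \<xi>) + z * of_real (v \<bullet> \<xi>)))) has_field_derivative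
     \<i> * of_real (v \<bullet> \<xi>) * exp (\<i> * (of_real (x \<bullet> \<xi>) + of_real t * of_real (v \<bullet> \<xi>)))) (at (of_real t))"
    by (auto intro!: derivative_eq_intros)
  from has_vector_derivative_real_field[OF this]
  show ?thesis by (simp add: cis_conv_exp inner_add_left)
qed

lemma fourier_partial:
  fixes f :: "real ^ 'n \<Rightarrow> complex"
  assumes f: "schwartz f"
  shows "norm (\<integral>x. cis (x \<bullet> \<xi>) * partial i f x \<partial>lborel) = \<bar>\<xi> $ i\<bar> * norm (\<integral>x. cis (x \<bullet> \<xi>) * f x \<partial>lborel)"
proof -
  let ?v = "axis i 1 :: real ^ 'n"
  note p = schwartz_partial[OF f, of i]
  let ?A = "\<lambda>x. \<i> * of_real (?v \<bullet> \<xi>) * (cis (x \<bullet> \<xi>) * f x)" and ?B = "\<lambda>x. cis (x \<bullet> \<xi>) * partial i f x"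
  have iA: "integrable lborel ?A" by (intro integrable_mult_right integrable_cis_mult schwartz_integrable f) simp
  have iB: "integrable lborel ?B" by (intro integrable_cis_mult schwartz_integrable p) simp
  have "(\<integral>x. ?A x + ?B x \<partial>lborel) = 0"
  proof (rule integral_directional_derivative_eq_0[where v="?v" and F="\<lambda>x. cis (x \<bullet> \<xi>) * f x"])
    show "((\<lambda>t. cis ((x + t *\<^sub>R ?v) \<bullet> \<xi>) * f (x + t *\<^sub>R ?v)) has_vector_derivative ?A (x + t *\<^sub>R ?v) + ?B (x + t *\<^sub>R ?v)) (at t)" for x t
      using has_vector_derivative_mult[OF cis_has_vector_derivative[of x ?v \<xi> t]
          partial_has_vector_derivative[OF schwartz_differentiable[OF f], of x i t]]
      by (simp add: mult_ac add.commute)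
    show "continuous_on UNIV (\<lambda>x. ?A x + ?B x)"
      by (intro continuous_intros schwartz_continuous f p)
    show "integrable lborel (\<lambda>x. cis (x \<bullet> \<xi>) * f x)" by (intro integrable_cis_mult schwartz_integrable f) simp
    show "integrable lborel (\<lambda>x. ?A x + ?B x)" by (intro Bochner_Integration.integrable_add iA iB)
  qed
  then have "(\<integral>x. ?B x \<partial>lborel) = - (\<integral>x. ?A x \<partial>lborel)"
    unfolding Bochner_Integration.integral_add[OF iA iB] by (simp add: eq_neg_iff_add_eq_0 add.commute)
  also have "(\<integral>x. ?A x \<partial>lborel) = \<i> * of_real (?v \<bullet> \<xi>) * (\<integral>x. cis (x \<bullet> \<xi>) * f x \<partial>lborel)"
    by (rule integral_mult_right_zero)
  finally have eq: "(\<integral>x. ?B x \<partial>lborel) = - (\<i> * of_real (?v \<bullet> \<xi>) * (\<integral>x. cis (x \<bullet> \<xi>) * f x \<partial>lborel))" .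
  show ?thesis unfolding eq by (simp add: norm_mult inner_axis inner_commute)
qed

lemma fourier_schwartz_rapidly_decreasing:
  fixes f :: "real ^ 'n \<Rightarrow> complex"
  assumes f: "schwartz f"
  shows "rapidly_decreasing (\<lambda>\<xi>. \<integral>x. cis (x \<bullet> \<xi>) * f x \<partial>lborel)"
proof -
  have "\<exists>C. \<forall>\<xi>. (1 + norm \<xi>) ^ N * norm (\<integral>x. cis (x \<bullet> \<xi>) * f x \<partial>lborel) \<le> C" for N
    using f
  proof (induction N arbitrary: f)
    case 0
    have "norm (\<integral>x. cis (x \<bullet> \<xi>) * f x \<partial>lborel) \<le> (\<integral>x. norm (f x) \<partial>lborel)" for \<xi>
      using integral_norm_bound[of lborel "\<lambda>x. cis (x \<bullet> \<xi>) * f x"] by (simp add: norm_mult)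
    then show ?case by auto
  next
    case (Suc N)
    obtain C0 where C0: "\<And>\<xi>. (1 + norm \<xi>) ^ N * norm (\<integral>x. cis (x \<bullet> \<xi>) * f x \<partial>lborel) \<le> C0"
      using Suc.IH[OF Suc.prems] by blast
    have "\<forall>i. \<exists>C. \<forall>\<xi>. (1 + norm \<xi>) ^ N * norm (\<integral>x. cis (x \<bullet> \<xi>) * partial i f x \<partial>lborel) \<le> C"
      using Suc.IH[OF schwartz_partial[OF Suc.prems]] by blast
    then obtain C where C: "\<And>i \<xi>. (1 + norm \<xi>) ^ N * norm (\<integral>x. cis (x \<bullet> \<xi>) * partial i f x \<partial>lborel) \<le> C i"
      by metis
    show ?case
    proof (intro exI allI)
      fix \<xi> :: "real ^ 'n"
      let ?I = "norm (\<integral>x. cis (x \<bullet> \<xi>) * f x \<partial>lborel)"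
      have "1 + norm \<xi> \<le> 1 + (\<Sum>i\<in>UNIV. \<bar>\<xi> $ i\<bar>)" using norm_le_l1_cart[of \<xi>] by simp
      then have "(1 + norm \<xi>) * ((1 + norm \<xi>) ^ N * ?I) \<le> (1 + (\<Sum>i\<in>UNIV. \<bar>\<xi> $ i\<bar>)) * ((1 + norm \<xi>) ^ N * ?I)"
        by (rule mult_right_mono) simp
      also have "\<dots> = (1 + norm \<xi>) ^ N * ?I + (\<Sum>i\<in>UNIV. (1 + norm \<xi>) ^ N * (\<bar>\<xi> $ i\<bar> * ?I))"
        unfolding distrib_right mult_1_left sum_distrib_right by (simp only: mult_ac)
      also have "\<dots> \<le> C0 + (\<Sum>i\<in>UNIV. C i)"
        using C0 C unfolding fourier_partial[OF Suc.prems] by (intro add_mono sum_mono) auto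
      finally show "(1 + norm \<xi>) ^ Suc N * ?I \<le> C0 + (\<Sum>i\<in>UNIV. C i)" by (simp add: mult.assoc)
    qed
  qed
  then have *: "\<exists>C. \<forall>\<xi>. (1 + norm \<xi>) ^ N * norm (\<integral>x. cis (x \<bullet> \<xi>) * f x \<partial>lborel) \<le> C" for N .
  show ?thesis unfolding rapidly_decreasing_def
  proof (intro allI)
    fix N
    obtain C where C: "\<And>\<xi>. (1 + norm \<xi>) ^ N * norm (\<integral>x. cis (x \<bullet> \<xi>) * f x \<partial>lborel) \<le> C" using * by blast
    show "\<exists>C. \<forall>\<xi>. norm (\<integral>x. cis (x \<bullet> \<xi>) * f x \<partial>lborel) \<le> C / (1 + norm \<xi>) ^ N"
    proof (intro exI allI)
      fix \<xi> :: "real ^ 'n"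
      have "(1 + norm \<xi>) ^ N > 0" by (intro zero_less_power add_pos_nonneg) auto
      then show "norm (\<integral>x. cis (x \<bullet> \<xi>) * f x \<partial>lborel) \<le> C / (1 + norm \<xi>) ^ N"
        using C[of \<xi>] by (simp add: pos_le_divide_eq mult.commute)
    qed
  qed
qed

lemma real_polynomial_function_derivative:
  fixes p :: "'a::real_normed_vector \<Rightarrow> real"
  assumes "real_polynomial_function p"
  shows "\<exists>D. (\<forall>x. (p has_derivative D x) (at x)) \<and> (\<forall>v. real_polynomial_function (\<lambda>x. D x v))"
  using assms
proof induction
  case (linear f)
  then show ?case
    by (intro exI[of _ "\<lambda>x. f"]) (auto intro: bounded_linear_imp_has_derivative)
next
  case (const c)
  show ?case by (intro exI[of _ "\<lambda>x h. 0"]) auto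
next
  case (add f g)
  then obtain Df Dg where "\<forall>x. (f has_derivative Df x) (at x)" "\<forall>v. real_polynomial_function (\<lambda>x. Df x v)"
    "\<forall>x. (g has_derivative Dg x) (at x)" "\<forall>v. real_polynomial_function (\<lambda>x. Dg x v)" by blast
  then show ?case by (intro exI[of _ "\<lambda>x h. Df x h + Dg x h"]) (auto intro: has_derivative_add)
next
  case (mult f g)
  then obtain Df Dg where "\<forall>x. (f has_derivative Df x) (at x)" "\<forall>v. real_polynomial_function (\<lambda>x. Df x v)"
    "\<forall>x. (g has_derivative Dg x) (at x)" "\<forall>v. real_polynomial_function (\<lambda>x. Dg x v)" by blast
  then show ?case using mult(1,2)
    by (intro exI[of _ "\<lambda>x h. f x * Dg x h + Df x h * g x"] conjI allI has_derivative_mult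
        real_polynomial_function.intros(3) real_polynomial_function.intros(4)) blast+
qed

lemma real_polynomial_function_growth:
  fixes p :: "'a::real_normed_vector \<Rightarrow> real"
  assumes "real_polynomial_function p"
  shows "\<exists>C\<ge>0. \<exists>N. \<forall>x. \<bar>p x\<bar> \<le> C * (1 + norm x) ^ N"
  using assms
proof induction
  case (linear f)
  then obtain K where K: "K \<ge> 0" "\<And>x. norm (f x) \<le> norm x * K" using bounded_linear.nonneg_bounded by blast
  show ?case
  proof (intro exI[of _ K] conjI K exI[of _ 1] allI)
    fix x :: 'a
    have "norm x * K \<le> (1 + norm x) * K" using K by (intro mult_right_mono) auto
    then show "\<bar>f x\<bar> \<le> K * (1 + norm x) ^ 1" using K(2)[of x] by (simp add: mult.commute)
  qed
next
  case (const c)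
  show ?case by (intro exI[of _ "\<bar>c\<bar>"] conjI exI[of _ 0]) auto
next
  case (add f g)
  then obtain C N D M where C: "C \<ge> 0" "\<And>x. \<bar>f x\<bar> \<le> C * (1 + norm x) ^ N"
    and D: "D \<ge> 0" "\<And>x. \<bar>g x\<bar> \<le> D * (1 + norm x) ^ M" by blast
  show ?case
  proof (intro exI[of _ "C + D"] conjI exI[of _ "N + M"] allI)
    fix x :: 'a
    have "C * (1 + norm x) ^ N \<le> C * (1 + norm x) ^ (N + M)" "D * (1 + norm x) ^ M \<le> D * (1 + norm x) ^ (N + M)"
      using C D by (auto intro!: mult_left_mono power_increasing)
    then show "\<bar>f x + g x\<bar> \<le> (C + D) * (1 + norm x) ^ (N + M)"
      using C(2)[of x] D(2)[of x] unfolding distrib_right by linarith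
  qed (use C D in auto)
next
  case (mult f g)
  then obtain C N D M where C: "C \<ge> 0" "\<And>x. \<bar>f x\<bar> \<le> C * (1 + norm x) ^ N"
    and D: "D \<ge> 0" "\<And>x. \<bar>g x\<bar> \<le> D * (1 + norm x) ^ M" by blast
  show ?case
  proof (intro exI[of _ "C * D"] conjI exI[of _ "N + M"] allI)
    fix x :: 'a
    have "\<bar>f x\<bar> * \<bar>g x\<bar> \<le> (C * (1 + norm x) ^ N) * (D * (1 + norm x) ^ M)"
      using C D by (intro mult_mono) auto
    then show "\<bar>f x * g x\<bar> \<le> C * D * (1 + norm x) ^ (N + M)" by (simp add: abs_mult power_add mult_ac)
  qed (use C D in auto)
qed

text \<open>
  Every iterated partial derivative is a polynomial times the Gaussian. Real polynomial functions are
  closed under the operation \<open>p \<mapsto> \<partial>\<^sub>i p + p (b\<^sub>i - 2 \<alpha> x\<^sub>i)\<close> that a derivative performs on that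
  factor, and completing the square dominates the Gaussian by \<open>exp (- |x|)\<close>.
\<close>

lemma schwartz_gaussian:
  fixes b :: "real ^ 'n" and c :: real
  assumes \<alpha>: "\<alpha> > 0"
  shows "schwartz (\<lambda>x. of_real (c * exp (- \<alpha> * (x \<bullet> x) + x \<bullet> b)))"
proof -
  define G where "G = (\<lambda>x::real ^ 'n. exp (- \<alpha> * (x \<bullet> x) + x \<bullet> b))"
  have dG: "(G has_derivative (\<lambda>h. G x * (- 2 * \<alpha> * (x \<bullet> h) + h \<bullet> b))) (at x)" for x
    unfolding G_def by (auto intro!: derivative_eq_intros simp: inner_commute algebra_simps)
  \<comment> \<open>one partial derivative of a polynomial times the Gaussian\<close>
  have step: "(\<forall>x. (\<lambda>x. complex_of_real (p x * G x)) differentiable (at x)) \<and>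
      (\<exists>q. real_polynomial_function q \<and> partial i (\<lambda>x. complex_of_real (p x * G x)) = (\<lambda>x. complex_of_real (q x * G x)))"
    if p: "real_polynomial_function p" for p i
  proof -
    obtain D where D: "\<And>x. (p has_derivative D x) (at x)" "\<And>v. real_polynomial_function (\<lambda>x. D x v)"
      using real_polynomial_function_derivative[OF p] by blast
    have d: "((\<lambda>x. complex_of_real (p x * G x)) has_derivative
        (\<lambda>h. complex_of_real (p x * (G x * (- 2 * \<alpha> * (x \<bullet> h) + h \<bullet> b)) + D x h * G x))) (at x)" for x
      by (intro has_derivative_of_real has_derivative_mult D dG)
    let ?q = "\<lambda>x. p x * (- 2 * \<alpha> * (x \<bullet> axis i 1) + axis i 1 \<bullet> b) + D x (axis i 1)"
    have part: "partial i (\<lambda>x. complex_of_real (p x * G x)) x = complex_of_real (?q x * G x)" for x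
      unfolding partial_def frechet_derivative_at[OF d, symmetric] by (simp add: algebra_simps)
    have "real_polynomial_function (\<lambda>x. x \<bullet> axis i 1)"
      by (rule real_polynomial_function.intros(1)) (rule bounded_linear_inner_left)
    then have q: "real_polynomial_function ?q"
      by (intro real_polynomial_function.intros(2,3,4) p D)
    show ?thesis
    proof (intro conjI allI exI[of _ ?q] q ext part)
      show "(\<lambda>x. complex_of_real (p x * G x)) differentiable (at x)" for x
        using d[of x] unfolding differentiable_def by blast
    qed
  qed
  have poly: "\<exists>q. real_polynomial_function q \<and> partials is (\<lambda>x. complex_of_real (c * G x)) = (\<lambda>x. complex_of_real (q x * G x))" for "is"
  proof (induction "is")
    case Nil
    show ?case by (intro exI[of _ "\<lambda>x. c"]) auto
  next
    case (Cons i "is")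
    then obtain q where "real_polynomial_function q" "partials is (\<lambda>x. complex_of_real (c * G x)) = (\<lambda>x. complex_of_real (q x * G x))" by blast
    with step[of q i] show ?case by auto
  qed
  have "smooth (\<lambda>x. complex_of_real (c * G x))"
    unfolding smooth_def
  proof (intro allI)
    fix "is" x
    obtain q where "real_polynomial_function q" "partials is (\<lambda>x. complex_of_real (c * G x)) = (\<lambda>x. complex_of_real (q x * G x))"
      using poly by blast
    then show "partials is (\<lambda>x. complex_of_real (c * G x)) differentiable (at x)" using step[of q] by auto
  qed
  moreover have "\<exists>C. \<forall>x. japanese x ^ N * cmod (partials is (\<lambda>x. complex_of_real (c * G x)) x) \<le> C" for "is" N
  proof -
    obtain q where q: "real_polynomial_function q" "partials is (\<lambda>x. complex_of_real (c * G x)) = (\<lambda>x. complex_of_real (q x * G x))"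
      using poly by blast
    obtain C M where C: "C \<ge> 0" "\<And>x. \<bar>q x\<bar> \<le> C * (1 + norm x) ^ M" using real_polynomial_function_growth[OF q(1)] by blast
    have "\<exists>E>0. \<forall>\<rho>\<ge>0. exp (- \<rho>) \<le> E / (1 + \<rho> :: real) ^ (N + M)"
      using exp_decay_polynomial[of 1 0 "N + M"] by simp
    then obtain E :: real where E: "E > 0" "\<And>\<rho>. \<rho> \<ge> 0 \<Longrightarrow> exp (- \<rho>) \<le> E / (1 + \<rho>) ^ (N + M)" by blast
    define B where "B = (norm b + 1)\<^sup>2 / (4 * \<alpha>)"
    have G: "G x \<le> exp B * (E / (1 + norm x) ^ (N + M))" for x
    proof -
      define \<rho> where "\<rho> = norm x"
      have "x \<bullet> b \<le> \<rho> * norm b" unfolding \<rho>_def by (rule norm_cauchy_schwarz)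
      moreover have "- \<alpha> * \<rho>\<^sup>2 + \<rho> * norm b + \<rho> \<le> B"
      proof -
        have "0 \<le> \<alpha> * (\<rho> - (norm b + 1) / (2 * \<alpha>))\<^sup>2" using \<alpha> by simp
        also have "\<dots> = \<alpha> * \<rho>\<^sup>2 - \<rho> * (norm b + 1) + B"
          unfolding B_def using \<alpha> by (simp add: power2_eq_square field_simps)
        finally show ?thesis by (simp add: algebra_simps)
      qed
      ultimately have "- \<alpha> * (x \<bullet> x) + x \<bullet> b \<le> B + - \<rho>"
        by (simp add: \<rho>_def dot_square_norm)
      then have "G x \<le> exp (B + - \<rho>)" by (simp add: G_def)
      also have "\<dots> = exp B * exp (- \<rho>)" by (rule exp_add)
      also have "\<dots> \<le> exp B * (E / (1 + \<rho>) ^ (N + M))" using E(2)[of \<rho>] by (intro mult_left_mono) (auto simp: \<rho>_def)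
      finally show ?thesis by (simp add: \<rho>_def)
    qed
    show ?thesis
    proof (intro exI allI)
      fix x :: "real ^ 'n"
      have pos: "(1 + norm x) ^ (N + M) > 0" by (intro zero_less_power add_pos_nonneg) auto
      have "japanese x ^ N * (\<bar>q x\<bar> * G x) \<le> (1 + norm x) ^ N * ((C * (1 + norm x) ^ M) * (exp B * (E / (1 + norm x) ^ (N + M))))"
        using C G[of x] japanese_le[of x] japanese_ge(1)[of x] by (intro mult_mono power_mono) (auto simp: G_def)
      also have "\<dots> = C * exp B * E * ((1 + norm x) ^ (N + M) / (1 + norm x) ^ (N + M))"
        by (simp add: power_add mult_ac)
      also have "(1 + norm x) ^ (N + M) / (1 + norm x) ^ (N + M) = 1" using pos by (intro divide_self) linarith
      finally show "japanese x ^ N * cmod (partials is (\<lambda>x. complex_of_real (c * G x)) x) \<le> C * exp B * E * 1"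
        unfolding q(2) by (simp add: G_def norm_mult abs_mult)
    qed
  qed
  ultimately show ?thesis unfolding schwartz_def G_def by blast
qed

section \<open>The Neumann series\<close>

lemma
  fixes f :: "nat \<Rightarrow> 'b \<Rightarrow> complex"
  assumes [measurable]: "\<And>i. f i \<in> borel_measurable M"
    and fin: "(\<integral>\<^sup>+x. (\<Sum>i. ennreal (norm (f i x))) \<partial>M) < \<infinity>"
  shows sums_integral_of_nn_integral: "(\<lambda>i. \<integral>x. f i x \<partial>M) sums (\<integral>x. (\<Sum>i. f i x) \<partial>M)"
    and integrable_suminf_of_nn_integral: "integrable M (\<lambda>x. \<Sum>i. f i x)"
proof -
  have eq: "(\<Sum>i. \<integral>\<^sup>+x. ennreal (norm (f i x)) \<partial>M) = (\<integral>\<^sup>+x. (\<Sum>i. ennreal (norm (f i x))) \<partial>M)"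
    by (rule nn_integral_suminf[of "\<lambda>i x. ennreal (norm (f i x))" M, symmetric]) measurable
  have le: "(\<integral>\<^sup>+x. ennreal (norm (f i x)) \<partial>M) \<le> (\<integral>\<^sup>+x. (\<Sum>i. ennreal (norm (f i x))) \<partial>M)" for i
  proof (rule nn_integral_mono)
    fix x
    have "sum (\<lambda>i. ennreal (norm (f i x))) {i} \<le> (\<Sum>i. ennreal (norm (f i x)))"
      by (rule sum_le_suminf[OF summableI]) simp_all
    then show "ennreal (norm (f i x)) \<le> (\<Sum>i. ennreal (norm (f i x)))"
      by (subst (asm) sum.insert) auto
  qed
  have i: "integrable M (f i)" for i
    using le[of i] fin by (intro integrableI_bounded) (auto intro: le_less_trans)
  have ae: "AE x in M. summable (\<lambda>i. norm (f i x))"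
  proof -
    have "AE x in M. (\<Sum>i. ennreal (norm (f i x))) \<noteq> \<infinity>"
      using fin by (intro nn_integral_PInf_AE) auto
    then show ?thesis by eventually_elim (rule summable_suminf_not_top, auto)
  qed
  have s: "summable (\<lambda>i. \<integral>x. norm (f i x) \<partial>M)"
  proof (rule summable_suminf_not_top)
    have "(\<Sum>i. ennreal (\<integral>x. norm (f i x) \<partial>M)) = (\<Sum>i. \<integral>\<^sup>+x. ennreal (norm (f i x)) \<partial>M)"
      using i by (intro arg_cong[where f=suminf] ext nn_integral_eq_integral[symmetric]) auto
    then show "(\<Sum>i. ennreal (\<integral>x. norm (f i x) \<partial>M)) \<noteq> \<top>" unfolding eq using fin by simp
  qed simp
  show "(\<lambda>i. \<integral>x. f i x \<partial>M) sums (\<integral>x. (\<Sum>i. f i x) \<partial>M)" by (rule sums_integral[OF i ae s])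
  show "integrable M (\<lambda>x. \<Sum>i. f i x)" by (rule integrable_suminf[OF i ae s])
qed

text \<open>
  The Cauchy--Schwarz inequality with the weights \<open>1 / 2 ^ k\<close> and \<open>2 ^ k\<close>. A contraction with factor
  \<open>1/4\<close> for squared norms still makes the series on the right converge.
\<close>

lemma suminf_square_le:
  fixes a :: "nat \<Rightarrow> real"
  assumes a: "\<And>k. a k \<ge> 0"
  shows "(\<Sum>k. ennreal (a k))\<^sup>2 \<le> 2 * (\<Sum>k. ennreal (2 ^ k * (a k)\<^sup>2))"
proof -
  let ?M = "count_space (UNIV :: nat set)"
  let ?f = "\<lambda>k::nat. ennreal (sqrt (1 / 2 ^ k))" and ?g = "\<lambda>k. ennreal (sqrt (2 ^ k) * a k)"
  have "(\<integral>\<^sup>+k. ?f k * ?g k \<partial>?M)\<^sup>2 \<le> (\<integral>\<^sup>+k. (?f k)\<^sup>2 \<partial>?M) * (\<integral>\<^sup>+k. (?g k)\<^sup>2 \<partial>?M)"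
    by (rule Cauchy_Schwarz_nn_integral) simp_all
  moreover have "?f k * ?g k = ennreal (a k)" for k
    using a by (subst ennreal_mult[symmetric]) (auto simp: real_sqrt_divide)
  moreover have "(?f k)\<^sup>2 = ennreal ((1 / 2) ^ k)" for k
    by (subst ennreal_power) (auto simp: power_one_over)
  moreover have "(?g k)\<^sup>2 = ennreal (2 ^ k * (a k)\<^sup>2)" for k
    using a by (subst ennreal_power) (auto simp: power_mult_distrib)
  moreover have "(\<Sum>k. ennreal ((1 / 2) ^ k)) = 2"
    by (subst suminf_ennreal2) (auto simp: suminf_geometric)
  ultimately show ?thesis by (simp add: nn_integral_count_space_nat)
qed

lemma L2_support_integrable:
  fixes f :: "'a::euclidean_space \<Rightarrow> complex"
  assumes [measurable]: "f \<in> borel_measurable borel" and f2: "(\<integral>\<^sup>+y. ennreal ((norm (f y))\<^sup>2) \<partial>lborel) < \<infinity>"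
    and supp: "\<And>y. norm y > L \<Longrightarrow> f y = 0"
  shows "integrable lborel f"
proof (rule integrableI_bounded)
  have "(\<integral>\<^sup>+y. ennreal (norm (f y)) \<partial>lborel) \<le> (\<integral>\<^sup>+y. indicator (cball 0 L) y + ennreal ((norm (f y))\<^sup>2) \<partial>lborel)"
  proof (rule nn_integral_mono)
    fix y :: 'a
    have "norm (f y) \<le> 1 + (norm (f y))\<^sup>2"
    proof -
      have "0 \<le> (norm (f y) - 1)\<^sup>2" by simp
      then have "2 * norm (f y) \<le> 1 + (norm (f y))\<^sup>2" by (simp add: power2_diff)
      then show ?thesis using norm_ge_zero[of "f y"] by linarith
    qed
    then have "ennreal (norm (f y)) \<le> ennreal (1 + (norm (f y))\<^sup>2)" by (rule ennreal_leI)
    also have "\<dots> = 1 + ennreal ((norm (f y))\<^sup>2)" by (subst ennreal_plus) auto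
    finally show "ennreal (norm (f y)) \<le> indicator (cball 0 L) y + ennreal ((norm (f y))\<^sup>2)"
      using supp[of y] by (cases "norm y \<le> L") auto
  qed
  also have "\<dots> = emeasure lborel (cball (0::'a) L) + (\<integral>\<^sup>+y. ennreal ((norm (f y))\<^sup>2) \<partial>lborel)"
    by (subst nn_integral_add) simp_all
  also have "\<dots> < \<infinity>" using f2 emeasure_lborel_cball_finite[of "0::'a" L] by (auto simp: less_top)
  finally show "(\<integral>\<^sup>+y. ennreal (norm (f y)) \<partial>lborel) < \<infinity>" .
qed simp

text \<open>
  The equation \<open>w = - T (q (1 + w))\<close>, where \<open>T\<close> is convolution with \<open>g\<close>, when \<open>f \<mapsto> T (q f)\<close> maps
  \<open>L\<^sup>2\<close> of the ball of radius \<open>L\<close> to itself with norm at most \<open>1/2\<close>. The terms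
  \<open>W 0 = - T q\<close>, \<open>W (k + 1) = - T (q (W k))\<close> of the Neumann series have squared norms of order
  \<open>(1/4) ^ k\<close>, so by \<open>suminf_square_le\<close> the sum of their absolute values is in \<open>L\<^sup>2\<close> of the
  ball. As \<open>q\<close> vanishes off the ball, this majorant permits summing under the integral sign at almost
  every point, on the ball and outside of it. The difference of two solutions is reproduced by the
  contraction, so it vanishes on the ball, and by the equation also outside.
\<close>

lemma
  fixes g q :: "'a::euclidean_space \<Rightarrow> complex" and \<kappa> M L :: real
  defines "T \<equiv> \<lambda>f x. \<integral>y. g (x - y) * f y \<partial>lborel"
  assumes g: "g \<in> borel_measurable borel" and q: "q \<in> borel_measurable borel"
    and M: "M \<ge> 0" "\<And>x. norm (q x) \<le> M" and supp: "\<And>x. norm x > L \<Longrightarrow> q x = 0"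
    and int: "\<And>f. f \<in> borel_measurable borel \<Longrightarrow> (\<integral>\<^sup>+y. ennreal ((norm (f y))\<^sup>2) \<partial>lborel) < \<infinity> \<Longrightarrow>
      (\<And>y. norm y > L \<Longrightarrow> f y = 0) \<Longrightarrow> AE x in lborel. integrable lborel (\<lambda>y. g (x - y) * f y)"
    and bound: "\<And>f. f \<in> borel_measurable borel \<Longrightarrow> (\<integral>\<^sup>+y. ennreal ((norm (f y))\<^sup>2) \<partial>lborel) < \<infinity> \<Longrightarrow>
      (\<And>y. norm y > L \<Longrightarrow> f y = 0) \<Longrightarrow>
      (\<integral>\<^sup>+x. indicator (cball 0 L) x * ennreal ((norm (T f x))\<^sup>2) \<partial>lborel) \<le> ennreal \<kappa> * (\<integral>\<^sup>+y. ennreal ((norm (f y))\<^sup>2) \<partial>lborel)"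
    and \<kappa>: "\<kappa> \<ge> 0" and small: "\<kappa> * M\<^sup>2 \<le> 1 / 4"
  shows neumann_series_solution: "\<exists>w. w \<in> borel_measurable borel \<and>
      (AE x in lborel. integrable lborel (\<lambda>y. g (x - y) * (q y * (1 + w y))) \<and> w x = - T (\<lambda>y. q y * (1 + w y)) x) \<and>
      (\<integral>\<^sup>+x. indicator (cball 0 L) x * ennreal ((norm (w x))\<^sup>2) \<partial>lborel) \<le> ennreal (4 * \<kappa>) * (\<integral>\<^sup>+y. ennreal ((norm (q y))\<^sup>2) \<partial>lborel)"
      (is ?exist)
    and neumann_series_unique: "\<lbrakk>v \<in> borel_measurable borel; w \<in> borel_measurable borel;
      (\<integral>\<^sup>+x. indicator (cball 0 L) x * ennreal ((norm (v x))\<^sup>2) \<partial>lborel) < \<infinity>;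
      (\<integral>\<^sup>+x. indicator (cball 0 L) x * ennreal ((norm (w x))\<^sup>2) \<partial>lborel) < \<infinity>;
      AE x in lborel. integrable lborel (\<lambda>y. g (x - y) * (q y * (1 + v y))) \<and> v x = - T (\<lambda>y. q y * (1 + v y)) x;
      AE x in lborel. integrable lborel (\<lambda>y. g (x - y) * (q y * (1 + w y))) \<and> w x = - T (\<lambda>y. q y * (1 + w y)) x\<rbrakk>
      \<Longrightarrow> AE x in lborel. v x = w x"
      (is "PROP ?unique")
proof -
  note [measurable] = g q
  let ?B = "cball (0::'a) L"
  have Tm[measurable]: "T f \<in> borel_measurable borel" if [measurable]: "f \<in> borel_measurable borel" for f
    unfolding T_def by measurable
  have qf: "(\<integral>\<^sup>+y. ennreal ((norm (q y * f y))\<^sup>2) \<partial>lborel) \<le> ennreal (M\<^sup>2) * (\<integral>\<^sup>+y. indicator ?B y * ennreal ((norm (f y))\<^sup>2) \<partial>lborel)"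
    if [measurable]: "f \<in> borel_measurable borel" for f :: "'a \<Rightarrow> complex"
  proof -
    have "(\<integral>\<^sup>+y. ennreal ((norm (q y * f y))\<^sup>2) \<partial>lborel) \<le> (\<integral>\<^sup>+y. ennreal (M\<^sup>2) * (indicator ?B y * ennreal ((norm (f y))\<^sup>2)) \<partial>lborel)"
    proof (rule nn_integral_mono)
      fix y :: 'a
      have "(norm (q y))\<^sup>2 \<le> M\<^sup>2" using M by (intro power_mono) auto
      then have "(norm (q y * f y))\<^sup>2 \<le> M\<^sup>2 * (norm (f y))\<^sup>2"
        unfolding norm_mult power_mult_distrib by (rule mult_right_mono) simp
      then have "ennreal ((norm (q y * f y))\<^sup>2) \<le> ennreal (M\<^sup>2) * ennreal ((norm (f y))\<^sup>2)"
        by (subst ennreal_mult[symmetric]) (auto intro: ennreal_leI)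
      then show "ennreal ((norm (q y * f y))\<^sup>2) \<le> ennreal (M\<^sup>2) * (indicator ?B y * ennreal ((norm (f y))\<^sup>2))"
        using supp[of y] by (cases "norm y \<le> L") auto
    qed
    also have "\<dots> = ennreal (M\<^sup>2) * (\<integral>\<^sup>+y. indicator ?B y * ennreal ((norm (f y))\<^sup>2) \<partial>lborel)"
      by (rule nn_integral_cmult) simp
    finally show ?thesis .
  qed
  have qs: "norm y > L \<Longrightarrow> q y * f y = 0" for y f using supp by simp
  define Q where "Q = (\<integral>\<^sup>+y. ennreal ((norm (q y))\<^sup>2) \<partial>lborel)"
  have Bfin: "emeasure lborel ?B < \<infinity>" using emeasure_lborel_cball_finite[of "0::'a" L] by (simp add: less_top)
  have Q: "Q < \<infinity>"
  proof -
    have "Q \<le> ennreal (M\<^sup>2) * (\<integral>\<^sup>+y. indicator ?B y * ennreal ((norm (1::complex))\<^sup>2) \<partial>lborel)"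
      unfolding Q_def using qf[of "\<lambda>y. 1"] by simp
    also have "\<dots> < \<infinity>" using Bfin by (simp add: ennreal_mult_less_top)
    finally show ?thesis .
  qed
  define N where "N = (\<lambda>f. \<integral>\<^sup>+x. indicator ?B x * ennreal ((norm (f x :: complex))\<^sup>2) \<partial>lborel)"
  have contr: "N (T (\<lambda>y. q y * f y)) \<le> ennreal (1 / 4) * N f"
    if [measurable]: "f \<in> borel_measurable borel" and fin: "N f < \<infinity>" for f
  proof -
    have fin': "(\<integral>\<^sup>+y. ennreal ((norm (q y * f y))\<^sup>2) \<partial>lborel) < \<infinity>"
      by (rule le_less_trans[OF qf]) (use fin in \<open>simp_all add: N_def ennreal_mult_less_top\<close>)
    have "N (T (\<lambda>y. q y * f y)) \<le> ennreal \<kappa> * (\<integral>\<^sup>+y. ennreal ((norm (q y * f y))\<^sup>2) \<partial>lborel)"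
      unfolding N_def by (intro bound fin' qs) measurable
    also have "\<dots> \<le> ennreal \<kappa> * (ennreal (M\<^sup>2) * N f)"
      unfolding N_def by (intro mult_left_mono qf) simp_all
    also have "\<dots> = ennreal (\<kappa> * M\<^sup>2) * N f" using \<kappa> by (simp add: ennreal_mult mult.assoc)
    also have "\<dots> \<le> ennreal (1 / 4) * N f" by (intro mult_right_mono ennreal_leI small) simp
    finally show ?thesis .
  qed
  show ?exist
  proof -
    define W where "W = rec_nat (\<lambda>x. - T q x) (\<lambda>_ f x. - T (\<lambda>y. q y * f y) x)"
    have W0: "W 0 = (\<lambda>x. - T q x)" and WS: "W (Suc k) = (\<lambda>x. - T (\<lambda>y. q y * W k y) x)" for k
      by (simp_all add: W_def)
    have Wm[measurable]: "W k \<in> borel_measurable borel" for k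
    proof (induction k)
      case 0
      show ?case unfolding W0 by measurable
    next
      case (Suc k)
      note [measurable] = Suc
      show ?case unfolding WS by measurable
    qed
    have Nm: "N (\<lambda>x. - f x) = N f" for f by (simp add: N_def)
    have NW: "N (W k) \<le> ennreal ((1 / 4) ^ k) * (ennreal \<kappa> * Q)" for k
    proof (induction k)
      case 0
      have "N (W 0) \<le> ennreal \<kappa> * Q"
        unfolding W0 Nm unfolding N_def Q_def using Q supp by (intro bound) (auto simp: Q_def)
      then show ?case by simp
    next
      case (Suc k)
      have fin: "N (W k) < \<infinity>" using Suc Q by (auto simp: ennreal_mult_less_top intro: le_less_trans)
      have "N (W (Suc k)) = N (T (\<lambda>y. q y * W k y))" unfolding WS by (rule Nm)
      also have "\<dots> \<le> ennreal (1 / 4) * N (W k)" by (rule contr[OF Wm fin])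
      also have "\<dots> \<le> ennreal (1 / 4) * (ennreal ((1 / 4) ^ k) * (ennreal \<kappa> * Q))"
        by (intro mult_left_mono Suc) simp
      also have "\<dots> = ennreal ((1 / 4) ^ Suc k) * (ennreal \<kappa> * Q)"
        unfolding mult.assoc[symmetric] by (subst ennreal_mult[symmetric]) auto
      finally show ?case .
    qed
    define S where "S = (\<lambda>y. \<Sum>k. ennreal (norm (W k y)))"
    have [measurable]: "S \<in> borel_measurable borel" unfolding S_def by measurable
    have S2: "(\<integral>\<^sup>+y. indicator ?B y * (S y)\<^sup>2 \<partial>lborel) \<le> ennreal (4 * \<kappa>) * Q"
    proof -
      have "(\<integral>\<^sup>+y. indicator ?B y * (S y)\<^sup>2 \<partial>lborel) \<le> (\<integral>\<^sup>+y. 2 * (\<Sum>k. ennreal (2 ^ k) * (indicator ?B y * ennreal ((norm (W k y))\<^sup>2))) \<partial>lborel)"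
      proof (rule nn_integral_mono)
        fix y :: 'a
        show "indicator ?B y * (S y)\<^sup>2 \<le> 2 * (\<Sum>k. ennreal (2 ^ k) * (indicator ?B y * ennreal ((norm (W k y))\<^sup>2)))"
        proof (cases "y \<in> ?B")
          case True
          have "(S y)\<^sup>2 \<le> 2 * (\<Sum>k. ennreal (2 ^ k * (norm (W k y))\<^sup>2))"
            unfolding S_def by (rule suminf_square_le) (rule norm_ge_zero)
          also have "(\<lambda>k. ennreal (2 ^ k * (norm (W k y))\<^sup>2)) = (\<lambda>k. ennreal (2 ^ k) * ennreal ((norm (W k y))\<^sup>2))"
            by (intro ext ennreal_mult) simp_all
          finally show ?thesis by (simp only: indicator_simps(1)[OF True] mult_1_left)
        next
          case False
          show ?thesis by (simp only: indicator_simps(2)[OF False] mult_zero_left zero_le)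
        qed
      qed
      also have "\<dots> = 2 * (\<integral>\<^sup>+y. (\<Sum>k. ennreal (2 ^ k) * (indicator ?B y * ennreal ((norm (W k y))\<^sup>2))) \<partial>lborel)"
        by (rule nn_integral_cmult) simp
      also have "(\<integral>\<^sup>+y. (\<Sum>k. ennreal (2 ^ k) * (indicator ?B y * ennreal ((norm (W k y))\<^sup>2))) \<partial>lborel) = (\<Sum>k. ennreal (2 ^ k) * N (W k))"
        unfolding N_def by (subst nn_integral_suminf, simp) (intro arg_cong[where f=suminf] ext nn_integral_cmult, simp)
      also have "(\<Sum>k. ennreal (2 ^ k) * N (W k)) \<le> (\<Sum>k. ennreal ((1 / 2) ^ k) * (ennreal \<kappa> * Q))"
      proof (intro suminf_le allI)
        fix k :: nat
        have "ennreal (2 ^ k) * N (W k) \<le> ennreal (2 ^ k) * (ennreal ((1 / 4) ^ k) * (ennreal \<kappa> * Q))"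
          by (intro mult_left_mono NW) simp
        also have "\<dots> = ennreal ((1 / 2) ^ k) * (ennreal \<kappa> * Q)"
        proof -
          have "(2::real) ^ k * (1 / 4) ^ k = (1 / 2) ^ k" by (simp add: power_mult_distrib[symmetric])
          then show ?thesis unfolding mult.assoc[symmetric] by (subst ennreal_mult[symmetric]) auto
        qed
        finally show "ennreal (2 ^ k) * N (W k) \<le> ennreal ((1 / 2) ^ k) * (ennreal \<kappa> * Q)" .
      qed simp_all
      also have "\<dots> = 2 * (ennreal \<kappa> * Q)"
        by (subst ennreal_suminf_multc, subst suminf_ennreal2) (auto simp: suminf_geometric)
      also have "2 * (2 * (ennreal \<kappa> * Q)) = ennreal (4 * \<kappa>) * Q"
        using \<kappa> by (simp add: ennreal_mult mult.assoc[symmetric])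
      finally show ?thesis by (simp add: mult_left_mono)
    qed
    have S2fin: "(\<integral>\<^sup>+y. indicator ?B y * (S y)\<^sup>2 \<partial>lborel) < \<infinity>"
      using S2 Q by (auto simp: ennreal_mult_less_top intro: le_less_trans)
    have AES: "AE y in lborel. y \<in> ?B \<longrightarrow> S y \<noteq> \<infinity>"
    proof -
      have "AE y in lborel. indicator ?B y * (S y)\<^sup>2 \<noteq> \<infinity>"
        using S2fin by (intro nn_integral_PInf_AE) auto
      then show ?thesis by eventually_elim (auto simp: power2_eq_square ennreal_mult_eq_top_iff)
    qed
    define f where "f = (\<lambda>y. complex_of_real (norm (q y) * enn2real (S y)))"
    have [measurable]: "f \<in> borel_measurable borel" unfolding f_def by measurable
    have fS: "AE y in lborel. ennreal (norm (f y)) = ennreal (norm (q y)) * S y"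
      using AES
    proof eventually_elim
      case (elim y)
      show ?case
      proof (cases "norm y \<le> L")
        case True
        then have "S y < \<top>" using elim by (simp add: less_top)
        then show ?thesis by (simp add: f_def norm_mult ennreal_mult)
      next
        case False
        then show ?thesis using supp[of y] by (simp add: f_def)
      qed
    qed
    have f2: "(\<integral>\<^sup>+y. ennreal ((norm (f y))\<^sup>2) \<partial>lborel) < \<infinity>"
    proof -
      have "(\<integral>\<^sup>+y. ennreal ((norm (f y))\<^sup>2) \<partial>lborel) \<le> (\<integral>\<^sup>+y. ennreal (M\<^sup>2) * (indicator ?B y * (S y)\<^sup>2) \<partial>lborel)"
      proof (rule nn_integral_mono_AE, use fS in eventually_elim)
        case (elim y)
        have "ennreal ((norm (f y))\<^sup>2) = (ennreal (norm (f y)))\<^sup>2" by (simp add: ennreal_power)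
        also have "\<dots> = (ennreal (norm (q y)))\<^sup>2 * (S y)\<^sup>2" unfolding elim by (simp add: power_mult_distrib)
        also have "\<dots> \<le> ennreal (M\<^sup>2) * (indicator ?B y * (S y)\<^sup>2)"
        proof (cases "norm y \<le> L")
          case True
          have "(ennreal (norm (q y)))\<^sup>2 \<le> ennreal (M\<^sup>2)"
            using M by (subst ennreal_power) (auto intro!: ennreal_leI power_mono)
          then show ?thesis using True by (simp add: mult_right_mono)
        next
          case False
          then show ?thesis using supp[of y] by simp
        qed
        finally show ?case .
      qed
      also have "\<dots> = ennreal (M\<^sup>2) * (\<integral>\<^sup>+y. indicator ?B y * (S y)\<^sup>2 \<partial>lborel)"
        by (rule nn_integral_cmult) simp
      also have "\<dots> < \<infinity>" using S2fin by (simp add: ennreal_mult_less_top)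
      finally show ?thesis .
    qed
    have fsupp: "norm y > L \<Longrightarrow> f y = 0" for y using supp by (simp add: f_def)
    have q2: "(\<integral>\<^sup>+y. ennreal ((norm (q y))\<^sup>2) \<partial>lborel) < \<infinity>" using Q by (simp add: Q_def)
    have intf: "AE x in lborel. integrable lborel (\<lambda>y. g (x - y) * f y)"
      by (rule int) (use f2 fsupp in simp_all)
    have intq: "AE x in lborel. integrable lborel (\<lambda>y. g (x - y) * q y)"
      by (rule int) (use q q2 supp in simp_all)
    define w where "w = (\<lambda>x. \<Sum>k. W k x)"
    have [measurable]: "w \<in> borel_measurable borel" unfolding w_def by measurable
    have eq: "AE x in lborel. integrable lborel (\<lambda>y. g (x - y) * (q y * (1 + w y))) \<and> w x = - T (\<lambda>y. q y * (1 + w y)) x"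
      using intf intq
    proof eventually_elim
      case (elim x)
      let ?h = "\<lambda>k y. g (x - y) * (q y * W k y)"
      have "(\<integral>\<^sup>+y. (\<Sum>k. ennreal (norm (?h k y))) \<partial>lborel) = (\<integral>\<^sup>+y. ennreal (norm (g (x - y) * f y)) \<partial>lborel)"
      proof (rule nn_integral_cong_AE, use fS in eventually_elim)
        case (elim y)
        have "ennreal (norm (?h k y)) = ennreal (norm (g (x - y)) * norm (q y)) * ennreal (norm (W k y))" for k
          by (subst ennreal_mult[symmetric]) (simp_all add: norm_mult mult.assoc)
        then have "(\<Sum>k. ennreal (norm (?h k y))) = (\<Sum>k. ennreal (norm (g (x - y)) * norm (q y)) * ennreal (norm (W k y)))"
          by (rule arg_cong[where f=suminf, OF ext])
        also have "\<dots> = ennreal (norm (g (x - y)) * norm (q y)) * S y" unfolding S_def by (rule ennreal_suminf_cmult)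
        also have "\<dots> = ennreal (norm (g (x - y))) * ennreal (norm (f y))" unfolding elim by (simp add: ennreal_mult mult.assoc)
        finally show ?case by (simp add: norm_mult ennreal_mult)
      qed
      also have "\<dots> < \<infinity>" using elim(1) by (simp add: integrable_iff_bounded)
      finally have fin: "(\<integral>\<^sup>+y. (\<Sum>k. ennreal (norm (?h k y))) \<partial>lborel) < \<infinity>" .
      have hm: "?h k \<in> borel_measurable lborel" for k by measurable
      have sum: "AE y in lborel. (\<Sum>k. ?h k y) = g (x - y) * (q y * w y)"
        using AES
      proof eventually_elim
        case (elim y)
        show ?case
        proof (cases "norm y \<le> L")
          case True
          then have "summable (\<lambda>k. norm (W k y))"
            using elim unfolding S_def by (intro summable_suminf_not_top norm_ge_zero) (simp only: mem_cball_0 infinity_ennreal_def simp_thms)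
          then have "summable (\<lambda>k. W k y)" by (rule summable_norm_cancel)
          then have "(\<Sum>k. (g (x - y) * q y) * W k y) = (g (x - y) * q y) * w y"
            unfolding w_def by (rule suminf_mult)
          then show ?thesis by (simp only: mult.assoc)
        next
          case False
          then show ?thesis using supp[of y] by simp
        qed
      qed
      have iw: "integrable lborel (\<lambda>y. g (x - y) * (q y * w y))"
        by (rule integrable_cong_AE_imp[OF integrable_suminf_of_nn_integral[OF hm fin] _ sum]) simp
      have "(\<lambda>k. \<integral>y. ?h k y \<partial>lborel) sums (\<integral>y. (\<Sum>k. ?h k y) \<partial>lborel)"
        by (rule sums_integral_of_nn_integral[OF hm fin])
      also have "(\<integral>y. (\<Sum>k. ?h k y) \<partial>lborel) = T (\<lambda>y. q y * w y) x"
        unfolding T_def using sum by (intro integral_cong_AE) auto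
      finally have "(\<lambda>k. - (\<integral>y. ?h k y \<partial>lborel)) sums (- T (\<lambda>y. q y * w y) x)" by (rule sums_minus)
      then have "(\<lambda>k. W (Suc k) x) sums (- T (\<lambda>y. q y * w y) x)" by (simp add: WS T_def)
      then have "(\<lambda>k. W k x) sums (- T (\<lambda>y. q y * w y) x + W 0 x)" by (rule sums_Suc)
      then have wx: "w x = - T (\<lambda>y. q y * w y) x + W 0 x" unfolding w_def by (rule sums_unique[symmetric])
      have split: "g (x - y) * (q y * (1 + w y)) = g (x - y) * q y + g (x - y) * (q y * w y)" for y
        by (simp add: algebra_simps)
      have "T (\<lambda>y. q y * (1 + w y)) x = T q x + T (\<lambda>y. q y * w y) x"
        unfolding T_def split by (rule Bochner_Integration.integral_add[OF elim(2) iw])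
      then show ?case unfolding split using elim(2) iw wx by (simp add: W0)
    qed
    have "N w \<le> ennreal (4 * \<kappa>) * Q"
    proof (rule order_trans[OF _ S2], unfold N_def, rule nn_integral_mono)
      fix y :: 'a
      have "ennreal (norm (w y)) \<le> S y"
      proof (cases "S y = \<top>")
        case False
        then have s: "summable (\<lambda>k. norm (W k y))" unfolding S_def by (intro summable_suminf_not_top norm_ge_zero) assumption
        have "norm (w y) \<le> (\<Sum>k. norm (W k y))" unfolding w_def by (rule summable_norm[OF s])
        then have "ennreal (norm (w y)) \<le> ennreal (\<Sum>k. norm (W k y))" by (rule ennreal_leI)
        also have "\<dots> = S y" unfolding S_def by (rule suminf_ennreal2[OF norm_ge_zero s, symmetric])
        finally show ?thesis .
      qed simp
      then have "(ennreal (norm (w y)))\<^sup>2 \<le> (S y)\<^sup>2" by (intro power_mono) auto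
      then show "indicator ?B y * ennreal ((norm (w y))\<^sup>2) \<le> indicator ?B y * (S y)\<^sup>2"
        by (intro mult_left_mono) (simp_all add: ennreal_power)
    qed
    then show ?thesis using eq unfolding N_def Q_def by (intro exI[of _ w]) simp
  qed
  show "PROP ?unique"
  proof -
    assume vm[measurable]: "v \<in> borel_measurable borel" and wm[measurable]: "w \<in> borel_measurable borel"
      and v2: "(\<integral>\<^sup>+x. indicator ?B x * ennreal ((norm (v x))\<^sup>2) \<partial>lborel) < \<infinity>"
      and w2: "(\<integral>\<^sup>+x. indicator ?B x * ennreal ((norm (w x))\<^sup>2) \<partial>lborel) < \<infinity>"
      and v: "AE x in lborel. integrable lborel (\<lambda>y. g (x - y) * (q y * (1 + v y))) \<and> v x = - T (\<lambda>y. q y * (1 + v y)) x"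
      and w: "AE x in lborel. integrable lborel (\<lambda>y. g (x - y) * (q y * (1 + w y))) \<and> w x = - T (\<lambda>y. q y * (1 + w y)) x"
    define d where "d = (\<lambda>x. v x - w x)"
    have [measurable]: "d \<in> borel_measurable borel" unfolding d_def by measurable
    have eq: "AE x in lborel. d x = - T (\<lambda>y. q y * d y) x"
      using v w
    proof eventually_elim
      case (elim x)
      have "T (\<lambda>y. q y * d y) x = (\<integral>y. g (x - y) * (q y * (1 + v y)) - g (x - y) * (q y * (1 + w y)) \<partial>lborel)"
        unfolding T_def d_def by (intro Bochner_Integration.integral_cong refl) (simp add: algebra_simps)
      also have "\<dots> = T (\<lambda>y. q y * (1 + v y)) x - T (\<lambda>y. q y * (1 + w y)) x"
        unfolding T_def using elim by (intro Bochner_Integration.integral_diff) auto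
      finally show ?case unfolding d_def using elim by simp
    qed
    have "N d \<le> (\<integral>\<^sup>+x. 2 * (indicator ?B x * ennreal ((norm (v x))\<^sup>2)) + 2 * (indicator ?B x * ennreal ((norm (w x))\<^sup>2)) \<partial>lborel)"
      unfolding N_def
    proof (rule nn_integral_mono)
      fix x
      have "(norm (d x))\<^sup>2 \<le> (norm (v x) + norm (w x))\<^sup>2"
        unfolding d_def by (intro power_mono norm_triangle_ineq4) auto
      also have "\<dots> \<le> 2 * (norm (v x))\<^sup>2 + 2 * (norm (w x))\<^sup>2"
        using zero_le_power2[of "norm (v x) - norm (w x)"] by (simp add: power2_eq_square algebra_simps)
      finally have "ennreal ((norm (d x))\<^sup>2) \<le> ennreal (2 * (norm (v x))\<^sup>2 + 2 * (norm (w x))\<^sup>2)" by (rule ennreal_leI)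
      also have "\<dots> = 2 * ennreal ((norm (v x))\<^sup>2) + 2 * ennreal ((norm (w x))\<^sup>2)"
        by (simp add: ennreal_plus ennreal_mult)
      finally show "indicator ?B x * ennreal ((norm (d x))\<^sup>2) \<le> 2 * (indicator ?B x * ennreal ((norm (v x))\<^sup>2)) + 2 * (indicator ?B x * ennreal ((norm (w x))\<^sup>2))"
        by (cases "x \<in> ?B") auto
    qed
    also have "\<dots> = 2 * (\<integral>\<^sup>+x. indicator ?B x * ennreal ((norm (v x))\<^sup>2) \<partial>lborel) + 2 * (\<integral>\<^sup>+x. indicator ?B x * ennreal ((norm (w x))\<^sup>2) \<partial>lborel)"
      by (subst nn_integral_add, simp, simp, subst nn_integral_cmult, simp, subst nn_integral_cmult, simp, rule refl)
    also have "\<dots> < \<infinity>" using v2 w2 by (simp add: ennreal_mult_less_top)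
    finally have fin: "N d < \<infinity>" .
    have "N d = N (\<lambda>x. - T (\<lambda>y. q y * d y) x)"
      unfolding N_def using eq by (intro nn_integral_cong_AE) auto
    also have "\<dots> = N (T (\<lambda>y. q y * d y))" by (simp add: N_def)
    also have "\<dots> \<le> ennreal (1 / 4) * N d" by (rule contr[OF _ fin]) simp
    finally have le: "N d \<le> ennreal (1 / 4) * N d" .
    have "N d = 0"
    proof -
      obtain r where r: "N d = ennreal r" "r \<ge> 0" using fin by (cases "N d") auto
      from le have "ennreal r \<le> ennreal (1 / 4 * r)" unfolding r(1) using r(2) by (simp only: ennreal_mult' zero_le_divide_1_iff)
      then have "r \<le> 1 / 4 * r" using r(2) by simp
      then show ?thesis using r by simp
    qed
    then have "AE x in lborel. indicator ?B x * ennreal ((norm (d x))\<^sup>2) = 0"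
      unfolding N_def by (subst (asm) nn_integral_0_iff_AE) simp_all
    then have qd: "AE y in lborel. q y * d y = 0"
    proof eventually_elim
      case (elim y)
      then show ?case using supp[of y] by (cases "norm y \<le> L") auto
    qed
    have "T (\<lambda>y. q y * d y) x = 0" for x
      unfolding T_def using qd by (intro integral_eq_zero_AE) (auto elim!: eventually_mono)
    with eq have "AE x in lborel. d x = 0" by simp
    then show "AE x in lborel. v x = w x" by eventually_elim (simp add: d_def)
  qed
qed

section \<open>Lebesgue measurable functions and their Borel representatives\<close>

text \<open>
  Fubini's theorem is used for Borel functions and Lebesgue--Borel measure, whereas the theorem speaks
  about Lebesgue measurable functions. The lemmas of this section pass between the two, up to null
  sets.
\<close>

lemma borel_representative:
  fixes f :: "'a::euclidean_space \<Rightarrow> complex"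
  assumes f: "f \<in> borel_measurable lebesgue"
  obtains f' where "f' \<in> borel_measurable borel" "AE x in lborel. f x = f' x"
proof -
  have "(\<lambda>x. Re (f x)) \<in> borel_measurable lebesgue" "(\<lambda>x. Im (f x)) \<in> borel_measurable lebesgue"
    using f by measurable
  then obtain u v where u: "u \<in> borel_measurable lborel" "AE x in lborel. Re (f x) = u x"
    and v: "v \<in> borel_measurable lborel" "AE x in lborel. Im (f x) = v x"
    using completion_ex_borel_measurable_real[of "\<lambda>x. Re (f x)" lborel]
      completion_ex_borel_measurable_real[of "\<lambda>x. Im (f x)" lborel] by blast
  show thesis
  proof
    show "(\<lambda>x. Complex (u x) (v x)) \<in> borel_measurable borel"
      using u(1) v(1) unfolding Complex_eq by simp
    show "AE x in lborel. f x = Complex (u x) (v x)"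
      using u(2) v(2) by eventually_elim (simp add: complex_eq_iff)
  qed
qed

lemma
  fixes f f' :: "'a::euclidean_space \<Rightarrow> 'b::euclidean_space"
  assumes m: "f' \<in> borel_measurable borel" and ae: "AE x in lborel. f x = f' x"
  shows lebesgue_measurable_AE: "f \<in> borel_measurable lebesgue"
    and integrable_lebesgue_AE: "integrable lebesgue f \<longleftrightarrow> integrable lborel f'"
    and integral_lebesgue_AE: "(\<integral>x. f x \<partial>lebesgue) = (\<integral>x. f' x \<partial>lborel)"
proof -
  have m': "f' \<in> borel_measurable lborel" and ml: "f' \<in> borel_measurable lebesgue"
    using m by (auto intro: measurable_completion)
  have ae': "AE x in lebesgue. f' x = f x" using ae by (auto simp: AE_completion_iff)
  show fm: "f \<in> borel_measurable lebesgue" by (rule borel_measurable_AE[OF ml ae'])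
  have "integrable lebesgue f \<longleftrightarrow> integrable lebesgue f'"
    using ae' by (intro integrable_cong_AE fm ml) auto
  then show "integrable lebesgue f \<longleftrightarrow> integrable lborel f'" by (simp add: integrable_completion[OF m'])
  have "(\<integral>x. f x \<partial>lebesgue) = (\<integral>x. f' x \<partial>lebesgue)"
    using ae' by (intro integral_cong_AE fm ml) auto
  then show "(\<integral>x. f x \<partial>lebesgue) = (\<integral>x. f' x \<partial>lborel)" by (simp add: integral_completion[OF m'])
qed

lemma AE_lborel_reflect:
  fixes P :: "'a::euclidean_space \<Rightarrow> bool"
  assumes "AE x in lborel. P x"
  shows "AE y in lborel. P (x - y)"
proof -
  obtain N where N: "{x. \<not> P x} \<subseteq> N" "emeasure lborel N = 0" "N \<in> sets borel"
    using AE_E[OF assms] by auto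
  have "AE z in distr lborel borel (\<lambda>y. x + (-1::real) *\<^sub>R y). z \<notin> N"
  proof -
    have "lborel = density (distr lborel borel (\<lambda>y. x + (-1::real) *\<^sub>R y)) (\<lambda>_. \<bar>-1::real\<bar> ^ DIM('a))"
      by (rule lborel_affine) simp
    also have "\<dots> = distr lborel borel (\<lambda>y. x + (-1::real) *\<^sub>R y)"
      by (simp add: density_1)
    finally have "distr lborel borel (\<lambda>y. x + (-1::real) *\<^sub>R y) = lborel" by simp
    moreover have "N \<in> null_sets lborel" using N by auto
    ultimately show ?thesis by (metis AE_not_in)
  qed
  then have "AE y in lborel. x - y \<notin> N" using N(3) by (subst (asm) AE_distr_iff) auto
  then show ?thesis using N(1) by (auto elim!: eventually_mono)
qed

section \<open>An explicit representative of the Faddeev Green function\<close>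

lemma cdot_add_right: "cdot x (y + z) = cdot x y + cdot x z"
  by (simp add: cdot_def distrib_left sum.distrib)

lemma cdot_cvec: "cdot (cvec x) (cvec y) = of_real (x \<bullet> y)"
  by (simp add: cdot_def cvec_def inner_vec_def)

lemma exp_i_cdot_cvec: "exp (\<i> * cdot (cvec x) (cvec y)) = cis (x \<bullet> y)"
  by (simp add: cdot_cvec cis_conv_exp)

lemma isotropic_decomposition:
  fixes \<zeta> :: "complex ^ 'n"
  assumes iso: "cdot \<zeta> \<zeta> = 0" and nz: "\<zeta> \<noteq> 0"
  obtains s a e where "s > 0" "norm a = s" "norm e = 1" "a \<bullet> e = 0" "(norm \<zeta>)\<^sup>2 = 2 * s\<^sup>2"
    "\<And>\<xi>. cdot \<zeta> (cvec \<xi>) = of_real (a \<bullet> \<xi>) + \<i> * of_real (s * (\<xi> \<bullet> e))"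
proof -
  define a b where "a = (\<chi> i. Re (\<zeta> $ i))" and "b = (\<chi> i. Im (\<zeta> $ i))"
  have "Re (cdot \<zeta> \<zeta>) = a \<bullet> a - b \<bullet> b" "Im (cdot \<zeta> \<zeta>) = 2 * (a \<bullet> b)"
    by (simp_all add: cdot_def inner_vec_def a_def b_def sum_subtractf sum_distrib_left algebra_simps)
  then have ab: "a \<bullet> a = b \<bullet> b" "a \<bullet> b = 0" using iso by simp_all
  have "(norm \<zeta>)\<^sup>2 = (\<Sum>i\<in>UNIV. (norm (\<zeta> $ i))\<^sup>2)"
    by (simp add: norm_vec_def L2_set_def sum_nonneg)
  also have "\<dots> = a \<bullet> a + b \<bullet> b"
    unfolding cmod_power2 sum.distrib by (simp add: inner_vec_def a_def b_def power2_eq_square)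
  finally have n: "(norm \<zeta>)\<^sup>2 = 2 * (norm a)\<^sup>2" using ab by (simp add: dot_square_norm)
  have na: "norm a > 0" using n nz by (cases "a = 0") auto
  have nb: "norm b = norm a" using ab(1) by (simp add: norm_eq)
  show thesis
  proof
    show "norm a > 0" by (rule na)
    show "norm a = norm a" ..
    show "norm ((1 / norm a) *\<^sub>R b) = 1" using na nb by simp
    show "a \<bullet> ((1 / norm a) *\<^sub>R b) = 0" using ab by simp
    show "(norm \<zeta>)\<^sup>2 = 2 * (norm a)\<^sup>2" by (rule n)
    show "cdot \<zeta> (cvec \<xi>) = of_real (a \<bullet> \<xi>) + \<i> * of_real (norm a * (\<xi> \<bullet> ((1 / norm a) *\<^sub>R b)))" for \<xi>
      using na by (simp add: complex_eq_iff cdot_def cvec_def a_def[symmetric] inner_commute[of \<xi>])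
        (simp add: inner_vec_def a_def b_def)
  qed
qed

lemma rapidly_decreasing_translate:
  assumes r: "rapidly_decreasing F"
  shows "rapidly_decreasing (\<lambda>x. F (x - c))"
  unfolding rapidly_decreasing_def
proof
  fix N
  obtain C where C: "C \<ge> 0" "\<And>x. norm (F x) \<le> C / (1 + norm x) ^ N" using rapidly_decreasingE[OF r] by blast
  show "\<exists>C. \<forall>x. norm (F (x - c)) \<le> C / (1 + norm x) ^ N"
  proof (intro exI allI)
    fix x
    have pos: "1 + norm x > 0" "1 + norm c > 0" "1 + norm (x - c) > 0" by (simp_all add: add_pos_nonneg)
    have "norm x \<le> norm (x - c) + norm c" using norm_triangle_ineq[of "x - c" c] by simp
    then have "1 + norm x \<le> (1 + norm c) * (1 + norm (x - c))"
      using mult_nonneg_nonneg[OF norm_ge_zero[of c] norm_ge_zero[of "x - c"]]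
      unfolding distrib_left distrib_right mult_1_left mult_1_right by linarith
    then have "(1 + norm x) ^ N \<le> (1 + norm c) ^ N * (1 + norm (x - c)) ^ N"
      unfolding power_mult_distrib[symmetric] using pos by (intro power_mono) auto
    then have "C * (1 + norm x) ^ N \<le> C * ((1 + norm c) ^ N * (1 + norm (x - c)) ^ N)"
      by (rule mult_left_mono[OF _ C(1)])
    moreover have "(1 + norm x) ^ N > 0" "(1 + norm (x - c)) ^ N > 0" using pos by simp_all
    ultimately have "C / (1 + norm (x - c)) ^ N \<le> (C * (1 + norm c) ^ N) / (1 + norm x) ^ N"
      by (simp add: divide_le_eq pos_le_divide_eq mult.assoc)
    then show "norm (F (x - c)) \<le> (C * (1 + norm c) ^ N) / (1 + norm x) ^ N" using C(2)[of "x - c"] by linarith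
  qed
qed

text \<open>
  The factor \<open>cis (- (x \<bullet> a))\<close> shifts the Fourier transform of the test function by \<open>a\<close>, which
  turns \<open>|\<xi>|\<^sup>2 + 2 \<zeta> \<cdot> \<xi>\<close> into \<open>faddeev_symbol\<close>.
\<close>

lemma represents_faddeev_distribution:
  fixes \<zeta> :: "complex ^ 'n" and a e :: "real ^ 'n"
  assumes n: "CARD('n) \<ge> 3" and s: "s > 0" and a: "norm a = s" and e: "norm e = 1" and ae: "a \<bullet> e = 0"
    and \<zeta>: "\<And>\<xi>. cdot \<zeta> (cvec \<xi>) = of_real (a \<bullet> \<xi>) + \<i> * of_real (s * (\<xi> \<bullet> e))"
  shows "represents_distribution (\<lambda>x. cis (- (x \<bullet> a)) * faddeev_h s e x) (faddeev_distribution \<zeta>)"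
  unfolding represents_distribution_def
proof (intro conjI allI impI)
  have D: "DIM(real ^ 'n) = CARD('n)" by simp
  have n': "DIM(real ^ 'n) \<ge> 3" using n by simp
  have hm[measurable]: "faddeev_h s e \<in> borel_measurable borel" by (rule measurable_faddeev_h[OF e])
  let ?g = "\<lambda>x. cis (- (x \<bullet> a)) * faddeev_h s e x"
  have gm: "?g \<in> borel_measurable borel" by measurable
  then show "?g \<in> borel_measurable lebesgue" by (intro measurable_completion) simp
  fix \<phi> :: "real ^ 'n \<Rightarrow> complex"
  assume \<phi>: "schwartz \<phi>"
  note [measurable] = schwartz_measurable[OF \<phi>]
  define \<Phi> where "\<Phi> = (\<lambda>x. cis (- (x \<bullet> a)) * \<phi> x)"
  define F where "F = (\<lambda>\<xi>. \<integral>x. cis (x \<bullet> \<xi>) * \<phi> x \<partial>lborel)"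
  have Fm[measurable]: "F \<in> borel_measurable borel" unfolding F_def by measurable
  have \<Phi>eq: "?g x * \<phi> x = faddeev_h s e x * \<Phi> x" for x by (simp add: \<Phi>_def mult_ac)
  have cont: "continuous_on UNIV \<Phi>" unfolding \<Phi>_def cis_conv_exp
    by (intro continuous_intros schwartz_continuous \<phi>)
  have n\<Phi>: "norm (\<Phi> x) = norm (\<phi> x)" for x by (simp add: \<Phi>_def norm_mult)
  have r\<Phi>: "rapidly_decreasing \<Phi>"
    using schwartz_rapidly_decreasing[OF \<phi>] unfolding rapidly_decreasing_def n\<Phi> .
  have m\<Phi>: "\<Phi> \<in> borel_measurable borel" unfolding \<Phi>_def by measurable
  have i\<Phi>: "integrable lborel \<Phi>" by (rule rapidly_decreasing_integrable[OF r\<Phi> m\<Phi>])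
  obtain B where B: "\<And>x. norm (\<Phi> x) \<le> B / (1 + norm x) ^ 0" using rapidly_decreasingE[OF r\<Phi>] by blast
  have ih: "integrable lborel (\<lambda>x. faddeev_h s e x * \<Phi> x)"
    by (rule integrable_faddeev_h_mult[OF e n' s i\<Phi>, of B]) (use B in simp)
  have gpm: "(\<lambda>x. ?g x * \<phi> x) \<in> borel_measurable lborel" by measurable
  show "integrable lebesgue (\<lambda>x. ?g x * \<phi> x)"
    using integrable_completion[OF gpm] ih unfolding \<Phi>eq by (rule iffD2)
  have Psi: "(\<integral>x. cis (x \<bullet> \<eta>) * \<Phi> x \<partial>lborel) = F (\<eta> - a)" for \<eta>
    unfolding F_def \<Phi>_def mult.assoc[symmetric] cis_mult by (simp add: inner_diff_right)
  have rF: "rapidly_decreasing (\<lambda>\<eta>. F (\<eta> - a))"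
    unfolding F_def by (rule rapidly_decreasing_translate[OF fourier_schwartz_rapidly_decreasing[OF \<phi>]])
  have main: "(\<integral>\<eta>. F (\<eta> - a) / faddeev_symbol s e \<eta> \<partial>lborel) = (2 * pi) ^ CARD('n) * (\<integral>x. faddeev_h s e x * \<Phi> x \<partial>lborel)"
    using faddeev_h_distribution[OF e n' s cont r\<Phi>] rF unfolding Psi D by blast
  let ?p = "\<lambda>\<xi>. of_real ((norm \<xi>)\<^sup>2) + 2 * cdot \<zeta> (cvec \<xi>)"
  have p: "?p (\<eta> + - a) = faddeev_symbol s e \<eta>" for \<eta>
  proof -
    have 1: "(norm (\<eta> - a))\<^sup>2 = (norm \<eta>)\<^sup>2 - 2 * (a \<bullet> \<eta>) + s\<^sup>2"
      using a by (simp add: power2_norm_eq_inner inner_diff_left inner_diff_right inner_commute[of \<eta> a] dot_square_norm[of a])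
    have 2: "a \<bullet> (\<eta> - a) = a \<bullet> \<eta> - s\<^sup>2" "(\<eta> - a) \<bullet> e = \<eta> \<bullet> e"
      using a ae by (simp_all add: inner_diff_left inner_diff_right dot_square_norm)
    show ?thesis unfolding faddeev_symbol_def \<zeta>
      using 1 2 by (simp add: complex_eq_iff algebra_simps)
  qed
  have pm[measurable]: "?p \<in> borel_measurable borel" unfolding \<zeta> by measurable
  have m2: "(\<lambda>\<xi>. F \<xi> / ?p \<xi>) \<in> borel_measurable borel" by measurable
  have inner: "(\<integral>x. exp (\<i> * cdot (cvec x) (cvec \<xi>)) * \<phi> x \<partial>lebesgue) = F \<xi>" for \<xi>
    unfolding F_def exp_i_cdot_cvec by (rule integral_completion) measurable
  have "(\<integral>x. ?g x * \<phi> x \<partial>lebesgue) = (\<integral>x. faddeev_h s e x * \<Phi> x \<partial>lborel)"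
    using integral_completion[OF gpm] unfolding \<Phi>eq .
  also have "\<dots> = 1 / (2 * pi) ^ CARD('n) * (\<integral>\<eta>. F (\<eta> - a) / faddeev_symbol s e \<eta> \<partial>lborel)"
    unfolding main mult.assoc[symmetric] of_real_mult[symmetric] by simp
  also have "(\<integral>\<eta>. F (\<eta> - a) / faddeev_symbol s e \<eta> \<partial>lborel) = (\<integral>\<xi>. F \<xi> / ?p \<xi> \<partial>lborel)"
    using integral_lborel_translate[OF m2, of "- a"] unfolding p by simp
  also have "\<dots> = (\<integral>\<xi>. F \<xi> / ?p \<xi> \<partial>lebesgue)"
    by (rule integral_completion[symmetric]) (use m2 in simp)
  finally show "(\<integral>x. ?g x * \<phi> x \<partial>lebesgue) = faddeev_distribution \<zeta> \<phi>"
    unfolding faddeev_distribution_def inner .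
qed

text \<open>
  The difference of two representatives times \<open>exp (- |x|\<^sup>2)\<close> is integrable, and it is orthogonal to
  all Gaussians because the product of two Gaussians is a Schwartz function.
\<close>

lemma represents_distribution_unique:
  fixes g g' :: "real ^ 'n \<Rightarrow> complex"
  assumes g: "represents_distribution g T" and g': "represents_distribution g' T"
  shows "AE x in lborel. g x = g' x"
proof -
  have gm: "g \<in> borel_measurable lebesgue" "g' \<in> borel_measurable lebesgue"
    using g g' unfolding represents_distribution_def by blast+
  obtain u where [measurable]: "u \<in> borel_measurable borel" and u1: "AE x in lborel. g x = u x"
    using borel_representative[OF gm(1)] .
  obtain u' where [measurable]: "u' \<in> borel_measurable borel" and u2: "AE x in lborel. g' x = u' x"
    using borel_representative[OF gm(2)] .
  note u = u1 u2
  have int: "integrable lborel (\<lambda>x. (u x - u' x) * \<phi> x)" and zero: "(\<integral>x. (u x - u' x) * \<phi> x \<partial>lborel) = 0"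
    if \<phi>: "schwartz \<phi>" for \<phi>
  proof -
    note [measurable] = schwartz_measurable[OF \<phi>]
    have 1: "(\<lambda>x. u x * \<phi> x) \<in> borel_measurable borel" "AE x in lborel. g x * \<phi> x = u x * \<phi> x"
      using u(1) by (auto elim!: eventually_mono)
    have 2: "(\<lambda>x. u' x * \<phi> x) \<in> borel_measurable borel" "AE x in lborel. g' x * \<phi> x = u' x * \<phi> x"
      using u(2) by (auto elim!: eventually_mono)
    have i: "integrable lborel (\<lambda>x. u x * \<phi> x)" "integrable lborel (\<lambda>x. u' x * \<phi> x)"
      using g g' \<phi> unfolding represents_distribution_def
        integrable_lebesgue_AE[OF 1, symmetric] integrable_lebesgue_AE[OF 2, symmetric] by blast+
    then show "integrable lborel (\<lambda>x. (u x - u' x) * \<phi> x)" by (simp add: left_diff_distrib)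
    have "(\<integral>x. u x * \<phi> x \<partial>lborel) = (\<integral>x. u' x * \<phi> x \<partial>lborel)"
      using g g' \<phi> unfolding represents_distribution_def
        integral_lebesgue_AE[OF 1, symmetric] integral_lebesgue_AE[OF 2, symmetric] by simp
    then show "(\<integral>x. (u x - u' x) * \<phi> x \<partial>lborel) = 0"
      using i by (simp add: left_diff_distrib)
  qed
  \<comment> \<open>the factor makes the difference, which is only locally integrable, integrable\<close>
  define d where "d = (\<lambda>x. (u x - u' x) * complex_of_real (exp (- (x \<bullet> x))))"
  have "AE x in lborel. d x = 0"
  proof (rule AE_eq_0_of_gaussians)
    show "integrable lborel d"
      using int[OF schwartz_gaussian[of 1 1 0]] unfolding d_def by simp
    fix k :: real and y :: "real ^ 'n"
    assume k: "k > 0"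
    have eq: "d x * of_real (exp (- k * (norm (x - y))\<^sup>2)) =
      (u x - u' x) * of_real (exp (- k * (y \<bullet> y)) * exp (- (1 + k) * (x \<bullet> x) + x \<bullet> ((2 * k) *\<^sub>R y)))" for x
    proof -
      have "- (x \<bullet> x) + - k * (norm (x - y))\<^sup>2 = - k * (y \<bullet> y) + (- (1 + k) * (x \<bullet> x) + x \<bullet> ((2 * k) *\<^sub>R y))"
        by (simp add: dot_square_norm[symmetric] inner_diff_left inner_diff_right inner_commute[of y x] algebra_simps)
      then show ?thesis unfolding d_def mult.assoc of_real_mult[symmetric] exp_add[symmetric] by simp
    qed
    show "(\<integral>x. d x * of_real (exp (- k * (norm (x - y))\<^sup>2)) \<partial>lborel) = 0"
      unfolding eq using k by (intro zero schwartz_gaussian) simp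
  qed
  with u show ?thesis by eventually_elim (simp add: d_def)
qed

lemma faddeev_g_AE:
  fixes \<zeta> :: "complex ^ 'n" and a e :: "real ^ 'n"
  assumes n: "CARD('n) \<ge> 3" and s: "s > 0" and a: "norm a = s" and e: "norm e = 1" and ae: "a \<bullet> e = 0"
    and \<zeta>: "\<And>\<xi>. cdot \<zeta> (cvec \<xi>) = of_real (a \<bullet> \<xi>) + \<i> * of_real (s * (\<xi> \<bullet> e))"
  shows "AE x in lborel. faddeev_g \<zeta> x = cis (- (x \<bullet> a)) * faddeev_h s e x"
proof -
  note r = represents_faddeev_distribution[OF n s a e ae \<zeta>]
  have "represents_distribution (faddeev_g \<zeta>) (faddeev_distribution \<zeta>)"
    unfolding faddeev_g_def by (rule someI[of "\<lambda>g. represents_distribution g (faddeev_distribution \<zeta>)", OF r])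
  then show ?thesis using r by (rule represents_distribution_unique)
qed

section \<open>Exponentially growing solutions and the scattering transform\<close>

lemma integrable_mult_nonzero_iff:
  fixes c :: complex
  assumes "c \<noteq> 0"
  shows "integrable M (\<lambda>x. c * f x) \<longleftrightarrow> integrable M f"
  using assms by (metis integrable_mult_right integrable_mult_right_cancel)

lemma measurable_japanese [measurable]: "japanese \<in> borel_measurable borel"
  unfolding japanese_def by measurable

lemma weighted_L2_AE:
  fixes f f' :: "real ^ 'n \<Rightarrow> complex"
  assumes m[measurable]: "f' \<in> borel_measurable borel" and ae: "AE x in lborel. f x = f' x"
  shows "weighted_L2 \<delta> f \<longleftrightarrow> (\<integral>\<^sup>+x. ennreal ((japanese x powr \<delta> * cmod (f' x))\<^sup>2) \<partial>lborel) < \<infinity>"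
proof -
  have m2: "(\<lambda>x. (japanese x powr \<delta> * cmod (f' x))\<^sup>2) \<in> borel_measurable borel" by measurable
  have ae2: "AE x in lborel. (japanese x powr \<delta> * cmod (f x))\<^sup>2 = (japanese x powr \<delta> * cmod (f' x))\<^sup>2"
    using ae by eventually_elim simp
  have "weighted_L2 \<delta> f \<longleftrightarrow> integrable lborel (\<lambda>x. (japanese x powr \<delta> * cmod (f' x))\<^sup>2)"
    unfolding weighted_L2_def using lebesgue_measurable_AE[OF m ae] integrable_lebesgue_AE[OF m2 ae2] by simp
  also have "\<dots> \<longleftrightarrow> (\<integral>\<^sup>+x. ennreal ((japanese x powr \<delta> * cmod (f' x))\<^sup>2) \<partial>lborel) < \<infinity>"
    using m2 by (simp add: integrable_iff_bounded)
  finally show ?thesis .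
qed

text \<open>
  The substitution \<open>\<phi> = exp (i x \<cdot> \<zeta>) (1 + v)\<close> removes the exponential factors from the integral
  equation, since the exponential is multiplicative. On the right side the functions \<open>g\<close> and \<open>q0\<close> are
  Borel representatives of \<open>faddeev_g\<close> and of the potential.
\<close>

lemma exp_growing_solution_iff:
  fixes \<zeta> :: "complex ^ 'n"
  assumes g[measurable]: "g \<in> borel_measurable borel" and gae: "AE x in lborel. faddeev_g \<zeta> x = g x"
    and q0[measurable]: "q0 \<in> borel_measurable borel" and qae: "AE x in lborel. q x = q0 x"
    and v[measurable]: "v \<in> borel_measurable borel"
    and \<phi>: "AE x in lborel. \<phi> x = exp (\<i> * cdot (cvec x) \<zeta>) * (1 + v x)"
  shows "exp_growing_solution q \<delta> \<zeta> \<phi> \<longleftrightarrow>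
    (AE x in lborel. integrable lborel (\<lambda>y. g (x - y) * (q0 y * (1 + v y))) \<and>
       v x = - (\<integral>y. g (x - y) * (q0 y * (1 + v y)) \<partial>lborel)) \<and>
    (\<integral>\<^sup>+x. ennreal ((japanese x powr (\<delta> - 1) * cmod (v x))\<^sup>2) \<partial>lborel) < \<infinity>"
proof -
  define E where "E = (\<lambda>x. exp (\<i> * cdot (cvec x) \<zeta>))"
  have Em[measurable]: "E \<in> borel_measurable borel"
    unfolding E_def cdot_def cvec_def by (intro borel_measurable_continuous_onI continuous_intros)
  have E0: "E x \<noteq> 0" for x by (simp add: E_def)
  have Einv: "exp (- \<i> * cdot (cvec x) \<zeta>) = inverse (E x)" for x by (simp add: E_def exp_minus)
  have Eadd: "E (x - y) * E y = E x" for x y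
  proof -
    have "cdot (cvec (x - y)) \<zeta> + cdot (cvec y) \<zeta> = cdot (cvec x) \<zeta>"
      by (simp add: cdot_def cvec_def sum.distrib[symmetric] algebra_simps)
    then show ?thesis unfolding E_def exp_add[symmetric] distrib_left[symmetric] by simp
  qed
  have G: "faddeev_G \<zeta> x = E x * faddeev_g \<zeta> x" for x by (simp add: faddeev_G_def E_def)
  have Ex: "exp (\<i> * cdot (cvec x) \<zeta>) = E x" for x by (simp add: E_def)
  note \<phi>' = \<phi>[unfolded Ex]
  have meas: "\<phi> \<in> borel_measurable lebesgue" by (rule lebesgue_measurable_AE[OF _ \<phi>']) measurable
  let ?h = "\<lambda>x y. g (x - y) * (q0 y * (1 + v y))"
  have hm: "(\<lambda>y. E x * ?h x y) \<in> borel_measurable borel" for x by measurable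
  have hae: "AE y in lborel. faddeev_G \<zeta> (x - y) * q y * \<phi> y = E x * ?h x y" for x
    using AE_lborel_reflect[OF gae, of x] qae \<phi>'
  proof eventually_elim
    case (elim y)
    show ?case unfolding G elim Eadd[of x y, symmetric] by (simp add: mult_ac)
  qed
  have I: "integrable lebesgue (\<lambda>y. faddeev_G \<zeta> (x - y) * q y * \<phi> y) \<longleftrightarrow> integrable lborel (?h x)" for x
    unfolding integrable_lebesgue_AE[OF hm hae] by (rule integrable_mult_nonzero_iff[OF E0])
  have J: "(\<integral>y. faddeev_G \<zeta> (x - y) * q y * \<phi> y \<partial>lebesgue) = E x * (\<integral>y. ?h x y \<partial>lborel)" for x
    unfolding integral_lebesgue_AE[OF hm hae] by simp
  have eq: "(E x * (1 + v x) = E x - E x * J) \<longleftrightarrow> v x = - J" for x J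
  proof -
    have "(E x * (1 + v x) = E x - E x * J) \<longleftrightarrow> E x * v x = E x * (- J)" by (simp add: distrib_left)
    then show ?thesis using E0[of x] by (simp only: mult_cancel_left simp_thms)
  qed
  have 1: "(AE x in lebesgue. integrable lebesgue (\<lambda>y. faddeev_G \<zeta> (x - y) * q y * \<phi> y) \<and>
       \<phi> x = exp (\<i> * cdot (cvec x) \<zeta>) - (\<integral>y. faddeev_G \<zeta> (x - y) * q y * \<phi> y \<partial>lebesgue)) \<longleftrightarrow>
    (AE x in lborel. integrable lborel (?h x) \<and> v x = - (\<integral>y. ?h x y \<partial>lborel))"
    unfolding AE_completion_iff I J Ex
  proof (rule eventually_subst, use \<phi>' in eventually_elim)
    case (elim x)
    then show ?case using eq[of x] by simp
  qed
  have "AE x in lborel. exp (- \<i> * cdot (cvec x) \<zeta>) * \<phi> x - 1 = v x"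
    using \<phi>' unfolding Einv
  proof eventually_elim
    case (elim x)
    then show ?case using E0[of x] by (simp add: field_simps)
  qed
  note 2 = weighted_L2_AE[OF v this, of "\<delta> - 1"]
  show ?thesis unfolding exp_growing_solution_def 1 2 using meas by simp
qed

text \<open>
  Multiplying the kernel by \<open>cis (- (x \<bullet> a))\<close> changes the convolution by factors of modulus 1 in
  front of the result and of \<open>f\<close>.
\<close>

lemma faddeev_green_convolution_bounds:
  fixes a e :: "'a::euclidean_space" and s :: real and f g :: "'a \<Rightarrow> complex"
  assumes g: "\<And>x. g x = cis (- (x \<bullet> a)) * faddeev_h s e x"
    and e: "norm e = 1" and n: "DIM('a) \<ge> 3" and s: "s > 0"
    and f: "f \<in> borel_measurable borel" and f2: "(\<integral>\<^sup>+y. ennreal ((norm (f y))\<^sup>2) \<partial>lborel) < \<infinity>"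
    and supp: "\<And>y. norm y > L \<Longrightarrow> f y = 0" and L: "L > 0"
  shows "AE x in lborel. integrable lborel (\<lambda>y. g (x - y) * f y)"
    and "(\<integral>\<^sup>+x. indicator (cball 0 L) x * ennreal ((norm (\<integral>y. g (x - y) * f y \<partial>lborel))\<^sup>2) \<partial>lborel)
      \<le> ennreal ((8 * L / s)\<^sup>2) * (\<integral>\<^sup>+y. ennreal ((norm (f y))\<^sup>2) \<partial>lborel)"
    and "0 < \<delta> \<Longrightarrow> \<delta> < 1 \<Longrightarrow>
      (\<integral>\<^sup>+x. ennreal ((1 + norm x) powr (2 * \<delta> - 2)) * ennreal ((norm (\<integral>y. g (x - y) * f y \<partial>lborel))\<^sup>2) \<partial>lborel) < \<infinity>"
proof -
  note [measurable] = f
  define F where "F = (\<lambda>y. cis (y \<bullet> a) * f y)"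
  have nF: "norm (F y) = norm (f y)" for y by (simp add: F_def norm_mult)
  have Fm: "F \<in> borel_measurable borel" unfolding F_def by measurable
  have F2: "(\<integral>\<^sup>+y. ennreal ((norm (F y))\<^sup>2) \<partial>lborel) < \<infinity>" using f2 by (simp add: nF)
  have Fs: "norm y > L \<Longrightarrow> F y = 0" for y using supp by (simp add: F_def)
  have Fi: "integrable lborel F" by (rule L2_support_integrable[OF Fm F2 Fs])
  have eq: "g (x - y) * f y = cis (- (x \<bullet> a)) * (faddeev_h s e (x - y) * F y)" for x y
  proof -
    have "cis (- ((x - y) \<bullet> a)) = cis (- (x \<bullet> a)) * cis (y \<bullet> a)" by (simp add: cis_mult inner_diff_left)
    then show ?thesis by (simp add: g F_def mult_ac)
  qed
  have nI: "norm (\<integral>y. g (x - y) * f y \<partial>lborel) = norm (\<integral>y. faddeev_h s e (x - y) * F y \<partial>lborel)" for x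
    unfolding eq integral_mult_right_zero norm_mult by simp
  have iI: "integrable lborel (\<lambda>y. g (x - y) * f y) \<longleftrightarrow> integrable lborel (\<lambda>y. faddeev_h s e (x - y) * F y)" for x
    unfolding eq by (rule integrable_mult_nonzero_iff) simp
  note b = faddeev_convolution_bounds[OF e n s Fi F2 Fs L]
  show "AE x in lborel. integrable lborel (\<lambda>y. g (x - y) * f y)" unfolding iI by (rule b(1))
  show "(\<integral>\<^sup>+x. indicator (cball 0 L) x * ennreal ((norm (\<integral>y. g (x - y) * f y \<partial>lborel))\<^sup>2) \<partial>lborel)
      \<le> ennreal ((8 * L / s)\<^sup>2) * (\<integral>\<^sup>+y. ennreal ((norm (f y))\<^sup>2) \<partial>lborel)"
    unfolding nI by (rule b(2)[unfolded nF])
  show "(\<integral>\<^sup>+x. ennreal ((1 + norm x) powr (2 * \<delta> - 2)) * ennreal ((norm (\<integral>y. g (x - y) * f y \<partial>lborel))\<^sup>2) \<partial>lborel) < \<infinity>"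
    if "0 < \<delta>" "\<delta> < 1"
    unfolding nI by (rule b(3)[OF _ that])
qed

lemma bounded_support_L2:
  fixes f u :: "'a::euclidean_space \<Rightarrow> complex"
  assumes [measurable]: "f \<in> borel_measurable borel" "u \<in> borel_measurable borel"
    and M: "M \<ge> 0" "\<And>x. norm (f x) \<le> M" and supp: "\<And>x. norm x > L \<Longrightarrow> f x = 0"
    and u: "(\<integral>\<^sup>+x. indicator (cball 0 L) x * ennreal ((norm (u x))\<^sup>2) \<partial>lborel) < \<infinity>"
  shows "(\<integral>\<^sup>+x. ennreal ((norm (f x * (1 + u x)))\<^sup>2) \<partial>lborel) < \<infinity>"
proof -
  have "(\<integral>\<^sup>+x. ennreal ((norm (f x * (1 + u x)))\<^sup>2) \<partial>lborel) \<le>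
    (\<integral>\<^sup>+x. ennreal (2 * M\<^sup>2) * (indicator (cball 0 L) x + indicator (cball 0 L) x * ennreal ((norm (u x))\<^sup>2)) \<partial>lborel)"
  proof (rule nn_integral_mono)
    fix x :: 'a
    show "ennreal ((norm (f x * (1 + u x)))\<^sup>2) \<le> ennreal (2 * M\<^sup>2) * (indicator (cball 0 L) x + indicator (cball 0 L) x * ennreal ((norm (u x))\<^sup>2))"
    proof (cases "norm x \<le> L")
      case True
      have "norm (1 + u x) \<le> 1 + norm (u x)" using norm_triangle_ineq[of 1 "u x"] by simp
      then have "(norm (1 + u x))\<^sup>2 \<le> (1 + norm (u x))\<^sup>2" by (rule power_mono) simp
      also have "\<dots> \<le> 2 * (1 + (norm (u x))\<^sup>2)"
        using zero_le_power2[of "norm (u x) - 1"] by (simp add: power2_eq_square algebra_simps)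
      finally have "(norm (f x * (1 + u x)))\<^sup>2 \<le> M\<^sup>2 * (2 * (1 + (norm (u x))\<^sup>2))"
        unfolding norm_mult power_mult_distrib by (intro mult_mono power_mono M) simp_all
      also have "\<dots> = (2 * M\<^sup>2) * (1 + (norm (u x))\<^sup>2)" by simp
      finally have "ennreal ((norm (f x * (1 + u x)))\<^sup>2) \<le> ennreal ((2 * M\<^sup>2) * (1 + (norm (u x))\<^sup>2))"
        by (rule ennreal_leI)
      also have "\<dots> = ennreal (2 * M\<^sup>2) * (1 + ennreal ((norm (u x))\<^sup>2))"
        by (subst ennreal_mult, simp, simp, subst ennreal_plus) simp_all
      finally show ?thesis using True by simp
    qed (simp add: supp)
  qed
  also have "\<dots> = ennreal (2 * M\<^sup>2) * (emeasure lborel (cball (0::'a) L) + (\<integral>\<^sup>+x. indicator (cball 0 L) x * ennreal ((norm (u x))\<^sup>2) \<partial>lborel))"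
    by (subst nn_integral_cmult, simp, subst nn_integral_add) simp_all
  also have "\<dots> < \<infinity>"
  proof -
    have "emeasure lborel (cball (0::'a) L) + (\<integral>\<^sup>+x. indicator (cball 0 L) x * ennreal ((norm (u x))\<^sup>2) \<partial>lborel) < \<infinity>"
      using u emeasure_lborel_cball_finite[of "0::'a" L] by (auto simp: less_top)
    then show ?thesis by (simp only: ennreal_mult_less_top infinity_ennreal_def ennreal_less_top simp_thms)
  qed
  finally show ?thesis .
qed

text \<open>
  The squared operator norm on the ball is at most \<open>\<kappa> = (8 L / s)\<^sup>2\<close>, and \<open>norm \<zeta> = sqrt 2 * s\<close>, so that the
  lower bound on \<open>norm \<zeta>\<close> gives \<open>\<kappa> M\<^sup>2 \<le> 1 / 4\<close>. A competing solution lies in the weighted space; the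
  weight is bounded below on the ball, so its restriction is in \<open>L\<^sup>2\<close> there and the uniqueness statement for
  the Neumann series applies.
\<close>

proposition exp_growing_solution_small_potential:
  fixes \<zeta> :: "complex ^ 'n" and q q0 :: "real ^ 'n \<Rightarrow> complex"
  assumes n: "CARD('n) \<ge> 3" and iso: "cdot \<zeta> \<zeta> = 0" and nz: "\<zeta> \<noteq> 0" and \<delta>: "0 < \<delta>" "\<delta> < 1"
    and q0[measurable]: "q0 \<in> borel_measurable borel" and qae: "AE x in lborel. q x = q0 x"
    and M: "M \<ge> 0" "\<And>x. norm (q0 x) \<le> M" and supp: "\<And>x. norm x > L \<Longrightarrow> q0 x = 0" and L: "L > 0"
    and large: "32 * L * M \<le> norm \<zeta>"
  shows "\<exists>\<psi>. exp_growing_solution q \<delta> \<zeta> \<psi> \<and>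
    (\<forall>\<phi>. exp_growing_solution q \<delta> \<zeta> \<phi> \<longrightarrow> (AE x in lebesgue. \<phi> x = \<psi> x)) \<and>
    (\<forall>\<xi>. cmod (scattering_transform q \<psi> \<xi> \<zeta> - fourier q \<xi>)
       \<le> 32 * L / norm \<zeta> * (\<integral>x. (norm (q0 x))\<^sup>2 \<partial>lborel))"
proof -
  obtain s a e where s: "s > 0" and a: "norm a = s" and e: "norm e = 1" and ae: "a \<bullet> e = 0"
    and ns: "(norm \<zeta>)\<^sup>2 = 2 * s\<^sup>2"
    and \<zeta>: "\<And>\<xi>. cdot \<zeta> (cvec \<xi>) = of_real (a \<bullet> \<xi>) + \<i> * of_real (s * (\<xi> \<bullet> e))"
    by (rule isotropic_decomposition[OF iso nz]) blast
  have n': "DIM(real ^ 'n) \<ge> 3" using n by simp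
  \<comment> \<open>the constant 2 replaces \<open>sqrt 2\<close>\<close>
  have s2: "norm \<zeta> \<le> 2 * s"
  proof (rule power2_le_imp_le)
    show "(norm \<zeta>)\<^sup>2 \<le> (2 * s)\<^sup>2" unfolding ns by (simp add: power_mult_distrib)
  qed (use s in simp)
  have n\<zeta>: "norm \<zeta> > 0" using nz by simp
  have hm: "faddeev_h s e \<in> borel_measurable borel" by (rule measurable_faddeev_h[OF e])
  define g where "g = (\<lambda>x. cis (- (x \<bullet> a)) * faddeev_h s e x)"
  have gm[measurable]: "g \<in> borel_measurable borel" unfolding g_def using hm by measurable
  have gae: "AE x in lborel. faddeev_g \<zeta> x = g x"
    unfolding g_def by (rule faddeev_g_AE[OF n s a e ae \<zeta>])
  have "g x = cis (- (x \<bullet> a)) * faddeev_h s e x" for x by (simp add: g_def)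
  note conv = faddeev_green_convolution_bounds[OF this e n' s]
  define \<kappa> where "\<kappa> = (8 * L / s)\<^sup>2"
  have \<kappa>: "\<kappa> \<ge> 0" "sqrt \<kappa> = 8 * L / s" using L s by (simp_all add: \<kappa>_def)
  have small: "\<kappa> * M\<^sup>2 \<le> 1 / 4"
  proof -
    have "8 * L / s * M \<le> 1 / 2" using large s2 s by (simp add: divide_le_eq)
    then have "(8 * L / s * M)\<^sup>2 \<le> (1 / 2)\<^sup>2" using L s M by (intro power_mono) auto
    then show ?thesis by (simp add: \<kappa>_def power_mult_distrib power_divide)
  qed
  let ?B = "cball (0 :: real ^ 'n) L"
  let ?N = "\<lambda>u. \<integral>\<^sup>+x. indicator ?B x * ennreal ((norm (u x :: complex))\<^sup>2) \<partial>lborel"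
  let ?eq = "\<lambda>u. AE x in lborel. integrable lborel (\<lambda>y. g (x - y) * (q0 y * (1 + u y))) \<and>
       u x = - (\<integral>y. g (x - y) * (q0 y * (1 + u y)) \<partial>lborel)"
  have conv1: "AE x in lborel. integrable lborel (\<lambda>y. g (x - y) * f y)"
    and conv2: "(\<integral>\<^sup>+x. indicator ?B x * ennreal ((norm (\<integral>y. g (x - y) * f y \<partial>lborel))\<^sup>2) \<partial>lborel)
      \<le> ennreal \<kappa> * (\<integral>\<^sup>+y. ennreal ((norm (f y))\<^sup>2) \<partial>lborel)"
    if "f \<in> borel_measurable borel" "(\<integral>\<^sup>+y. ennreal ((norm (f y))\<^sup>2) \<partial>lborel) < \<infinity>" "\<And>y. norm y > L \<Longrightarrow> f y = 0" for f
    unfolding \<kappa>_def using conv(1)[of f L] conv(2)[of f L] that L by blast+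
  obtain w where wm[measurable]: "w \<in> borel_measurable borel" and weq: "?eq w"
    and w2: "?N w \<le> ennreal (4 * \<kappa>) * (\<integral>\<^sup>+y. ennreal ((norm (q0 y))\<^sup>2) \<partial>lborel)"
  proof -
    have "\<exists>w. w \<in> borel_measurable borel \<and> ?eq w \<and> ?N w \<le> ennreal (4 * \<kappa>) * (\<integral>\<^sup>+y. ennreal ((norm (q0 y))\<^sup>2) \<partial>lborel)"
      by (rule neumann_series_solution) (fact gm q0 M(1) M(2) supp conv1 conv2 \<kappa>(1) small)+
    then show thesis using that by blast
  qed
  define Q where "Q = (\<integral>x. (norm (q0 x))\<^sup>2 \<partial>lborel)"
  have Q0: "Q \<ge> 0" by (simp add: Q_def)
  have q2: "(\<integral>\<^sup>+x. ennreal ((norm (q0 x))\<^sup>2) \<partial>lborel) < \<infinity>"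
    using bounded_support_L2[OF q0 _ M, of "\<lambda>x. 0" L] supp by simp
  have Qeq: "(\<integral>\<^sup>+x. ennreal ((norm (q0 x))\<^sup>2) \<partial>lborel) = ennreal Q"
    unfolding Q_def using q2 by (intro nn_integral_eq_integral) (auto simp: integrable_iff_bounded)
  have wfin: "?N w < \<infinity>" using w2 unfolding Qeq by (rule le_less_trans) (simp add: ennreal_mult_less_top)
  have fin: "(\<integral>\<^sup>+x. ennreal ((norm (q0 x * (1 + w x)))\<^sup>2) \<partial>lborel) < \<infinity>"
    by (rule bounded_support_L2[OF q0 wm M _ wfin]) (rule supp)
  have s0: "norm y > L \<Longrightarrow> q0 y * (1 + w y) = 0" for y using supp by simp
  define \<psi> where "\<psi> = (\<lambda>x. exp (\<i> * cdot (cvec x) \<zeta>) * (1 + w x))"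
  have \<psi>: "AE x in lborel. \<psi> x = exp (\<i> * cdot (cvec x) \<zeta>) * (1 + w x)" by (simp add: \<psi>_def)
  have weighted: "(\<integral>\<^sup>+x. ennreal ((japanese x powr (\<delta> - 1) * cmod (w x))\<^sup>2) \<partial>lborel) < \<infinity>"
  proof -
    let ?I = "\<lambda>x. \<integral>y. g (x - y) * (q0 y * (1 + w y)) \<partial>lborel"
    have "(\<integral>\<^sup>+x. ennreal ((japanese x powr (\<delta> - 1) * cmod (w x))\<^sup>2) \<partial>lborel) \<le>
      (\<integral>\<^sup>+x. ennreal 4 * (ennreal ((1 + norm x) powr (2 * \<delta> - 2)) * ennreal ((norm (?I x))\<^sup>2)) \<partial>lborel)"
    proof (rule nn_integral_mono_AE, use weq in eventually_elim)
      case (elim x)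
      have pos: "1 + norm x > 0" by (simp add: add_pos_nonneg)
      have "japanese x powr (2 * \<delta> - 2) \<le> ((1 / 2) * (1 + norm x)) powr (2 * \<delta> - 2)"
        using japanese_ge(2)[of x] pos \<delta> by (intro powr_mono2') auto
      also have "\<dots> = (1 / 2) powr (2 * \<delta> - 2) * (1 + norm x) powr (2 * \<delta> - 2)"
        by (rule powr_mult)
      also have "\<dots> \<le> 4 * (1 + norm x) powr (2 * \<delta> - 2)"
      proof (rule mult_right_mono)
        have "(1 / 2 :: real) powr (2 * \<delta> - 2) \<le> (1 / 2) powr (- 2)"
          using \<delta> by (intro powr_mono') auto
        then show "(1 / 2 :: real) powr (2 * \<delta> - 2) \<le> 4" by (simp add: powr_minus power_divide)
      qed simp
      finally have j: "japanese x powr (2 * \<delta> - 2) \<le> 4 * (1 + norm x) powr (2 * \<delta> - 2)" .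
      have "(japanese x powr (\<delta> - 1))\<^sup>2 = japanese x powr (2 * \<delta> - 2)"
        by (simp add: power2_eq_square powr_add[symmetric])
      moreover have "cmod (w x) = norm (?I x)" using elim by (metis norm_minus_cancel)
      ultimately have "(japanese x powr (\<delta> - 1) * cmod (w x))\<^sup>2 \<le> (4 * (1 + norm x) powr (2 * \<delta> - 2)) * (norm (?I x))\<^sup>2"
        unfolding power_mult_distrib using j by (simp add: mult_right_mono)
      then have "ennreal ((japanese x powr (\<delta> - 1) * cmod (w x))\<^sup>2) \<le> ennreal ((4 * (1 + norm x) powr (2 * \<delta> - 2)) * (norm (?I x))\<^sup>2)"
        by (rule ennreal_leI)
      also have "\<dots> = ennreal 4 * (ennreal ((1 + norm x) powr (2 * \<delta> - 2)) * ennreal ((norm (?I x))\<^sup>2))"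
        by (simp add: ennreal_mult mult.assoc)
      finally show ?case .
    qed
    also have "\<dots> = ennreal 4 * (\<integral>\<^sup>+x. ennreal ((1 + norm x) powr (2 * \<delta> - 2)) * ennreal ((norm (?I x))\<^sup>2) \<partial>lborel)"
      by (rule nn_integral_cmult) measurable
    also have "\<dots> < \<infinity>"
    proof -
      have "(\<integral>\<^sup>+x. ennreal ((1 + norm x) powr (2 * \<delta> - 2)) * ennreal ((norm (?I x))\<^sup>2) \<partial>lborel) < \<infinity>"
        by (rule conv(3)[OF _ fin _ L \<delta>]) (use s0 in simp_all)
      then show ?thesis by (simp add: ennreal_mult_less_top)
    qed
    finally show ?thesis .
  qed
  have sol: "exp_growing_solution q \<delta> \<zeta> \<psi>"
    unfolding exp_growing_solution_iff[OF gm gae q0 qae wm \<psi>] using weq weighted by blast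
  have unique: "AE x in lebesgue. \<phi> x = \<psi> x" if \<phi>: "exp_growing_solution q \<delta> \<zeta> \<phi>" for \<phi>
  proof -
    have "\<phi> \<in> borel_measurable lebesgue" using \<phi> by (simp add: exp_growing_solution_def)
    then obtain f where [measurable]: "f \<in> borel_measurable borel" and f: "AE x in lborel. \<phi> x = f x"
      using borel_representative by blast
    define v where "v = (\<lambda>x. exp (- (\<i> * cdot (cvec x) \<zeta>)) * f x - 1)"
    have [measurable]: "(\<lambda>x. exp (- (\<i> * cdot (cvec x) \<zeta>))) \<in> borel_measurable borel"
      unfolding cdot_def cvec_def by (intro borel_measurable_continuous_onI continuous_intros)
    have vm[measurable]: "v \<in> borel_measurable borel" unfolding v_def by measurable
    have v: "AE x in lborel. \<phi> x = exp (\<i> * cdot (cvec x) \<zeta>) * (1 + v x)"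
      using f by eventually_elim (simp add: v_def mult.assoc[symmetric] exp_add[symmetric])
    have veq: "?eq v" and vw: "(\<integral>\<^sup>+x. ennreal ((japanese x powr (\<delta> - 1) * cmod (v x))\<^sup>2) \<partial>lborel) < \<infinity>"
      using \<phi> unfolding exp_growing_solution_iff[OF gm gae q0 qae vm v] by blast+
    have vfin: "?N v < \<infinity>"
    proof -
      let ?c = "((1 + L) powr (1 - \<delta>))\<^sup>2"
      have "?N v \<le> (\<integral>\<^sup>+x. ennreal ?c * ennreal ((japanese x powr (\<delta> - 1) * cmod (v x))\<^sup>2) \<partial>lborel)"
      proof (rule nn_integral_mono)
        fix x :: "real ^ 'n"
        show "indicator ?B x * ennreal ((norm (v x))\<^sup>2) \<le> ennreal ?c * ennreal ((japanese x powr (\<delta> - 1) * cmod (v x))\<^sup>2)"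
        proof (cases "norm x \<le> L")
          case True
          have j: "japanese x \<ge> 1" "japanese x \<le> 1 + L" using True japanese_ge(1)[of x] japanese_le[of x] by auto
          have "1 = japanese x powr (1 - \<delta>) * japanese x powr (\<delta> - 1)"
            using j by (simp add: powr_add[symmetric])
          also have "\<dots> \<le> (1 + L) powr (1 - \<delta>) * japanese x powr (\<delta> - 1)"
            using j \<delta> by (intro mult_right_mono powr_mono2) auto
          finally have "1 * norm (v x) \<le> ((1 + L) powr (1 - \<delta>) * japanese x powr (\<delta> - 1)) * norm (v x)"
            by (rule mult_right_mono) simp
          then have "(norm (v x))\<^sup>2 \<le> ((1 + L) powr (1 - \<delta>) * (japanese x powr (\<delta> - 1) * norm (v x)))\<^sup>2"
            by (intro power_mono) (simp_all add: mult.assoc)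
          then have "ennreal ((norm (v x))\<^sup>2) \<le> ennreal (?c * (japanese x powr (\<delta> - 1) * cmod (v x))\<^sup>2)"
            unfolding power_mult_distrib[of "(1 + L) powr (1 - \<delta>)"] by (rule ennreal_leI)
          then show ?thesis using True by (simp add: ennreal_mult)
        qed simp
      qed
      also have "\<dots> = ennreal ?c * (\<integral>\<^sup>+x. ennreal ((japanese x powr (\<delta> - 1) * cmod (v x))\<^sup>2) \<partial>lborel)"
        by (rule nn_integral_cmult) measurable
      also have "\<dots> < \<infinity>" using vw by (simp add: ennreal_mult_less_top)
      finally show ?thesis .
    qed
    have "AE x in lborel. v x = w x"
      by (rule neumann_series_unique[OF _ _ _ _ _ _ _ _ _ vm wm vfin wfin veq weq])
        (fact gm q0 M(1) M(2) supp conv1 conv2 \<kappa>(1) small)+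
    with v show ?thesis unfolding AE_completion_iff by eventually_elim (simp add: \<psi>_def)
  qed
  have bound: "cmod (scattering_transform q \<psi> \<xi> \<zeta> - fourier q \<xi>) \<le> 32 * L / norm \<zeta> * Q" for \<xi>
  proof -
    have e1: "AE x in lborel. exp (- \<i> * cdot (cvec x) (\<zeta> + cvec \<xi>)) * q x * \<psi> x = cis (- (x \<bullet> \<xi>)) * (q0 x * (1 + w x))"
      using qae
    proof eventually_elim
      case (elim x)
      have "exp (- \<i> * cdot (cvec x) (\<zeta> + cvec \<xi>)) * exp (\<i> * cdot (cvec x) \<zeta>) = cis (- (x \<bullet> \<xi>))"
        unfolding cdot_add_right cdot_cvec exp_add[symmetric] cis_conv_exp by (simp add: algebra_simps)
      then show ?case unfolding elim \<psi>_def by (simp add: mult_ac)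
    qed
    have e2: "AE x in lborel. exp (- \<i> * cdot (cvec x) (cvec \<xi>)) * q x = cis (- (x \<bullet> \<xi>)) * q0 x"
      using qae by eventually_elim (simp add: cdot_cvec cis_conv_exp)
    have i1: "integrable lborel (\<lambda>x. cis (- (x \<bullet> \<xi>)) * (q0 x * (1 + w x)))"
      by (rule integrable_mult_bounded[OF L2_support_integrable[OF _ fin], where B=1]) (use s0 in auto)
    have i2: "integrable lborel (\<lambda>x. cis (- (x \<bullet> \<xi>)) * q0 x)"
      by (rule integrable_mult_bounded[OF L2_support_integrable[OF q0 q2], where B=1]) (use supp in auto)
    have "scattering_transform q \<psi> \<xi> \<zeta> - fourier q \<xi> =
      (\<integral>x. cis (- (x \<bullet> \<xi>)) * (q0 x * (1 + w x)) \<partial>lborel) - (\<integral>x. cis (- (x \<bullet> \<xi>)) * q0 x \<partial>lborel)"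
      unfolding scattering_transform_def fourier_def
      by (subst integral_lebesgue_AE[OF _ e1], measurable, subst integral_lebesgue_AE[OF _ e2], measurable)
    also have "\<dots> = (\<integral>x. cis (- (x \<bullet> \<xi>)) * (q0 x * w x) \<partial>lborel)"
      unfolding Bochner_Integration.integral_diff[OF i1 i2, symmetric]
      by (intro Bochner_Integration.integral_cong) (simp_all add: algebra_simps)
    finally have eq: "scattering_transform q \<psi> \<xi> \<zeta> - fourier q \<xi> = (\<integral>x. cis (- (x \<bullet> \<xi>)) * (q0 x * w x) \<partial>lborel)" .
    have "ennreal (cmod (scattering_transform q \<psi> \<xi> \<zeta> - fourier q \<xi>)) \<le> (\<integral>\<^sup>+x. ennreal (norm (cis (- (x \<bullet> \<xi>)) * (q0 x * w x))) \<partial>lborel)"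
      unfolding eq by (rule norm_integral_le_nn_integral)
    also have "\<dots> = (\<integral>\<^sup>+x. ennreal (norm (q0 x)) * (indicator ?B x * ennreal (norm (w x))) \<partial>lborel)"
    proof (intro nn_integral_cong)
      fix x :: "real ^ 'n"
      show "ennreal (norm (cis (- (x \<bullet> \<xi>)) * (q0 x * w x))) = ennreal (norm (q0 x)) * (indicator ?B x * ennreal (norm (w x)))"
        using supp[of x] by (cases "norm x \<le> L") (simp_all add: norm_mult ennreal_mult)
    qed
    finally have "(ennreal (cmod (scattering_transform q \<psi> \<xi> \<zeta> - fourier q \<xi>)))\<^sup>2 \<le>
      (\<integral>\<^sup>+x. ennreal (norm (q0 x)) * (indicator ?B x * ennreal (norm (w x))) \<partial>lborel)\<^sup>2"
      by (rule power_mono) simp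
    also have "\<dots> \<le> (\<integral>\<^sup>+x. (ennreal (norm (q0 x)))\<^sup>2 \<partial>lborel) * (\<integral>\<^sup>+x. (indicator ?B x * ennreal (norm (w x)))\<^sup>2 \<partial>lborel)"
      by (rule Cauchy_Schwarz_nn_integral) simp_all
    also have "(\<integral>\<^sup>+x. (ennreal (norm (q0 x)))\<^sup>2 \<partial>lborel) = ennreal Q"
      unfolding Qeq[symmetric] by (simp add: ennreal_power)
    also have "(\<integral>\<^sup>+x. (indicator ?B x * ennreal (norm (w x)))\<^sup>2 \<partial>lborel) = ?N w"
    proof (intro nn_integral_cong)
      fix x :: "real ^ 'n"
      show "(indicator ?B x * ennreal (norm (w x)))\<^sup>2 = indicator ?B x * ennreal ((norm (w x))\<^sup>2)"
        by (cases "x \<in> ?B") (simp_all add: ennreal_power)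
    qed
    also have "ennreal Q * ?N w \<le> ennreal Q * (ennreal (4 * \<kappa>) * ennreal Q)"
      using w2 unfolding Qeq by (rule mult_left_mono) simp
    also have "\<dots> = ennreal (Q * (4 * \<kappa> * Q))"
      using Q0 \<kappa> by (simp add: ennreal_mult)
    finally have "ennreal ((cmod (scattering_transform q \<psi> \<xi> \<zeta> - fourier q \<xi>))\<^sup>2) \<le> ennreal (Q * (4 * \<kappa> * Q))"
      by (simp add: ennreal_power)
    then have "(cmod (scattering_transform q \<psi> \<xi> \<zeta> - fourier q \<xi>))\<^sup>2 \<le> Q * (4 * \<kappa> * Q)"
      using Q0 \<kappa> by simp
    also have "\<dots> = (16 * L / s * Q)\<^sup>2"
      unfolding \<kappa>_def by (simp add: power2_eq_square)
    finally have "cmod (scattering_transform q \<psi> \<xi> \<zeta> - fourier q \<xi>) \<le> 16 * L / s * Q"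
      by (rule power2_le_imp_le) (use L s Q0 in simp)
    also have "\<dots> \<le> 32 * L / norm \<zeta> * Q"
    proof (rule mult_right_mono[OF _ Q0])
      have "16 * L / s = 32 * L / (2 * s)" by simp
      also have "\<dots> \<le> 32 * L / norm \<zeta>" using L n\<zeta> s s2 by (intro divide_left_mono) auto
      finally show "16 * L / s \<le> 32 * L / norm \<zeta>" .
    qed
    finally show ?thesis .
  qed
  show ?thesis using sol unique bound unfolding Q_def by blast
qed

theorem theorem5p1:
  assumes "CARD('n::finite) \<ge> 3"
  shows "\<exists>c :: real \<Rightarrow> real \<Rightarrow> real.
    \<forall>(\<Omega> :: (real ^ 'n) set) (q :: real ^ 'n \<Rightarrow> complex) (\<delta> :: real).
      bounded \<Omega> \<and> C11_domain \<Omega> \<and> Linf_ext \<Omega> q \<and>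
      \<not> dirichlet_eigenvalue \<Omega> q 0 \<and> 0 < \<delta> \<and> \<delta> < 1 \<longrightarrow>
      (\<exists>R>0. \<forall>\<zeta> :: complex ^ 'n. cdot \<zeta> \<zeta> = 0 \<and> norm \<zeta> > R \<longrightarrow>
        (\<exists>\<psi>. exp_growing_solution q \<delta> \<zeta> \<psi> \<and>
             (\<forall>\<phi>. exp_growing_solution q \<delta> \<zeta> \<phi> \<longrightarrow> (AE x in lebesgue. \<phi> x = \<psi> x)) \<and>
             (\<forall>\<xi> :: real ^ 'n.
                cmod (scattering_transform q \<psi> \<xi> \<zeta> - fourier q \<xi>)
                  \<le> c \<delta> R / norm \<zeta> * (weighted_norm \<delta> q)\<^sup>2)))"
proof (rule exI[of _ "\<lambda>\<delta> R. R"], intro allI impI)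
  \<comment> \<open>\<open>R\<close> depends on the support and the size of \<open>q\<close> and so serves as the constant\<close>
  fix \<Omega> :: "(real ^ 'n) set" and q :: "real ^ 'n \<Rightarrow> complex" and \<delta> :: real
  assume "bounded \<Omega> \<and> C11_domain \<Omega> \<and> Linf_ext \<Omega> q \<and> \<not> dirichlet_eigenvalue \<Omega> q 0 \<and> 0 < \<delta> \<and> \<delta> < 1"
  then have \<Omega>: "bounded \<Omega>" and q: "Linf_ext \<Omega> q" and \<delta>: "0 < \<delta>" "\<delta> < 1" by auto
  obtain L where L: "L > 0" "\<And>x. x \<in> \<Omega> \<Longrightarrow> norm x \<le> L" using bounded_pos[of \<Omega>] \<Omega> by blast
  have qm: "q \<in> borel_measurable lebesgue" and qz: "\<And>x. x \<notin> \<Omega> \<Longrightarrow> q x = 0"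
    using q by (auto simp: Linf_ext_def)
  obtain M0 where "AE x in lebesgue. cmod (q x) \<le> M0" using q by (auto simp: Linf_ext_def)
  then have M0: "AE x in lborel. cmod (q x) \<le> M0" unfolding AE_completion_iff .
  define M where "M = max 0 M0"
  have M: "M \<ge> 0" by (simp add: M_def)
  obtain q' where q'[measurable]: "q' \<in> borel_measurable borel" and q'ae: "AE x in lborel. q x = q' x"
    using borel_representative[OF qm] .
  \<comment> \<open>a Borel representative that obeys the bound and the support condition at every point\<close>
  define q0 where "q0 = (\<lambda>x. if norm x \<le> L \<and> norm (q' x) \<le> M then q' x else 0)"
  have q0[measurable]: "q0 \<in> borel_measurable borel" unfolding q0_def by measurable
  have qae: "AE x in lborel. q x = q0 x"
    using M0 q'ae
  proof eventually_elim
    case (elim x)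
    show ?case
    proof (cases "norm x \<le> L")
      case True
      then show ?thesis using elim by (simp add: q0_def M_def)
    next
      case False
      then have "x \<notin> \<Omega>" using L(2) by blast
      then show ?thesis using False qz by (simp add: q0_def)
    qed
  qed
  have q0M: "norm (q0 x) \<le> M" for x using M by (simp add: q0_def)
  have supp: "norm x > L \<Longrightarrow> q0 x = 0" for x by (simp add: q0_def)
  \<comment> \<open>large enough for the contraction, which needs \<open>32 L M\<close>, and for the constant \<open>32 L\<close> in the estimate\<close>
  define R where "R = 32 * L * (M + 1)"
  have R: "R > 0" "32 * L * M \<le> R" "32 * L \<le> R"
    using L(1) M by (auto simp: R_def intro!: mult_pos_pos)
  have Q: "(\<integral>x. (norm (q0 x))\<^sup>2 \<partial>lborel) \<le> (weighted_norm \<delta> q)\<^sup>2"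
  proof -
    have m: "(\<lambda>x. (japanese x powr \<delta> * cmod (q0 x))\<^sup>2) \<in> borel_measurable borel" by measurable
    have ae: "AE x in lborel. (japanese x powr \<delta> * cmod (q x))\<^sup>2 = (japanese x powr \<delta> * cmod (q0 x))\<^sup>2"
      using qae by eventually_elim simp
    have jap: "(cmod (q0 x))\<^sup>2 \<le> (japanese x powr \<delta> * cmod (q0 x))\<^sup>2" for x
    proof (intro power_mono)
      have "1 \<le> japanese x powr \<delta>" using japanese_ge(1)[of x] \<delta> by (intro ge_one_powr_ge_zero) auto
      then show "cmod (q0 x) \<le> japanese x powr \<delta> * cmod (q0 x)"
        using mult_right_mono[of 1 "japanese x powr \<delta>" "cmod (q0 x)"] by simp
    qed simp
    have ind: "integrable lborel (indicator (cball (0 :: real ^ 'n) L) :: _ \<Rightarrow> real)"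
      using emeasure_lborel_cball_finite[of "0 :: real ^ 'n" L]
      by (intro integrable_real_indicator) (auto simp: less_top)
    have i: "integrable lborel (\<lambda>x. (japanese x powr \<delta> * cmod (q0 x))\<^sup>2)"
    proof (rule Bochner_Integration.integrable_bound)
      show "integrable lborel (\<lambda>x::real ^ 'n. indicator (cball 0 L) x * ((1 + L) powr \<delta> * M)\<^sup>2 :: real)"
        by (intro integrable_mult_left) (rule ind)
      show "AE x in lborel. norm ((japanese x powr \<delta> * cmod (q0 x))\<^sup>2) \<le> norm (indicator (cball 0 L) x * ((1 + L) powr \<delta> * M)\<^sup>2 :: real)"
      proof (intro AE_I2)
        fix x :: "real ^ 'n"
        show "norm ((japanese x powr \<delta> * cmod (q0 x))\<^sup>2) \<le> norm (indicator (cball 0 L) x * ((1 + L) powr \<delta> * M)\<^sup>2 :: real)"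
        proof (cases "norm x \<le> L")
          case True
          then have "japanese x powr \<delta> \<le> (1 + L) powr \<delta>"
            using japanese_le[of x] japanese_ge(1)[of x] \<delta> by (intro powr_mono2) auto
          then have "(japanese x powr \<delta> * cmod (q0 x))\<^sup>2 \<le> ((1 + L) powr \<delta> * M)\<^sup>2"
            using q0M M by (intro power_mono mult_mono) auto
          then show ?thesis using True by simp
        qed (simp add: supp)
      qed
    qed (use m in simp)
    have "(\<integral>x. (norm (q0 x))\<^sup>2 \<partial>lborel) \<le> (\<integral>x. (japanese x powr \<delta> * cmod (q0 x))\<^sup>2 \<partial>lborel)"
      using jap by (intro integral_mono i Bochner_Integration.integrable_bound[OF i]) auto
    also have "\<dots> = (weighted_norm \<delta> q)\<^sup>2"
      unfolding weighted_norm_def integral_lebesgue_AE[OF m ae] by simp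
    finally show ?thesis .
  qed
  show "\<exists>R>0. \<forall>\<zeta> :: complex ^ 'n. cdot \<zeta> \<zeta> = 0 \<and> norm \<zeta> > R \<longrightarrow>
        (\<exists>\<psi>. exp_growing_solution q \<delta> \<zeta> \<psi> \<and>
             (\<forall>\<phi>. exp_growing_solution q \<delta> \<zeta> \<phi> \<longrightarrow> (AE x in lebesgue. \<phi> x = \<psi> x)) \<and>
             (\<forall>\<xi> :: real ^ 'n.
                cmod (scattering_transform q \<psi> \<xi> \<zeta> - fourier q \<xi>)
                  \<le> R / norm \<zeta> * (weighted_norm \<delta> q)\<^sup>2))"
  proof (intro exI[of _ R] conjI R(1) allI impI)
    fix \<zeta> :: "complex ^ 'n"
    assume "cdot \<zeta> \<zeta> = 0 \<and> R < norm \<zeta>"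
    then have iso: "cdot \<zeta> \<zeta> = 0" and big: "32 * L * M \<le> norm \<zeta>" and nz: "\<zeta> \<noteq> 0" using R by auto
    have le: "32 * L / norm \<zeta> * (\<integral>x. (norm (q0 x))\<^sup>2 \<partial>lborel) \<le> R / norm \<zeta> * (weighted_norm \<delta> q)\<^sup>2"
      using Q R(1,3) nz by (intro mult_mono divide_right_mono) auto
    show "\<exists>\<psi>. exp_growing_solution q \<delta> \<zeta> \<psi> \<and>
             (\<forall>\<phi>. exp_growing_solution q \<delta> \<zeta> \<phi> \<longrightarrow> (AE x in lebesgue. \<phi> x = \<psi> x)) \<and>
             (\<forall>\<xi> :: real ^ 'n.
                cmod (scattering_transform q \<psi> \<xi> \<zeta> - fourier q \<xi>)
                  \<le> R / norm \<zeta> * (weighted_norm \<delta> q)\<^sup>2)"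
      using exp_growing_solution_small_potential[OF assms iso nz \<delta> q0 qae M q0M supp L(1) big] le
      by (meson order_trans)
  qed
qed

end
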